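(* Let $G$ be an undirected graph with $n$ vertices and $m$ edges, and let $X\subseteq V(G)$ be $\phi$-tough in $G$. There is an algorithm running in $O(mn\log n)$ time that computes a Steiner tree spanning $X$ in $G$ with maximum degree at most $2/\phi+3$.
   Context: For a graph $H$ and $X\subseteq V(H)$, $c_H(X)$ is the number of connected components of $H$ that contain at least one vertex of $X$. $X$ is $\phi$-tough in $G$ if for every $S\subseteq V(G)$ with $c_{G-S}(X)>1$, we have $|S|\ge\phi\cdot c_{G-S}(X)$. A Steiner tree spanning $X$ in $G$ is a subgraph of $G$ that is a tree containing all vertices of $X$. *)

theory Defs
  imports Complex_Main
begin

section \<open>Simple undirected graphs\<close>

record 'a ugraph =
  verts :: "'a set"
  edges :: "'a set set"

definition ugraph :: "'a ugraph \<Rightarrow> bool" where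
  "ugraph G \<longleftrightarrow> finite (verts G) \<and>
     (\<forall>e\<in>edges G. \<exists>u\<in>verts G. \<exists>v\<in>verts G. u \<noteq> v \<and> e = {u, v})"

definition subgraph :: "'a ugraph \<Rightarrow> 'a ugraph \<Rightarrow> bool" where
  "subgraph H G \<longleftrightarrow> ugraph H \<and> verts H \<subseteq> verts G \<and> edges H \<subseteq> edges G"

definition del_verts :: "'a ugraph \<Rightarrow> 'a set \<Rightarrow> 'a ugraph" where
  "del_verts G S = \<lparr>verts = verts G - S, edges = {e \<in> edges G. e \<inter> S = {}}\<rparr>"

definition connected_in :: "'a ugraph \<Rightarrow> 'a \<Rightarrow> 'a \<Rightarrow> bool" where
  "connected_in G u v \<longleftrightarrow>
     u \<in> verts G \<and> v \<in> verts G \<and> (\<lambda>x y. {x, y} \<in> edges G)\<^sup>*\<^sup>* u v"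

text \<open>Components are represented by their vertex sets.\<close>

definition components :: "'a ugraph \<Rightarrow> 'a set set" where
  "components G = {{v. connected_in G u v} | u. u \<in> verts G}"

definition num_comps :: "'a ugraph \<Rightarrow> 'a set \<Rightarrow> nat" where
  "num_comps H X = card {C \<in> components H. C \<inter> X \<noteq> {}}"

definition tough :: "real \<Rightarrow> 'a set \<Rightarrow> 'a ugraph \<Rightarrow> bool" where
  "tough \<phi> X G \<longleftrightarrow>
     (\<forall>S \<subseteq> verts G. num_comps (del_verts G S) X > 1 \<longrightarrow>
        real (card S) \<ge> \<phi> * real (num_comps (del_verts G S) X))"

definition cycle_in :: "'a ugraph \<Rightarrow> 'a list \<Rightarrow> bool" where
  "cycle_in G p \<longleftrightarrow> length p \<ge> 3 \<and> distinct p \<and>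
     (\<forall>i < length p. {p ! i, p ! (Suc i mod length p)} \<in> edges G)"

definition tree :: "'a ugraph \<Rightarrow> bool" where
  "tree T \<longleftrightarrow> ugraph T \<and> verts T \<noteq> {} \<and>
     (\<forall>u\<in>verts T. \<forall>v\<in>verts T. connected_in T u v) \<and> (\<nexists>p. cycle_in T p)"

definition steiner_tree :: "'a ugraph \<Rightarrow> 'a set \<Rightarrow> 'a ugraph \<Rightarrow> bool" where
  "steiner_tree G X T \<longleftrightarrow> subgraph T G \<and> tree T \<and> X \<subseteq> verts T"

definition degree :: "'a ugraph \<Rightarrow> 'a \<Rightarrow> nat" where
  "degree G v = card {e \<in> edges G. v \<in> e}"

definition max_degree :: "'a ugraph \<Rightarrow> nat" where
  "max_degree G = Max (degree G ` verts G)"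


section \<open>Word RAM programs and their running time\<close>

text \<open>
  Structured programs for a unit-cost word RAM. Registers and arrays are named by natural
  numbers. A program mentions only finitely many of either, so it addresses a
  fixed number of registers and arrays; interleaving the arrays gives a single memory.
  Every value ever computed (hence also every address) must be at most the
  parameter \<open>W\<close> of the semantics: an instruction whose result would exceed \<open>W\<close> has no
  transition, so that no run completes. Words of logarithmic size are
  obtained by taking \<open>W\<close> polynomial in the input size. Each instruction and each
  evaluation of a test costs one step.
\<close>

datatype test = Less nat nat | LessEq nat nat | Equal nat nat | NotEqual nat nat

datatype com =
    Skip
  | Const nat nat
  | Move nat nat
  | Add nat nat nat
  | Sub nat nat nat
  | Load nat nat nat
  | Store nat nat nat
  | Seq com com
  | If test com com
  | While test com

record state =
  regs :: "nat \<Rightarrow> nat"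
  arrs :: "nat \<Rightarrow> nat \<Rightarrow> nat"

fun holds :: "test \<Rightarrow> state \<Rightarrow> bool" where
  "holds (Less i j) s \<longleftrightarrow> regs s i < regs s j"
| "holds (LessEq i j) s \<longleftrightarrow> regs s i \<le> regs s j"
| "holds (Equal i j) s \<longleftrightarrow> regs s i = regs s j"
| "holds (NotEqual i j) s \<longleftrightarrow> regs s i \<noteq> regs s j"

definition set_reg :: "nat \<Rightarrow> nat \<Rightarrow> state \<Rightarrow> state" where
  "set_reg r x s = s\<lparr>regs := (regs s)(r := x)\<rparr>"

definition set_arr :: "nat \<Rightarrow> nat \<Rightarrow> nat \<Rightarrow> state \<Rightarrow> state" where
  "set_arr a i x s = s\<lparr>arrs := (arrs s)(a := (arrs s a)(i := x))\<rparr>"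

inductive exec :: "nat \<Rightarrow> com \<Rightarrow> state \<Rightarrow> nat \<Rightarrow> state \<Rightarrow> bool" for W :: nat where
  Skip: "exec W Skip s 1 s"
| Const: "k \<le> W \<Longrightarrow> exec W (Const r k) s 1 (set_reg r k s)"
| Move: "exec W (Move r i) s 1 (set_reg r (regs s i) s)"
| Add: "regs s i + regs s j \<le> W \<Longrightarrow>
    exec W (Add r i j) s 1 (set_reg r (regs s i + regs s j) s)"
| Sub: "exec W (Sub r i j) s 1 (set_reg r (regs s i - regs s j) s)"
| Load: "exec W (Load r a i) s 1 (set_reg r (arrs s a (regs s i)) s)"
| Store: "exec W (Store a i j) s 1 (set_arr a (regs s i) (regs s j) s)"
| Seq: "exec W c1 s t1 s1 \<Longrightarrow> exec W c2 s1 t2 s2 \<Longrightarrow> exec W (Seq c1 c2) s (t1 + t2) s2"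
| IfTrue: "holds b s \<Longrightarrow> exec W c1 s t s' \<Longrightarrow> exec W (If b c1 c2) s (1 + t) s'"
| IfFalse: "\<not> holds b s \<Longrightarrow> exec W c2 s t s' \<Longrightarrow> exec W (If b c1 c2) s (1 + t) s'"
| WhileFalse: "\<not> holds b s \<Longrightarrow> exec W (While b c) s 1 s"
| WhileTrue: "holds b s \<Longrightarrow> exec W c s t1 s1 \<Longrightarrow> exec W (While b c) s1 t2 s2 \<Longrightarrow>
    exec W (While b c) s (1 + t1 + t2) s2"

lemma exec_deterministic:
  "exec W c s t s' \<Longrightarrow> exec W c s u s'' \<Longrightarrow> t = u \<and> s' = s''"
proof (induction arbitrary: u s'' rule: exec.induct)
  case (Seq c1 s t1 s1 c2 t2 s2)
  from Seq.prems show ?case by cases (use Seq.IH in blast)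
next
  case (WhileTrue b s c t1 s1 t2 s2)
  from WhileTrue.prems show ?case
    by cases (use WhileTrue.hyps WhileTrue.IH in blast)+
qed (erule exec.cases; fastforce)+

text \<open>Input is read from array 0 and output is written to array 1. All other cells, and all
  registers, are initially zero.\<close>

definition init_state :: "nat list \<Rightarrow> state" where
  "init_state inp =
     \<lparr>regs = (\<lambda>_. 0),
      arrs = (\<lambda>a i. if a = 0 \<and> i < length inp then inp ! i else 0)\<rparr>"

definition runs :: "nat \<Rightarrow> com \<Rightarrow> nat list \<Rightarrow> nat \<Rightarrow> nat list \<Rightarrow> bool" where
  "runs W P inp t out \<longleftrightarrow>
     (\<exists>s. exec W P (init_state inp) t s \<and> (\<forall>i < length out. arrs s 1 i = out ! i))"


section \<open>Encoding of graphs\<close>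

definition enumerates :: "'a list \<Rightarrow> 'a set \<Rightarrow> bool" where
  "enumerates xs A \<longleftrightarrow> distinct xs \<and> set xs = A"

text \<open>Each edge is listed exactly once, in one of its two orientations.\<close>

definition enumerates_edges :: "('a \<times> 'a) list \<Rightarrow> 'a set set \<Rightarrow> bool" where
  "enumerates_edges es E \<longleftrightarrow> enumerates (map (\<lambda>(u, v). {u, v}) es) E"

definition enc_list :: "nat list \<Rightarrow> nat list" where
  "enc_list xs = length xs # xs"

definition enc_edges :: "(nat \<times> nat) list \<Rightarrow> nat list" where
  "enc_edges es = length es # concat (map (\<lambda>(u, v). [u, v]) es)"

text \<open>Input graphs have vertex set \<open>{..<n}\<close>, so only \<open>n\<close> is given.\<close>

definition enc_input :: "nat \<Rightarrow> (nat \<times> nat) list \<Rightarrow> nat list \<Rightarrow> nat list" where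
  "enc_input n es xs = n # enc_edges es @ enc_list xs"

definition enc_output :: "nat list \<Rightarrow> (nat \<times> nat) list \<Rightarrow> nat list" where
  "enc_output vs es = enc_list vs @ enc_edges es"

end

theory Submission
  imports Defs
begin

text \<open>
  The algorithm is a scaled form of the local search of Fuerer and Raghavachari. Let \<open>k\<close> be the
  maximum degree of the current tree, and block its vertices of degree at least \<open>k - 1\<close>. A round first
  absorbs all vertices reachable from unblocked tree vertices, and then looks for an edge that
  joins two branches at a blocked vertex \<open>w\<close> while avoiding blocked vertices: such an edge can replace a
  tree edge at \<open>w\<close>, so \<open>w\<close> is unblocked. If a vertex of degree \<open>k\<close> is unblocked, the recorded replacements
  are carried out backwards from it; the degree of that vertex drops, and no new vertex of degree \<open>k\<close> arises.
  If at most half of the blocked vertices are unblocked in a round, the search stops.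
  Deleting the \<open>B\<close> vertices blocked before this round then leaves every branch at the at least \<open>B / 2\<close>
  vertices still blocked in components of its own, of which more than \<open>(k - 3) * B / 2\<close> contain terminals,
  since all leaves of the tree are terminals. Toughness gives \<open>k \<le> 2 / \<phi> + 3\<close>.

  For the running time, call \<open>q\<close> the number of vertices of degree \<open>k\<close> at the beginning of a phase. The number of blocked
  vertices is halved in each round and stays at least \<open>q\<close>, and it is at most \<open>N / (k - 1)\<close> initially, with \<open>N = 2 * min n m\<close>.
  Since \<open>(k, q)\<close> decreases lexicographically, there are at most as many rounds as triples \<open>(k, q, i)\<close> with
  \<open>q * (k - 1) * 2 ^ i \<le> N\<close>, hence \<open>O(N log N)\<close> rounds, and each takes time \<open>O(n + m)\<close>.
\<close>

section \<open>Total correctness with a time budget for machine programs\<close>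

section \<open>Reasoning about programs\<close>

text \<open>A replacement gives one more edge to each of its endpoints. Blocking degree
  \<open>k - 1\<close> along with \<open>k\<close> leaves unblocked endpoints with degree at most
  \<open>k - 2\<close>, except those that were freed, and these give up an edge in turn; hence the
  chains of replacements. The obstacle is that the replacements of a chain must not disturb one
  another. Each is confined to a region, the piece of the tree around its vertex that was live when
  that vertex became live. The two ends of a replacement edge have disjoint regions inside that of
  the vertex relieved, so the regions of all vertices waiting for treatment stay disjoint. Vertices
  outside the Steiner tree are absorbed because the components left by the deletion might otherwise
  be joined through them; one that enters the tree in an improvement gets degree at most 2. The
  factor 2 in \<open>2 / \<phi>\<close> is the price of stopping early: the deleted set may be twice
  as large as the set whose branches are counted. In return, a round that does not stop the search
  more than halves the blocked set or ends in an improvement.\<close>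

definition tr :: "nat \<Rightarrow> com \<Rightarrow> state \<Rightarrow> nat \<Rightarrow> (state \<Rightarrow> bool) \<Rightarrow> bool" where
 "tr W c s T Q \<longleftrightarrow> (\<exists>t s'. exec W c s t s' \<and> t \<le> T \<and> Q s')"

abbreviation seq_com :: "com \<Rightarrow> com \<Rightarrow> com" (infixr ";;" 60) where
 "c1 ;; c2 \<equiv> Seq c1 c2"

fun wr :: "com \<Rightarrow> nat set" where
 "wr (Const r k) = {r}"
| "wr (Move r i) = {r}"
| "wr (Add r i j) = {r}"
| "wr (Sub r i j) = {r}"
| "wr (Load r a i) = {r}"
| "wr (Seq c d) = wr c \<union> wr d"
| "wr (If b c d) = wr c \<union> wr d"
| "wr (While b c) = wr c"
| "wr _ = {}"

fun wa :: "com \<Rightarrow> nat set" where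
 "wa (Store a i j) = {a}"
| "wa (Seq c d) = wa c \<union> wa d"
| "wa (If b c d) = wa c \<union> wa d"
| "wa (While b c) = wa c"
| "wa _ = {}"

text \<open>The cells a program can write are read off its text, so the preservation of all others
  holds for every run and stays out of the specifications.\<close>

definition frame :: "com \<Rightarrow> state \<Rightarrow> state \<Rightarrow> bool" where
 "frame c s s' \<longleftrightarrow> (\<forall>r. r \<notin> wr c --> regs s' r = regs s r) \<and> (\<forall>a. a \<notin> wa c --> arrs s' a = arrs s a)"

lemma frame_regs: "frame c s s' ==> r \<notin> wr c ==> regs s' r = regs s r"
 and frame_arrs: "frame c s s' ==> a \<notin> wa c ==> arrs s' a = arrs s a"
 by (auto simp: frame_def)

lemma frame_refl: "frame c s s"
 by (simp add: frame_def)

lemma frame_trans: "frame c s s1 ==> frame c s1 s2 ==> frame c s s2"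
 by (auto simp: frame_def)

lemma regs_set [simp]: "regs (set_reg r x s) = (regs s)(r := x)" "arrs (set_reg r x s) = arrs s"
  "regs (set_arr a i x s) = regs s" "arrs (set_arr a i x s) = (arrs s)(a := (arrs s a)(i := x))"
 by (simp_all add: set_reg_def set_arr_def)

lemma exec_frame: "exec W c s t s' ==> frame c s s'"
proof (induction rule: exec.induct)
 case (Seq c1 s t1 s1 c2 t2 s2)
 then show ?case by (auto simp: frame_def)
next
 case (WhileTrue b s c t1 s1 t2 s2)
 then show ?case by (auto simp: frame_def)
qed (auto simp: frame_def)

lemma trE:
 assumes "tr W c s T Q"
 obtains t s' where "exec W c s t s'" "t \<le> T" "Q s'" "frame c s s'"
 using assms exec_frame unfolding tr_def by blast

lemma tr_cons: "tr W c s T Q ==> T \<le> T' ==> (\<And>s'. frame c s s' ==> Q s' ==> Q' s') ==> tr W c s T' Q'"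
 unfolding tr_def using exec_frame by (meson order_trans)

lemma tr_le: "tr W c s T Q ==> T \<le> T' ==> tr W c s T' Q"
 unfolding tr_def by (meson order_trans)

lemma tr_seq:
 assumes "tr W c s T1 Q" "\<And>s1. frame c s s1 ==> Q s1 ==> tr W d s1 T2 R"
 shows "tr W (c ;; d) s (T1 + T2) R"
 using assms exec_frame unfolding tr_def by (meson Seq add_mono)

lemma tr_If:
 assumes "holds b s ==> tr W c s T Q" "\<not> holds b s ==> tr W d s T Q"
 shows "tr W (If b c d) s (Suc T) Q"
proof (cases "holds b s")
 case True
 then obtain t s' where "exec W c s t s'" "t \<le> T" "Q s'" using assms unfolding tr_def by blast
 with IfTrue[OF True this(1)] show ?thesis unfolding tr_def by (intro exI[of _ "1 + t"]) auto
next
 case False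
 then obtain t s' where "exec W d s t s'" "t \<le> T" "Q s'" using assms unfolding tr_def by blast
 with IfFalse[OF False this(1)] show ?thesis unfolding tr_def by (intro exI[of _ "1 + t"]) auto
qed

text \<open>For loop-free code only: a loop gets the precondition \<open>False\<close>, which makes
  the arbitrary value \<open>tm (While b c) = 0\<close> harmless.\<close>

fun wp :: "nat \<Rightarrow> com \<Rightarrow> (state \<Rightarrow> bool) \<Rightarrow> state \<Rightarrow> bool" where
 "wp W Skip Q s = Q s"
| "wp W (Const r k) Q s = (k \<le> W \<and> Q (set_reg r k s))"
| "wp W (Move r i) Q s = Q (set_reg r (regs s i) s)"
| "wp W (Add r i j) Q s = (regs s i + regs s j \<le> W \<and> Q (set_reg r (regs s i + regs s j) s))"
| "wp W (Sub r i j) Q s = Q (set_reg r (regs s i - regs s j) s)"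
| "wp W (Load r a i) Q s = Q (set_reg r (arrs s a (regs s i)) s)"
| "wp W (Store a i j) Q s = Q (set_arr a (regs s i) (regs s j) s)"
| "wp W (Seq c d) Q s = wp W c (wp W d Q) s"
| "wp W (If b c d) Q s = (if holds b s then wp W c Q s else wp W d Q s)"
| "wp W (While b c) Q s = False"

fun tm :: "com \<Rightarrow> nat" where
 "tm (Seq c d) = tm c + tm d"
| "tm (If b c d) = Suc (max (tm c) (tm d))"
| "tm (While b c) = 0"
| "tm _ = 1"

lemma wp_tr: "wp W c Q s ==> tr W c s (tm c) Q"
proof (induction c arbitrary: Q s)
 case (Seq c d)
 from Seq(3) have "tr W c s (tm c) (wp W d Q)" by (intro Seq(1)) simp
 from tr_seq[OF this Seq(2)] show ?case by simp
next
 case (If b c d)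
 have "tr W (If b c d) s (Suc (max (tm c) (tm d))) Q"
  by (rule tr_If; rule tr_le) (use If in \<open>auto split: if_splits\<close>)
 then show ?case by simp
qed (auto simp: tr_def intro!: exI[of _ 1] intro: exec.intros)

lemma tr_wp: "wp W c Q s ==> tm c \<le> T ==> tr W c s T Q"
 using wp_tr tr_cons by blast

text \<open>The value \<open>z\<close> is the remaining time budget.\<close>

lemma tr_while:
 assumes "I z s"
  and "\<And>z s'. I z s' ==> frame c s s' ==> holds b s' ==> \<exists>T z'. T + 1 + z' \<le> z \<and> tr W c s' T (I z')"
  and "\<And>z s. I z s ==> 1 \<le> z"
 shows "tr W (While b c) s z (\<lambda>s'. \<not> holds b s' \<and> (\<exists>z'. I z' s'))"
proof -
 have "I z s1 ==> frame c s s1 ==> tr W (While b c) s1 z (\<lambda>s'. \<not> holds b s' \<and> (\<exists>z'. I z' s'))" for s1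
 proof (induction z arbitrary: s1 rule: less_induct)
  case (less z)
  show ?case
  proof (cases "holds b s1")
   case False
   then show ?thesis unfolding tr_def using WhileFalse[OF False] less.prems assms(3) by blast
  next
   case True
   from assms(2)[OF less.prems True] obtain T z' where *: "T + 1 + z' \<le> z" "tr W c s1 T (I z')" by blast
   from *(2) obtain t s2 where e: "exec W c s1 t s2" "t \<le> T" "I z' s2" "frame c s1 s2" by (rule trE)
   from less.IH[OF _ e(3)] * less.prems(2) e(4)
   have "tr W (While b c) s2 z' (\<lambda>s'. \<not> holds b s' \<and> (\<exists>z'. I z' s'))" by (auto intro: frame_trans)
   then obtain t' s' where f: "exec W (While b c) s2 t' s'" "t' \<le> z'" "\<not> holds b s'" "\<exists>z'. I z' s'"
    unfolding tr_def by blast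
   from WhileTrue[OF True e(1) f(1)] f * e(2) show ?thesis unfolding tr_def
    by (intro exI[of _ "1 + t + t'"]) auto
  qed
 qed
 with assms(1) frame_refl show ?thesis by blast
qed

definition for_up :: "nat \<Rightarrow> nat \<Rightarrow> com \<Rightarrow> com" where
 "for_up i lm c = While (Less i lm) (c ;; Add i i 1)"

definition for_down :: "nat \<Rightarrow> nat \<Rightarrow> com \<Rightarrow> com" where
 "for_down i lm c = While (Less lm i) (Sub i i 1 ;; c)"

lemma wr_for [simp]: "wr (for_up i lm c) = insert i (wr c)" "wa (for_up i lm c) = wa c"
 "wr (for_down i lm c) = insert i (wr c)" "wa (for_down i lm c) = wa c"
 by (simp_all add: for_up_def for_down_def)

text \<open>An iteration costs the body, one test and one increment, hence \<open>T + 2\<close>; the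
  final \<open>1\<close> is the failing test. The increment comes after the body has established the
  invariant for \<open>Suc j\<close>, so the invariant may not look at the counter register
  (\<open>indep\<close>).\<close>

lemma tr_for_up:
 assumes init: "I (regs s i) s" and N: "regs s lm = N" "regs s i \<le> N" "N \<le> W"
  and one: "regs s 1 = 1"
  and nw: "i \<notin> wr c" "lm \<notin> wr c" "1 \<notin> wr c" "i \<noteq> lm" "i \<noteq> 1"
  and indep: "\<And>j s x. I j s ==> I j (set_reg i x s)"
  and body: "\<And>j s'. regs s i \<le> j ==> j < N ==> I j s' ==> regs s' i = j ==>
    frame (for_up i lm c) s s' ==> tr W c s' T (I (Suc j))"
  and time: "(N - regs s i) * (T + 2) + 1 \<le> T'"
 shows "tr W (for_up i lm c) s T' (\<lambda>s'. I N s' \<and> regs s' i = N)"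
proof -
 let ?J = "\<lambda>z s'. \<exists>j. j = regs s' i \<and> regs s i \<le> j \<and> j \<le> N \<and> I j s' \<and> z = (N - j) * (T + 2) + 1"
 have fr: "frame (for_up i lm c) s s' ==> regs s' lm = N \<and> regs s' 1 = 1" for s'
  using nw N one frame_regs[of "for_up i lm c" s s' lm] frame_regs[of "for_up i lm c" s s' 1] by auto
 have "tr W (While (Less i lm) (c ;; Add i i 1)) s ((N - regs s i) * (T + 2) + 1)
   (\<lambda>s'. \<not> holds (Less i lm) s' \<and> (\<exists>z'. ?J z' s'))"
 proof (rule tr_while)
  show "?J ((N - regs s i) * (T + 2) + 1) s" using init N by auto
 next
  fix z s' assume J: "?J z s'" and f: "frame (c ;; Add i i 1) s s'" and h: "holds (Less i lm) s'"
  have f': "frame (for_up i lm c) s s'" using f by (auto simp: frame_def)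
  note g = fr[OF f']
  let ?j = "regs s' i"
  from h g have lt: "?j < N" by simp
  have b: "tr W c s' T (I (Suc ?j))" using J lt f' by (intro body) auto
  have *: "tr W (c ;; Add i i 1) s' (T + 1) (?J ((N - Suc ?j) * (T + 2) + 1))"
  proof (rule tr_seq[OF b])
   fix s1 assume fr1: "frame c s' s1" and I1: "I (Suc ?j) s1"
   have 1: "regs s1 i = ?j" "regs s1 1 = 1" using frame_regs[OF fr1] nw g by auto
   show "tr W (Add i i 1) s1 1 (?J ((N - Suc ?j) * (T + 2) + 1))"
    using 1 lt N I1 J by (intro tr_wp) (simp_all add: indep)
  qed
  have "(N - ?j) = Suc (N - Suc ?j)" using lt by simp
  then have "(T + 1) + 1 + ((N - Suc ?j) * (T + 2) + 1) \<le> z" using J by auto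
  with * show "\<exists>T0 z'. T0 + 1 + z' \<le> z \<and> tr W (c ;; Add i i 1) s' T0 (?J z')" by blast
 qed auto
 then show ?thesis
  unfolding for_up_def[symmetric]
 proof (rule tr_cons)
  fix s' assume f: "frame (for_up i lm c) s s'" and q: "\<not> holds (Less i lm) s' \<and> (\<exists>z'. ?J z' s')"
  then have "regs s' i = N" using fr[OF f] by auto
  then show "I N s' \<and> regs s' i = N" using q by auto
 qed (rule time)
qed

text \<open>The counter is decreased before the body, so the body sees the index \<open>j\<close>
  that it has to treat and turns the invariant for \<open>Suc j\<close> into the one for
  \<open>j\<close>.\<close>

lemma tr_for_down:
 assumes init: "I (regs s i) s" and N: "regs s lm = N" "N \<le> regs s i"
  and one: "regs s 1 = 1"
  and nw: "i \<notin> wr c" "lm \<notin> wr c" "1 \<notin> wr c" "i \<noteq> lm" "i \<noteq> 1"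
  and indep: "\<And>j s x. I j s ==> I j (set_reg i x s)"
  and body: "\<And>j s'. N \<le> j ==> j < regs s i ==> I (Suc j) s' ==> regs s' i = j ==>
    frame (for_down i lm c) s s' ==> tr W c s' T (I j)"
  and time: "(regs s i - N) * (T + 2) + 1 \<le> T'"
 shows "tr W (for_down i lm c) s T' (\<lambda>s'. I N s' \<and> regs s' i = N)"
proof -
 let ?J = "\<lambda>z s'. \<exists>j. j = regs s' i \<and> N \<le> j \<and> j \<le> regs s i \<and> I j s' \<and> z = (j - N) * (T + 2) + 1"
 have fr: "frame (for_down i lm c) s s' ==> regs s' lm = N \<and> regs s' 1 = 1" for s'
  using nw N one frame_regs[of "for_down i lm c" s s' lm] frame_regs[of "for_down i lm c" s s' 1] by auto
 have "tr W (While (Less lm i) (Sub i i 1 ;; c)) s ((regs s i - N) * (T + 2) + 1)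
   (\<lambda>s'. \<not> holds (Less lm i) s' \<and> (\<exists>z'. ?J z' s'))"
 proof (rule tr_while)
  show "?J ((regs s i - N) * (T + 2) + 1) s" using init N by auto
 next
  fix z s' assume J: "?J z s'" and f: "frame (Sub i i 1 ;; c) s s'" and h: "holds (Less lm i) s'"
  have f': "frame (for_down i lm c) s s'" using f by (auto simp: frame_def)
  note g = fr[OF f']
  let ?j = "regs s' i - 1"
  from h g have lt: "N < regs s' i" by simp
  then have sj: "Suc ?j = regs s' i" by simp
  let ?s1 = "set_reg i ?j s'"
  have f1: "frame (for_down i lm c) s ?s1" using f' by (auto simp: frame_def)
  have b: "tr W c ?s1 T (I ?j)"
  proof (rule body)
   show "I (Suc ?j) ?s1" unfolding sj using J indep by simp
  qed (use lt J f1 in auto)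
  have *: "tr W (Sub i i 1 ;; c) s' (1 + T) (?J ((?j - N) * (T + 2) + 1))"
  proof (rule tr_seq)
   show "tr W (Sub i i 1) s' 1 (\<lambda>s1. s1 = ?s1)" using g by (intro tr_wp) auto
   fix s1 assume "s1 = ?s1"
   then have b': "tr W c s1 T (I ?j)" using b by simp
   show "tr W c s1 T (?J ((?j - N) * (T + 2) + 1))"
   proof (rule tr_cons[OF b' order_refl])
    fix s2 assume "frame c s1 s2" "I ?j s2"
    moreover from this have "regs s2 i = ?j" using \<open>s1 = ?s1\<close> nw frame_regs[of c s1 s2 i] by simp
    ultimately show "?J ((?j - N) * (T + 2) + 1) s2" using lt J by auto
   qed
  qed
  have "regs s' i - N = Suc (?j - N)" using lt by simp
  then have "(1 + T) + 1 + ((?j - N) * (T + 2) + 1) \<le> z" using J by auto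
  with * show "\<exists>T0 z'. T0 + 1 + z' \<le> z \<and> tr W (Sub i i 1 ;; c) s' T0 (?J z')" by blast
 qed auto
 then show ?thesis
  unfolding for_down_def[symmetric]
 proof (rule tr_cons)
  fix s' assume f: "frame (for_down i lm c) s s'" and q: "\<not> holds (Less lm i) s' \<and> (\<exists>z'. ?J z' s')"
  then have "regs s' i = N" using fr[OF f] by auto
  then show "I N s' \<and> regs s' i = N" using q by auto
 qed (rule time)
qed

section \<open>Ancestor relation and tree paths\<close>

section \<open>Rooted trees given by parent pointers\<close>

lemma rtranclp_first: "r\<^sup>*\<^sup>* x y \<longleftrightarrow> x = y \<or> (\<exists>z. r x z \<and> r\<^sup>*\<^sup>* z y)"
 by (blast elim: converse_rtranclpE intro: converse_rtranclp_into_rtranclp)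

lemma rtranclp_imp: "r\<^sup>*\<^sup>* x y ==> (\<And>x y. r x y ==> q x y) ==> q\<^sup>*\<^sup>* x y"
 by (induction rule: rtranclp_induct) (auto intro: rtranclp.rtrancl_into_rtrancl)

lemma rtranclp_sym: "r\<^sup>*\<^sup>* x y ==> (\<And>x y. r x y ==> r y x) ==> r\<^sup>*\<^sup>* y x"
 by (induction rule: rtranclp_induct) (auto intro: converse_rtranclp_into_rtranclp)

text \<open>The relation stops at \<open>rt\<close>, so the value \<open>par rt\<close> is free; the
  programs store \<open>rt\<close> itself there.\<close>

definition anc :: "nat \<Rightarrow> (nat \<Rightarrow> nat) \<Rightarrow> nat \<Rightarrow> nat \<Rightarrow> bool" where
 "anc rt par = (\<lambda>a b. a \<noteq> rt \<and> b = par a)\<^sup>*\<^sup>*"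

lemma anc_refl [simp]: "anc rt par v v"
 by (simp add: anc_def)

lemma anc_step: "anc rt par v x \<longleftrightarrow> v = x \<or> (v \<noteq> rt \<and> anc rt par (par v) x)"
 unfolding anc_def by (subst rtranclp_first) auto

lemma anc_trans: "anc rt par v x ==> anc rt par x y ==> anc rt par v y"
 unfolding anc_def by simp

lemma anc_par: "anc rt par v x ==> x \<noteq> rt ==> anc rt par v (par x)"
 by (rule anc_trans[of rt par v x]) (simp_all add: anc_step[of rt par x "par x"])

text \<open>Parents are unique, so of two upward chains from \<open>v\<close> one is an initial
  piece of the other.\<close>

lemma anc_linear: "anc rt par v x ==> anc rt par v y ==> anc rt par x y \<or> anc rt par y x"
 unfolding anc_def
proof (induction arbitrary: y rule: converse_rtranclp_induct)
 case (step v u)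
 from step.prems show ?case
 proof (cases rule: converse_rtranclpE)
  case base
  have "(\<lambda>a b. a \<noteq> rt \<and> b = par a)\<^sup>*\<^sup>* v x"
   using step(1,2) by (rule converse_rtranclp_into_rtranclp)
  then show ?thesis using base by simp
 next
  case (step y')
  then show ?thesis using \<open>v \<noteq> rt \<and> u = par v\<close> step.IH by auto
 qed
qed auto

text \<open>\<open>pos\<close> takes the place of acyclicity: it drops towards the root and is the
  induction measure. It will be the position of a vertex in the list of insertion.\<close>

locale rtree =
 fixes V :: "nat set" and rt :: nat and par pos :: "nat \<Rightarrow> nat"
 assumes finV: "finite V" and rootV: "rt \<in> V"
  and parV: "v \<in> V ==> v \<noteq> rt ==> par v \<in> V"
  and pos_par: "v \<in> V ==> v \<noteq> rt ==> pos (par v) < pos v"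
begin

abbreviation "sub \<equiv> anc rt par"

lemma sub_V: "sub v x ==> v \<in> V ==> x \<in> V"
 unfolding anc_def by (induction rule: rtranclp_induct) (auto intro: parV)

lemma sub_pos: "sub v x ==> v \<in> V ==> pos x \<le> pos v"
 unfolding anc_def
proof (induction rule: converse_rtranclp_induct)
 case (step v u)
 then show ?case using parV[of v] pos_par[of v] by auto
qed auto

lemma sub_root: "v \<in> V ==> sub v rt"
proof (induction "pos v" arbitrary: v rule: less_induct)
 case less
 then show ?case using parV[of v] pos_par[of v] anc_step[of rt par v rt] by auto
qed

lemma sub_antisym: "sub v x ==> sub x v ==> v \<in> V ==> v = x"
proof (rule ccontr)
 assume a: "sub v x" "sub x v" "v \<in> V" "v \<noteq> x"
 then have v: "v \<noteq> rt" "sub (par v) x" using anc_step[of rt par v x] by auto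
 then have "pos x \<le> pos (par v)" "pos v \<le> pos x" using a sub_pos parV sub_V by metis+
 then show False using pos_par[OF a(3) v(1)] by simp
qed

lemma not_sub_par: "v \<in> V ==> v \<noteq> rt ==> \<not> sub (par v) v"
 using sub_pos[of "par v" v] pos_par[of v] parV[of v] by fastforce

lemma child_towards:
 assumes "sub u x" "u \<noteq> x"
 shows "\<exists>c. sub u c \<and> c \<noteq> rt \<and> par c = x"
 using assms unfolding anc_def
proof (induction rule: converse_rtranclp_induct)
 case (step u v)
 show ?case
 proof (cases "v = x")
  case True
  with step show ?thesis by auto
 next
  case False
  with step obtain c where "(\<lambda>a b. a \<noteq> rt \<and> b = par a)\<^sup>*\<^sup>* v c" "c \<noteq> rt" "par c = x" by auto
  moreover have "(\<lambda>a b. a \<noteq> rt \<and> b = par a)\<^sup>*\<^sup>* u c"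
   using step(1) calculation(1) by (auto intro: converse_rtranclp_into_rtranclp)
  ultimately show ?thesis by blast
 qed
qed auto

definition sep :: "nat \<Rightarrow> nat \<Rightarrow> nat \<Rightarrow> nat \<Rightarrow> bool" where
 "sep a b x y \<longleftrightarrow>
   (\<exists>z\<in>V. z \<noteq> rt \<and> sub a z \<noteq> sub b z \<and> (x = z \<and> y = par z \<or> y = z \<and> x = par z))"

lemma sep_commute: "sep a b = sep b a"
 unfolding sep_def by (intro ext) auto

lemma sep_sym: "(sep a b)\<^sup>*\<^sup>* x y ==> (sep a b)\<^sup>*\<^sup>* y x"
 by (erule rtranclp_sym) (unfold sep_def, blast)

text \<open>The tree path between \<open>a\<close> and \<open>b\<close> consists of the tree edges separating them.\<close>

lemma separating_path:
 assumes "a \<in> V" "b \<in> V"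
 shows "(sep a b)\<^sup>*\<^sup>* a b"
 using assms
proof (induction "pos a + pos b" arbitrary: a b rule: less_induct)
 case less
 \<comment> \<open>Here \<open>b\<close> is not below \<open>a\<close>, so the path from
   \<open>a\<close> begins with the step to its parent. The edge above \<open>a\<close> separates
   \<open>a\<close> from \<open>b\<close> but not \<open>par a\<close> from \<open>b\<close>; all
   other separating edges are the same for both.\<close>
 have *: "(sep a b)\<^sup>*\<^sup>* a b"
  if ab: "a \<noteq> b" "a \<in> V" "b \<in> V" "\<not> sub b a" and
   IH: "(\<And>x. x \<in> V ==> pos x < pos a ==> (sep x b)\<^sup>*\<^sup>* x b)"
  for a b
 proof -
  have nr: "a \<noteq> rt" using ab sub_root by auto
  let ?p = "par a"
  have p: "?p \<in> V" "pos ?p < pos a" using nr ab parV pos_par by auto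
  have pb: "(sep ?p b)\<^sup>*\<^sup>* ?p b" using p by (rule IH)
  have z: "sub a z \<noteq> sub b z" if "sub ?p z \<noteq> sub b z" for z
   using ab(4) not_sub_par[OF ab(2) nr] anc_step[of rt par a z] nr that by (cases "z = a") auto
  have mono: "sep ?p b x y ==> sep a b x y" for x y
   unfolding sep_def using z by blast
  have "(sep a b)\<^sup>*\<^sup>* ?p b" using pb mono by (rule rtranclp_imp)
  moreover have "sep a b a ?p" unfolding sep_def using ab nr by (intro bexI[of _ a]) auto
  ultimately show ?thesis by (rule converse_rtranclp_into_rtranclp[rotated])
 qed
 consider "a = b" | "a \<noteq> b" "\<not> sub b a" | "a \<noteq> b" "\<not> sub a b"
  using sub_antisym less.prems by blast
 then show ?case
 proof cases
  case 2
  show ?thesis by (rule *) (use 2 less in auto)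
 next
  case 3
  have "(sep b a)\<^sup>*\<^sup>* b a"
  proof (rule *)
   fix x assume "x \<in> V" "pos x < pos b"
   then have "(sep a x)\<^sup>*\<^sup>* a x" using less by auto
   then show "(sep x a)\<^sup>*\<^sup>* x a" using sep_sym sep_commute by metis
  qed (use 3 less in auto)
  then show ?thesis using sep_sym sep_commute by metis
 qed simp
qed

end

section \<open>Chained edge replacements and their disjoint regions\<close>

section \<open>Lowering the degree of a vertex\<close>

definition hadj :: "(nat \<Rightarrow> nat) \<Rightarrow> (nat \<Rightarrow> nat) \<Rightarrow> nat set \<Rightarrow> nat \<Rightarrow> nat \<Rightarrow> bool" where
 "hadj eu ev H x y \<longleftrightarrow> (\<exists>e\<in>H. eu e = x \<and> ev e = y \<or> eu e = y \<and> ev e = x)"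

lemma hadj_sym: "hadj eu ev H x y ==> hadj eu ev H y x"
 by (auto simp: hadj_def)

lemma hadj_rtranclp_sym: "(hadj eu ev H)\<^sup>*\<^sup>* x y ==> (hadj eu ev H)\<^sup>*\<^sup>* y x"
 by (erule rtranclp_sym) (rule hadj_sym)

lemma hadj_mono: "(hadj eu ev H)\<^sup>*\<^sup>* x y ==> H \<subseteq> H' ==> (hadj eu ev H')\<^sup>*\<^sup>* x y"
 by (erule rtranclp_imp) (unfold hadj_def, blast)

definition inc :: "(nat \<Rightarrow> nat) \<Rightarrow> (nat \<Rightarrow> nat) \<Rightarrow> nat set \<Rightarrow> nat \<Rightarrow> nat set" where
 "inc eu ev H v = {e\<in>H. eu e = v \<or> ev e = v}"

text \<open>\<open>C\<close> is the vertex set of the current Steiner tree, \<open>L\<close> the set of live (unblocked) vertices,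
 \<open>F\<close> the set of freed ones and \<open>rk\<close> the time at which a vertex became live.
 The vertices of \<open>V - C\<close> have been attached to live ones.\<close>

locale improvement = rtree V rt par pos
 for V rt par pos +
 fixes C L F :: "nat set" and rk :: "nat \<Rightarrow> nat" and m :: nat and eu ev pe ce cc :: "nat \<Rightarrow> nat"
 assumes CV: "C \<subseteq> V" and LV: "L \<subseteq> V" and FC: "F \<subseteq> C" "F \<subseteq> L"
  and rootC: "rt \<in> C" and parC: "v \<in> C ==> v \<noteq> rt ==> par v \<in> C"
  and pe: "v \<in> V ==> v \<noteq> rt ==>
   pe v < m \<and> (eu (pe v) = v \<and> ev (pe v) = par v \<or> eu (pe v) = par v \<and> ev (pe v) = v)"
  and absorbed: "v \<in> V ==> v \<notin> C ==> v \<in> L \<and> par v \<in> L \<and> rk (par v) < rk v"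
  and cc: "w \<in> F ==> cc w \<in> C \<and> cc w \<noteq> rt \<and> par (cc w) = w"
  and ce: "w \<in> F ==> ce w < m \<and> eu (ce w) \<in> L \<and> ev (ce w) \<in> L \<and>
   rk (eu (ce w)) < rk w \<and> rk (ev (ce w)) < rk w \<and>
   anc rt par (eu (ce w)) (cc w) \<noteq> anc rt par (ev (ce w)) (cc w)"
  and ce_path: "w \<in> F ==>
   (\<lambda>x y. (x \<noteq> rt \<and> y = par x \<or> y \<noteq> rt \<and> x = par y) \<and> x \<in> L \<and> y \<in> L \<and> rk x \<le> rk w \<and> rk y \<le> rk w)\<^sup>*\<^sup>*
    (eu (ce w)) (ev (ce w))"
begin

text \<open>With \<open>r = rk w\<close> this is the relation of \<open>ce_path\<close>: the forest
  of tree edges that were live at time \<open>r\<close>.\<close>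

definition lk :: "nat \<Rightarrow> nat \<Rightarrow> nat \<Rightarrow> bool" where
 "lk r x y \<longleftrightarrow> (x \<noteq> rt \<and> y = par x \<or> y \<noteq> rt \<and> x = par y) \<and> x \<in> L \<and> y \<in> L \<and> rk x \<le> r \<and> rk y \<le> r"

text \<open>The component of \<open>v\<close> in the live forest at the time when \<open>v\<close>
  became live. Every tree edge that is given up in order to make room for an additional edge at
  \<open>v\<close> lies in it.\<close>

definition Reg :: "nat \<Rightarrow> nat set" where
 "Reg v = {u. (lk (rk v))\<^sup>*\<^sup>* v u}"

lemma lk_sym: "lk r x y ==> lk r y x"
 by (auto simp: lk_def)

lemma lk_rtranclp_sym: "(lk r)\<^sup>*\<^sup>* x y ==> (lk r)\<^sup>*\<^sup>* y x"
 by (erule rtranclp_sym) (rule lk_sym)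

lemma lk_mono: "(lk r)\<^sup>*\<^sup>* x y ==> r \<le> r' ==> (lk r')\<^sup>*\<^sup>* x y"
 by (erule rtranclp_imp) (auto simp: lk_def)

lemma Reg_self: "v \<in> Reg v"
 by (simp add: Reg_def)

lemma lk_last:
 assumes "(lk r)\<^sup>*\<^sup>* x y" "x \<in> L" "rk x \<le> r"
 shows "y \<in> L \<and> rk y \<le> r"
 using assms(1) by (cases rule: rtranclp.cases) (use assms(2,3) in \<open>auto simp: lk_def\<close>)

lemma Reg_rk: "u \<in> Reg v ==> rk u \<le> rk v"
 unfolding Reg_def mem_Collect_eq by (cases "lk (rk v)" v u rule: rtranclp.cases) (auto simp: lk_def)

text \<open>At an earlier time there are fewer live edges, and \<open>v\<close> itself was not yet
  live.\<close>

lemma Reg_subset: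
 assumes "u \<in> Reg v" "rk u < rk v"
 shows "Reg u \<subseteq> Reg v - {v}"
proof
 fix x assume x: "x \<in> Reg u"
 then have "(lk (rk v))\<^sup>*\<^sup>* u x" using lk_mono assms unfolding Reg_def by auto
 then have "x \<in> Reg v" using assms unfolding Reg_def by auto
 moreover have "x \<noteq> v" using Reg_rk[OF x] assms by auto
 ultimately show "x \<in> Reg v - {v}" by blast
qed

text \<open>The walk is cut at its first exit from \<open>D\<close>, which by assumption happens at
  \<open>c\<close>. It is applied to the two sides of the edge above \<open>cc w\<close>, where the
  exit is unique.\<close>

lemma leave_region:
 assumes "(lk r)\<^sup>*\<^sup>* a b" "a \<in> D" "\<And>x y. lk r x y ==> x \<in> D ==> y \<notin> D ==> x = c"
 shows "(b \<in> D \<and> (\<lambda>x y. lk r x y \<and> x \<in> D \<and> y \<in> D)\<^sup>*\<^sup>* a b) \<or> (\<lambda>x y. lk r x y \<and> x \<in> D \<and> y \<in> D)\<^sup>*\<^sup>* a c"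
 using assms(1)
proof (induction rule: rtranclp_induct)
 case (step y z)
 then show ?case
  using assms(3)[of y z]
  by (cases "z \<in> D") (auto intro: rtranclp.rtrancl_into_rtrancl)
qed (use assms(2) in auto)

lemma leave_sub: "lk r x y ==> sub x c ==> \<not> sub y c ==> x = c \<and> y = par c \<and> c \<noteq> rt"
 using anc_step[of rt par x c] anc_step[of rt par y c] by (auto simp: lk_def)

text \<open>The live path between the ends of the replacement edge has to cross the edge from
  \<open>cc w\<close> to \<open>w\<close>. Cutting it there leaves one piece on either side, and
  neither piece uses the edge that is going to be removed.\<close>

lemma cc_paths:
 assumes w: "w \<in> F" and xy: "{x, y} = {eu (ce w), ev (ce w)}" and s: "sub x (cc w)" "\<not> sub y (cc w)"
 shows "(\<lambda>a b. lk (rk w) a b \<and> sub a (cc w) \<and> sub b (cc w))\<^sup>*\<^sup>* x (cc w)" (is "?P\<^sup>*\<^sup>* _ _")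
  and "(\<lambda>a b. lk (rk w) a b \<and> \<not> sub a (cc w) \<and> \<not> sub b (cc w))\<^sup>*\<^sup>* y w" (is "?Q\<^sup>*\<^sup>* _ _")
proof -
 let ?c = "cc w"
 have "(lk (rk w))\<^sup>*\<^sup>* (eu (ce w)) (ev (ce w))"
  using ce_path[OF w] unfolding lk_def by blast
 then have p: "(lk (rk w))\<^sup>*\<^sup>* x y" "(lk (rk w))\<^sup>*\<^sup>* y x"
  using xy lk_rtranclp_sym by (auto simp: doubleton_eq_iff)
 show "?P\<^sup>*\<^sup>* x (cc w)"
  using leave_region[OF p(1), of "{u. sub u ?c}" ?c] s leave_sub by auto
 show "?Q\<^sup>*\<^sup>* y w"
  using leave_region[OF p(2), of "{u. \<not> sub u ?c}" w] s leave_sub[OF lk_sym] cc[OF w] by auto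
qed

text \<open>The regions of \<open>x\<close> and \<open>y\<close> are disjoint since both became live
  before \<open>w\<close>: a common vertex would give a path from \<open>y\<close> to
  \<open>x\<close> that was live before time \<open>rk w\<close>, but every path between the two
  sides passes through \<open>w\<close>.\<close>

lemma ce_region:
 assumes w: "w \<in> F" and xy: "{x, y} = {eu (ce w), ev (ce w)}" and s: "sub x (cc w)" "\<not> sub y (cc w)"
 shows "cc w \<in> Reg w" "x \<in> Reg w" "y \<in> Reg w" "Reg x \<inter> Reg y = {}"
proof -
 let ?c = "cc w"
 note P = cc_paths[OF assms]
 have y: "(lk (rk w))\<^sup>*\<^sup>* y w" using P(2) by (rule rtranclp_imp) auto
 then show yR: "y \<in> Reg w" unfolding Reg_def using lk_rtranclp_sym by auto
 have x: "(lk (rk w))\<^sup>*\<^sup>* x ?c" using P(1) by (rule rtranclp_imp) auto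
 have cx: "?c \<in> L" "rk ?c \<le> rk w"
  using lk_last[OF x] ce[OF w] xy by (auto simp: doubleton_eq_iff)
 have "lk (rk w) ?c w" using cc[OF w] cx w FC by (auto simp: lk_def)
 then have wc: "(lk (rk w))\<^sup>*\<^sup>* w ?c" using lk_sym by blast
 then show "?c \<in> Reg w" unfolding Reg_def by simp
 show "x \<in> Reg w" unfolding Reg_def using rtranclp_trans[OF wc lk_rtranclp_sym[OF x]] by simp
 have rx: "rk x < rk w" "rk y < rk w" using ce[OF w] xy by (auto simp: doubleton_eq_iff)
 show "Reg x \<inter> Reg y = {}"
 proof (rule ccontr)
  assume "Reg x \<inter> Reg y \<noteq> {}"
  then obtain u where u: "(lk (rk x))\<^sup>*\<^sup>* x u" "(lk (rk y))\<^sup>*\<^sup>* y u" by (auto simp: Reg_def)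
  let ?r = "max (rk x) (rk y)"
  have "(lk ?r)\<^sup>*\<^sup>* y u" "(lk ?r)\<^sup>*\<^sup>* u x" using u lk_mono lk_rtranclp_sym by (meson max.cobounded1 max.cobounded2)+
  then have "(lk ?r)\<^sup>*\<^sup>* y x" by simp
  moreover have "a = w" if "lk ?r a b" "a \<in> {u. \<not> sub u ?c}" "b \<notin> {u. \<not> sub u ?c}" for a b
   using leave_sub[OF lk_sym[OF that(1)]] that cc[OF w] by auto
  ultimately have "(\<lambda>a b. lk ?r a b \<and> a \<in> {u. \<not> sub u ?c} \<and> b \<in> {u. \<not> sub u ?c})\<^sup>*\<^sup>* y w"
   using leave_region[of ?r y x "{u. \<not> sub u ?c}" w] s by blast
  then have "(lk ?r)\<^sup>*\<^sup>* y w" by (rule rtranclp_imp) auto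
  moreover have "y \<in> L" using ce[OF w] xy by (auto simp: doubleton_eq_iff)
  ultimately have "rk w \<le> ?r" using lk_last by auto
  with rx show False by auto
 qed
qed

abbreviation "pend \<equiv> pe ` (V - C)"
abbreviation "hdeg H v \<equiv> card (inc eu ev H v)"

text \<open>An edge determines the child as its endpoint of larger \<open>pos\<close>.\<close>

lemma pe_inj:
 assumes "x \<in> V" "x \<noteq> rt" "y \<in> V" "y \<noteq> rt" "pe x = pe y"
 shows "x = y"
 using pe[OF assms(1,2)] pe[OF assms(3,4)] assms(5) pos_par[OF assms(1,2)] pos_par[OF assms(3,4)]
 by auto

text \<open>\<open>M\<close> is the set of marked vertices, \<open>D\<close> that of the processed ones; the marked vertices other than
 \<open>w0\<close> receive one additional edge each.\<close>

definition Inv :: "nat \<Rightarrow> nat set \<Rightarrow> nat set \<Rightarrow> nat set \<Rightarrow> bool" where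
 "Inv w0 H M D \<longleftrightarrow> H \<subseteq> {..<m} \<and> M \<subseteq> L \<and> D \<subseteq> M \<and> w0 \<in> M \<and> D \<subseteq> (V - C) \<union> F \<and>
  (\<forall>v\<in>M - D. \<forall>v'\<in>M - D. v \<noteq> v' --> Reg v \<inter> Reg v' = {}) \<and>
  (\<forall>v\<in>M - D. M \<inter> Reg v = {v}) \<and>
  (\<forall>v\<in>M - D. \<forall>x\<in>C. x \<noteq> rt --> x \<in> Reg v --> par x \<in> Reg v --> pe x \<in> H) \<and>
  (\<forall>v\<in>V. (hadj eu ev (H \<union> pend))\<^sup>*\<^sup>* v rt) \<and>
  (\<forall>v\<in>C. hdeg H v + of_bool (v \<in> D \<inter> F) \<le> hdeg (pe ` (C - {rt})) v + of_bool (v \<in> M - {w0})) \<and>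
  (\<forall>v\<in>V - C. hdeg H v \<le> of_bool (v \<in> M) + of_bool (v \<in> D)) \<and>
  (\<forall>v. v \<notin> V --> inc eu ev H v = {}) \<and>
  (\<forall>v\<in>D - C. pe v \<in> H \<and> par v \<in> M)"

lemma tree_reaches_root:
 assumes "\<And>x. x \<in> V ==> x \<noteq> rt ==> pe x \<in> H" "v \<in> V"
 shows "(hadj eu ev H)\<^sup>*\<^sup>* v rt"
 using assms(2)
proof (induction "pos v" arbitrary: v rule: less_induct)
 case (less v)
 show ?case
 proof (cases "v = rt")
  case False
  then have "(hadj eu ev H)\<^sup>*\<^sup>* (par v) rt" using less parV pos_par by auto
  moreover have "hadj eu ev H v (par v)" using assms(1)[OF less.prems False] pe[OF less.prems False]
   unfolding hadj_def by auto
  ultimately show ?thesis by (meson converse_rtranclp_into_rtranclp)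
 qed simp
qed

lemma Inv_init:
 assumes "w0 \<in> F"
 shows "Inv w0 (pe ` (C - {rt})) {w0} {}"
proof -
 let ?H = "pe ` (C - {rt})"
 have 1: "?H \<subseteq> {..<m}" using pe CV by auto
 have "pe x \<in> ?H \<union> pend" if "x \<in> V" "x \<noteq> rt" for x using that rootC by auto
 then have 2: "\<forall>v\<in>V. (hadj eu ev (?H \<union> pend))\<^sup>*\<^sup>* v rt" using tree_reaches_root by blast
 have 3: "inc eu ev ?H v = {}" if "v \<notin> C" for v
 proof -
  have "eu (pe x) \<noteq> v \<and> ev (pe x) \<noteq> v" if "x \<in> C - {rt}" for x
  proof -
   have "x \<in> V" "x \<noteq> rt" "x \<noteq> v" "par x \<noteq> v" using that parC[of x] \<open>v \<notin> C\<close> CV by auto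
   then show ?thesis using pe[of x] by auto
  qed
  then show ?thesis unfolding inc_def by auto
 qed
 have 4: "\<forall>v. v \<notin> V --> inc eu ev ?H v = {}" "\<forall>v\<in>V - C. hdeg ?H v = 0" using 3 CV by auto
 show ?thesis unfolding Inv_def using assms FC 1 2 4 Reg_self by auto
qed

text \<open>A marked absorbed vertex must be tied to the tree, so its parent edge is added and the
  parent, gaining an edge, is marked. The parent is not marked yet, because \<open>v\<close> is the
  only marked vertex in its own region; and the region of the parent is a smaller one inside, so
  disjointness is inherited.\<close>

lemma Inv_absorbed:
 assumes I: "Inv w0 H M D" and v: "v \<in> M" "v \<notin> D" "v \<notin> C"
 shows "Inv w0 (insert (pe v) H) (insert (par v) M) (insert v D)"
proof -
 let ?p = "par v"
 have vV: "v \<in> V" "v \<in> L" using I v LV by (auto simp: Inv_def)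
 have nr: "v \<noteq> rt" using v rootC by auto
 have p: "?p \<in> L" "rk ?p < rk v" using absorbed[OF vV(1) v(3)] by auto
 have "lk (rk v) v ?p" using nr vV p by (auto simp: lk_def)
 then have pR: "?p \<in> Reg v" by (auto simp: Reg_def)
 then have sub: "Reg ?p \<subseteq> Reg v - {v}" using p Reg_subset by auto
 have pM: "?p \<notin> M" using I v pR p unfolding Inv_def by (metis DiffI IntI singletonD less_irrefl)
 have Hm: "H \<subseteq> {..<m}" using I by (auto simp: Inv_def)
 then have fin: "finite H" using finite_subset by blast
 have pev: "pe v < m" "eu (pe v) = v \<and> ev (pe v) = ?p \<or> eu (pe v) = ?p \<and> ev (pe v) = v"
  using pe[OF vV(1) nr] by auto
 have d1: "hdeg (insert (pe v) H) x \<le> hdeg H x + of_bool (x = v \<or> x = ?p)" for x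
 proof (cases "x = v \<or> x = ?p")
  case True
  have "inc eu ev (insert (pe v) H) x \<subseteq> insert (pe v) (inc eu ev H x)" by (auto simp: inc_def)
  then have "hdeg (insert (pe v) H) x \<le> card (insert (pe v) (inc eu ev H x))"
   by (rule card_mono[rotated]) (use fin in \<open>auto simp: inc_def\<close>)
  also have "\<dots> \<le> Suc (hdeg H x)" by (simp add: card_insert_if fin inc_def)
  finally show ?thesis using True by simp
 next
  case False
  then have "inc eu ev (insert (pe v) H) x = inc eu ev H x" using pev by (auto simp: inc_def)
  then show ?thesis by simp
 qed
 have vp: "v \<noteq> ?p" using p by auto
 have w0: "w0 \<noteq> ?p" using I pM by (auto simp: Inv_def)
 have D: "D \<subseteq> M" using I by (simp add: Inv_def)
 have disj: "Reg x \<inter> Reg v = {}" if "x \<in> M - D" "x \<noteq> v" for x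
  using I that v unfolding Inv_def by blast
 show ?thesis unfolding Inv_def
 proof (intro conjI ballI impI allI)
  show "insert (pe v) H \<subseteq> {..<m}" using Hm pev by auto
  show "insert ?p M \<subseteq> L" using I p by (auto simp: Inv_def)
  show "insert v D \<subseteq> insert ?p M" "w0 \<in> insert ?p M" "insert v D \<subseteq> V - C \<union> F"
   using I v vV by (auto simp: Inv_def)
 next
  fix x y assume "x \<in> insert ?p M - insert v D" "y \<in> insert ?p M - insert v D" "x \<noteq> y"
  moreover have "Reg a \<inter> Reg b = {}" if "a \<in> M - D" "b \<in> M - D" "a \<noteq> b" for a b
   using I that unfolding Inv_def by blast
  ultimately show "Reg x \<inter> Reg y = {}" using disj sub by blast
 next
  fix x assume x: "x \<in> insert ?p M - insert v D"
  have Mx: "M \<inter> Reg y = {y}" if "y \<in> M - D" for y using I that by (auto simp: Inv_def)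
  show "insert ?p M \<inter> Reg x = {x}"
  proof (cases "x = ?p")
   case True
   then show ?thesis using sub Mx[of v] v Reg_self[of x] by auto
  next
   case False
   then have "?p \<notin> Reg x" using disj[of x] pR x by auto
   then show ?thesis using Mx[of x] x False by auto
  qed
 next
  fix x y assume x: "x \<in> insert ?p M - insert v D" and y: "y \<in> C" "y \<noteq> rt" "y \<in> Reg x" "par y \<in> Reg x"
  show "pe y \<in> insert (pe v) H"
  proof (cases "x = ?p")
   case True
   then have "y \<in> Reg v" "par y \<in> Reg v" using y sub by auto
   then show ?thesis using I v y unfolding Inv_def by blast
  next
   case False
   then show ?thesis using I x y unfolding Inv_def by blast
  qed
 next
  fix x assume "x \<in> V"
  then have "(hadj eu ev (H \<union> pend))\<^sup>*\<^sup>* x rt" using I by (auto simp: Inv_def)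
  then show "(hadj eu ev (insert (pe v) H \<union> pend))\<^sup>*\<^sup>* x rt" by (rule hadj_mono) auto
 next
  fix x assume x: "x \<in> C"
  then have "hdeg H x + of_bool (x \<in> D \<inter> F) \<le> hdeg (pe ` (C - {rt})) x + of_bool (x \<in> M - {w0})"
   using I by (auto simp: Inv_def)
  then show "hdeg (insert (pe v) H) x + of_bool (x \<in> insert v D \<inter> F)
   \<le> hdeg (pe ` (C - {rt})) x + of_bool (x \<in> insert ?p M - {w0})"
   using d1[of x] x v pM w0 by (cases "x = ?p"; cases "x = v") auto
 next
  fix x assume x: "x \<in> V - C"
  then have "hdeg H x \<le> of_bool (x \<in> M) + of_bool (x \<in> D)"
   using I by (auto simp: Inv_def)
  then show "hdeg (insert (pe v) H) x \<le> of_bool (x \<in> insert ?p M) + of_bool (x \<in> insert v D)"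
   using d1[of x] x v pM vp D by (cases "x = ?p"; cases "x = v") auto
 next
  fix x assume x: "x \<notin> V"
  then have "inc eu ev H x = {}" using I by (auto simp: Inv_def)
  then show "inc eu ev (insert (pe v) H) x = {}" using pev x vV p LV by (auto simp: inc_def)
 next
  fix x assume x: "x \<in> insert v D - C"
  then show "pe x \<in> insert (pe v) H" "par x \<in> insert ?p M"
   using I by (auto simp: Inv_def)
 qed
qed

text \<open>The edge from \<open>cc w\<close> to \<open>w\<close> is exchanged for
  \<open>ce w\<close>. The two pieces of \<open>cc_paths\<close> run inside the region of
  \<open>w\<close>, where no tree edge has been given up so far, so \<open>cc w\<close> and
  \<open>w\<close> stay connected through \<open>ce w\<close>. The burden of one extra edge passes
  from \<open>w\<close> to the two ends of \<open>ce w\<close>, whose regions are disjoint.\<close>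

lemma Inv_freed:
 assumes I: "Inv w0 H M D" and w: "w \<in> M" "w \<notin> D" "w \<in> F"
 shows "Inv w0 (insert (ce w) (H - {pe (cc w)})) (insert (eu (ce w)) (insert (ev (ce w)) M)) (insert w D)"
proof -
 define H' where "H' = insert (ce w) (H - {pe (cc w)})"
 let ?c = "cc w" let ?M = "insert (eu (ce w)) (insert (ev (ce w)) M)"
 obtain a b where ab: "{a, b} = {eu (ce w), ev (ce w)}" and s: "sub a ?c" "\<not> sub b ?c"
  using ce[OF w(3)] by (metis insert_commute)
 note R = ce_region[OF w(3) ab s]
 have M': "?M = insert a (insert b M)" using ab by blast
 have rk: "rk a < rk w" "rk b < rk w" "a \<in> L" "b \<in> L" using ce[OF w(3)] ab by (auto simp: doubleton_eq_iff)
 have subs: "Reg a \<subseteq> Reg w - {w}" "Reg b \<subseteq> Reg w - {w}" using R rk Reg_subset by auto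
 have Mw: "M \<inter> Reg w = {w}" using I w by (auto simp: Inv_def)
 have nM: "a \<notin> M" "b \<notin> M" using R rk Mw by fastforce+
 have anb: "a \<noteq> b" using s by auto
 have c: "?c \<in> C" "?c \<noteq> rt" "par ?c = w" "?c \<in> V" using cc[OF w(3)] CV by auto
 have wL: "w \<in> L" "w \<in> C" "w \<in> V" using w FC CV by auto
 have peH: "pe ?c \<in> H" using I w c R(1) Reg_self[of w] unfolding Inv_def by (metis DiffI)
 have Hm: "H \<subseteq> {..<m}" using I by (auto simp: Inv_def)
 then have fin: "finite H" using finite_subset by blast
 have ew: "eu (ce w) = a \<and> ev (ce w) = b \<or> eu (ce w) = b \<and> ev (ce w) = a"
  using ab by (auto simp: doubleton_eq_iff)
 have d1: "hdeg H' x + of_bool (x = w) \<le> hdeg H x + of_bool (x = a \<or> x = b)" for x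
 proof -
  have f: "finite (inc eu ev (H - {pe ?c}) x)" using fin by (auto simp: inc_def)
  have 1: "hdeg H' x \<le> hdeg (H - {pe ?c}) x + of_bool (x = a \<or> x = b)"
  proof (cases "x = a \<or> x = b")
   case True
   have "inc eu ev H' x \<subseteq> insert (ce w) (inc eu ev (H - {pe ?c}) x)" by (auto simp: inc_def H'_def)
   then have "hdeg H' x \<le> card (insert (ce w) (inc eu ev (H - {pe ?c}) x))"
    by (rule card_mono[rotated]) (use f in auto)
   also have "\<dots> \<le> Suc (hdeg (H - {pe ?c}) x)" by (simp add: card_insert_if f)
   finally show ?thesis using True by simp
  next
   case False
   then have "inc eu ev H' x = inc eu ev (H - {pe ?c}) x" using ew by (auto simp: inc_def H'_def)
   then show ?thesis by simp
  qed
  have 2: "hdeg (H - {pe ?c}) x + of_bool (x = w) \<le> hdeg H x"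
  proof (cases "x = w")
   case True
   have "inc eu ev (H - {pe ?c}) x = inc eu ev H x - {pe ?c}" by (auto simp: inc_def)
   moreover have "pe ?c \<in> inc eu ev H x" using peH pe[OF c(4,2)] c(3) True by (auto simp: inc_def)
   ultimately show ?thesis using True fin card_Suc_Diff1[of "inc eu ev H x" "pe ?c"]
    by (auto simp: inc_def)
  next
   case False
   then show ?thesis using fin by (auto simp: inc_def intro!: card_mono)
  qed
  from 1 2 show ?thesis by linarith
 qed
 have wab: "w \<noteq> a" "w \<noteq> b" "w0 \<noteq> a" "w0 \<noteq> b" using rk nM I by (auto simp: Inv_def)
 have DM: "D \<subseteq> M" using I by (simp add: Inv_def)
 have disj: "Reg x \<inter> Reg w = {}" if "x \<in> M - D" "x \<noteq> w" for x
  using I that w unfolding Inv_def by blast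
 \<comment> \<open>The edges of the two pieces are available: those above core vertices by the
   region clause of the invariant, those above absorbed vertices because connectivity is measured
   with \<open>pend\<close> added.\<close>
 have keep: "hadj eu ev (H' \<union> pend) x y"
  if l: "lk (rk w) x y" and xR: "x \<in> Reg w" "y \<in> Reg w" and ne: "sub x ?c = sub y ?c" for x y
 proof -
  obtain z where z: "z \<noteq> rt" "x = z \<and> y = par z \<or> y = z \<and> x = par z" "z \<in> L" "par z \<in> L"
   using l by (auto simp: lk_def)
  have zV: "z \<in> V" using z LV by auto
  have "z \<noteq> ?c" using z ne not_sub_par[OF c(4,2)] by auto
  have "pe z \<in> H' \<union> pend"
  proof (cases "z \<in> C")
   case True
   then have "pe z \<in> H" using I w z xR unfolding Inv_def by blast
   moreover have "pe z \<noteq> pe ?c" using pe_inj[OF zV z(1) c(4,2)] \<open>z \<noteq> ?c\<close> by auto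
   ultimately show ?thesis unfolding H'_def by auto
  qed (use zV in auto)
  then show ?thesis using pe[OF zV z(1)] z unfolding hadj_def by auto
 qed
 have conn: "(hadj eu ev (H' \<union> pend))\<^sup>*\<^sup>* x y" if "(\<lambda>x y. lk (rk w) x y \<and> P x \<and> P y)\<^sup>*\<^sup>* x y" "x \<in> Reg w"
  "\<And>x y. P x ==> P y ==> sub x ?c = sub y ?c" for P x y
  using that(1)
 proof (induction rule: rtranclp_induct)
  case (step y z)
  have "(lk (rk w))\<^sup>*\<^sup>* x y"
   using step(1) by (rule rtranclp_imp) auto
  then have "y \<in> Reg w" using that(2) unfolding Reg_def by auto
  moreover from this have "z \<in> Reg w" using step(2) unfolding Reg_def by auto
  ultimately have "hadj eu ev (H' \<union> pend) y z" using keep step(2) that(3) by blast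
  then show ?case using step.IH by (meson rtranclp.rtrancl_into_rtrancl)
 qed auto
 have ac: "(hadj eu ev (H' \<union> pend))\<^sup>*\<^sup>* a ?c"
  by (rule conn[OF cc_paths(1)[OF w(3) ab s] R(2)]) auto
 have bw: "(hadj eu ev (H' \<union> pend))\<^sup>*\<^sup>* b w"
  by (rule conn[OF cc_paths(2)[OF w(3) ab s] R(3)]) auto
 have "hadj eu ev (H' \<union> pend) a b" using ew unfolding hadj_def H'_def by blast
 then have cw: "(hadj eu ev (H' \<union> pend))\<^sup>*\<^sup>* ?c w"
  using hadj_rtranclp_sym[OF ac] bw by (meson rtranclp.rtrancl_into_rtrancl rtranclp_trans)
 \<comment> \<open>Only the removed edge needs a detour; every other old edge is still
   there.\<close>
 have edge: "(hadj eu ev (H' \<union> pend))\<^sup>*\<^sup>* x y" if "hadj eu ev (H \<union> pend) x y" for x y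
 proof -
  obtain e where e: "e \<in> H \<union> pend" "eu e = x \<and> ev e = y \<or> eu e = y \<and> ev e = x"
   using \<open>hadj eu ev (H \<union> pend) x y\<close> by (auto simp: hadj_def)
  show ?thesis
  proof (cases "e = pe ?c")
   case True
   then have "{x, y} = {?c, w}" using e pe[OF c(4,2)] c(3) by auto
   then show ?thesis using cw hadj_rtranclp_sym by (auto simp: doubleton_eq_iff)
  next
   case False
   then have "hadj eu ev (H' \<union> pend) x y" using e unfolding hadj_def H'_def by blast
   then show ?thesis by blast
  qed
 qed
 show ?thesis unfolding Inv_def H'_def[symmetric] unfolding M'
 proof (intro conjI ballI impI allI)
  show "H' \<subseteq> {..<m}" using Hm ce[OF w(3)] by (auto simp: H'_def)
  show "insert a (insert b M) \<subseteq> L" using I rk by (auto simp: Inv_def)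
  show "insert w D \<subseteq> insert a (insert b M)" "w0 \<in> insert a (insert b M)" "insert w D \<subseteq> V - C \<union> F"
   using I w by (auto simp: Inv_def)
 next
  fix x y assume "x \<in> insert a (insert b M) - insert w D" "y \<in> insert a (insert b M) - insert w D" "x \<noteq> y"
  moreover have "Reg x \<inter> Reg y = {}" if "x \<in> M - D" "y \<in> M - D" "x \<noteq> y" for x y
   using I that unfolding Inv_def by blast
  ultimately show "Reg x \<inter> Reg y = {}" using disj subs R(4) by blast
 next
  fix x assume x: "x \<in> insert a (insert b M) - insert w D"
  have Mx: "M \<inter> Reg y = {y}" if "y \<in> M - D" for y using I that by (auto simp: Inv_def)
  have na: "a \<notin> Reg b" "b \<notin> Reg a" using R(4) Reg_self by blast+
  show "insert a (insert b M) \<inter> Reg x = {x}"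
  proof (cases "x = a \<or> x = b")
   case True
   then show ?thesis using subs Mw w Reg_self[of x] na anb by auto
  next
   case False
   then have "a \<notin> Reg x" "b \<notin> Reg x" using disj[of x] R x by auto
   then show ?thesis using Mx[of x] x False by auto
  qed
 next
  fix x y assume x: "x \<in> insert a (insert b M) - insert w D"
   and y: "y \<in> C" "y \<noteq> rt" "y \<in> Reg x" "par y \<in> Reg x"
  have "w \<notin> Reg x" using disj[of x] x subs Reg_self[of w] by blast
  then have "y \<noteq> ?c" using y c by auto
  then have ne: "pe y \<noteq> pe ?c" using pe_inj[of y ?c] y c CV by auto
  have "pe y \<in> H"
  proof (cases "x = a \<or> x = b")
   case True
   then have "y \<in> Reg w" "par y \<in> Reg w" using y subs by auto
   then show ?thesis using I w y unfolding Inv_def by blast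
  next
   case False
   then show ?thesis using I x y unfolding Inv_def by blast
  qed
  with ne show "pe y \<in> H'" unfolding H'_def by auto
 next
  fix x assume "x \<in> V"
  then have "(hadj eu ev (H \<union> pend))\<^sup>*\<^sup>* x rt" using I by (auto simp: Inv_def)
  then show "(hadj eu ev (H' \<union> pend))\<^sup>*\<^sup>* x rt"
   by (induction rule: converse_rtranclp_induct) (use edge in \<open>auto intro: rtranclp_trans\<close>)
 next
  fix x assume x: "x \<in> C"
  then have "hdeg H x + of_bool (x \<in> D \<inter> F) \<le> hdeg (pe ` (C - {rt})) x + of_bool (x \<in> M - {w0})"
   using I by (auto simp: Inv_def)
  then show "hdeg H' x + of_bool (x \<in> insert w D \<inter> F)
   \<le> hdeg (pe ` (C - {rt})) x + of_bool (x \<in> insert a (insert b M) - {w0})"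
   using d1[of x] w wab nM DM by (cases "x = a \<or> x = b"; cases "x = w") auto
 next
  fix x assume x: "x \<in> V - C"
  then have "hdeg H x \<le> of_bool (x \<in> M) + of_bool (x \<in> D)"
   using I by (auto simp: Inv_def)
  then show "hdeg H' x \<le> of_bool (x \<in> insert a (insert b M)) + of_bool (x \<in> insert w D)"
   using d1[of x] x wL nM DM by (cases "x = a \<or> x = b"; cases "x = w") auto
 next
  fix x assume x: "x \<notin> V"
  then have "inc eu ev H x = {}" using I by (auto simp: Inv_def)
  then show "inc eu ev H' x = {}" using ew x rk LV by (auto simp: inc_def H'_def)
 next
  fix x assume x: "x \<in> insert w D - C"
  then have x': "x \<in> D" "x \<notin> C" using wL by auto
  then have "pe x \<in> H" "par x \<in> M" using I by (auto simp: Inv_def)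
  moreover have "x \<in> V" using x' DM I LV by (auto simp: Inv_def)
  moreover have "x \<noteq> rt" "x \<noteq> ?c" using x' c(1) rootC by auto
  ultimately have "pe x \<in> H" "par x \<in> M" "pe x \<noteq> pe ?c" using pe_inj[of x ?c] c(2,4) by auto
  then show "pe x \<in> H'" "par x \<in> insert a (insert b M)" by (auto simp: H'_def)
 qed
qed

text \<open>Absorbed vertices that were never marked hang on pending parent edges only. Retracting
  each of them to the first vertex of \<open>C \<union> M\<close> above it removes these edges from
  a walk. A marked absorbed vertex has one edge for its mark and one to its parent, hence the bound
  2.\<close>

lemma Inv_final:
 assumes I: "Inv w0 H M D" and fin: "M \<inter> ((V - C) \<union> F) \<subseteq> D" and w0: "w0 \<in> F"
 shows "\<And>v. v \<in> C ==> (hadj eu ev H)\<^sup>*\<^sup>* v rt"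
  and "\<And>v. v \<in> C ==> hdeg H v + of_bool (v \<in> M \<inter> F) \<le> hdeg (pe ` (C - {rt})) v + of_bool (v \<in> M - {w0})"
  and "\<And>v. v \<notin> C ==> hdeg H v \<le> 2"
  and "M \<subseteq> L" "w0 \<in> M" "H \<subseteq> {..<m}"
proof -
 let ?Z = "C \<union> M"
 \<comment> \<open>The retraction, kept as a relation so that no termination argument for the parent
   chain is needed.\<close>
 define g where "g x z \<longleftrightarrow> (\<lambda>a b. a \<notin> ?Z \<and> b = par a)\<^sup>*\<^sup>* x z \<and> z \<in> ?Z" for x z
 have gZ: "g x z \<longleftrightarrow> z = x" if "x \<in> ?Z" for x z
  using that unfolding g_def by (auto elim: converse_rtranclpE)
 have gN: "g x z \<longleftrightarrow> g (par x) z" if "x \<notin> ?Z" for x z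
  using that unfolding g_def by (subst rtranclp_first) auto
 \<comment> \<open>Unmarked vertices outside \<open>C\<close> have degree 0 in \<open>H\<close> by
   the degree clauses of the invariant.\<close>
 have HZ: "x \<in> ?Z" if "e \<in> H" "eu e = x \<or> ev e = x" for e x
 proof -
  have f: "finite (inc eu ev H x)" using I finite_subset unfolding Inv_def inc_def by fastforce
  have e: "e \<in> inc eu ev H x" using that by (auto simp: inc_def)
  then have "x \<in> V" using I unfolding Inv_def by blast
  moreover have "hdeg H x \<noteq> 0" using e f by auto
  moreover have "D \<subseteq> M" "x \<in> V - C ==> hdeg H x \<le> of_bool (x \<in> M) + of_bool (x \<in> D)"
   using I by (simp_all add: Inv_def)
  ultimately show ?thesis by (cases "x \<in> M"; cases "x \<in> D") auto
 qed
 have edge: "g y z' ==> \<exists>z. g x z \<and> (hadj eu ev H)\<^sup>*\<^sup>* z z'" if "hadj eu ev (H \<union> pend) x y" for x y z'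
 proof -
  obtain e where e: "e \<in> H \<union> pend" "eu e = x \<and> ev e = y \<or> eu e = y \<and> ev e = x"
   using \<open>hadj eu ev (H \<union> pend) x y\<close> by (auto simp: hadj_def)
  assume gy: "g y z'"
  show ?thesis
  proof (cases "e \<in> H")
   case True
   then have "hadj eu ev H x y" "x \<in> ?Z" "y \<in> ?Z" using e HZ[OF True] by (auto simp: hadj_def)
   then show ?thesis using gZ gy by auto
  next
   case False
   then obtain q where q: "q \<in> V - C" "e = pe q" using e by auto
   have "\<forall>v\<in>D - C. pe v \<in> H" using I by (simp add: Inv_def)
   \<comment> \<open>A marked absorbed vertex has been processed by now, and then its parent edge
     belongs to \<open>H\<close>.\<close>
   then have "q \<notin> M" using False q fin by auto
   then have qZ: "q \<notin> ?Z" using q by auto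
   have "q \<noteq> rt" using q rootC by auto
   then have "{x, y} = {q, par q}" using e q pe[of q] by auto
   then show ?thesis using gy gN[OF qZ] by (auto simp: doubleton_eq_iff)
  qed
 qed
 have path: "\<exists>z. g x z \<and> (hadj eu ev H)\<^sup>*\<^sup>* z rt" if "(hadj eu ev (H \<union> pend))\<^sup>*\<^sup>* x rt" for x
  using that
 proof (induction rule: converse_rtranclp_induct)
  case base
  then show ?case using gZ[of rt] rootC by auto
 next
  case (step x y)
  then obtain z where "g y z" "(hadj eu ev H)\<^sup>*\<^sup>* z rt" by auto
  with edge[OF step(1)] show ?case by (meson rtranclp_trans)
 qed
 show "(hadj eu ev H)\<^sup>*\<^sup>* v rt" if "v \<in> C" for v
 proof -
  have "(hadj eu ev (H \<union> pend))\<^sup>*\<^sup>* v rt" using I CV that unfolding Inv_def by auto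
  then obtain z where "g v z" "(hadj eu ev H)\<^sup>*\<^sup>* z rt" using path by blast
  with gZ[of v] that show ?thesis by simp
 qed
 have DM: "D \<subseteq> M" using I by (auto simp: Inv_def)
 show "hdeg H v + of_bool (v \<in> M \<inter> F) \<le> hdeg (pe ` (C - {rt})) v + of_bool (v \<in> M - {w0})" if "v \<in> C" for v
 proof -
  have "v \<in> M \<inter> F \<longleftrightarrow> v \<in> D \<inter> F" using DM fin by auto
  then show ?thesis using I that unfolding Inv_def by simp
 qed
 show "hdeg H v \<le> 2" if "v \<notin> C" for v
 proof (cases "v \<in> V")
  case True
  then have "hdeg H v \<le> of_bool (v \<in> M) + of_bool (v \<in> D)" using I that by (auto simp: Inv_def)
  also have "\<dots> \<le> 2" by (simp split: if_splits)
  finally show ?thesis .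
 next
  case False
  then show ?thesis using I by (simp add: Inv_def)
 qed
 show "M \<subseteq> L" "w0 \<in> M" "H \<subseteq> {..<m}" using I by (auto simp: Inv_def)
qed

end

section \<open>Counting branches below a vertex set; intervals of preorder numbers\<close>

context rtree
begin

text \<open>A vertex on the tree path from \<open>a\<close> to \<open>b\<close> is one of its ends
  or the parent of a vertex whose upper edge lies on the path. So it suffices that the parents of
  such edges are live.\<close>

lemma sep_live:
 assumes "sep a b x y" "a \<in> L" "b \<in> L" "L \<subseteq> L'" "L' \<subseteq> V"
  and cov: "\<And>c. c \<in> V ==> c \<noteq> rt ==> sub a c \<noteq> sub b c ==> par c \<in> L'"
 shows "x \<in> L'" "y \<in> L'" "x \<noteq> rt \<and> y = par x \<or> y \<noteq> rt \<and> x = par y"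
proof -
 obtain z where z: "z \<in> V" "z \<noteq> rt" "sub a z \<noteq> sub b z" "x = z \<and> y = par z \<or> y = z \<and> x = par z"
  using assms(1) by (auto simp: sep_def)
 have *: "z \<in> L'" if u: "sub u z" "\<not> sub v z" "u \<in> L" "v \<in> L"
  and uv: "\<And>c. c \<in> V ==> c \<noteq> rt ==> sub u c \<noteq> sub v c ==> par c \<in> L'" for u v
 proof (cases "u = z")
  case False
  with child_towards[OF u(1)] obtain c where c: "sub u c" "c \<noteq> rt" "par c = z" by auto
  have cV: "c \<in> V" using c u assms(4,5) sub_V by blast
  have "sub c z" using c anc_step[of rt par c z] by auto
  then have "\<not> sub v c" using u anc_trans by blast
  then show ?thesis using uv[OF cV c(2)] c by auto
 qed (use u assms(4) in auto)
 have "z \<in> L'"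
 proof (cases "sub a z")
  case True
  then show ?thesis using *[of a b] z assms by auto
 next
  case False
  then show ?thesis using *[of b a] z assms(2-3) cov by blast
 qed
 moreover have "par z \<in> L'" using cov z by auto
 ultimately show "x \<in> L'" "y \<in> L'" "x \<noteq> rt \<and> y = par x \<or> y \<noteq> rt \<and> x = par y" using z by auto
qed

definition children :: "nat \<Rightarrow> nat set" where
 "children w = {c \<in> V. c \<noteq> rt \<and> par c = w}"

text \<open>These branches stay in one piece when \<open>W\<close> is deleted; each will account for
  a component of its own.\<close>

definition leaf_children :: "nat set \<Rightarrow> nat set" where
 "leaf_children W = {c \<in> V. c \<noteq> rt \<and> par c \<in> W \<and> (\<forall>w\<in>W. \<not> sub w c)}"

lemma finite_children: "finite (children w)"
 using finV by (auto simp: children_def)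

lemma card_children_Union: "finite W ==> card {c \<in> V. c \<noteq> rt \<and> par c \<in> W} = (\<Sum>w\<in>W. card (children w))"
proof -
 assume "finite W"
 have "{c \<in> V. c \<noteq> rt \<and> par c \<in> W} = (\<Union>w\<in>W. children w)" by (auto simp: children_def)
 then show ?thesis
  using card_UN_disjoint[OF \<open>finite W\<close>, of children] finite_children by (auto simp: children_def)
qed

text \<open>Every other child of \<open>W\<close> has vertices of \<open>W\<close> below it and is
  charged to the one of smallest \<open>pos\<close>. The charge is injective and misses a vertex of
  \<open>W\<close>, so at most \<open>card W - 1\<close> children are lost.\<close>

lemma leaf_children_count:
 assumes "W \<subseteq> V" "W \<noteq> {}"
 shows "(\<Sum>w\<in>W. card (children w)) + 1 \<le> card (leaf_children W) + card W"
proof -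
 have fW: "finite W" using assms finV finite_subset by blast
 let ?K = "{c \<in> V. c \<noteq> rt \<and> par c \<in> W}"
 let ?LC = "leaf_children W"
 define f where "f c = (ARG_MIN pos w. w \<in> W \<and> sub w c)" for c
 have f: "f c \<in> W \<and> sub (f c) c \<and> (\<forall>w\<in>W. sub w c --> pos (f c) \<le> pos w)" if "c \<in> ?K - ?LC" for c
 proof -
  have "\<exists>w. w \<in> W \<and> sub w c" using that by (auto simp: leaf_children_def)
  then obtain w where "w \<in> W \<and> sub w c" ..
  from arg_min_nat_lemma[of "\<lambda>w. w \<in> W \<and> sub w c", OF this, of pos] show ?thesis
   unfolding f_def by blast
 qed
 have pc: "pos (par c) < pos w" if "c \<in> ?K" "w \<in> W" "sub w c" for c w
 proof -
  have "pos c \<le> pos w" using that assms sub_pos by blast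
  then show ?thesis using pos_par[of c] that by auto
 qed
 \<comment> \<open>If \<open>c\<close> were strictly below \<open>d\<close>, then
   \<open>par c\<close> would be a vertex of \<open>W\<close> below \<open>d\<close> with smaller
   \<open>pos\<close> than any vertex of \<open>W\<close> below \<open>c\<close>.\<close>
 have key: "c = d" if cd: "c \<in> ?K - ?LC" "d \<in> ?K - ?LC" "f c = f d" "sub c d" for c d
 proof (rule ccontr)
  assume "c \<noteq> d"
  then have "sub (par c) d" using cd(4) anc_step[of rt par c d] by auto
  then have "pos (f d) \<le> pos (par c)" using f[OF cd(2)] cd(1) by auto
  moreover have "pos (par c) < pos (f c)" using pc[of c "f c"] f[OF cd(1)] cd(1) by auto
  ultimately show False using cd(3) by simp
 qed
 have inj: "inj_on f (?K - ?LC)"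
 proof (rule inj_onI)
  fix c d assume cd: "c \<in> ?K - ?LC" "d \<in> ?K - ?LC" "f c = f d"
  have "sub (f c) c" "sub (f c) d" using f[OF cd(1)] f[OF cd(2)] cd(3) by auto
  from anc_linear[OF this] show "c = d" using key[OF cd] key[OF cd(2,1) cd(3)[symmetric]] by blast
 qed
 \<comment> \<open>A vertex of smallest \<open>pos\<close> in \<open>W\<close> lies below no child
   of \<open>W\<close>, so it receives no charge.\<close>
 obtain w0 where w0: "w0 \<in> W" "\<And>w. w \<in> W ==> pos w0 \<le> pos w"
  using arg_min_nat_lemma[of "\<lambda>w. w \<in> W" _ pos] assms(2) by blast
 have "f ` (?K - ?LC) \<subseteq> W - {w0}"
 proof
  fix w assume "w \<in> f ` (?K - ?LC)"
  then obtain c where c: "c \<in> ?K - ?LC" "w = f c" by blast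
  then have "pos (par c) < pos w" using pc[of c "f c"] f[OF c(1)] by auto
  then show "w \<in> W - {w0}" using f[OF c(1)] c w0 by fastforce
 qed
 then have "card (?K - ?LC) \<le> card (W - {w0})"
  using fW by (intro card_inj_on_le[OF inj]) auto
 then have 1: "card (?K - ?LC) + 1 \<le> card W" using card_Suc_Diff1[OF fW w0(1)] by simp
 have fK: "finite ?K" using finV by auto
 have "?LC \<subseteq> ?K" by (auto simp: leaf_children_def)
 then have "card ?K = card ?LC + card (?K - ?LC)"
  using card_Diff_subset[OF finite_subset[OF _ fK], of ?LC] card_mono[OF fK, of ?LC] by simp
 with 1 card_children_Union[OF fW] show ?thesis by simp
qed

text \<open>Branches that meet are nested, and then the parent of the lower one is a vertex of
  \<open>W\<close> inside the upper one.\<close>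

lemma leaf_children_disjoint:
 assumes "W \<subseteq> V" "c \<in> leaf_children W" "d \<in> leaf_children W" "c \<noteq> d"
 shows "{u. sub u c} \<inter> {u. sub u d} = {}"
proof (rule ccontr)
 assume "\<not> ?thesis"
 then obtain u where u: "sub u c" "sub u d" by auto
 have *: False if "sub x y" "x \<noteq> y" "x \<in> leaf_children W" "y \<in> leaf_children W" for x y
  using that anc_step[of rt par x y] by (auto simp: leaf_children_def)
 show False using anc_linear[OF u] *[of c d] *[of d c] assms by auto
qed

text \<open>A vertex of largest \<open>pos\<close> below \<open>c\<close> cannot have a child. In
  the pruned tree this leaf will be a terminal.\<close>

lemma exists_leaf_below:
 assumes "c \<in> V"
 shows "\<exists>x\<in>V. sub x c \<and> children x = {}"
proof -
 have "c \<in> {x\<in>V. sub x c}" using assms by auto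
 then have ne: "{x\<in>V. sub x c} \<noteq> {}" by blast
 obtain x where x: "x \<in> {x\<in>V. sub x c}" "\<And>y. y \<in> {x\<in>V. sub x c} ==> pos y \<le> pos x"
 proof -
  have f: "finite (pos ` {x\<in>V. sub x c})" using finV by auto
  have "Max (pos ` {x\<in>V. sub x c}) \<in> pos ` {x\<in>V. sub x c}" using Max_in[OF f] ne by blast
  then obtain x where "x \<in> {x\<in>V. sub x c}" "pos x = Max (pos ` {x\<in>V. sub x c})" by auto
  moreover then have "pos y \<le> pos x" if "y \<in> {x\<in>V. sub x c}" for y using f that by simp
  ultimately show ?thesis using that by blast
 qed
 have "children x = {}"
 proof (rule ccontr)
  assume "children x \<noteq> {}"
  then obtain y where y: "y \<in> V" "y \<noteq> rt" "par y = x" by (auto simp: children_def)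
  then have "sub y c" using x(1) anc_step[of rt par y c] by auto
  then have "pos y \<le> pos x" using x(2) y by auto
  then show False using pos_par[OF y(1,2)] y by simp
 qed
 then show ?thesis using x by blast
qed

text \<open>Handshake: each tree edge is counted once from above and once from below.\<close>

lemma sum_tree_degrees:
 "(\<Sum>v\<in>V. card (children v) + of_bool (v \<noteq> rt)) = 2 * (card V - 1)"
proof -
 have e: "{c \<in> V. c \<noteq> rt \<and> par c \<in> V} = V - {rt}" using parV by auto
 have "(\<Sum>v\<in>V. card (children v)) = card V - 1"
  using card_children_Union[OF finV] e rootV by (simp add: card_Diff_singleton)
 moreover have "(\<Sum>v\<in>V. of_bool (v \<noteq> rt)) = card (V - {rt})"
 proof -
  have "V \<inter> {v. v \<noteq> rt} = V - {rt}" by auto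
  then show ?thesis using finV by (simp add: sum.If_cases of_bool_def)
 qed
 ultimately show ?thesis using rootV by (simp add: sum.distrib card_Diff_singleton)
qed

text \<open>Descending from the root: if \<open>pre u\<close> lies in the interval of
  \<open>x\<close>, then \<open>u\<close> is below \<open>par x\<close> by induction, and the child
  of \<open>par x\<close> towards \<open>u\<close> has an interval containing \<open>pre u\<close>.
  Siblings have disjoint intervals, so this child is \<open>x\<close>.\<close>

lemma sub_interval:
 fixes pre sz :: "nat \<Rightarrow> nat"
 assumes sz: "\<And>v. v \<in> V ==> 1 \<le> sz v"
  and child: "\<And>c. c \<in> V ==> c \<noteq> rt ==> pre (par c) < pre c \<and> pre c + sz c \<le> pre (par c) + sz (par c)"
  and sib: "\<And>c d. c \<in> V ==> d \<in> V ==> c \<noteq> rt ==> d \<noteq> rt ==> c \<noteq> d ==> par c = par d ==>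
    pre c + sz c \<le> pre d \<or> pre d + sz d \<le> pre c"
  and uV: "u \<in> V" "x \<in> V"
 shows "sub u x \<longleftrightarrow> pre x \<le> pre u \<and> pre u < pre x + sz x"
proof -
 have a: "pre x \<le> pre u \<and> pre u + sz u \<le> pre x + sz x" if "sub u x" "u \<in> V" for u x
  using that unfolding anc_def
 proof (induction rule: converse_rtranclp_induct)
  case (step y z)
  then show ?case using child[of y] parV[of y] by auto
 qed auto
 have b: "pre x \<le> pre u \<and> pre u < pre x + sz x ==> sub u x" if "x \<in> V" for x
  using that
 proof (induction "pos x" arbitrary: x rule: less_induct)
  case (less x)
  show ?case
  proof (cases "x = rt")
   case True
   then show ?thesis using sub_root uV by auto
  next
   case False
   let ?p = "par x"
   have p: "?p \<in> V" "pos ?p < pos x" "pre ?p < pre x" "pre x + sz x \<le> pre ?p + sz ?p"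
    using False less.prems parV pos_par child[of x] by auto
   then have "sub u ?p" using less by auto
   moreover have "u \<noteq> ?p" using p less.prems by auto
   ultimately obtain c where c: "sub u c" "c \<noteq> rt" "par c = ?p" using child_towards by blast
   have cV: "c \<in> V" using c uV sub_V by blast
   have "pre c \<le> pre u" "pre u < pre c + sz c" using a[OF c(1) uV(1)] sz[OF uV(1)] by auto
   then have "c = x" using sib[OF cV less.prems(2) c(2) False] c(3) less.prems(1) by fastforce
   then show ?thesis using c by simp
  qed
 qed
 show ?thesis using a[of u x] b[of x] uV sz[OF uV(1)] by fastforce
qed

end

section \<open>Lower bounds for the number of components that contain terminals\<close>

section \<open>Components after deleting a vertex set\<close>

text \<open>The sets \<open>S i\<close> need not be connected: being closed under edges, each
  contains the whole component of its terminal \<open>x i\<close>, and disjointness keeps these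
  components apart.\<close>

lemma components_ge:
 assumes "finite (verts H)" "finite I"
  and mem: "\<And>i. i \<in> I ==> x i \<in> X \<and> x i \<in> S i \<and> x i \<in> verts H"
  and closed: "\<And>i u v. i \<in> I ==> u \<in> S i ==> u \<in> verts H ==> v \<in> verts H ==> {u, v} \<in> edges H ==> v \<in> S i"
  and disj: "\<And>i j. i \<in> I ==> j \<in> I ==> i \<noteq> j ==> S i \<inter> S j = {}"
  and eH: "\<And>u v. {u, v} \<in> edges H ==> u \<in> verts H \<and> v \<in> verts H"
 shows "card I \<le> num_comps H X"
proof -
 let ?C = "\<lambda>i. {v. connected_in H (x i) v}"
 have sub: "?C i \<subseteq> S i" if i: "i \<in> I" for i
 proof
  fix v assume "v \<in> ?C i"
  then have "(\<lambda>x y. {x, y} \<in> edges H)\<^sup>*\<^sup>* (x i) v" by (simp add: connected_in_def)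
  then show "v \<in> S i"
   by (induction rule: rtranclp_induct) (use mem[OF i] closed[OF i] eH in blast)+
 qed
 have self: "x i \<in> ?C i" if "i \<in> I" for i using mem[OF that] by (simp add: connected_in_def)
 have inj: "inj_on ?C I"
 proof (rule inj_onI)
  fix i j assume ij: "i \<in> I" "j \<in> I" "?C i = ?C j"
  then have "x i \<in> S i \<inter> S j" using self sub mem by blast
  then show "i = j" using disj ij by blast
 qed
 have fin: "finite (components H)" using assms(1) unfolding components_def by simp
 have "?C ` I \<subseteq> {C \<in> components H. C \<inter> X \<noteq> {}}"
  using self mem unfolding components_def by blast
 then have "card (?C ` I) \<le> num_comps H X" unfolding num_comps_def
  by (rule card_mono[rotated]) (use fin in auto)
 then show ?thesis using card_image[OF inj] by simp
qed

lemma num_comps_le_1: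
 assumes "num_comps H X \<le> 1" "finite (verts H)" "x \<in> X" "y \<in> X" "x \<in> verts H" "y \<in> verts H"
 shows "connected_in H x y"
proof (rule ccontr)
 assume n: "\<not> connected_in H x y"
 let ?C = "\<lambda>x. {v. connected_in H x v}"
 have "?C x \<noteq> ?C y" using n assms(5,6) by (auto simp: connected_in_def)
 then have "card {?C x, ?C y} = 2" by simp
 moreover have "{?C x, ?C y} \<subseteq> {C \<in> components H. C \<inter> X \<noteq> {}}"
  using assms(3-6) by (auto simp: components_def connected_in_def)
 moreover have "finite (components H)" using assms(2) unfolding components_def by simp
 ultimately have "2 \<le> num_comps H X" unfolding num_comps_def
  using card_mono[of "{C \<in> components H. C \<inter> X \<noteq> {}}" "{?C x, ?C y}"] by simp
 with assms(1) show False by simp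
qed

section \<open>A geometric and a harmonic sum bound the number of rounds\<close>

section \<open>Counting rounds\<close>

text \<open>The pairs \<open>(k, q)\<close> range over those lexicographically at most
  \<open>(K, p)\<close>, so the cardinality is a potential that falls from phase to phase.\<close>

definition trips :: "nat \<Rightarrow> nat \<Rightarrow> nat \<Rightarrow> (nat \<times> nat \<times> nat) set" where
 "trips N K p = {(k, q, i). 4 \<le> k \<and> 1 \<le> q \<and> q * (k - 1) * 2 ^ i \<le> N \<and> (k < K \<or> k = K \<and> q \<le> p)}"

definition rounds :: "nat \<Rightarrow> nat \<Rightarrow> nat \<Rightarrow> nat set" where
 "rounds N k p = {i. p * (k - 1) * 2 ^ i \<le> N}"

text \<open>With \<open>j = k - 1\<close> there are \<open>N div (j * 2 ^ i)\<close> values of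
  \<open>q\<close>, ready for summation. The range of \<open>i\<close> is crude, but the terms decay
  geometrically in \<open>i\<close>.\<close>

lemma trips_subset: "trips N K p \<subseteq> (\<lambda>(j, i, q). (j + 1, q, i)) ` (SIGMA j:{1..N}. SIGMA i:{..<N}. {1..N div (j * 2 ^ i)})"
proof
 fix t assume "t \<in> trips N K p"
 then obtain k q i where t: "t = (k, q, i)" "4 \<le> k" "1 \<le> q" "q * (k - 1) * 2 ^ i \<le> N"
  by (auto simp: trips_def)
 have a: "k - 1 \<le> q * (k - 1) * 2 ^ i" "2 ^ i \<le> q * (k - 1) * 2 ^ i" using t by auto
 have "i < (2::nat) ^ i" by simp
 then have i: "i < N" and kN: "k - 1 \<le> N" using a t by linarith+
 have "q \<le> N div ((k - 1) * 2 ^ i)" using t by (simp add: less_eq_div_iff_mult_less_eq mult.assoc)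
 then have "(k - 1, i, q) \<in> (SIGMA j:{1..N}. SIGMA i:{..<N}. {1..N div (j * 2 ^ i)})"
  using t i kN by auto
 moreover have "t = (\<lambda>(j, i, q). (j + 1, q, i)) (k - 1, i, q)" using t by auto
 ultimately show "t \<in> (\<lambda>(j, i, q). (j + 1, q, i)) ` (SIGMA j:{1..N}. SIGMA i:{..<N}. {1..N div (j * 2 ^ i)})"
  by blast
qed

lemma finite_trips: "finite (trips N K p)"
 by (rule finite_subset[OF trips_subset]) auto

lemma finite_rounds: "1 \<le> p ==> 4 \<le> k ==> finite (rounds N k p)"
proof -
 assume a: "1 \<le> p" "4 \<le> k"
 have "rounds N k p \<subseteq> {..<N}"
 proof
  fix i assume "i \<in> rounds N k p"
  then have 1: "p * (k - 1) * 2 ^ i \<le> N" by (simp add: rounds_def)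
  have 2: "2 ^ i \<le> p * (k - 1) * 2 ^ i" using a by auto
  have "i < (2::nat) ^ i" by simp
  with 1 2 have "i < N" by linarith
  then show "i \<in> {..<N}" by simp
 qed
 then show ?thesis using finite_subset by blast
qed

lemma trips_mono: "k < K \<or> k = K \<and> q \<le> p ==> card (trips N k q) \<le> card (trips N K p)"
 by (rule card_mono[OF finite_trips]) (auto simp: trips_def)

text \<open>Lowering \<open>p\<close> by one drops exactly the triples \<open>(k, p, i)\<close>, one
  for each possible round of a phase with \<open>p\<close> vertices of degree
  \<open>k\<close>.\<close>

lemma trips_step:
 assumes "4 \<le> k" "1 \<le> p"
 shows "card (trips N k p) = card (trips N k (p - 1)) + card (rounds N k p)"
proof -
 have "trips N k p = trips N k (p - 1) \<union> (\<lambda>i. (k, p, i)) ` rounds N k p"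
 proof -
  have e: "q \<le> p \<longleftrightarrow> q \<le> p - 1 \<or> q = p" for q using assms by auto
  show ?thesis using assms by (auto simp: trips_def rounds_def e)
 qed
 moreover have "trips N k (p - 1) \<inter> (\<lambda>i. (k, p, i)) ` rounds N k p = {}"
  using assms by (auto simp: trips_def)
 ultimately show ?thesis
  using finite_rounds[OF assms(2,1)] finite_trips
  by (simp add: card_Un_disjoint card_image inj_on_def)
qed

lemma sum_inverse_le: "1 \<le> N ==> (\<Sum>j=1..N. 1 / real j) \<le> 1 + ln (real N)"
proof (induction N rule: nat_induct_at_least)
 case (Suc n)
 \<comment> \<open>The step \<open>1 / (n + 1) \<le> ln (n + 1) - ln n\<close> is
   \<open>ln x \<le> x - 1\<close> at \<open>x = n / (n + 1)\<close>.\<close>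
 have "ln (real n / real (Suc n)) \<le> real n / real (Suc n) - 1"
  using Suc by (intro ln_le_minus_one) auto
 also have "\<dots> = - 1 / real (Suc n)" by (simp add: field_simps)
 finally have "1 / real (Suc n) \<le> ln (real (Suc n)) - ln (real n)"
  using Suc by (simp add: ln_div)
 with Suc show ?case by simp
qed simp

text \<open>The geometric sum over \<open>i\<close> contributes the factor 2, the harmonic sum over
  \<open>j\<close> the factor \<open>1 + ln N\<close>.\<close>

lemma card_trips_le:
 assumes "1 \<le> N"
 shows "real (card (trips N K p)) \<le> 2 * real N * (1 + ln (real N))"
proof -
 let ?S = "SIGMA j:{1..N}. SIGMA i:{..<N}. {1..N div (j * 2 ^ i)}"
 have "card (trips N K p) \<le> card ((\<lambda>(j, i, q). (j + 1, q, i)) ` ?S)"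
  by (rule card_mono[OF _ trips_subset]) auto
 also have "\<dots> \<le> card ?S" by (rule card_image_le) auto
 also have "card ?S = (\<Sum>j=1..N. \<Sum>i<N. N div (j * 2 ^ i))" by simp
 finally have "real (card (trips N K p)) \<le> (\<Sum>j=1..N. \<Sum>i<N. real (N div (j * 2 ^ i)))"
  unfolding of_nat_sum[symmetric] of_nat_le_iff .
 also have "\<dots> \<le> (\<Sum>j=1..N. \<Sum>i<N. (real N / real j) * (1 / 2) ^ i)"
  by (intro sum_mono order_trans[OF of_nat_div_le_of_nat]) (simp add: power_divide)
 also have "\<dots> = (\<Sum>j=1..N. (real N / real j) * (\<Sum>i<N. (1 / 2) ^ i))"
  by (simp add: sum_distrib_left)
 also have "\<dots> \<le> (\<Sum>j=1..N. (real N / real j) * 2)"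
 proof (intro sum_mono mult_left_mono)
  have "(\<Sum>i<N. (1 / 2 :: real) ^ i) = 2 - 2 * (1 / 2) ^ N"
   by (induction N) simp_all
  then show "(\<Sum>i<N. (1 / 2 :: real) ^ i) \<le> 2" by simp
 qed auto
 also have "\<dots> = 2 * real N * (\<Sum>j=1..N. 1 / real j)" by (simp add: sum_distrib_left mult.commute)
 also have "\<dots> \<le> 2 * real N * (1 + ln (real N))"
  using sum_inverse_le[OF assms] by (intro mult_left_mono) auto
 finally show ?thesis .
qed

section \<open>Search along allowed edges, expanding unblocked vertices only\<close>

section \<open>Growing a tree\<close>

text \<open>
 Registers: 0 and 1 hold the constants 0 and 1, 2 and 3 hold \<open>n\<close> and \<open>m\<close>, 4 the root, 5 is nonzero until the
 search stops, 7 counts the vertices of the grown tree and 18 those of its core (the current Steiner tree),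
 17 is the maximum degree \<open>k\<close>, 19 the length of the time line, 20 the number of blocked vertices,
 21 the number of vertices unblocked in the current round, 28 tells whether 23 holds an unblocked vertex of degree \<open>k\<close>.
 Arrays: 2 and 3 are the endpoints of the edges, 4 marks the terminals, 5, 6 and 7 are the adjacency lists (edge, neighbour,
 offsets), 8 and 9 are edge sets (current and next), 10 marks the tree vertices, 11 and 12 are the parent and
 the parent edge, 13 lists the vertices in the order of insertion, 14 marks blocked and 15 absorbed vertices,
 16 is the time line of absorbed and unblocked vertices, 17 the degree, 18 the subtree size, 19 the preorder number,
 21 to 24 are the extreme preorder numbers (and the edges attaining them) reached from a subtree by unblocked edges,
 25 and 26 are the replacement edge and the child at which it applies, 27 marks vertices to be improved, 28 those kept by pruning.
\<close>

definition joins :: "(nat \<Rightarrow> nat) \<Rightarrow> (nat \<Rightarrow> nat) \<Rightarrow> nat \<Rightarrow> nat \<Rightarrow> nat \<Rightarrow> bool" where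
 "joins eu ev e x y \<longleftrightarrow> eu e = x \<and> ev e = y \<or> eu e = y \<and> ev e = x"

lemma joins_sym: "joins eu ev e x y ==> joins eu ev e y x"
 by (auto simp: joins_def)

text \<open>The input after preprocessing, with adjacency lists stored row by row. The root counts
  as a terminal (\<open>tmrt\<close>), so pruning cannot remove it. From here on a word bound linear
  in \<open>n + m\<close> is enough.\<close>

locale graph =
 fixes W n m rt :: nat and eu ev tm adj nb st :: "nat \<Rightarrow> nat"
 assumes n1: "1 \<le> n" and rtn: "rt < n"
  and W: "8 * (n + m + 2) \<le> W"
  and eun: "e < m ==> eu e < n" and evn: "e < m ==> ev e < n" and euev: "e < m ==> eu e \<noteq> ev e"
  and tmrt: "tm rt = 1" and tm01: "v < n ==> tm v = 0 \<or> tm v = 1"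
  and st_mono: "v < n ==> st v \<le> st (Suc v)" and st0: "st 0 = 0" and stn: "st n \<le> 2 * m"
  and adj1: "v < n ==> st v \<le> j ==> j < st (Suc v) ==> adj j < m \<and> joins eu ev (adj j) v (nb j)"
  and adj2: "v < n ==> e < m ==> joins eu ev e v y ==>
    \<exists>j. st v \<le> j \<and> j < st (Suc v) \<and> adj j = e \<and> nb j = y"
begin

lemma joins_lt: "e < m ==> joins eu ev e x y ==> x < n \<and> y < n"
 using eun[of e] evn[of e] by (auto simp: joins_def)

lemma st_le: "v \<le> w ==> w \<le> n ==> st v \<le> st w"
proof (induction w rule: dec_induct)
 case (step w)
 then show ?case using st_mono[of w] by simp
qed simp

definition static :: "state \<Rightarrow> bool" where
 "static s \<longleftrightarrow> regs s 0 = 0 \<and> regs s 1 = 1 \<and> regs s 2 = n \<and> regs s 3 = m \<and> regs s 4 = rt \<and>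
   arrs s 2 = eu \<and> arrs s 3 = ev \<and> arrs s 4 = tm \<and> arrs s 5 = adj \<and> arrs s 6 = nb \<and> arrs s 7 = st"

lemma staticD:
 assumes "static s"
 shows "regs s 0 = 0" "regs s (Suc 0) = 1" "regs s 2 = n" "regs s 3 = m" "regs s 4 = rt"
  "arrs s 2 = eu" "arrs s 3 = ev" "arrs s 4 = tm" "arrs s 5 = adj" "arrs s 6 = nb" "arrs s 7 = st"
 using assms by (simp_all add: static_def)

lemma static_set [simp]:
 "r \<notin> {0,1,2,3,4} ==> static (set_reg r x s) = static s"
 "a \<notin> {2,3,4,5,6,7} ==> static (set_arr a i x s) = static s"
 by (auto simp: static_def)

lemma static_frame:
 "static s ==> frame c s s' ==> wr c \<inter> {0,1,2,3,4} = {} ==> wa c \<inter> {2,3,4,5,6,7} = {} ==> static s'"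
 unfolding static_def frame_def by auto

end

definition grow_edge :: com where
 "grow_edge = Load 12 5 10 ;; Load 13 8 12 ;;
   If (Equal 13 1)
    (Load 14 6 10 ;; Load 15 10 14 ;;
    If (Equal 15 0)
     (Store 10 14 1 ;; Store 11 14 8 ;; Store 12 14 12 ;; Store 13 7 14 ;; Add 7 7 1)
     Skip)
    Skip"

definition grow_vertex :: com where
 "grow_vertex = (Load 8 13 6 ;; Load 9 14 8) ;;
   If (Equal 9 0) ((Load 10 7 8 ;; Add 16 8 1 ;; Load 11 7 16) ;; for_up 10 11 grow_edge) Skip"

text \<open>The same loop serves two purposes: in the first search of a phase array 8 restricts the
  edges and nothing is blocked, whereas in a round all edges are allowed but blocked vertices are
  not expanded. It always starts at index 0, so vertices freed since the last round get expanded as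
  well.\<close>

definition grow :: com where
 "grow = Const 6 0 ;; While (Less 6 7) (grow_vertex ;; Add 6 6 1)"

lemma wr_grow [simp]:
 "wr grow_edge = {7,12,13,14,15}" "wa grow_edge = {10,11,12,13}"
 "wr grow_vertex = {7,8,9,10,11,12,13,14,15,16}" "wa grow_vertex = {10,11,12,13}"
 "wr grow = {6,7,8,9,10,11,12,13,14,15,16}" "wa grow = {10,11,12,13}"
 by (auto simp: grow_edge_def grow_vertex_def grow_def)

context graph
begin

definition listed :: "(nat \<Rightarrow> nat) \<Rightarrow> nat \<Rightarrow> (nat \<Rightarrow> nat) \<Rightarrow> bool" where
 "listed ord cnt inn \<longleftrightarrow> inj_on ord {..<cnt} \<and> ord ` {..<cnt} = {v. v < n \<and> inn v \<noteq> 0}"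

lemma listed_lt: "listed ord cnt inn ==> i < cnt ==> ord i < n \<and> inn (ord i) \<noteq> 0"
 unfolding listed_def by blast

lemma listed_inj: "listed ord cnt inn ==> i < cnt ==> j < cnt ==> ord i = ord j \<longleftrightarrow> i = j"
 by (auto simp: listed_def inj_on_def)

lemma listed_cnt: "listed ord cnt inn ==> cnt \<le> n"
 unfolding listed_def using card_image[of ord "{..<cnt}"] card_mono[of "{..<n}" "ord ` {..<cnt}"] by auto

lemma listed_add:
 assumes "listed ord cnt inn" "y < n" "inn y = 0"
 shows "listed (ord(cnt := y)) (Suc cnt) (inn(y := 1))"
proof -
 have e: "(ord(cnt := y)) ` {..<Suc cnt} = insert y (ord ` {..<cnt})"
  by (auto simp: lessThan_Suc image_iff)
 have "y \<notin> ord ` {..<cnt}" using assms by (auto simp: listed_def)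
 moreover have "inj_on (ord(cnt := y)) {..<cnt}" using assms by (auto simp: listed_def inj_on_def)
 moreover have "(ord(cnt := y)) ` {..<cnt} = ord ` {..<cnt}" by auto
 ultimately have "inj_on (ord(cnt := y)) {..<Suc cnt}" by (simp add: lessThan_Suc)
 then show ?thesis unfolding listed_def e using assms by (auto simp: listed_def)
qed

definition linked :: "(nat \<Rightarrow> nat) \<Rightarrow> (nat \<Rightarrow> nat) \<Rightarrow> (nat \<Rightarrow> nat) \<Rightarrow> (nat \<Rightarrow> nat) \<Rightarrow> (nat \<Rightarrow> nat) \<Rightarrow> nat \<Rightarrow> bool" where
 "linked bl ff ord par pe j \<longleftrightarrow> (\<exists>i<j. par (ord j) = ord i \<and> bl (ord i) = 0 \<and> pe (ord j) < m \<and>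
   ff (pe (ord j)) = 1 \<and> joins eu ev (pe (ord j)) (ord j) (ord i))"

definition grown :: "state \<Rightarrow> state \<Rightarrow> bool" where
 "grown s s' \<longleftrightarrow> static s' \<and> regs s 7 \<le> regs s' 7 \<and>
   arrs s' 8 = arrs s 8 \<and> arrs s' 14 = arrs s 14 \<and>
   listed (arrs s' 13) (regs s' 7) (arrs s' 10) \<and>
   (\<forall>j<regs s 7. arrs s' 13 j = arrs s 13 j) \<and>
   (\<forall>v. v < n --> arrs s 10 v \<noteq> 0 --> arrs s' 10 v = arrs s 10 v \<and> arrs s' 11 v = arrs s 11 v \<and> arrs s' 12 v = arrs s 12 v) \<and>
   (\<forall>v. v < n --> arrs s 10 v = 0 --> arrs s' 10 v = 0 \<or> arrs s' 10 v = 1) \<and>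
   (\<forall>j. regs s 7 \<le> j --> j < regs s' 7 -->
    linked (arrs s 14) (arrs s 8) (arrs s' 13) (arrs s' 11) (arrs s' 12) j)"

definition scanned :: "state \<Rightarrow> nat \<Rightarrow> nat \<Rightarrow> bool" where
 "scanned s i q \<longleftrightarrow> arrs s 14 (arrs s 13 i) = 0 -->
   (\<forall>j. st (arrs s 13 i) \<le> j --> j < q --> arrs s 8 (adj j) = 1 --> arrs s 10 (nb j) \<noteq> 0)"

definition scan_inv :: "state \<Rightarrow> nat \<Rightarrow> state \<Rightarrow> bool" where
 "scan_inv s i s' \<longleftrightarrow> grown s s' \<and> (\<forall>i'<i. scanned s' i' (st (Suc (arrs s' 13 i'))))"

text \<open>Tree marks are never withdrawn, so a finished row stays finished.\<close>

lemma scan_invI: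
 assumes "scan_inv s i s1" "grown s s2" "i \<le> regs s1 7"
  "\<forall>j<regs s1 7. arrs s2 13 j = arrs s1 13 j" "\<forall>v<n. arrs s1 10 v \<noteq> 0 --> arrs s2 10 v \<noteq> 0"
 shows "scan_inv s i s2"
 unfolding scan_inv_def
proof (intro conjI allI impI assms(2))
 fix i' assume i': "i' < i"
 have e: "arrs s2 8 = arrs s1 8" "arrs s2 14 = arrs s1 14" using assms(1,2) by (auto simp: grown_def scan_inv_def)
 have o: "arrs s2 13 i' = arrs s1 13 i'" using assms(3,4) i' by auto
 have l: "listed (arrs s1 13) (regs s1 7) (arrs s1 10)" using assms(1) by (auto simp: grown_def scan_inv_def)
 have v: "arrs s1 13 i' < n" using listed_lt[OF l, of i'] i' assms(3) by auto
 have sc: "scanned s1 i' (st (Suc (arrs s1 13 i')))" using assms(1) i' by (auto simp: scan_inv_def)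
 show "scanned s2 i' (st (Suc (arrs s2 13 i')))"
  unfolding scanned_def o e
 proof (intro impI allI)
  fix j assume j: "arrs s1 14 (arrs s1 13 i') = 0" "st (arrs s1 13 i') \<le> j" "j < st (Suc (arrs s1 13 i'))"
   "arrs s1 8 (adj j) = 1"
  then have "arrs s1 10 (nb j) \<noteq> 0" using sc unfolding scanned_def by blast
  moreover have "nb j < n" using adj1[OF v j(2,3)] joins_lt by blast
  ultimately show "arrs s2 10 (nb j) \<noteq> 0" using assms(5) by auto
 qed
qed

lemma grow_edge:
 assumes S: "scan_inv s i s1" and i: "i < regs s1 7" "v = arrs s1 13 i" "regs s1 8 = v"
  and bl: "arrs s1 14 v = 0" and j: "st v \<le> j" "j < st (Suc v)" "regs s1 10 = j"
  and sc: "scanned s1 i j"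
 shows "tr W grow_edge s1 11 (\<lambda>s'. scan_inv s i s' \<and> i < regs s' 7 \<and> v = arrs s' 13 i \<and> scanned s' i (Suc j) \<and>
  regs s1 7 \<le> regs s' 7 \<and> (\<forall>k<regs s1 7. arrs s' 13 k = arrs s1 13 k))"
proof -
 have g: "grown s s1" using S by (simp add: scan_inv_def)
 have l: "listed (arrs s1 13) (regs s1 7) (arrs s1 10)" using g by (auto simp: grown_def)
 have stt: "static s1" using g by (auto simp: grown_def)
 have v: "v < n" using listed_lt[OF l i(1)] i by auto
 note a = adj1[OF v j(1,2)]
 have y: "nb j < n" using a joins_lt by blast
 let ?y = "nb j"
 have c: "regs s1 7 \<le> n" using listed_cnt[OF l] .
 define Q where "Q s' \<longleftrightarrow> scan_inv s i s' \<and> i < regs s' 7 \<and> v = arrs s' 13 i \<and> scanned s' i (Suc j) \<and>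
  regs s1 7 \<le> regs s' 7 \<and> (\<forall>k<regs s1 7. arrs s' 13 k = arrs s1 13 k)" for s'
 have main: "Q s'" if "regs s' 7 = regs s1 7" "arrs s' = arrs s1" "static s'"
  "arrs s1 8 (adj j) = 1 --> arrs s1 10 ?y \<noteq> 0" for s'
 proof -
  have "grown s s'" using g that by (simp add: grown_def)
  then have "scan_inv s i s'" using S i that by (intro scan_invI[OF S]) auto
  moreover have "scanned s' i (Suc j)" using sc that by (auto simp: scanned_def less_Suc_eq)
  ultimately show ?thesis unfolding Q_def using that i by auto
 qed
 have new: "Q s'" if e: "regs s' 7 = Suc (regs s1 7)" "static s'"
   "arrs s' = (arrs s1)(10 := (arrs s1 10)(?y := 1), 11 := (arrs s1 11)(?y := v), 12 := (arrs s1 12)(?y := adj j),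
     13 := (arrs s1 13)(regs s1 7 := ?y))"
   "arrs s1 8 (adj j) = 1" "arrs s1 10 ?y = 0" for s'
 proof -
  have "listed (arrs s' 13) (regs s' 7) (arrs s' 10)" using listed_add[OF l y e(5)] e by simp
  moreover have "arrs s 10 ?y = 0"
  proof (rule ccontr)
   assume "arrs s 10 ?y \<noteq> 0"
   then have "arrs s1 10 ?y \<noteq> 0" using g y unfolding grown_def by metis
   then show False using e by simp
  qed
  moreover have "linked (arrs s 14) (arrs s 8) (arrs s' 13) (arrs s' 11) (arrs s' 12) k"
   if k: "regs s 7 \<le> k" "k < regs s' 7" for k
  proof (cases "k = regs s1 7")
   case True
   have "arrs s 14 = arrs s1 14" "arrs s 8 = arrs s1 8" using g by (auto simp: grown_def)
   then show ?thesis unfolding linked_def using True e i bl a joins_sym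
    by (intro exI[of _ i]) auto
  next
   case False
   then have k1: "k < regs s1 7" using k e by auto
   then have "linked (arrs s 14) (arrs s 8) (arrs s1 13) (arrs s1 11) (arrs s1 12) k"
    using g k unfolding grown_def by auto
   moreover have "arrs s1 13 k \<noteq> ?y" using listed_lt[OF l k1] e by auto
   ultimately show ?thesis using e k1 unfolding linked_def by (elim exE conjE, intro exI conjI) auto
  qed
  ultimately have "grown s s'" using g e unfolding grown_def by auto
  then have "scan_inv s i s'" using i e by (intro scan_invI[OF S]) auto
  moreover have "scanned s' i (Suc j)" using sc e i by (auto simp: scanned_def less_Suc_eq)
  ultimately show ?thesis unfolding Q_def using e i by auto
 qed
 have "tr W grow_edge s1 11 Q" unfolding grow_edge_def
  by (rule tr_wp) (use c W stt in \<open>simp_all add: j i(3) staticD main new\<close>)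
 then show ?thesis unfolding Q_def .
qed

lemma grow_vertex:
 assumes S: "scan_inv s i s1" and i: "i < regs s1 7" "v = arrs s1 13 i" "regs s1 6 = i"
 shows "tr W grow_vertex s1 (7 + 13 * (st (Suc v) - st v))
  (\<lambda>s'. scan_inv s (Suc i) s' \<and> Suc i \<le> regs s' 7 \<and> (\<forall>j\<le>i. arrs s' 13 j = arrs s1 13 j))"
proof -
 have g: "grown s s1" using S by (simp add: scan_inv_def)
 have l: "listed (arrs s1 13) (regs s1 7) (arrs s1 10)" using g by (auto simp: grown_def)
 have stt: "static s1" using g by (auto simp: grown_def)
 have v: "v < n" using listed_lt[OF l i(1)] i by auto
 let ?l = "st (Suc v) - st v"
 let ?Q = "\<lambda>s'. scan_inv s (Suc i) s' \<and> Suc i \<le> regs s' 7 \<and> (\<forall>j\<le>i. arrs s' 13 j = arrs s1 13 j)"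
 let ?R = "\<lambda>s2. arrs s2 = arrs s1 \<and> regs s2 7 = regs s1 7 \<and> regs s2 8 = v \<and> static s2"
 have sc: "scan_inv s i s2" if "?R s2" for s2
  using S that i by (intro scan_invI[OF S]) (auto simp: grown_def scan_inv_def)
 have "tr W (Load 8 13 6 ;; Load 9 14 8) s1 2 (\<lambda>s2. ?R s2 \<and> regs s2 9 = arrs s1 14 v)"
  using i stt by (intro tr_wp) (simp_all add: staticD)
 moreover have "tr W (If (Equal 9 0) ((Load 10 7 8 ;; Add 16 8 1 ;; Load 11 7 16) ;; for_up 10 11 grow_edge) Skip) s2
   (Suc (4 + 13 * ?l)) ?Q" if R: "?R s2 \<and> regs s2 9 = arrs s1 14 v" for s2
 proof (rule tr_If)
  assume "holds (Equal 9 0) s2"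
  then have bl: "arrs s1 14 v = 0" using R by (auto simp: staticD)
  let ?R' = "\<lambda>s3. ?R s3 \<and> regs s3 10 = st v \<and> regs s3 11 = st (Suc v)"
  have "tr W (Load 10 7 8 ;; Add 16 8 1 ;; Load 11 7 16) s2 3 ?R'"
   using R v W by (intro tr_wp) (auto simp: staticD staticD[OF stt])
  moreover have "tr W (for_up 10 11 grow_edge) s3 (1 + 13 * ?l) ?Q" if R3: "?R' s3" for s3
  proof -
   let ?I = "\<lambda>j s'. scan_inv s i s' \<and> i < regs s' 7 \<and> v = arrs s' 13 i \<and> scanned s' i j \<and>
    regs s1 7 \<le> regs s' 7 \<and> (\<forall>k<regs s1 7. arrs s' 13 k = arrs s1 13 k)"
   have "tr W (for_up 10 11 grow_edge) s3 (1 + 13 * ?l) (\<lambda>s'. ?I (st (Suc v)) s' \<and> regs s' 10 = st (Suc v))"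
   proof (rule tr_for_up[where T = 11])
    show "?I (regs s3 10) s3" using sc[of s3] R3 i by (auto simp: scanned_def)
    show "st (Suc v) \<le> W"
     using st_le[of "Suc v" n] v stn W by simp
   next
    fix j s' assume I: "?I j s'" and j: "regs s3 10 \<le> j" "j < st (Suc v)" "regs s' 10 = j"
     and f: "frame (for_up 10 11 grow_edge) s3 s'"
    have r8: "regs s' 8 = v" using frame_regs[OF f, of 8] R3 by simp
    have "arrs s' 14 v = 0" using frame_arrs[OF f, of 14] R3 bl by simp
    then have "tr W grow_edge s' 11 (\<lambda>s''. scan_inv s i s'' \<and> i < regs s'' 7 \<and> v = arrs s'' 13 i \<and>
      scanned s'' i (Suc j) \<and> regs s' 7 \<le> regs s'' 7 \<and> (\<forall>k<regs s' 7. arrs s'' 13 k = arrs s' 13 k))"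
     using I j R3 r8 by (intro grow_edge) auto
    then show "tr W grow_edge s' 11 (?I (Suc j))"
    proof (rule tr_cons)
     fix s'' assume q: "scan_inv s i s'' \<and> i < regs s'' 7 \<and> v = arrs s'' 13 i \<and>
      scanned s'' i (Suc j) \<and> regs s' 7 \<le> regs s'' 7 \<and> (\<forall>k<regs s' 7. arrs s'' 13 k = arrs s' 13 k)"
     have "arrs s'' 13 k = arrs s1 13 k" if "k < regs s1 7" for k
     proof -
      have "k < regs s' 7" using I that by linarith
      then have "arrs s'' 13 k = arrs s' 13 k" using q by blast
      then show ?thesis using I that by simp
     qed
     moreover have "regs s1 7 \<le> regs s'' 7" using q I by linarith
     ultimately show "?I (Suc j) s''" using q by blast
    qed simp
   qed (use R3 st_mono[OF v] in \<open>auto simp: staticD scan_inv_def grown_def scanned_def\<close>)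
   then show ?thesis
   proof (rule tr_cons)
    fix s' assume f: "frame (for_up 10 11 grow_edge) s3 s'" and I: "?I (st (Suc v)) s' \<and> regs s' 10 = st (Suc v)"
    then have "scan_inv s (Suc i) s'" by (auto simp: scan_inv_def less_Suc_eq)
    moreover have "Suc i \<le> regs s' 7" using I by linarith
    moreover have "arrs s' 13 j = arrs s1 13 j" if "j \<le> i" for j
    proof -
     have "j < regs s1 7" using that i(1) by linarith
     then show ?thesis using I by blast
    qed
    ultimately show "?Q s'" by blast
   qed simp
  qed
  ultimately have "tr W ((Load 10 7 8 ;; Add 16 8 1 ;; Load 11 7 16) ;; for_up 10 11 grow_edge) s2 (3 + (1 + 13 * ?l)) ?Q"
   by (rule tr_seq)
  then show "tr W ((Load 10 7 8 ;; Add 16 8 1 ;; Load 11 7 16) ;; for_up 10 11 grow_edge) s2 (4 + 13 * ?l) ?Q"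
   by simp
 next
  assume "\<not> holds (Equal 9 0) s2"
  then have "arrs s1 14 v \<noteq> 0" using R by (auto simp: staticD)
  then show "tr W Skip s2 (4 + 13 * ?l) ?Q" using sc[of s2] R i
   by (intro tr_wp) (auto simp: scan_inv_def less_Suc_eq scanned_def)
 qed
 ultimately have "tr W ((Load 8 13 6 ;; Load 9 14 8) ;; If (Equal 9 0) ((Load 10 7 8 ;; Add 16 8 1 ;; Load 11 7 16) ;; for_up 10 11 grow_edge) Skip) s1
   (2 + (Suc (4 + 13 * ?l))) ?Q"
  by (rule tr_seq)
 then show ?thesis by (simp add: grow_vertex_def)
qed

lemma grow:
 assumes "static s" and l: "listed (arrs s 13) (regs s 7) (arrs s 10)"
 shows "tr W grow s (2 + 10 * n + 26 * m) (\<lambda>s'. grown s s' \<and>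
  (\<forall>i<regs s' 7. arrs s 14 (arrs s' 13 i) = 0 -->
    (\<forall>e<m. \<forall>y. arrs s 8 e = 1 --> joins eu ev e (arrs s' 13 i) y --> arrs s' 10 y \<noteq> 0)))"
proof -
 let ?f = "\<lambda>v. 10 + 13 * (st (Suc v) - st v)"
 \<comment> \<open>The remaining budget: the rows of the vertices not yet scanned. Listed vertices
   are distinct, so each row is paid for once, and all rows together have at most
   \<open>2 * m\<close> entries.\<close>
 define pot where "pot s' i = 1 + sum ?f ({..<n} - arrs s' 13 ` {..<i})" for s' :: state and i
 let ?I = "\<lambda>z s'. \<exists>i. i = regs s' 6 \<and> scan_inv s i s' \<and> i \<le> regs s' 7 \<and> pot s' i \<le> z"
 have tot: "pot s' 0 \<le> 1 + 10 * n + 26 * m" for s'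
 proof -
  have "(\<Sum>v<k. st (Suc v) - st v) = st k - st 0" if "k \<le> n" for k
   using that by (induction k) (use st_mono st_le[of 0] in auto)
  then have "(\<Sum>v<n. st (Suc v) - st v) \<le> 2 * m" using stn by auto
  then show ?thesis unfolding pot_def by (simp add: sum.distrib sum_distrib_left[symmetric])
 qed
 have "tr W (Const 6 0) s 1 (\<lambda>s'. s' = set_reg 6 0 s)" by (intro tr_wp) auto
 moreover have "tr W (While (Less 6 7) (grow_vertex ;; Add 6 6 1)) s' (1 + 10 * n + 26 * m)
   (\<lambda>s'. \<not> holds (Less 6 7) s' \<and> (\<exists>z. ?I z s'))" if s': "s' = set_reg 6 0 s" for s'
 proof (rule tr_while)
  show "?I (1 + 10 * n + 26 * m) s'" using assms s' tot[of s']
   by (auto simp: scan_inv_def grown_def)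
 next
  fix z s1 assume I: "?I z s1" and h: "holds (Less 6 7) s1"
  let ?i = "regs s1 6" let ?v = "arrs s1 13 ?i"
  have S: "scan_inv s ?i s1" and i: "?i < regs s1 7" and z: "pot s1 ?i \<le> z" using I h by auto
  have l1: "listed (arrs s1 13) (regs s1 7) (arrs s1 10)" using S by (auto simp: scan_inv_def grown_def)
  let ?Q = "\<lambda>s2. scan_inv s (Suc ?i) s2 \<and> Suc ?i \<le> regs s2 7 \<and> (\<forall>j\<le>?i. arrs s2 13 j = arrs s1 13 j)"
  have p: "pot s1 ?i = ?f ?v + pot s2 (Suc ?i)" if "\<forall>j\<le>?i. arrs s2 13 j = arrs s1 13 j" for s2
  proof -
   have "arrs s1 13 x \<noteq> ?v" if "x < ?i" for x using listed_inj[OF l1, of x ?i] i that by simp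
   then have v: "?v \<in> {..<n} - arrs s1 13 ` {..<?i}" using listed_lt[OF l1 i] by fastforce
   have "arrs s2 13 ` {..<Suc ?i} = arrs s1 13 ` {..<Suc ?i}" using that by (intro image_cong) auto
   also have "\<dots> = insert ?v (arrs s1 13 ` {..<?i})" by (simp add: lessThan_Suc)
   finally have "{..<n} - arrs s2 13 ` {..<Suc ?i} = ({..<n} - arrs s1 13 ` {..<?i}) - {?v}" by auto
   then show ?thesis unfolding pot_def using sum.remove[OF _ v, of ?f] by simp
  qed
  have "tr W (grow_vertex ;; Add 6 6 1) s1 (7 + 13 * (st (Suc ?v) - st ?v) + 1) (?I (z - ?f ?v))"
  proof (rule tr_seq)
   show "tr W grow_vertex s1 (7 + 13 * (st (Suc ?v) - st ?v)) ?Q" by (rule grow_vertex[OF S i]) auto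
   fix s2 assume f: "frame grow_vertex s1 s2" and Q: "?Q s2"
   have st2: "static s2" using Q by (auto simp: scan_inv_def grown_def)
   have "regs s2 6 = ?i" using frame_regs[OF f, of 6] by simp
   moreover have "?i < n" using listed_cnt[OF l1] i by simp
   moreover have "scan_inv s (Suc ?i) (set_reg 6 (Suc ?i) s2)"
    using Q by (auto simp: scan_inv_def grown_def scanned_def)
   moreover have "pot s2 (Suc ?i) \<le> z - ?f ?v" using z p[of s2] Q by auto
   ultimately show "tr W (Add 6 6 1) s2 1 (?I (z - ?f ?v))"
    using st2 W Q by (intro tr_wp) (auto simp: staticD pot_def)
  qed
  moreover have "?f ?v \<le> z" using z p[of s1] by auto
  ultimately show "\<exists>T z'. T + 1 + z' \<le> z \<and> tr W (grow_vertex ;; Add 6 6 1) s1 T (?I z')"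
   by (intro exI[of _ "7 + 13 * (st (Suc ?v) - st ?v) + 1"] exI[of _ "z - ?f ?v"]) auto
 qed (auto simp: pot_def)
 ultimately have "tr W grow s (1 + (1 + 10 * n + 26 * m)) (\<lambda>s'. \<not> holds (Less 6 7) s' \<and> (\<exists>z. ?I z s'))"
  unfolding grow_def by (rule tr_seq)
 then show ?thesis
 proof (rule tr_cons)
  fix s' assume "\<not> holds (Less 6 7) s' \<and> (\<exists>z. ?I z s')"
  then have S: "scan_inv s (regs s' 7) s'" by (auto simp: scan_inv_def)
  then have g: "grown s s'" by (simp add: scan_inv_def)
  have l': "listed (arrs s' 13) (regs s' 7) (arrs s' 10)" using g by (auto simp: grown_def)
  have "arrs s' 10 y \<noteq> 0" if i: "i < regs s' 7" "arrs s 14 (arrs s' 13 i) = 0" and e: "e < m" "arrs s 8 e = 1"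
   "joins eu ev e (arrs s' 13 i) y" for i e y
  proof -
   have v: "arrs s' 13 i < n" using listed_lt[OF l' i(1)] by simp
   obtain j where "st (arrs s' 13 i) \<le> j" "j < st (Suc (arrs s' 13 i))" "adj j = e" "nb j = y"
    using adj2[OF v e(1,3)] by blast
   moreover have "scanned s' i (st (Suc (arrs s' 13 i)))" using S i by (auto simp: scan_inv_def)
   moreover have "arrs s' 14 = arrs s 14" "arrs s' 8 = arrs s 8" using g by (auto simp: grown_def)
   ultimately show ?thesis using i e unfolding scanned_def by metis
  qed
  then show "grown s s' \<and>
  (\<forall>i<regs s' 7. arrs s 14 (arrs s' 13 i) = 0 -->
    (\<forall>e<m. \<forall>y. arrs s 8 e = 1 --> joins eu ev e (arrs s' 13 i) y --> arrs s' 10 y \<noteq> 0))"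
   using g by blast
 qed simp
qed

end

section \<open>Extracting a tree and marking the part of it that leads to terminals\<close>

section \<open>Breadth-first search\<close>

definition init_phase :: com where
 "init_phase = (Const 6 0 ;;
   for_up 6 2 (Store 10 6 0 ;; Store 14 6 0 ;; Store 15 6 0 ;; Store 17 6 0 ;; Store 27 6 0)) ;;
   (Store 10 4 1 ;; Store 11 4 4 ;; Store 13 0 4 ;; Move 7 1)"

text \<open>Running backwards through the list treats each vertex before its parent, so one pass
  carries the marks up to the root.\<close>

definition mark_kept :: com where
 "mark_kept = (Const 6 0 ;; for_up 6 2 (Load 8 4 6 ;; Store 28 6 8)) ;;
   Move 6 7 ;;
   for_down 6 0 (Load 8 13 6 ;; Load 9 28 8 ;; If (Equal 9 1) (Load 24 11 8 ;; Store 28 24 1) Skip)"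

definition compress :: com where
 "compress = ((Const 18 0 ;; Const 6 0) ;;
   for_up 6 7 (Load 8 13 6 ;; Load 9 28 8 ;;
    If (Equal 9 1) (Store 13 18 8 ;; Add 18 18 1) (Store 10 8 0))) ;;
   Move 7 18"

text \<open>The loop starts at index 1: each vertex except the root contributes its parent edge, at
  both ends.\<close>

definition degrees :: com where
 "degrees = Move 6 1 ;;
   for_up 6 7 (Load 8 13 6 ;; Load 9 17 8 ;; Add 9 9 1 ;; Store 17 8 9 ;;
    Load 24 11 8 ;; Load 9 17 24 ;; Add 9 9 1 ;; Store 17 24 9)"

definition max_deg :: com where
 "max_deg = (Const 17 0 ;; Const 6 0) ;;
   for_up 6 7 (Load 8 13 6 ;; Load 9 17 8 ;; If (Less 17 9) (Move 17 9) Skip)"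

lemma wr_phase1 [simp]:
 "wr init_phase = {6,7}" "wa init_phase = {10,11,13,14,15,17,27}"
 "wr mark_kept = {6,8,9,24}" "wa mark_kept = {28}"
 "wr compress = {6,7,8,9,18}" "wa compress = {10,13}"
 "wr degrees = {6,8,9,24}" "wa degrees = {17}"
 "wr max_deg = {6,8,9,17}" "wa max_deg = {}"
 by (auto simp: init_phase_def mark_kept_def compress_def degrees_def max_deg_def)

lemma set_arr_set_reg: "set_arr a i x (set_reg r y s) = set_reg r y (set_arr a i x s)"
 by (simp add: set_arr_def set_reg_def)

lemma tr_for_up0:
 assumes "I 0 (set_reg i 0 s)" and N: "regs s lm = N" "N \<le> W"
  and one: "regs s 1 = 1"
  and nw: "i \<notin> wr c" "lm \<notin> wr c" "1 \<notin> wr c" "i \<noteq> lm" "i \<noteq> 1"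
  and indep: "\<And>j s x. I j s ==> I j (set_reg i x s)"
  and body: "\<And>j s'. j < N ==> I j s' ==> regs s' i = j ==>
    frame (for_up i lm c) s s' ==> tr W c s' T (I (Suc j))"
  and time: "N * (T + 2) + 2 \<le> T'"
 shows "tr W (Const i 0 ;; for_up i lm c) s T' (\<lambda>s'. I N s' \<and> regs s' i = N)"
proof (rule tr_le)
 show "tr W (Const i 0 ;; for_up i lm c) s (1 + (N * (T + 2) + 1)) (\<lambda>s'. I N s' \<and> regs s' i = N)"
 proof (rule tr_seq)
  show "tr W (Const i 0) s 1 (\<lambda>s1. s1 = set_reg i 0 s)" by (intro tr_wp) auto
  fix s1 assume s1: "s1 = set_reg i 0 s"
  show "tr W (for_up i lm c) s1 (N * (T + 2) + 1) (\<lambda>s'. I N s' \<and> regs s' i = N)"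
  proof (rule tr_for_up[where T = T])
   fix j s' assume a: "j < N" "I j s'" "regs s' i = j" "frame (for_up i lm c) s1 s'"
   then have "frame (for_up i lm c) s s'" unfolding s1 by (auto simp: frame_def)
   with a show "tr W c s' T (I (Suc j))" using body by blast
  qed (use assms s1 in auto)
 qed
qed (use time in simp)

context graph
begin

text \<open>Acyclicity is implicit in the order of the list, and the index in it becomes the
  \<open>pos\<close> of \<open>rtree\<close>.\<close>

definition treeP :: "(nat \<Rightarrow> nat) \<Rightarrow> nat \<Rightarrow> (nat \<Rightarrow> nat) \<Rightarrow> (nat \<Rightarrow> nat) \<Rightarrow> bool" where
 "treeP ord cnt par pe \<longleftrightarrow> 0 < cnt \<and> ord 0 = rt \<and> inj_on ord {..<cnt} \<and> ord ` {..<cnt} \<subseteq> {..<n} \<and>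
   (\<forall>j. 0 < j --> j < cnt -->
    (\<exists>i<j. par (ord j) = ord i \<and> pe (ord j) < m \<and> joins eu ev (pe (ord j)) (ord j) (ord i)))"

lemma treeP_lt: "treeP ord cnt par pe ==> i < cnt ==> ord i < n"
 by (auto simp: treeP_def)

lemma treeP_inj: "treeP ord cnt par pe ==> i < cnt ==> j < cnt ==> ord i = ord j \<longleftrightarrow> i = j"
 by (auto simp: treeP_def inj_on_def)

lemma treeP_cnt: "treeP ord cnt par pe ==> 0 < cnt \<and> cnt \<le> n"
 unfolding treeP_def using card_image[of ord "{..<cnt}"] card_mono[of "{..<n}" "ord ` {..<cnt}"] by auto

lemma treeP_par:
 assumes "treeP ord cnt par pe" "0 < j" "j < cnt"
 obtains i where "i < j" "par (ord j) = ord i" "pe (ord j) < m" "joins eu ev (pe (ord j)) (ord j) (ord i)"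
 using assms unfolding treeP_def by blast

lemma treeP_rt: "treeP ord cnt par pe ==> j < cnt ==> ord j = rt \<longleftrightarrow> j = 0"
 using treeP_inj[of ord cnt par pe j 0] by (auto simp: treeP_def)

lemma treeP_rtree:
 assumes "treeP ord cnt par pe"
 shows "rtree (ord ` {..<cnt}) rt par (inv_into {..<cnt} ord)"
proof -
 have pos: "inv_into {..<cnt} ord (ord j) = j" if "j < cnt" for j
  using assms that by (intro inv_into_f_f) (auto simp: treeP_def)
 show ?thesis
 proof
  show "finite (ord ` {..<cnt})" by simp
  show "rt \<in> ord ` {..<cnt}" using assms unfolding treeP_def by (metis imageI lessThan_iff)
  fix v assume "v \<in> ord ` {..<cnt}" "v \<noteq> rt"
  then obtain j where j: "v = ord j" "j < cnt" "0 < j" using treeP_rt[OF assms] by auto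
  obtain i where i: "i < j" "par (ord j) = ord i" using treeP_par[OF assms j(3,2)] by blast
  then show "par v \<in> ord ` {..<cnt}" using j by auto
  show "inv_into {..<cnt} ord (par v) < inv_into {..<cnt} ord v" using i j pos by simp
 qed
qed

definition hset :: "(nat \<Rightarrow> nat) \<Rightarrow> nat set" where
 "hset f = {e. e < m \<and> f e = 1}"

abbreviation "tree_of s \<equiv> treeP (arrs s 13) (regs s 7) (arrs s 11) (arrs s 12)"
abbreviation "Vof s \<equiv> arrs s 13 ` {..<regs s 7}"

lemma init_phase:
 assumes "static s"
 shows "tr W init_phase s (7 * n + 6) (\<lambda>s'. static s' \<and> regs s' 7 = 1 \<and> arrs s' 13 0 = rt \<and> arrs s' 11 rt = rt \<and>
   (\<forall>v<n. arrs s' 10 v = of_bool (v = rt) \<and> arrs s' 14 v = 0 \<and> arrs s' 15 v = 0 \<and> arrs s' 17 v = 0 \<and> arrs s' 27 v = 0))"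
proof -
 let ?I = "\<lambda>j s'. \<forall>v<j. arrs s' 10 v = 0 \<and> arrs s' 14 v = 0 \<and> arrs s' 15 v = 0 \<and> arrs s' 17 v = 0 \<and> arrs s' 27 v = 0"
 have "tr W (Const 6 0 ;; for_up 6 2 (Store 10 6 0 ;; Store 14 6 0 ;; Store 15 6 0 ;; Store 17 6 0 ;; Store 27 6 0)) s
   (n * (5 + 2) + 2) (\<lambda>s'. ?I n s' \<and> regs s' 6 = n)"
 proof (rule tr_for_up0[where T = 5])
  fix j s' assume I: "?I j s'" and j: "regs s' 6 = j" "j < n"
   and f: "frame (for_up 6 2 (Store 10 6 0 ;; Store 14 6 0 ;; Store 15 6 0 ;; Store 17 6 0 ;; Store 27 6 0)) s s'"
  have "static s'" using static_frame[OF assms f] by simp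
  then show "tr W (Store 10 6 0 ;; Store 14 6 0 ;; Store 15 6 0 ;; Store 17 6 0 ;; Store 27 6 0) s' 5 (?I (Suc j))"
   using I j by (intro tr_wp) (auto simp: staticD less_Suc_eq)
 qed (use assms W in \<open>auto simp: staticD\<close>)
 then have "tr W init_phase s ((n * (5 + 2) + 2) + 4) (\<lambda>s'. static s' \<and> regs s' 7 = 1 \<and> arrs s' 13 0 = rt \<and> arrs s' 11 rt = rt \<and>
   (\<forall>v<n. arrs s' 10 v = of_bool (v = rt) \<and> arrs s' 14 v = 0 \<and> arrs s' 15 v = 0 \<and> arrs s' 17 v = 0 \<and> arrs s' 27 v = 0))"
  unfolding init_phase_def
 proof (rule tr_seq)
  fix s1 assume f: "frame (Const 6 0 ;; for_up 6 2 (Store 10 6 0 ;; Store 14 6 0 ;; Store 15 6 0 ;; Store 17 6 0 ;; Store 27 6 0)) s s1"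
   and I: "?I n s1 \<and> regs s1 6 = n"
  have "static s1" using static_frame[OF assms f] by simp
  then show "tr W (Store 10 4 1 ;; Store 11 4 4 ;; Store 13 0 4 ;; Move 7 1) s1 4 (\<lambda>s'. static s' \<and> regs s' 7 = 1 \<and> arrs s' 13 0 = rt \<and> arrs s' 11 rt = rt \<and>
   (\<forall>v<n. arrs s' 10 v = of_bool (v = rt) \<and> arrs s' 14 v = 0 \<and> arrs s' 15 v = 0 \<and> arrs s' 17 v = 0 \<and> arrs s' 27 v = 0))"
   using I by (intro tr_wp) (auto simp: staticD)
 qed
 then show ?thesis by (rule tr_le) simp
qed

definition bfs_ok :: "state \<Rightarrow> bool" where
 "bfs_ok s \<longleftrightarrow> static s \<and> tree_of s \<and> listed (arrs s 13) (regs s 7) (arrs s 10) \<and> arrs s 11 rt = rt \<and>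
   (\<forall>j. 0 < j --> j < regs s 7 --> arrs s 8 (arrs s 12 (arrs s 13 j)) = 1) \<and>
   (\<forall>v<n. arrs s 10 v = 0 \<or> arrs s 10 v = 1) \<and>
   (\<forall>v<n. arrs s 14 v = 0 \<and> arrs s 15 v = 0 \<and> arrs s 17 v = 0 \<and> arrs s 27 v = 0) \<and>
   (\<forall>v. (hadj eu ev (hset (arrs s 8)))\<^sup>*\<^sup>* rt v --> v \<in> Vof s)"

lemma bfs:
 assumes "static s"
 shows "tr W (init_phase ;; grow) s (8 + 17 * n + 26 * m) (\<lambda>s'. bfs_ok s' \<and> arrs s' 8 = arrs s 8)"
proof -
 have "tr W (init_phase ;; grow) s ((7 * n + 6) + (2 + 10 * n + 26 * m)) (\<lambda>s'. bfs_ok s' \<and> arrs s' 8 = arrs s 8)"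
 proof (rule tr_seq[OF init_phase[OF assms]])
  fix s1 assume f: "frame init_phase s s1" and Q: "static s1 \<and> regs s1 7 = 1 \<and> arrs s1 13 0 = rt \<and> arrs s1 11 rt = rt \<and>
   (\<forall>v<n. arrs s1 10 v = of_bool (v = rt) \<and> arrs s1 14 v = 0 \<and> arrs s1 15 v = 0 \<and> arrs s1 17 v = 0 \<and> arrs s1 27 v = 0)"
  have f8: "arrs s1 8 = arrs s 8" using frame_arrs[OF f, of 8] by simp
  have Q1: "regs s1 7 = 1" "arrs s1 13 0 = rt" "arrs s1 11 rt = rt" and Q2: "static s1"
   and Qv: "\<And>v. v < n ==> arrs s1 10 v = of_bool (v = rt)" "\<And>v. v < n ==> arrs s1 14 v = 0"
    "\<And>v. v < n ==> arrs s1 15 v = 0" "\<And>v. v < n ==> arrs s1 17 v = 0" "\<And>v. v < n ==> arrs s1 27 v = 0"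
   using Q by blast+
  have "{..<regs s1 7} = {0}" "{v. v < n \<and> arrs s1 10 v \<noteq> 0} = {rt}" using Q1 Qv(1) rtn by auto
  then have l: "listed (arrs s1 13) (regs s1 7) (arrs s1 10)" unfolding listed_def using Q1 by simp
  show "tr W grow s1 (2 + 10 * n + 26 * m) (\<lambda>s'. bfs_ok s' \<and> arrs s' 8 = arrs s 8)"
  proof (rule tr_cons[OF grow[OF Q2 l]])
   fix s' assume fr: "frame grow s1 s'" and G: "grown s1 s' \<and>
    (\<forall>i<regs s' 7. arrs s1 14 (arrs s' 13 i) = 0 -->
     (\<forall>e<m. \<forall>y. arrs s1 8 e = 1 --> joins eu ev e (arrs s' 13 i) y --> arrs s' 10 y \<noteq> 0))"
   then have g: "grown s1 s'" by blast
   have fr': "arrs s' 14 = arrs s1 14" "arrs s' 15 = arrs s1 15" "arrs s' 17 = arrs s1 17" "arrs s' 27 = arrs s1 27"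
     "arrs s' 8 = arrs s1 8"
    using frame_arrs[OF fr] by simp_all
   have l': "listed (arrs s' 13) (regs s' 7) (arrs s' 10)" and st': "static s'" and c: "1 \<le> regs s' 7"
    and o0: "arrs s' 13 0 = rt"
    using g Q1 by (auto simp: grown_def)
   have lk: "linked (arrs s1 14) (arrs s1 8) (arrs s' 13) (arrs s' 11) (arrs s' 12) j" if "0 < j" "j < regs s' 7" for j
    using g that Q1 unfolding grown_def by auto
   have T: "tree_of s'" unfolding treeP_def
   proof (intro conjI allI impI)
    show "inj_on (arrs s' 13) {..<regs s' 7}" "Vof s' \<subseteq> {..<n}" using l' by (auto simp: listed_def)
    fix j assume "0 < j" "j < regs s' 7"
    from lk[OF this] show "\<exists>i<j. arrs s' 11 (arrs s' 13 j) = arrs s' 13 i \<and> arrs s' 12 (arrs s' 13 j) < m \<and>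
      joins eu ev (arrs s' 12 (arrs s' 13 j)) (arrs s' 13 j) (arrs s' 13 i)"
     unfolding linked_def by (elim exE conjE) (rule exI, intro conjI)
   qed (use c o0 in auto)
   have p: "arrs s' 11 rt = rt" using g Q1 Qv rtn unfolding grown_def by auto
   have in01: "arrs s' 10 v = 0 \<or> arrs s' 10 v = 1" if "v < n" for v
    using g Qv(1)[OF that] that unfolding grown_def by (cases "v = rt") auto
   have reach: "v \<in> Vof s'" if "(hadj eu ev (hset (arrs s' 8)))\<^sup>*\<^sup>* rt v" for v
    using that
   proof (induction rule: rtranclp_induct)
    case base
    then show ?case using o0 c by force
   next
    case (step y z)
    then obtain i where i: "y = arrs s' 13 i" "i < regs s' 7" by auto
    obtain e where e: "e < m" "arrs s1 8 e = 1" "joins eu ev e y z"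
     using step(2) fr' by (auto simp: hadj_def hset_def joins_def)
    have y: "y < n" "z < n" using joins_lt[OF e(1,3)] by auto
    then have "arrs s' 10 z \<noteq> 0" using G i e Qv(2)[OF y(1)] by blast
    then have "z \<in> {v. v < n \<and> arrs s' 10 v \<noteq> 0}" using y by simp
    then show ?case using l' unfolding listed_def by blast
   qed
   have "arrs s' 8 (arrs s' 12 (arrs s' 13 j)) = 1" if "0 < j" "j < regs s' 7" for j
    using lk[OF that] fr' unfolding linked_def by auto
   then have "bfs_ok s'" unfolding bfs_ok_def using T l' st' p in01 reach Qv fr' by auto
   then show "bfs_ok s' \<and> arrs s' 8 = arrs s 8" using fr' f8 by simp
  qed simp
 qed
 then show ?thesis by (rule tr_le) simp
qed

text \<open>The third clause makes the kept part closed under parents from index \<open>i\<close>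
  on; the last one makes every leaf of the pruned tree a terminal.\<close>

definition kept_ok :: "state \<Rightarrow> nat \<Rightarrow> bool" where
 "kept_ok s i \<longleftrightarrow> (\<forall>v<n. arrs s 28 v = 0 \<or> arrs s 28 v = 1) \<and> (\<forall>v<n. tm v = 1 --> arrs s 28 v = 1) \<and>
   (\<forall>j. i \<le> j --> j < regs s 7 --> arrs s 28 (arrs s 13 j) = 1 --> arrs s 28 (arrs s 11 (arrs s 13 j)) = 1) \<and>
   (\<forall>v<n. arrs s 28 v = 1 --> tm v = 1 \<or>
    (\<exists>j. 0 < j \<and> j < regs s 7 \<and> arrs s 11 (arrs s 13 j) = v \<and> arrs s 28 (arrs s 13 j) = 1))"

lemma kept_ok_set_reg: "r \<noteq> 7 ==> kept_ok (set_reg r x s) i = kept_ok s i"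
 by (simp add: kept_ok_def)

lemma kept_step:
 assumes B: "tree_of s" "arrs s 11 rt = rt" and K: "kept_ok s (Suc i)" and i: "i < regs s 7" "arrs s 13 i = v"
 shows "arrs s 28 v = 1 ==> kept_ok (set_arr 28 (arrs s 11 v) 1 s) i"
  and "arrs s 28 v \<noteq> 1 ==> kept_ok s i"
proof -
 show "kept_ok s i" if "arrs s 28 v \<noteq> 1"
  unfolding kept_ok_def
 proof (intro conjI)
  show "\<forall>j. i \<le> j --> j < regs s 7 --> arrs s 28 (arrs s 13 j) = 1 --> arrs s 28 (arrs s 11 (arrs s 13 j)) = 1"
  proof (intro allI impI)
   fix j assume j: "i \<le> j" "j < regs s 7" "arrs s 28 (arrs s 13 j) = 1"
   then have "Suc i \<le> j" using that i by (cases "j = i") auto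
   then show "arrs s 28 (arrs s 11 (arrs s 13 j)) = 1" using K j unfolding kept_ok_def by blast
  qed
 qed (use K in \<open>simp_all add: kept_ok_def\<close>)
 assume v1: "arrs s 28 v = 1"
 let ?p = "arrs s 11 v"
 have vn: "v < n" using treeP_lt[OF B(1) i(1)] i by simp
 \<comment> \<open>Marking the parent creates no new duty at indices above \<open>i\<close>, as the
   parent comes earlier in the list or, for the root, at \<open>i\<close> itself.\<close>
 have later: "arrs s 13 j \<noteq> ?p" if "i < j" "j < regs s 7" for j
 proof (cases "i = 0")
  case True
  then have "?p = arrs s 13 0" using B i by (auto simp: treeP_def)
  then show ?thesis using treeP_inj[OF B(1), of j 0] that i by auto
 next
  case False
  obtain i' where "i' < i" "?p = arrs s 13 i'" using treeP_par[OF B(1), of i] i False by auto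
  then show ?thesis using treeP_inj[OF B(1), of j i'] that by auto
 qed
 \<comment> \<open>At index 0 the stored parent is the root itself, so its mark has to be justified
   by its being a terminal.\<close>
 have root: "tm ?p = 1" if "i = 0" using that B i tmrt by (auto simp: treeP_def)
 show "kept_ok (set_arr 28 (arrs s 11 v) 1 s) i"
  unfolding kept_ok_def
 proof (intro conjI allI impI)
  fix j assume j: "i \<le> j" "j < regs (set_arr 28 ?p 1 s) 7"
   "arrs (set_arr 28 ?p 1 s) 28
    (arrs (set_arr 28 ?p 1 s) 13 j) = 1"
  show "arrs (set_arr 28 ?p 1 s) 28
    (arrs (set_arr 28 ?p 1 s) 11
     (arrs (set_arr 28 ?p 1 s) 13 j)) = 1"
  proof (cases "j = i")
   case False
   then have "arrs s 28 (arrs s 11 (arrs s 13 j)) = 1"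
    using K j later[of j] unfolding kept_ok_def by simp
   then show ?thesis by simp
  qed (use i in simp)
 next
  fix w assume w: "w < n" "arrs (set_arr 28 ?p 1 s) 28 w = 1"
  show "tm w = 1 \<or> (\<exists>j. 0 < j \<and> j < regs (set_arr 28 ?p 1 s) 7 \<and>
    arrs (set_arr 28 ?p 1 s) 11
     (arrs (set_arr 28 ?p 1 s) 13 j) = w \<and>
    arrs (set_arr 28 ?p 1 s) 28
     (arrs (set_arr 28 ?p 1 s) 13 j) = 1)"
  proof (cases "w = ?p")
   case True
   then show ?thesis using root i v1 by (cases "i = 0") auto
  next
   case False
   then have "arrs s 28 w = 1" using w by simp
   then have "tm w = 1 \<or> (\<exists>j. 0 < j \<and> j < regs s 7 \<and> arrs s 11 (arrs s 13 j) = w \<and> arrs s 28 (arrs s 13 j) = 1)"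
    using K w unfolding kept_ok_def by blast
   then show ?thesis by auto
  qed
 qed (use K in \<open>simp_all add: kept_ok_def\<close>)
qed

lemma mark_kept:
 assumes B: "bfs_ok s"
 shows "tr W mark_kept s (12 * n + 6) (\<lambda>s'. kept_ok s' 0)"
proof -
 let ?I = "\<lambda>j s'. \<forall>v<j. arrs s' 28 v = tm v"
 let ?c1 = "Load 8 4 6 ;; Store 28 6 8"
 let ?c2 = "Load 8 13 6 ;; Load 9 28 8 ;; If (Equal 9 1) (Load 24 11 8 ;; Store 28 24 1) Skip"
 have stt: "static s" and T: "tree_of s" and p: "arrs s 11 rt = rt" using B by (auto simp: bfs_ok_def)
 have cn: "regs s 7 \<le> n" using treeP_cnt[OF T] by simp
 have "tr W (Const 6 0 ;; for_up 6 2 ?c1) s (n * (2 + 2) + 2) (\<lambda>s'. ?I n s' \<and> regs s' 6 = n)"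
 proof (rule tr_for_up0[where T = 2])
  fix j s' assume I: "?I j s'" and j: "regs s' 6 = j" "j < n" and f: "frame (for_up 6 2 ?c1) s s'"
  have "static s'" using static_frame[OF stt f] by simp
  then show "tr W ?c1 s' 2 (?I (Suc j))"
   using I j by (intro tr_wp) (auto simp: staticD less_Suc_eq)
 qed (use stt W in \<open>auto simp: staticD\<close>)
 moreover have "tr W (Move 6 7 ;; for_down 6 0 ?c2) s1 (1 + (n * (5 + 2) + 1)) (\<lambda>s'. kept_ok s' 0)"
  if f: "frame (Const 6 0 ;; for_up 6 2 ?c1) s s1" and I: "?I n s1 \<and> regs s1 6 = n" for s1
 proof (rule tr_seq)
  show "tr W (Move 6 7) s1 1 (\<lambda>s2. s2 = set_reg 6 (regs s1 7) s1)" by (intro tr_wp) auto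
  fix s2 assume s2: "s2 = set_reg 6 (regs s1 7) s1"
  have st1: "static s1" using static_frame[OF stt f] by simp
  have e: "regs s1 7 = regs s 7" "arrs s1 13 = arrs s 13" "arrs s1 11 = arrs s 11" "arrs s1 12 = arrs s 12"
   using frame_regs[OF f] frame_arrs[OF f] by simp_all
  have "tr W (for_down 6 0 ?c2) s2 (n * (5 + 2) + 1) (\<lambda>s'. kept_ok s' 0 \<and> regs s' 6 = 0)"
  proof (rule tr_for_down[where T = 5 and I = "\<lambda>i s. kept_ok s i"])
   have "kept_ok s1 (regs s1 7)" using I tm01 by (auto simp: kept_ok_def)
   then show "kept_ok s2 (regs s2 6)" unfolding s2 by (simp add: kept_ok_def)
  next
   fix j s' assume K: "kept_ok s' (Suc j)" and j: "j < regs s2 6" "regs s' 6 = j" and f': "frame (for_down 6 0 ?c2) s2 s'"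
   have st': "static s'" using static_frame[OF _ f'] st1 s2 by simp
   have e': "regs s' 7 = regs s 7" "arrs s' 13 = arrs s 13" "arrs s' 11 = arrs s 11" "arrs s' 12 = arrs s 12"
    using frame_regs[OF f', of 7] frame_arrs[OF f'] s2 e by simp_all
   have jj: "j < regs s' 7" using j e e' s2 by simp
   have T': "tree_of s'" "arrs s' 11 rt = rt" using T p e' by simp_all
   note step = kept_step[OF T' K jj refl]
   show "tr W ?c2 s' 5 (\<lambda>s. kept_ok s j)"
    by (rule tr_wp) (use step in \<open>simp_all add: staticD[OF st'] j set_arr_set_reg kept_ok_set_reg\<close>)
  qed (use stt st1 s2 e cn in \<open>auto simp: staticD kept_ok_def\<close>)
  then show "tr W (for_down 6 0 ?c2) s2 (n * (5 + 2) + 1) (\<lambda>s'. kept_ok s' 0)" by (rule tr_cons) auto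
 qed
 ultimately have "tr W mark_kept s ((n * (2 + 2) + 2) + (1 + (n * (5 + 2) + 1))) (\<lambda>s'. kept_ok s' 0)"
  unfolding mark_kept_def by (rule tr_seq)
 then show ?thesis by (rule tr_le) simp
qed

end

section \<open>Compacting the pruned tree and computing its degrees\<close>

section \<open>Pruning and degrees\<close>

context graph
begin

lemma W8: "8 * n + 8 * m + 16 \<le> W"
 using W by simp

definition core_ok :: "nat set \<Rightarrow> state \<Rightarrow> bool" where
 "core_ok H s \<longleftrightarrow> static s \<and> tree_of s \<and> listed (arrs s 13) (regs s 7) (arrs s 10) \<and>
   (\<forall>j. 0 < j --> j < regs s 7 --> arrs s 12 (arrs s 13 j) \<in> H) \<and>
   (\<forall>v<n. arrs s 10 v = 0 \<or> arrs s 10 v = 1) \<and>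
   (\<forall>v\<in>Vof s. tm v = 1 \<or> (\<exists>c\<in>Vof s. c \<noteq> rt \<and> arrs s 11 c = v)) \<and>
   (\<forall>v<n. tm v = 1 --> (hadj eu ev H)\<^sup>*\<^sup>* rt v --> v \<in> Vof s)"

definition comp_inv :: "state \<Rightarrow> nat \<Rightarrow> state \<Rightarrow> bool" where
 "comp_inv s i s' \<longleftrightarrow> regs s' 18 \<le> i \<and> (\<forall>j. i \<le> j --> arrs s' 13 j = arrs s 13 j) \<and>
   arrs s' 13 ` {..<regs s' 18} = {v. v \<in> arrs s 13 ` {..<i} \<and> arrs s 28 v = 1} \<and>
   inj_on (arrs s' 13) {..<regs s' 18} \<and> (0 < i --> 0 < regs s' 18 \<and> arrs s' 13 0 = rt) \<and>
   (\<forall>j. 0 < j --> j < regs s' 18 --> (\<exists>i'<j. arrs s 11 (arrs s' 13 j) = arrs s' 13 i') \<and>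
    arrs s 12 (arrs s' 13 j) < m \<and> joins eu ev (arrs s 12 (arrs s' 13 j)) (arrs s' 13 j) (arrs s 11 (arrs s' 13 j)) \<and>
    arrs s 8 (arrs s 12 (arrs s' 13 j)) = 1) \<and>
   (\<forall>v. arrs s' 10 v = (if v \<in> arrs s 13 ` {..<i} \<and> arrs s 28 v \<noteq> 1 then 0 else arrs s 10 v))"

text \<open>The list is compacted in place: the write position never passes the read position, and
  the parent of a kept vertex is kept and has been written before.\<close>

lemma comp_step:
 assumes B: "bfs_ok s" and K: "kept_ok s 0" and I: "comp_inv s i s'" and i: "i < regs s 7" and v: "arrs s 13 i = v"
 shows "arrs s 28 v = 1 ==> comp_inv s (Suc i) (set_reg 18 (Suc (regs s' 18)) (set_arr 13 (regs s' 18) v s'))"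
  and "arrs s 28 v \<noteq> 1 ==> comp_inv s (Suc i) (set_arr 10 v 0 s')"
proof -
 have T: "tree_of s" using B by (simp add: bfs_ok_def)
 have im: "arrs s 13 ` {..<Suc i} = insert v (arrs s 13 ` {..<i})" using v by (simp add: lessThan_Suc)
 have r1: "arrs s 28 rt = 1" using K tmrt rtn by (simp add: kept_ok_def)
 have i0: "i = 0 ==> v = rt" using T v by (simp add: treeP_def)
 have vn: "v \<notin> arrs s 13 ` {..<i}"
 proof
  assume "v \<in> arrs s 13 ` {..<i}"
  then obtain j where "j < i" "arrs s 13 j = arrs s 13 i" using v by auto
  then show False using treeP_inj[OF T, of j i] i by simp
 qed
 let ?c = "regs s' 18"
 have c: "?c \<le> i" and O1: "\<And>j. i \<le> j ==> arrs s' 13 j = arrs s 13 j"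
  and O2: "arrs s' 13 ` {..<?c} = {v. v \<in> arrs s 13 ` {..<i} \<and> arrs s 28 v = 1}"
  and O3: "inj_on (arrs s' 13) {..<?c}" and O4: "0 < i ==> 0 < ?c \<and> arrs s' 13 0 = rt"
  and O5: "\<And>j. 0 < j ==> j < ?c ==> (\<exists>i'<j. arrs s 11 (arrs s' 13 j) = arrs s' 13 i') \<and>
    arrs s 12 (arrs s' 13 j) < m \<and> joins eu ev (arrs s 12 (arrs s' 13 j)) (arrs s' 13 j) (arrs s 11 (arrs s' 13 j)) \<and>
    arrs s 8 (arrs s 12 (arrs s' 13 j)) = 1"
  and N: "\<And>v. arrs s' 10 v = (if v \<in> arrs s 13 ` {..<i} \<and> arrs s 28 v \<noteq> 1 then 0 else arrs s 10 v)"
  using I unfolding comp_inv_def by blast+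
 show "comp_inv s (Suc i) (set_arr 10 v 0 s')" if k: "arrs s 28 v \<noteq> 1"
 proof -
  have "i \<noteq> 0" using i0 r1 k by auto
  then show ?thesis unfolding comp_inv_def im using c O1 O2 O3 O4 O5 N k by auto
 qed
 show "comp_inv s (Suc i) (set_reg 18 (Suc ?c) (set_arr 13 ?c v s'))" if k: "arrs s 28 v = 1"
 proof -
  let ?O = "(arrs s' 13)(?c := v)"
  have e: "?O j = arrs s' 13 j" if "j < ?c" for j using that by simp
  have e1: "?O ` {..<?c} = arrs s' 13 ` {..<?c}" by (rule image_cong) (use e in auto)
  have vO: "v \<notin> arrs s' 13 ` {..<?c}" using O2 vn by auto
  have im': "?O ` {..<Suc ?c} = {u. u \<in> insert v (arrs s 13 ` {..<i}) \<and> arrs s 28 u = 1}"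
   unfolding lessThan_Suc image_insert e1 O2 using k by auto
  have "inj_on ?O {..<?c}" using O3 by (simp add: inj_on_def)
  then have inj: "inj_on ?O {..<Suc ?c}" unfolding lessThan_Suc using vO e1 by (simp add: inj_on_insert)
  have rt0: "?O 0 = rt" using O4 i0 c by (cases "i = 0") auto
  have lk: "(\<exists>i'<j. arrs s 11 (?O j) = ?O i') \<and> arrs s 12 (?O j) < m \<and>
    joins eu ev (arrs s 12 (?O j)) (?O j) (arrs s 11 (?O j)) \<and> arrs s 8 (arrs s 12 (?O j)) = 1"
   if j: "0 < j" "j < Suc ?c" for j
  proof (cases "j = ?c")
   case False
   then have j': "j < ?c" using j by simp
   obtain i' where "i' < j" "arrs s 11 (arrs s' 13 j) = arrs s' 13 i'" using O5[OF j(1) j'] by blast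
   then have "\<exists>i'<j. arrs s 11 (?O j) = ?O i'" using j' by (intro exI[of _ i']) auto
   then show ?thesis using O5[OF j(1) j'] j' by simp
  next
   case True
   then have "0 < i" using j c by simp
   obtain i' where i': "i' < i" "arrs s 11 v = arrs s 13 i'" "arrs s 12 v < m" "joins eu ev (arrs s 12 v) v (arrs s 11 v)"
    using treeP_par[OF T \<open>0 < i\<close> i] v by metis
   have "arrs s 28 (arrs s 11 v) = 1" using K i v k unfolding kept_ok_def by blast
   then have "arrs s 11 v \<in> arrs s' 13 ` {..<?c}" unfolding O2 using i' by auto
   then obtain i'' where "i'' < ?c" "arrs s 11 v = arrs s' 13 i''" by auto
   moreover have "arrs s 8 (arrs s 12 v) = 1" using B \<open>0 < i\<close> i v unfolding bfs_ok_def by blast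
   ultimately show ?thesis using True i' by (auto intro!: exI[of _ i''])
  qed
  show ?thesis unfolding comp_inv_def im
  proof (intro conjI)
   show "\<forall>v'. arrs (set_reg 18 (Suc ?c) (set_arr 13 ?c v s')) 10 v' =
    (if v' \<in> insert v (arrs s 13 ` {..<i}) \<and> arrs s 28 v' \<noteq> 1 then 0 else arrs s 10 v')"
    using N k by auto
  qed (use c O1 inj rt0 lk im' in \<open>simp_all\<close>)
 qed
qed

lemma comp_step':
 assumes "bfs_ok s" "kept_ok s 0" "comp_inv s i s'" "i < regs s 7"
 shows "arrs s 28 (arrs s 13 i) = 1 ==> regs s'' 18 = Suc (regs s' 18) ==>
   arrs s'' = (arrs s')(13 := (arrs s' 13)(regs s' 18 := arrs s 13 i)) ==> comp_inv s (Suc i) s''"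
  and "arrs s 28 (arrs s 13 i) \<noteq> 1 ==> regs s'' 18 = regs s' 18 ==>
   arrs s'' = (arrs s')(10 := (arrs s' 10)(arrs s 13 i := 0)) ==> comp_inv s (Suc i) s''"
proof -
 have c: "comp_inv s (Suc i) a ==> regs a 18 = regs b 18 ==> arrs a = arrs b ==> comp_inv s (Suc i) b" for a b :: state
  by (simp add: comp_inv_def)
 show "comp_inv s (Suc i) s''" if "arrs s 28 (arrs s 13 i) = 1" "regs s'' 18 = Suc (regs s' 18)"
  "arrs s'' = (arrs s')(13 := (arrs s' 13)(regs s' 18 := arrs s 13 i))"
  by (rule c[OF comp_step(1)[OF assms refl that(1)]]) (use that in simp_all)
 show "comp_inv s (Suc i) s''" if "arrs s 28 (arrs s 13 i) \<noteq> 1" "regs s'' 18 = regs s' 18"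
  "arrs s'' = (arrs s')(10 := (arrs s' 10)(arrs s 13 i := 0))"
  by (rule c[OF comp_step(2)[OF assms refl that(1)]]) (use that in simp_all)
qed

lemma compress:
 assumes B: "bfs_ok s" and K: "kept_ok s 0"
 shows "tr W compress s (8 * n + 4) (core_ok (hset (arrs s 8)))"
proof -
 have stt: "static s" and T: "tree_of s" and l: "listed (arrs s 13) (regs s 7) (arrs s 10)"
  using B by (auto simp: bfs_ok_def)
 have cn: "0 < regs s 7" "regs s 7 \<le> n" using treeP_cnt[OF T] by auto
 let ?b = "Load 8 13 6 ;; Load 9 28 8 ;; If (Equal 9 1) (Store 13 18 8 ;; Add 18 18 1) (Store 10 8 0)"
 have "tr W ((Const 18 0 ;; Const 6 0) ;; for_up 6 7 ?b) s (2 + (n * (5 + 2) + 1)) (\<lambda>s'. comp_inv s (regs s 7) s' \<and> regs s' 6 = regs s 7)"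
 proof (rule tr_seq)
  show "tr W (Const 18 0 ;; Const 6 0) s 2 (\<lambda>s1. s1 = set_reg 6 0 (set_reg 18 0 s))" by (intro tr_wp) auto
  fix s1 assume s1: "s1 = set_reg 6 0 (set_reg 18 0 s)"
  show "tr W (for_up 6 7 ?b) s1 (n * (5 + 2) + 1) (\<lambda>s'. comp_inv s (regs s 7) s' \<and> regs s' 6 = regs s 7)"
  proof (rule tr_for_up[where T = 5 and I = "comp_inv s"])
   fix j s' assume I: "comp_inv s j s'" and j: "j < regs s 7" "regs s' 6 = j" and f: "frame (for_up 6 7 ?b) s1 s'"
   have st': "static s'" using static_frame[OF _ f] stt s1 by simp
   have k: "arrs s' 28 = arrs s 28" using frame_arrs[OF f, of 28] s1 by simp
   have v: "arrs s' 13 j = arrs s 13 j" and c: "regs s' 18 \<le> j" using I by (auto simp: comp_inv_def)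
   note step = comp_step'[OF B K I j(1)]
   have cW: "Suc (regs s' 18) \<le> W" using c j(1) cn W8 by linarith
   show "tr W ?b s' 5 (comp_inv s (Suc j))"
    by (rule tr_wp) (use step cW in \<open>simp_all add: staticD[OF st'] j k v\<close>)
  qed (use stt s1 cn W in \<open>auto simp: staticD comp_inv_def\<close>)
 qed
 then have "tr W compress s ((2 + (n * (5 + 2) + 1)) + 1) (core_ok (hset (arrs s 8)))"
  unfolding compress_def
 proof (rule tr_seq)
  fix s1 assume f: "frame ((Const 18 0 ;; Const 6 0) ;; for_up 6 7 ?b) s s1" and I: "comp_inv s (regs s 7) s1 \<and> regs s1 6 = regs s 7"
  have st1: "static s1" using static_frame[OF stt f] by simp
  have e: "arrs s1 11 = arrs s 11" "arrs s1 12 = arrs s 12" using frame_arrs[OF f] by simp_all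
  let ?c = "regs s1 18" and ?i = "regs s 7"
  have c: "?c \<le> ?i" and O2: "arrs s1 13 ` {..<?c} = {v. v \<in> arrs s 13 ` {..<?i} \<and> arrs s 28 v = 1}"
   and O3: "inj_on (arrs s1 13) {..<?c}" and O4: "0 < ?c \<and> arrs s1 13 0 = rt"
   and O5: "\<And>j. 0 < j ==> j < ?c ==> (\<exists>i'<j. arrs s 11 (arrs s1 13 j) = arrs s1 13 i') \<and>
    arrs s 12 (arrs s1 13 j) < m \<and> joins eu ev (arrs s 12 (arrs s1 13 j)) (arrs s1 13 j) (arrs s 11 (arrs s1 13 j)) \<and>
    arrs s 8 (arrs s 12 (arrs s1 13 j)) = 1"
   and N: "\<And>v. arrs s1 10 v = (if v \<in> arrs s 13 ` {..<?i} \<and> arrs s 28 v \<noteq> 1 then 0 else arrs s 10 v)"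
   using I cn unfolding comp_inv_def by blast+
  have lim: "arrs s 13 ` {..<?i} = {v. v < n \<and> arrs s 10 v \<noteq> 0}" using l by (simp add: listed_def)
  let ?s = "set_reg 7 ?c s1"
  have im: "arrs s1 13 ` {..<?c} = {v. v < n \<and> arrs s1 10 v \<noteq> 0}"
   unfolding O2 lim using N lim by auto
  have tree: "tree_of ?s" unfolding treeP_def
  proof (intro conjI allI impI)
   fix j assume "0 < j" "j < regs ?s 7"
   then have "0 < j" "j < ?c" by simp_all
   from O5[OF this] show "\<exists>i<j. arrs ?s 11 (arrs ?s 13 j) = arrs ?s 13 i \<and> arrs ?s 12 (arrs ?s 13 j) < m \<and>
     joins eu ev (arrs ?s 12 (arrs ?s 13 j)) (arrs ?s 13 j) (arrs ?s 13 i)"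
    using e by auto
  qed (use O3 O4 im in auto)
  have leaf: "tm v = 1 \<or> (\<exists>c\<in>Vof ?s. c \<noteq> rt \<and> arrs ?s 11 c = v)" if "v \<in> Vof ?s" for v
  proof -
   have v: "v < n" "arrs s 28 v = 1" using that O2 lim by auto
   then have "tm v = 1 \<or> (\<exists>j. 0 < j \<and> j < regs s 7 \<and> arrs s 11 (arrs s 13 j) = v \<and> arrs s 28 (arrs s 13 j) = 1)"
    using K unfolding kept_ok_def by blast
   then show ?thesis
   proof
    assume "\<exists>j. 0 < j \<and> j < regs s 7 \<and> arrs s 11 (arrs s 13 j) = v \<and> arrs s 28 (arrs s 13 j) = 1"
    then obtain j where j: "0 < j" "j < regs s 7" "arrs s 11 (arrs s 13 j) = v" "arrs s 28 (arrs s 13 j) = 1" by blast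
    then have "arrs s 13 j \<in> Vof ?s" using O2 by auto
    moreover have "arrs s 13 j \<noteq> rt" using treeP_rt[OF T j(2)] j by simp
    ultimately show ?thesis using j e by auto
   qed simp
  qed
  have trm: "v \<in> Vof ?s" if "v < n" "tm v = 1" "(hadj eu ev (hset (arrs s 8)))\<^sup>*\<^sup>* rt v" for v
  proof -
   have "v \<in> Vof s" using B that unfolding bfs_ok_def by blast
   moreover have "arrs s 28 v = 1" using K that unfolding kept_ok_def by blast
   ultimately show ?thesis using O2 by auto
  qed
  have in01: "arrs ?s 10 v = 0 \<or> arrs ?s 10 v = 1" if "v < n" for v
   using B N that unfolding bfs_ok_def by auto
  have ff: "arrs ?s 12 (arrs ?s 13 j) \<in> hset (arrs s 8)" if "0 < j" "j < regs ?s 7" for j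
   using O5[of j] that e by (auto simp: hset_def)
  have "core_ok (hset (arrs s 8)) ?s" unfolding core_ok_def
   using tree leaf trm in01 ff st1 O3 im by (auto simp: listed_def)
  then show "tr W (Move 7 18) s1 1 (core_ok (hset (arrs s 8)))" by (intro tr_wp) simp_all
 qed
 then show ?thesis by (rule tr_le) simp
qed

definition chld :: "state \<Rightarrow> nat \<Rightarrow> nat set" where
 "chld s v = {c \<in> Vof s. c \<noteq> rt \<and> arrs s 11 c = v}"

lemma degrees:
 assumes T: "tree_of s" and stt: "static s" and z: "\<forall>v<n. arrs s 17 v = 0"
 shows "tr W degrees s (10 * n + 2) (\<lambda>s'. \<forall>v<n. arrs s' 17 v = card (chld s v) + of_bool (v \<in> Vof s \<and> v \<noteq> rt))"
proof -
 let ?b = "Load 8 13 6 ;; Load 9 17 8 ;; Add 9 9 1 ;; Store 17 8 9 ;;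
    Load 24 11 8 ;; Load 9 17 24 ;; Add 9 9 1 ;; Store 17 24 9"
 define ch where "ch i v = {j. 0 < j \<and> j < i \<and> arrs s 11 (arrs s 13 j) = v}" for i v
 define cnt where "cnt i v = card (ch i v) + of_bool (\<exists>j. 0 < j \<and> j < i \<and> arrs s 13 j = v)" for i v
 have cn: "0 < regs s 7" "regs s 7 \<le> n" using treeP_cnt[OF T] by auto
 have fin: "finite (ch i v)" for i v unfolding ch_def by (rule finite_subset[of _ "{..<i}"]) auto
 have chS: "ch (Suc i) v = (if 0 < i \<and> arrs s 11 (arrs s 13 i) = v then insert i (ch i v) else ch i v)" for i v
  unfolding ch_def by (auto simp: less_Suc_eq)
 have cntS: "cnt (Suc i) v = cnt i v + of_bool (v = arrs s 11 (arrs s 13 i)) + of_bool (v = arrs s 13 i)"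
  if "0 < i" "i < regs s 7" for i v
 proof -
  have "\<not> (\<exists>j. 0 < j \<and> j < i \<and> arrs s 13 j = arrs s 13 i)"
   using treeP_inj[OF T, of _ i] that by fastforce
  moreover have "(\<exists>j. 0 < j \<and> j < Suc i \<and> arrs s 13 j = v) \<longleftrightarrow> (\<exists>j. 0 < j \<and> j < i \<and> arrs s 13 j = v) \<or> v = arrs s 13 i"
   using that by (auto simp: less_Suc_eq)
  ultimately have "of_bool (\<exists>j. 0 < j \<and> j < Suc i \<and> arrs s 13 j = v) =
   (of_bool (\<exists>j. 0 < j \<and> j < i \<and> arrs s 13 j = v) + of_bool (v = arrs s 13 i) :: nat)"
   by (cases "v = arrs s 13 i") simp_all
  moreover have "i \<notin> ch i v" by (simp add: ch_def)
  ultimately show ?thesis unfolding cnt_def chS using that fin by auto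
 qed
 have cnt_le: "cnt i v \<le> i + 1" for i v
 proof -
  have "card (ch i v) \<le> card {..<i}" by (rule card_mono) (auto simp: ch_def)
  then show ?thesis by (auto simp: cnt_def)
 qed
 have "tr W (Move 6 1 ;; for_up 6 7 ?b) s (1 + (n * (8 + 2) + 1)) (\<lambda>s'. (\<forall>v<n. arrs s' 17 v = cnt (regs s 7) v) \<and> regs s' 6 = regs s 7)"
 proof (rule tr_seq)
  show "tr W (Move 6 1) s 1 (\<lambda>s1. s1 = set_reg 6 1 s)" by (intro tr_wp) (use stt in \<open>auto simp: staticD\<close>)
  fix s1 assume s1: "s1 = set_reg 6 1 s"
  show "tr W (for_up 6 7 ?b) s1 (n * (8 + 2) + 1) (\<lambda>s'. (\<forall>v<n. arrs s' 17 v = cnt (regs s 7) v) \<and> regs s' 6 = regs s 7)"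
  proof (rule tr_for_up[where T = 8 and I = "\<lambda>i s'. \<forall>v<n. arrs s' 17 v = cnt i v"])
   have "cnt 1 v = 0" for v by (auto simp: cnt_def ch_def)
   then show "\<forall>v<n. arrs s1 17 v = cnt (regs s1 6) v" using z s1 by simp
  next
   fix i s' assume I: "\<forall>v<n. arrs s' 17 v = cnt i v" and i: "regs s1 6 \<le> i" "i < regs s 7" "regs s' 6 = i"
    and f: "frame (for_up 6 7 ?b) s1 s'"
   have st': "static s'" using static_frame[OF _ f] stt s1 by simp
   have e: "arrs s' 13 = arrs s 13" "arrs s' 11 = arrs s 11" using frame_arrs[OF f] s1 by simp_all
   have i0: "0 < i" using i s1 by simp
   have vn: "arrs s 13 i < n" using treeP_lt[OF T i(2)] .
   obtain i' where i': "i' < i" "arrs s 11 (arrs s 13 i) = arrs s 13 i'" using treeP_par[OF T i0 i(2)] by blast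
   have pn: "arrs s 11 (arrs s 13 i) < n" using treeP_lt[OF T, of i'] i' i by simp
   \<comment> \<open>The two increments of the body must hit different cells.\<close>
   have ne: "arrs s 11 (arrs s 13 i) \<noteq> arrs s 13 i" using treeP_inj[OF T, of i' i] i' i by simp
   have b: "cnt i v + 1 \<le> W" for v using cnt_le[of i v] i cn W by simp
   have I': "arrs s' 17 v = cnt i v" if "v < n" for v using I that by simp
   show "tr W ?b s' 8 (\<lambda>s'. \<forall>v<n. arrs s' 17 v = cnt (Suc i) v)"
    by (rule tr_wp) (use b[of "arrs s 13 i"] b[of "arrs s 11 (arrs s 13 i)"] vn pn ne in
      \<open>simp_all add: staticD[OF st'] i(3) e I' cntS[OF i0 i(2)]\<close>)
  qed (use stt s1 cn W in \<open>auto simp: staticD\<close>)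
 qed
 then show ?thesis unfolding degrees_def
 proof (rule tr_cons)
  fix s' assume "(\<forall>v<n. arrs s' 17 v = cnt (regs s 7) v) \<and> regs s' 6 = regs s 7"
  moreover have "cnt (regs s 7) v = card (chld s v) + of_bool (v \<in> Vof s \<and> v \<noteq> rt)" for v
  proof -
   have "chld s v = arrs s 13 ` ch (regs s 7) v" unfolding chld_def ch_def using treeP_rt[OF T] by auto
   moreover have "inj_on (arrs s 13) (ch (regs s 7) v)"
    using T unfolding treeP_def ch_def by (auto intro: inj_on_subset)
   moreover have "(\<exists>j. 0 < j \<and> j < regs s 7 \<and> arrs s 13 j = v) \<longleftrightarrow> v \<in> Vof s \<and> v \<noteq> rt"
    using treeP_rt[OF T] by auto
   ultimately show ?thesis unfolding cnt_def by (simp add: card_image)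
  qed
  ultimately show "\<forall>v<n. arrs s' 17 v = card (chld s v) + of_bool (v \<in> Vof s \<and> v \<noteq> rt)" by simp
 qed simp
qed

lemma max_deg:
 assumes T: "tree_of s" and stt: "static s"
 shows "tr W max_deg s (6 * n + 3) (\<lambda>s'. (\<forall>v\<in>Vof s. arrs s 17 v \<le> regs s' 17) \<and>
  (regs s' 17 = 0 \<or> (\<exists>v\<in>Vof s. arrs s 17 v = regs s' 17)))"
proof -
 let ?b = "Load 8 13 6 ;; Load 9 17 8 ;; If (Less 17 9) (Move 17 9) Skip"
 let ?I = "\<lambda>i s'. (\<forall>j<i. arrs s 17 (arrs s 13 j) \<le> regs s' 17) \<and>
  (regs s' 17 = 0 \<or> (\<exists>j<i. arrs s 17 (arrs s 13 j) = regs s' 17))"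
 have cn: "0 < regs s 7" "regs s 7 \<le> n" using treeP_cnt[OF T] by auto
 have "tr W ((Const 17 0 ;; Const 6 0) ;; for_up 6 7 ?b) s (2 + (n * (4 + 2) + 1)) (\<lambda>s'. ?I (regs s 7) s' \<and> regs s' 6 = regs s 7)"
 proof (rule tr_seq)
  show "tr W (Const 17 0 ;; Const 6 0) s 2 (\<lambda>s1. s1 = set_reg 6 0 (set_reg 17 0 s))" by (intro tr_wp) auto
  fix s1 assume s1: "s1 = set_reg 6 0 (set_reg 17 0 s)"
  show "tr W (for_up 6 7 ?b) s1 (n * (4 + 2) + 1) (\<lambda>s'. ?I (regs s 7) s' \<and> regs s' 6 = regs s 7)"
  proof (rule tr_for_up[where T = 4 and I = ?I])
   fix i s' assume I: "?I i s'" and i: "regs s' 6 = i" "i < regs s 7" and f: "frame (for_up 6 7 ?b) s1 s'"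
   have st': "static s'" using static_frame[OF _ f] stt s1 by simp
   have e: "arrs s' 13 = arrs s 13" "arrs s' 17 = arrs s 17" using frame_arrs[OF f] s1 by simp_all
   have a: "\<And>j. j < i ==> arrs s 17 (arrs s 13 j) \<le> regs s' 17"
    and b: "regs s' 17 = 0 \<or> (\<exists>j<i. arrs s 17 (arrs s 13 j) = regs s' 17)" using I by blast+
   define Q :: "state \<Rightarrow> bool" where "Q = ?I (Suc i)"
   have 1: "Q s''" if "regs s'' 17 = regs s' 17" "arrs s 17 (arrs s 13 i) \<le> regs s' 17" for s''
    unfolding Q_def that(1) using a b that(2) by (auto simp: less_Suc_eq)
   have 2: "Q s''" if "regs s'' 17 = arrs s 17 (arrs s 13 i)" "regs s' 17 < arrs s 17 (arrs s 13 i)" for s''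
    unfolding Q_def that(1) using that(2) a by (force simp: less_Suc_eq)
   have "tr W ?b s' 4 Q"
    by (rule tr_wp) (use 1 2 in \<open>simp_all add: staticD[OF st'] i(1) e\<close>)
   then show "tr W ?b s' 4 (?I (Suc i))" unfolding Q_def .
  qed (use stt s1 cn W in \<open>auto simp: staticD\<close>)
 qed
 then show ?thesis unfolding max_deg_def by (rule tr_cons) auto
qed

end

section \<open>Blocking, subtree sizes and preorder numbers by linear passes\<close>

section \<open>The ingredients of a round\<close>

text \<open>Array 8 held the edges from which the tree was extracted; now that the tree is fixed,
  all edges become available. Array 9 receives the tree edges and is the set that an improvement
  edits.\<close>

definition flags :: com where
 "flags = (Const 6 0 ;; for_up 6 3 (Store 8 6 1 ;; Store 9 6 0)) ;;
   Move 6 1 ;; for_up 6 7 (Load 8 13 6 ;; Load 12 12 8 ;; Store 9 12 1)"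

definition block :: com where
 "block = (Sub 25 17 1 ;; Const 20 0 ;; Const 6 0) ;;
   for_up 6 7 (Load 8 13 6 ;; Load 9 17 8 ;;
    If (LessEq 25 9) (Store 14 8 1 ;; Add 20 20 1) Skip)"

definition add_absorbed :: com where
 "add_absorbed = Move 6 29 ;;
   for_up 6 7 (Load 8 13 6 ;; Store 15 8 1 ;; Store 16 19 8 ;; Add 19 19 1)"

definition sizes :: com where
 "sizes = (Const 6 0 ;; for_up 6 7 (Load 8 13 6 ;; Store 18 8 1)) ;;
   Move 6 7 ;;
   for_down 6 1 (Load 8 13 6 ;; Load 24 11 8 ;; Load 9 18 8 ;; Load 15 18 24 ;;
    Add 9 9 15 ;; Store 18 24 9)"

text \<open>Array 20 keeps for each vertex the next free number of its interval. So a single forward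
  pass through the list allots disjoint intervals to siblings without any recursion.\<close>

definition preorder_nums :: com where
 "preorder_nums = (Store 19 4 0 ;; Store 20 4 1 ;; Move 6 1) ;;
   for_up 6 7 (Load 8 13 6 ;; Load 24 11 8 ;; Load 9 20 24 ;; Store 19 8 9 ;;
    Load 15 18 8 ;; Add 15 9 15 ;; Store 20 24 15 ;; Add 9 9 1 ;; Store 20 8 9)"

lemma wr_pg4 [simp]:
 "wr flags = {6,8,12}" "wa flags = {8,9}"
 "wr block = {6,8,9,20,25}" "wa block = {14}"
 "wr add_absorbed = {6,8,19}" "wa add_absorbed = {15,16}"
 "wr sizes = {6,8,9,15,24}" "wa sizes = {18}"
 "wr preorder_nums = {6,8,9,15,24}" "wa preorder_nums = {19,20}"
 by (auto simp: flags_def block_def add_absorbed_def sizes_def preorder_nums_def)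

context graph
begin

lemma treeP_notin:
 assumes "treeP ord cnt par pe" "i < cnt"
 shows "ord i \<notin> ord ` {..<i}"
proof
 assume "ord i \<in> ord ` {..<i}"
 then obtain j where j: "j < i" "ord i = ord j" by blast
 then have "i = j" using treeP_inj[OF assms(1,2), of j] assms(2) by simp
 then show False using j by simp
qed

lemma flags:
 assumes T: "tree_of s" and stt: "static s"
 shows "tr W flags s (4 * m + 5 * n + 5) (\<lambda>s'. (\<forall>e<m. arrs s' 8 e = 1) \<and>
   (\<forall>e<m. arrs s' 9 e = of_bool (e \<in> arrs s 12 ` (Vof s - {rt}))))"
proof -
 have cn: "0 < regs s 7" "regs s 7 \<le> n" using treeP_cnt[OF T] by auto
 let ?b = "Store 8 6 1 ;; Store 9 6 0" and ?b2 = "Load 8 13 6 ;; Load 12 12 8 ;; Store 9 12 1"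
 let ?I = "\<lambda>i s'. \<forall>e<i. arrs s' 8 e = 1 \<and> arrs s' 9 e = 0"
 have V: "Vof s - {rt} = arrs s 13 ` {j. 0 < j \<and> j < regs s 7}" using treeP_rt[OF T] by auto
 have "tr W (Const 6 0 ;; for_up 6 3 ?b) s (m * (2 + 2) + 2) (\<lambda>s'. ?I m s' \<and> regs s' 6 = m)"
 proof (rule tr_for_up0[where T = 2])
  fix i s' assume I: "?I i s'" and i: "i < m" "regs s' 6 = i" and f: "frame (for_up 6 3 ?b) s s'"
  have st': "static s'" using static_frame[OF stt f] by simp
  show "tr W ?b s' 2 (?I (Suc i))"
   using I by (intro tr_wp) (auto simp: staticD[OF st'] i(2) less_Suc_eq)
 qed (use stt W in \<open>auto simp: staticD\<close>)
 then have "tr W flags s ((m * (2 + 2) + 2) + (1 + (n * (3 + 2) + 1))) (\<lambda>s'. (\<forall>e<m. arrs s' 8 e = 1) \<and>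
   (\<forall>e<m. arrs s' 9 e = of_bool (e \<in> arrs s 12 ` (Vof s - {rt}))))"
  unfolding flags_def
 proof (rule tr_seq)
  fix s1 assume f: "frame (Const 6 0 ;; for_up 6 3 ?b) s s1" and I: "?I m s1 \<and> regs s1 6 = m"
  have st1: "static s1" using static_frame[OF stt f] by simp
  have e1: "regs s1 7 = regs s 7" "arrs s1 13 = arrs s 13" "arrs s1 12 = arrs s 12"
   using frame_regs[OF f] frame_arrs[OF f] by simp_all
  show "tr W (Move 6 1 ;; for_up 6 7 ?b2) s1 (1 + (n * (3 + 2) + 1)) (\<lambda>s'. (\<forall>e<m. arrs s' 8 e = 1) \<and>
   (\<forall>e<m. arrs s' 9 e = of_bool (e \<in> arrs s 12 ` (Vof s - {rt}))))"
  proof (rule tr_seq)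
   show "tr W (Move 6 1) s1 1 (\<lambda>s2. s2 = set_reg 6 1 s1)" by (intro tr_wp) (simp_all add: staticD[OF st1])
   fix s2 assume s2: "s2 = set_reg 6 1 s1"
   let ?J = "\<lambda>i s'. \<forall>e<m. arrs s' 9 e = of_bool (e \<in> arrs s 12 ` (arrs s 13 ` {j. 0 < j \<and> j < i}))"
   have "tr W (for_up 6 7 ?b2) s2 (n * (3 + 2) + 1) (\<lambda>s'. ?J (regs s 7) s' \<and> regs s' 6 = regs s 7)"
   proof (rule tr_for_up[where T = 3])
    have "{j. 0 < j \<and> j < regs s2 6} = {}" using s2 by auto
    then show "?J (regs s2 6) s2" unfolding \<open>{j. 0 < j \<and> j < regs s2 6} = {}\<close> using I s2 by simp
   next
    fix i s' assume J: "?J i s'" and i: "regs s2 6 \<le> i" "i < regs s 7" "regs s' 6 = i" and f2: "frame (for_up 6 7 ?b2) s2 s'"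
    have st': "static s'" using static_frame[OF _ f2] st1 s2 by simp
    have e': "arrs s' 13 = arrs s 13" "arrs s' 12 = arrs s 12" using frame_arrs[OF f2] s2 e1 by simp_all
    have "{j. 0 < j \<and> j < Suc i} = insert i {j. 0 < j \<and> j < i}" using i(1) s2 by auto
    then show "tr W ?b2 s' 3 (?J (Suc i))"
     using J by (intro tr_wp) (simp_all add: staticD[OF st'] i(3) e')
   qed (use st1 s2 e1 cn W in \<open>auto simp: staticD\<close>)
   then show "tr W (for_up 6 7 ?b2) s2 (n * (3 + 2) + 1) (\<lambda>s'. (\<forall>e<m. arrs s' 8 e = 1) \<and>
     (\<forall>e<m. arrs s' 9 e = of_bool (e \<in> arrs s 12 ` (Vof s - {rt}))))"
   proof (rule tr_cons)
    fix s' assume f2: "frame (for_up 6 7 ?b2) s2 s'" and J: "?J (regs s 7) s' \<and> regs s' 6 = regs s 7"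
    have "arrs s' 8 = arrs s1 8" using frame_arrs[OF f2] s2 by simp
    then show "(\<forall>e<m. arrs s' 8 e = 1) \<and> (\<forall>e<m. arrs s' 9 e = of_bool (e \<in> arrs s 12 ` (Vof s - {rt})))"
     unfolding V using J I by simp
   qed simp
  qed
 qed
 then show ?thesis by (rule tr_le) simp
qed

lemma block:
 assumes T: "tree_of s" and stt: "static s" and z: "\<forall>v<n. arrs s 14 v = 0"
 shows "tr W block s (8 * n + 4) (\<lambda>s'. (\<forall>v<n. arrs s' 14 v = of_bool (v \<in> Vof s \<and> regs s 17 - 1 \<le> arrs s 17 v)) \<and>
   regs s' 20 = card {v \<in> Vof s. regs s 17 - 1 \<le> arrs s 17 v})"
proof -
 have cn: "0 < regs s 7" "regs s 7 \<le> n" using treeP_cnt[OF T] by auto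
 let ?b = "Load 8 13 6 ;; Load 9 17 8 ;; If (LessEq 25 9) (Store 14 8 1 ;; Add 20 20 1) Skip"
 define S where "S i = {v \<in> arrs s 13 ` {..<i}. regs s 17 - 1 \<le> arrs s 17 v}" for i
 define I :: "nat \<Rightarrow> state \<Rightarrow> bool" where
  "I i s' \<longleftrightarrow> (\<forall>v<n. arrs s' 14 v = of_bool (v \<in> S i)) \<and> regs s' 20 = card (S i)" for i s'
 have finS: "finite (S i)" for i unfolding S_def by simp
 have S_le: "card (S i) \<le> i" for i
  using card_mono[of "arrs s 13 ` {..<i}" "S i"] card_image_le[of "{..<i}" "arrs s 13"] unfolding S_def by auto
 have "tr W ((Sub 25 17 1 ;; Const 20 0 ;; Const 6 0) ;; for_up 6 7 ?b) s (3 + (n * (5 + 2) + 1)) (\<lambda>s'. I (regs s 7) s' \<and> regs s' 6 = regs s 7)"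
 proof (rule tr_seq)
  show "tr W (Sub 25 17 1 ;; Const 20 0 ;; Const 6 0) s 3 (\<lambda>s1. s1 = set_reg 6 0 (set_reg 20 0 (set_reg 25 (regs s 17 - 1) s)))"
   by (intro tr_wp) (simp_all add: staticD[OF stt])
  fix s1 assume s1: "s1 = set_reg 6 0 (set_reg 20 0 (set_reg 25 (regs s 17 - 1) s))"
  show "tr W (for_up 6 7 ?b) s1 (n * (5 + 2) + 1) (\<lambda>s'. I (regs s 7) s' \<and> regs s' 6 = regs s 7)"
  proof (rule tr_for_up[where T = 5])
   show "I (regs s1 6) s1" using z s1 by (simp add: I_def S_def)
  next
   fix i s' assume J: "I i s'" and i: "i < regs s 7" "regs s' 6 = i" and f: "frame (for_up 6 7 ?b) s1 s'"
   have st': "static s'" using static_frame[OF _ f] stt s1 by simp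
   have e: "arrs s' 13 = arrs s 13" "arrs s' 17 = arrs s 17" "regs s' 25 = regs s 17 - 1"
    using frame_arrs[OF f] frame_regs[OF f, of 25] s1 by simp_all
   let ?v = "arrs s 13 i"
   have vn: "?v < n" using treeP_lt[OF T i(1)] .
   have nv: "?v \<notin> S i" using treeP_notin[OF T i(1)] by (simp add: S_def)
   have SS: "S (Suc i) = (if regs s 17 - 1 \<le> arrs s 17 ?v then insert ?v (S i) else S i)"
    unfolding S_def by (auto simp: lessThan_Suc)
   have b: "Suc (card (S i)) \<le> W" using S_le[of i] i cn W8 by linarith
   have c20: "regs s' 20 = card (S i)" using J by (simp add: I_def)
   have 1: "I (Suc i) s''" if "regs s 17 - 1 \<le> arrs s 17 ?v" "regs s'' 20 = Suc (card (S i))" "arrs s'' 14 = (arrs s' 14)(?v := 1)" for s''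
    using J that nv finS by (simp add: I_def SS)
   have 2: "I (Suc i) s''" if "\<not> regs s 17 - 1 \<le> arrs s 17 ?v" "regs s'' 20 = card (S i)" "arrs s'' 14 = arrs s' 14" for s''
    using J that by (simp add: I_def SS)
   show "tr W ?b s' 5 (I (Suc i))"
    by (rule tr_wp) (use 1 2 b in \<open>simp_all add: staticD[OF st'] i(2) e c20\<close>)
  qed (use stt s1 cn W in \<open>auto simp: staticD I_def\<close>)
 qed
 then show ?thesis unfolding block_def by (rule tr_cons) (auto simp: I_def S_def)
qed

lemma add_absorbed:
 assumes T: "tree_of s" and stt: "static s" and c: "regs s 29 \<le> regs s 7" "regs s 19 \<le> n"
 shows "tr W add_absorbed s (6 * n + 2) (\<lambda>s'. regs s' 19 = regs s 19 + (regs s 7 - regs s 29) \<and>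
   (\<forall>j<regs s 19. arrs s' 16 j = arrs s 16 j) \<and>
   (\<forall>j. regs s 29 \<le> j --> j < regs s 7 --> arrs s' 16 (regs s 19 + (j - regs s 29)) = arrs s 13 j) \<and>
   (\<forall>v. arrs s' 15 v = (if v \<in> arrs s 13 ` {regs s 29..<regs s 7} then 1 else arrs s 15 v)))"
proof -
 have cn: "0 < regs s 7" "regs s 7 \<le> n" using treeP_cnt[OF T] by auto
 let ?b = "Load 8 13 6 ;; Store 15 8 1 ;; Store 16 19 8 ;; Add 19 19 1"
 let ?c = "regs s 29" and ?n = "regs s 19"
 define I :: "nat \<Rightarrow> state \<Rightarrow> bool" where
  "I i s' \<longleftrightarrow> regs s' 19 = ?n + (i - ?c) \<and> (\<forall>j<?n. arrs s' 16 j = arrs s 16 j) \<and>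
   (\<forall>j. ?c \<le> j --> j < i --> arrs s' 16 (?n + (j - ?c)) = arrs s 13 j) \<and>
   (\<forall>v. arrs s' 15 v = (if v \<in> arrs s 13 ` {?c..<i} then 1 else arrs s 15 v))" for i s'
 have "tr W (Move 6 29 ;; for_up 6 7 ?b) s (1 + (n * (4 + 2) + 1)) (\<lambda>s'. I (regs s 7) s' \<and> regs s' 6 = regs s 7)"
 proof (rule tr_seq)
  show "tr W (Move 6 29) s 1 (\<lambda>s1. s1 = set_reg 6 ?c s)" by (intro tr_wp) simp_all
  fix s1 assume s1: "s1 = set_reg 6 ?c s"
  show "tr W (for_up 6 7 ?b) s1 (n * (4 + 2) + 1) (\<lambda>s'. I (regs s 7) s' \<and> regs s' 6 = regs s 7)"
  proof (rule tr_for_up[where T = 4])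
   fix i s' assume J: "I i s'" and i: "regs s1 6 \<le> i" "i < regs s 7" "regs s' 6 = i" and f: "frame (for_up 6 7 ?b) s1 s'"
   have st': "static s'" using static_frame[OF _ f] stt s1 by simp
   have e: "arrs s' 13 = arrs s 13" using frame_arrs[OF f] s1 by simp
   have ci: "?c \<le> i" using i s1 by simp
   have r: "regs s' 19 = ?n + (i - ?c)" using J by (simp add: I_def)
   have b: "Suc (?n + (i - ?c)) \<le> W" using i cn c W8 by linarith
   have im: "arrs s 13 ` {?c..<Suc i} = insert (arrs s 13 i) (arrs s 13 ` {?c..<i})"
    using ci by (simp add: atLeastLessThanSuc)
   have 1: "I (Suc i) s''" if "regs s'' 19 = Suc (?n + (i - ?c))" "arrs s'' 16 = (arrs s' 16)(?n + (i - ?c) := arrs s 13 i)"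
    "arrs s'' 15 = (arrs s' 15)(arrs s 13 i := 1)" for s''
    unfolding I_def im
   proof (intro conjI allI impI)
    fix j assume j: "?c \<le> j" "j < Suc i"
    show "arrs s'' 16 (?n + (j - ?c)) = arrs s 13 j"
    proof (cases "j = i")
     case False
     then have "?n + (j - ?c) \<noteq> ?n + (i - ?c)" "j < i" using j ci by auto
     moreover have "arrs s' 16 (?n + (j - ?c)) = arrs s 13 j" using J j \<open>j < i\<close> unfolding I_def by blast
     ultimately show ?thesis using that(2) by (metis fun_upd_other)
    qed (use that in simp)
   qed (use J that ci in \<open>auto simp: I_def\<close>)
   show "tr W ?b s' 4 (I (Suc i))"
    by (rule tr_wp) (use 1 b in \<open>simp_all add: staticD[OF st'] i(3) e r\<close>)
  qed (use stt s1 cn W c in \<open>auto simp: staticD I_def\<close>)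
 qed
 then show ?thesis unfolding add_absorbed_def by (rule tr_cons) (auto simp: I_def)
qed

definition cidx :: "state \<Rightarrow> nat \<Rightarrow> nat set" where
 "cidx s j = {q. 0 < q \<and> q < regs s 7 \<and> arrs s 11 (arrs s 13 q) = arrs s 13 j}"

lemma finite_cidx: "finite (cidx s j)"
 unfolding cidx_def by (rule finite_subset[of _ "{..<regs s 7}"]) auto

definition sizes_ok :: "state \<Rightarrow> (nat \<Rightarrow> nat) \<Rightarrow> bool" where
 "sizes_ok s sz \<longleftrightarrow> sz rt = regs s 7 \<and>
   (\<forall>j<regs s 7. sz (arrs s 13 j) = 1 + (\<Sum>q\<in>cidx s j. sz (arrs s 13 q)))"

lemma sizes:
 assumes T: "tree_of s" and stt: "static s"
 shows "tr W sizes s (12 * n + 4) (\<lambda>s'. sizes_ok s (arrs s' 18))"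
proof -
 have cn: "0 < regs s 7" "regs s 7 \<le> n" using treeP_cnt[OF T] by auto
 let ?b1 = "Load 8 13 6 ;; Store 18 8 1"
 let ?b2 = "Load 8 13 6 ;; Load 24 11 8 ;; Load 9 18 8 ;; Load 15 18 24 ;; Add 9 9 15 ;; Store 18 24 9"
 let ?O = "arrs s 13" and ?n = "regs s 7"
 let ?I = "\<lambda>i s'. \<forall>j<i. arrs s' 18 (?O j) = 1"
 have "tr W (Const 6 0 ;; for_up 6 7 ?b1) s (n * (2 + 2) + 2) (\<lambda>s'. ?I ?n s' \<and> regs s' 6 = ?n)"
 proof (rule tr_for_up0[where T = 2])
  fix i s' assume I: "?I i s'" and i: "i < ?n" "regs s' 6 = i" and f: "frame (for_up 6 7 ?b1) s s'"
  have st': "static s'" using static_frame[OF stt f] by simp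
  have e: "arrs s' 13 = ?O" using frame_arrs[OF f] by simp
  show "tr W ?b1 s' 2 (?I (Suc i))"
   using I by (intro tr_wp) (auto simp: staticD[OF st'] i(2) e less_Suc_eq)
 qed (use stt cn W in \<open>auto simp: staticD\<close>)
 then have "tr W sizes s ((n * (2 + 2) + 2) + (1 + (n * (6 + 2) + 1))) (\<lambda>s'. sizes_ok s (arrs s' 18))"
  unfolding sizes_def
 proof (rule tr_seq)
  fix s1 assume f: "frame (Const 6 0 ;; for_up 6 7 ?b1) s s1" and I: "?I ?n s1 \<and> regs s1 6 = ?n"
  have st1: "static s1" using static_frame[OF stt f] by simp
  have e1: "regs s1 7 = regs s 7" "arrs s1 13 = arrs s 13" "arrs s1 11 = arrs s 11"
   using frame_regs[OF f] frame_arrs[OF f] by simp_all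
  define C where "C i j = {q \<in> cidx s j. i \<le> q}" for i j
  \<comment> \<open>By the first conjunct the sizes of the vertices still to be pushed to their
    parents add up to the number of tree vertices. This yields the size of the root at the end and
    excludes an overflow on the way.\<close>
  define J :: "nat \<Rightarrow> state \<Rightarrow> bool" where
   "J i s' \<longleftrightarrow> (\<Sum>j<i. arrs s' 18 (?O j)) = ?n \<and>
    (\<forall>j<?n. arrs s' 18 (?O j) = 1 + (\<Sum>q\<in>C i j. arrs s' 18 (?O q)))" for i s'
  show "tr W (Move 6 7 ;; for_down 6 1 ?b2) s1 (1 + (n * (6 + 2) + 1)) (\<lambda>s'. sizes_ok s (arrs s' 18))"
  proof (rule tr_seq)
   show "tr W (Move 6 7) s1 1 (\<lambda>s2. s2 = set_reg 6 ?n s1)" by (intro tr_wp) (simp_all add: e1)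
   fix s2 assume s2: "s2 = set_reg 6 ?n s1"
   have "tr W (for_down 6 1 ?b2) s2 (n * (6 + 2) + 1) (\<lambda>s'. J 1 s' \<and> regs s' 6 = 1)"
   proof (rule tr_for_down[where T = 6])
    have "C ?n j = {}" for j by (auto simp: C_def cidx_def)
    moreover have "(\<Sum>j<?n. arrs s1 18 (?O j)) = (\<Sum>j<?n. 1)" using I by (intro sum.cong) auto
    ultimately show "J (regs s2 6) s2" using I s2 by (simp add: J_def)
   next
    fix i s' assume K: "J (Suc i) s'" and i: "1 \<le> i" "i < regs s2 6" "regs s' 6 = i" and f2: "frame (for_down 6 1 ?b2) s2 s'"
    have st': "static s'" using static_frame[OF _ f2] st1 s2 by simp
    have e: "arrs s' 13 = ?O" "arrs s' 11 = arrs s 11" using frame_arrs[OF f2] s2 e1 by simp_all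
    have i1: "i < ?n" "0 < i" using i s2 by auto
    obtain p where p: "p < i" "arrs s 11 (?O i) = ?O p" using treeP_par[OF T i1(2,1)] by blast
    define sz where "sz = arrs s' 18"
    define sz' where "sz' = sz(?O p := sz (?O p) + sz (?O i))"
    have K1: "(\<Sum>j<Suc i. sz (?O j)) = ?n" and K2: "\<And>j. j < ?n ==> sz (?O j) = 1 + (\<Sum>q\<in>C (Suc i) j. sz (?O q))"
     using K by (simp_all add: J_def sz_def)
    have sz'j: "sz' (?O j) = sz (?O j) + (if j = p then sz (?O i) else 0)" if "j < ?n" for j
     using treeP_inj[OF T, of j p] that p i1 by (simp add: sz'_def)
    have "(\<Sum>j<i. sz' (?O j)) = (\<Sum>j<i. sz (?O j) + (if j = p then sz (?O i) else 0))"
     using i1 by (intro sum.cong) (auto simp: sz'j)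
    also have "\<dots> = ?n" using K1 p by (simp add: sum.distrib)
    finally have s1': "(\<Sum>j<i. sz' (?O j)) = ?n" .
    have s2': "sz' (?O j) = 1 + (\<Sum>q\<in>C i j. sz' (?O q))" if j: "j < ?n" for j
    proof -
     have e1: "(\<Sum>q\<in>C i j. sz' (?O q)) = (\<Sum>q\<in>C i j. sz (?O q))"
     proof (rule sum.cong[OF refl])
      fix q assume "q \<in> C i j"
      then have "q < ?n" "q \<noteq> p" using p by (auto simp: C_def cidx_def)
      then show "sz' (?O q) = sz (?O q)" by (simp add: sz'j)
     qed
     have e2: "C i j = (if j = p then insert i (C (Suc i) j) else C (Suc i) j)"
     proof -
      have "i \<in> cidx s j \<longleftrightarrow> j = p" using p i1 treeP_inj[OF T, of p j] j by (auto simp: cidx_def)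
      moreover have "C i j = C (Suc i) j \<union> ({i} \<inter> cidx s j)" by (auto simp: C_def)
      ultimately show ?thesis by auto
     qed
     have "(\<Sum>q\<in>C i j. sz (?O q)) = (\<Sum>q\<in>C (Suc i) j. sz (?O q)) + (if j = p then sz (?O i) else 0)"
      unfolding e2 using finite_cidx[of s j] by (auto simp: C_def)
     then show ?thesis unfolding e1 using sz'j[OF j] K2[OF j] by simp
    qed
    have b: "sz (?O i) + sz (?O p) \<le> W"
    proof -
     have "sz (?O p) \<le> (\<Sum>j<i. sz (?O j))" using p by (intro member_le_sum) auto
     then have "sz (?O i) + sz (?O p) \<le> ?n" using K1 by simp
     then show ?thesis using cn W8 by linarith
    qed
    have 1: "J i s''" if "arrs s'' 18 = sz'" for s'' using s1' s2' that by (simp add: J_def)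
    show "tr W ?b2 s' 6 (J i)"
     by (rule tr_wp) (use 1 b in \<open>simp_all add: staticD[OF st'] i(3) e p(2) sz_def sz'_def add.commute\<close>)
   qed (use st1 s2 cn W in \<open>auto simp: staticD J_def\<close>)
   then show "tr W (for_down 6 1 ?b2) s2 (n * (6 + 2) + 1) (\<lambda>s'. sizes_ok s (arrs s' 18))"
   proof (rule tr_cons)
    fix s' assume J1: "J 1 s' \<and> regs s' 6 = 1"
    have "C 1 j = cidx s j" for j by (auto simp: C_def cidx_def)
    moreover have "?O 0 = rt" using T by (simp add: treeP_def)
    ultimately show "sizes_ok s (arrs s' 18)" using J1 by (simp add: J_def sizes_ok_def)
   qed simp
  qed
 qed
 then show ?thesis by (rule tr_le) simp
qed

definition nums_ok :: "state \<Rightarrow> (nat \<Rightarrow> nat) \<Rightarrow> (nat \<Rightarrow> nat) \<Rightarrow> bool" where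
 "nums_ok s sz pre \<longleftrightarrow>
  (\<forall>q p. 0 < q --> q < regs s 7 --> p < regs s 7 --> arrs s 11 (arrs s 13 q) = arrs s 13 p -->
    pre (arrs s 13 p) < pre (arrs s 13 q) \<and>
    pre (arrs s 13 q) + sz (arrs s 13 q) \<le> pre (arrs s 13 p) + sz (arrs s 13 p)) \<and>
  (\<forall>q q'. 0 < q --> q < q' --> q' < regs s 7 --> arrs s 11 (arrs s 13 q) = arrs s 11 (arrs s 13 q') -->
    pre (arrs s 13 q) + sz (arrs s 13 q) \<le> pre (arrs s 13 q')) \<and>
  (\<forall>j<regs s 7. pre (arrs s 13 j) + sz (arrs s 13 j) \<le> regs s 7)"

lemma preorder_nums:
 assumes T: "tree_of s" and stt: "static s" and S: "sizes_ok s (arrs s 18)"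
 shows "tr W preorder_nums s (11 * n + 4) (\<lambda>s'. nums_ok s (arrs s 18) (arrs s' 19))"
proof -
 have cn: "0 < regs s 7" "regs s 7 \<le> n" using treeP_cnt[OF T] by auto
 let ?b = "Load 8 13 6 ;; Load 24 11 8 ;; Load 9 20 24 ;; Store 19 8 9 ;;
    Load 15 18 8 ;; Add 15 9 15 ;; Store 20 24 15 ;; Add 9 9 1 ;; Store 20 8 9"
 let ?O = "arrs s 13" and ?n = "regs s 7" and ?sz = "arrs s 18"
 define C where "C i j = {q \<in> cidx s j. q < i}" for i j
 define I :: "nat \<Rightarrow> state \<Rightarrow> bool" where "I i s' \<longleftrightarrow>
   (\<forall>j<i. arrs s' 20 (?O j) = arrs s' 19 (?O j) + 1 + (\<Sum>q\<in>C i j. ?sz (?O q)) \<and>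
    arrs s' 19 (?O j) + ?sz (?O j) \<le> ?n) \<and>
   (\<forall>q p. 0 < q --> q < i --> p < i --> arrs s 11 (?O q) = ?O p -->
    arrs s' 19 (?O p) < arrs s' 19 (?O q) \<and> arrs s' 19 (?O q) + ?sz (?O q) \<le> arrs s' 20 (?O p)) \<and>
   (\<forall>q q'. 0 < q --> q < q' --> q' < i --> arrs s 11 (?O q) = arrs s 11 (?O q') -->
    arrs s' 19 (?O q) + ?sz (?O q) \<le> arrs s' 19 (?O q'))" for i s'
 have szj: "?sz (?O j) = 1 + (\<Sum>q\<in>cidx s j. ?sz (?O q))" if "j < ?n" for j
  using S that by (simp add: sizes_ok_def)
 have o0: "?O 0 = rt" using T by (simp add: treeP_def)
 have "tr W ((Store 19 4 0 ;; Store 20 4 1 ;; Move 6 1) ;; for_up 6 7 ?b) s (3 + (n * (9 + 2) + 1)) (\<lambda>s'. I ?n s' \<and> regs s' 6 = ?n)"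
 proof (rule tr_seq)
  let ?s1 = "set_reg 6 1 (set_arr 20 rt 1 (set_arr 19 rt 0 s))"
  show "tr W (Store 19 4 0 ;; Store 20 4 1 ;; Move 6 1) s 3 (\<lambda>s1. s1 = ?s1)"
   by (intro tr_wp) (simp_all add: staticD[OF stt])
  fix s1 assume s1: "s1 = ?s1"
  show "tr W (for_up 6 7 ?b) s1 (n * (9 + 2) + 1) (\<lambda>s'. I ?n s' \<and> regs s' 6 = ?n)"
  proof (rule tr_for_up[where T = 9])
   have "C 1 0 = {}" by (auto simp: C_def cidx_def)
   then show "I (regs s1 6) s1" using S s1 o0 by (simp add: I_def sizes_ok_def)
  next
   fix i s' assume J: "I i s'" and i: "regs s1 6 \<le> i" "i < ?n" "regs s' 6 = i" and f: "frame (for_up 6 7 ?b) s1 s'"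
   have st': "static s'" using static_frame[OF _ f] stt s1 by simp
   have e: "arrs s' 13 = ?O" "arrs s' 11 = arrs s 11" "arrs s' 18 = ?sz" using frame_arrs[OF f] s1 by simp_all
   have i1: "0 < i" using i s1 by auto
   obtain p where p: "p < i" "arrs s 11 (?O i) = ?O p" using treeP_par[OF T i1 i(2)] by blast
   define pre where "pre = arrs s' 19"
   define nx where "nx = arrs s' 20"
   define pre' where "pre' = pre(?O i := nx (?O p))"
   define nx' where "nx' = (nx(?O p := nx (?O p) + ?sz (?O i)))(?O i := nx (?O p) + 1)"
   have J1: "\<And>j. j < i ==> nx (?O j) = pre (?O j) + 1 + (\<Sum>q\<in>C i j. ?sz (?O q))"
    and J2: "\<And>j. j < i ==> pre (?O j) + ?sz (?O j) \<le> ?n"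
    and J3: "\<And>q p. 0 < q ==> q < i ==> p < i ==> arrs s 11 (?O q) = ?O p ==>
     pre (?O p) < pre (?O q) \<and> pre (?O q) + ?sz (?O q) \<le> nx (?O p)"
    and J4: "\<And>q q'. 0 < q ==> q < q' ==> q' < i ==> arrs s 11 (?O q) = arrs s 11 (?O q') ==>
     pre (?O q) + ?sz (?O q) \<le> pre (?O q')"
    using J unfolding I_def pre_def nx_def by blast+
   have inj: "?O j = ?O k \<longleftrightarrow> j = k" if "j < ?n" "k < ?n" for j k using treeP_inj[OF T that] .
   have pn: "p < ?n" using p i by simp
   have prej: "pre' (?O j) = (if j = i then nx (?O p) else pre (?O j))" if "j < ?n" for j
    using inj[OF that i(2)] by (simp add: pre'_def)
   have nxj: "nx' (?O j) = (if j = i then nx (?O p) + 1 else if j = p then nx (?O p) + ?sz (?O i) else nx (?O j))"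
    if "j < ?n" for j
    using inj[OF that i(2)] inj[OF that pn] by (simp add: nx'_def)
   have CS: "C (Suc i) j = (if j = p then insert i (C i j) else C i j)" if "j < ?n" for j
   proof -
    have "i \<in> cidx s j \<longleftrightarrow> j = p" using p(2) inj[OF pn that] i1 i(2) by (auto simp: cidx_def)
    moreover have "C (Suc i) j = C i j \<union> ({i} \<inter> cidx s j)" by (auto simp: C_def)
    ultimately show ?thesis by auto
   qed
   have finC: "finite (C i j)" for i j using finite_cidx[of s j] by (simp add: C_def)
   \<comment> \<open>When \<open>i\<close> is numbered, none of its children is, so its next free
     number is the one after its own.\<close>
   have Ci: "C i i = {}"
   proof (rule ccontr)
    assume "C i i \<noteq> {}"
    then obtain q where q: "0 < q" "q < i" "q < ?n" "arrs s 11 (?O q) = ?O i" by (auto simp: C_def cidx_def)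
    obtain p' where "p' < q" "arrs s 11 (?O q) = ?O p'" using treeP_par[OF T q(1,3)] by blast
    then show False using q inj[of p' i] i by auto
   qed
   \<comment> \<open>There is room in the interval of the parent: its size is 1 plus the sizes of
     all its children, and those numbered so far, \<open>i\<close> included, are only some of
     them.\<close>
   have szp: "(\<Sum>q\<in>C (Suc i) p. ?sz (?O q)) + 1 \<le> ?sz (?O p)"
   proof -
    have "(\<Sum>q\<in>C (Suc i) p. ?sz (?O q)) \<le> (\<Sum>q\<in>cidx s p. ?sz (?O q))"
     by (rule sum_mono2) (auto simp: finite_cidx C_def)
    then show ?thesis using szj[OF pn] by simp
   qed
   have sumS: "(\<Sum>q\<in>C (Suc i) p. ?sz (?O q)) = ?sz (?O i) + (\<Sum>q\<in>C i p. ?sz (?O q))"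
    using CS[OF pn] finC by (simp add: C_def)
   have szi: "1 \<le> ?sz (?O i)" using szj[OF i(2)] by simp
   have bnd: "nx (?O p) + ?sz (?O i) \<le> ?n" using J1[OF p(1)] J2[OF p(1)] szp sumS by linarith
   have 1: "I (Suc i) s''" if "arrs s'' 19 = pre'" "arrs s'' 20 = nx'" for s''
    unfolding I_def that
   proof (intro conjI allI impI)
    fix j assume j: "j < Suc i"
    then have jn: "j < ?n" using i by simp
    show "nx' (?O j) = pre' (?O j) + 1 + (\<Sum>q\<in>C (Suc i) j. ?sz (?O q))"
    proof (cases "j = i")
     case True
     then show ?thesis using prej[OF jn] nxj[OF jn] CS[OF jn] p Ci by simp
    next
     case False
     then show ?thesis using prej[OF jn] nxj[OF jn] CS[OF jn] J1[of j] j sumS by (cases "j = p") auto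
    qed
    show "pre' (?O j) + ?sz (?O j) \<le> ?n"
     using prej[OF jn] J2[of j] j bnd by (cases "j = i") auto
   next
    fix q r assume q: "0 < q" "q < Suc i" "r < Suc i" "arrs s 11 (?O q) = ?O r"
    then have qn: "q < ?n" "r < ?n" using i by auto
    obtain r' where r': "r' < q" "arrs s 11 (?O q) = ?O r'" using treeP_par[OF T q(1) qn(1)] by blast
    then have "r' = r" using q(4) inj[of r' r] qn by simp
    then have rq: "r < q" using r' by simp
    show "pre' (?O r) < pre' (?O q)" "pre' (?O q) + ?sz (?O q) \<le> nx' (?O r)"
    proof -
     have "pre' (?O r) < pre' (?O q) \<and> pre' (?O q) + ?sz (?O q) \<le> nx' (?O r)"
     proof (cases "q = i")
      case True
      have "?O r = ?O p" unfolding q(4)[symmetric] p(2)[symmetric] True ..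
      then have "r = p" using inj[OF qn(2) pn] by blast
      have "pre' (?O q) = nx (?O p)" using prej[OF qn(1)] True by simp
      moreover have "pre' (?O r) = pre (?O p)" using prej[OF qn(2)] rq True \<open>r = p\<close> by simp
      moreover have "nx' (?O r) = nx (?O p) + ?sz (?O q)" using nxj[OF qn(2)] rq True \<open>r = p\<close> by simp
      ultimately show ?thesis using J1[OF p(1)] by linarith
     next
      case False
      then have "q < i" "r < i" using q rq by auto
      have "pre' (?O q) = pre (?O q)" using prej[OF qn(1)] False by simp
      moreover have "pre' (?O r) = pre (?O r)" using prej[OF qn(2)] \<open>r < i\<close> by simp
      moreover have "nx (?O r) \<le> nx' (?O r)" using nxj[OF qn(2)] \<open>r < i\<close> by simp
      moreover note J3[OF q(1) \<open>q < i\<close> \<open>r < i\<close> q(4)]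
      ultimately show ?thesis by linarith
     qed
     then show "pre' (?O r) < pre' (?O q)" "pre' (?O q) + ?sz (?O q) \<le> nx' (?O r)" by auto
    qed
   next
    fix q q' assume q: "0 < q" "q < q'" "q' < Suc i" "arrs s 11 (?O q) = arrs s 11 (?O q')"
    then have qn: "q < ?n" "q' < ?n" "q < i" using i by auto
    show "pre' (?O q) + ?sz (?O q) \<le> pre' (?O q')"
    proof (cases "q' = i")
     case True
     then have "arrs s 11 (?O q) = ?O p" using q(4) p(2) by metis
     note J3[OF q(1) qn(3) p(1) this]
     moreover have "pre' (?O q) = pre (?O q)" using prej[OF qn(1)] qn by simp
     moreover have "pre' (?O q') = nx (?O p)" using prej[OF qn(2)] True by simp
     ultimately show ?thesis by linarith
    next
     case False
     then have "q' < i" using q by simp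
     note J4[OF q(1,2) this q(4)]
     moreover have "pre' (?O q) = pre (?O q)" using prej[OF qn(1)] qn by simp
     moreover have "pre' (?O q') = pre (?O q')" using prej[OF qn(2)] False by simp
     ultimately show ?thesis by linarith
    qed
   qed
   have b: "nx (?O p) + ?sz (?O i) \<le> W" "Suc (nx (?O p)) \<le> W" using bnd szi cn W8 by linarith+
   have ne: "?O i \<noteq> ?O p" using inj[OF i(2) pn] p by simp
   show "tr W ?b s' 9 (I (Suc i))"
    by (rule tr_wp) (use 1 b ne in \<open>simp_all add: staticD[OF st'] i(3) e p(2) pre_def nx_def pre'_def nx'_def\<close>)
  qed (use stt s1 cn W in \<open>auto simp: staticD I_def\<close>)
 qed
 then show ?thesis unfolding preorder_nums_def
 proof (rule tr_cons)
  fix s' assume I: "I ?n s' \<and> regs s' 6 = ?n"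
  have C: "C ?n j = cidx s j" for j by (auto simp: C_def cidx_def)
  have a: "arrs s' 20 (?O j) = arrs s' 19 (?O j) + ?sz (?O j)" if "j < ?n" for j
   using I szj[OF that] that unfolding I_def C by simp
  show "nums_ok s ?sz (arrs s' 19)" unfolding nums_ok_def
  proof (intro conjI allI impI)
   fix q p assume "0 < q" "q < ?n" "p < ?n" "arrs s 11 (?O q) = ?O p"
   then have "arrs s' 19 (?O p) < arrs s' 19 (?O q) \<and> arrs s' 19 (?O q) + ?sz (?O q) \<le> arrs s' 20 (?O p)"
    using I unfolding I_def by blast
   then show "arrs s' 19 (?O p) < arrs s' 19 (?O q)"
    "arrs s' 19 (?O q) + ?sz (?O q) \<le> arrs s' 19 (?O p) + ?sz (?O p)" using a[OF \<open>p < ?n\<close>] by auto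
  next
   fix q q' assume "0 < q" "q < q'" "q' < ?n" "arrs s 11 (?O q) = arrs s 11 (?O q')"
   then show "arrs s' 19 (?O q) + ?sz (?O q) \<le> arrs s' 19 (?O q')" using I unfolding I_def by blast
  next
   fix j assume "j < ?n"
   then show "arrs s' 19 (?O j) + ?sz (?O j) \<le> ?n" using I unfolding I_def by blast
  qed
 qed simp
qed

end

section \<open>Finding the live edges that leave a subtree\<close>

definition upd_range :: "nat \<Rightarrow> nat \<Rightarrow> com" where
 "upd_range a b = (Load 9 19 b ;; Load 15 21 a) ;;
   If (Less 9 15) (Store 21 a 9 ;; Store 23 a 6) Skip ;;
   Load 15 22 a ;;
   If (Less 15 9) (Store 22 a 9 ;; Store 24 a 6) Skip"

text \<open>An edge from inside a subtree leaves it exactly if the preorder number of its far end is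
  outside the interval. If any such number is outside, the smallest or the largest one is, so only
  these two are stored, with the edges attaining them.\<close>

definition ranges :: com where
 "ranges = (Const 6 0 ;; for_up 6 7 (Load 8 13 6 ;; Load 9 19 8 ;; Store 21 8 9 ;; Store 22 8 9)) ;;
   Const 6 0 ;;
   for_up 6 3 ((Load 12 2 6 ;; Load 14 3 6 ;; Load 9 10 12 ;; Load 15 10 14 ;; Load 24 14 12 ;; Load 8 14 14) ;;
    If (Equal 9 0) Skip (If (Equal 15 0) Skip (If (NotEqual 24 0) Skip (If (NotEqual 8 0) Skip
     (upd_range 12 14 ;; upd_range 14 12)))))"

definition push_ranges :: com where
 "push_ranges = Move 6 7 ;;
   for_down 6 1 (Load 8 13 6 ;; Load 24 11 8 ;; Load 9 21 8 ;; Load 15 21 24 ;;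
    If (Less 9 15) (Store 21 24 9 ;; Load 15 23 8 ;; Store 23 24 15) Skip ;;
    Load 9 22 8 ;; Load 15 22 24 ;;
    If (Less 15 9) (Store 22 24 9 ;; Load 15 24 8 ;; Store 24 24 15) Skip)"

lemma wr_pg5 [simp]:
 "wr (upd_range a b) = {9,15}" "wa (upd_range a b) = {21,22,23,24}"
 "wr ranges = {6,8,9,12,14,15,24}" "wa ranges = {21,22,23,24}"
 "wr push_ranges = {6,8,9,15,24}" "wa push_ranges = {21,22,23,24}"
 by (auto simp: upd_range_def ranges_def push_ranges_def)

context graph
begin

lemma sub_iff:
 assumes T: "tree_of s" and S: "sizes_ok s sz" and N: "nums_ok s sz pre" and u: "u \<in> Vof s" "x \<in> Vof s"
 shows "anc rt (arrs s 11) u x \<longleftrightarrow> pre x \<le> pre u \<and> pre u < pre x + sz x"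
proof -
 interpret rtree "Vof s" rt "arrs s 11" "inv_into {..<regs s 7} (arrs s 13)" using treeP_rtree[OF T] .
 show ?thesis
 proof (rule sub_interval)
  fix v assume "v \<in> Vof s"
  then show "1 \<le> sz v" using S by (auto simp: sizes_ok_def)
 next
  fix c assume c: "c \<in> Vof s" "c \<noteq> rt"
  then obtain q where q: "c = arrs s 13 q" "q < regs s 7" "0 < q" using treeP_rt[OF T] by auto
  obtain p where p: "p < q" "arrs s 11 (arrs s 13 q) = arrs s 13 p" using treeP_par[OF T q(3,2)] by blast
  have "p < regs s 7" using p q by simp
  then show "pre (arrs s 11 c) < pre c \<and> pre c + sz c \<le> pre (arrs s 11 c) + sz (arrs s 11 c)"
   using N q p unfolding nums_ok_def by metis
 next
  fix c d assume cd: "c \<in> Vof s" "d \<in> Vof s" "c \<noteq> rt" "d \<noteq> rt" "c \<noteq> d" "arrs s 11 c = arrs s 11 d"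
  then obtain q r where q: "c = arrs s 13 q" "q < regs s 7" "0 < q" "d = arrs s 13 r" "r < regs s 7" "0 < r"
   using treeP_rt[OF T] by auto
  then have "q \<noteq> r" using cd by auto
  then consider "q < r" | "r < q" by linarith
  then show "pre c + sz c \<le> pre d \<or> pre d + sz d \<le> pre c"
  proof cases
   case 1
   then have "pre c + sz c \<le> pre d" using N q cd(6) unfolding nums_ok_def by blast
   then show ?thesis ..
  next
   case 2
   then have "pre d + sz d \<le> pre c" using N q cd(6) unfolding nums_ok_def by metis
   then show ?thesis ..
  qed
 qed (use u in auto)
qed

text \<open>Both extremes start at \<open>pre v\<close> itself, which stands for no edge; only a
  strict excess comes with a witness.\<close>

definition rng :: "nat set \<Rightarrow> (nat \<Rightarrow> nat) \<Rightarrow> (nat \<times> nat \<times> nat) set \<Rightarrow> state \<Rightarrow> bool" where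
 "rng V pre F s \<longleftrightarrow> (\<forall>v\<in>V. arrs s 21 v \<le> pre v \<and> pre v \<le> arrs s 22 v \<and>
   (arrs s 21 v < pre v --> (\<exists>b. (v, b, arrs s 23 v) \<in> F \<and> pre b = arrs s 21 v)) \<and>
   (pre v < arrs s 22 v --> (\<exists>b. (v, b, arrs s 24 v) \<in> F \<and> pre b = arrs s 22 v)) \<and>
   (\<forall>b e. (v, b, e) \<in> F --> arrs s 21 v \<le> pre b \<and> pre b \<le> arrs s 22 v))"

lemma upd_range:
 assumes R: "rng V (arrs s 19) F s" and r: "regs s a = u" "regs s b = w" "regs s 6 = e" "a \<notin> {9,15}" "b \<notin> {9,15}"
  and uV: "u \<in> V"
 shows "tr W (upd_range a b) s 11 (rng V (arrs s 19) (insert (u, w, e) F))"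
proof -
 let ?x = "arrs s 19 w"
 have 1: "rng V (arrs s 19) (insert (u, w, e) F) s'"
  if "arrs s' 21 = (if ?x < arrs s 21 u then (arrs s 21)(u := ?x) else arrs s 21)"
    "arrs s' 23 = (if ?x < arrs s 21 u then (arrs s 23)(u := e) else arrs s 23)"
    "arrs s' 22 = (if arrs s 22 u < ?x then (arrs s 22)(u := ?x) else arrs s 22)"
    "arrs s' 24 = (if arrs s 22 u < ?x then (arrs s 24)(u := e) else arrs s 24)" for s'
  unfolding rng_def
 proof (intro ballI)
  fix v assume v: "v \<in> V"
  have Rv: "arrs s 21 v \<le> arrs s 19 v" "arrs s 19 v \<le> arrs s 22 v"
   "arrs s 21 v < arrs s 19 v ==> \<exists>b. (v, b, arrs s 23 v) \<in> F \<and> arrs s 19 b = arrs s 21 v"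
   "arrs s 19 v < arrs s 22 v ==> \<exists>b. (v, b, arrs s 24 v) \<in> F \<and> arrs s 19 b = arrs s 22 v"
   "\<And>b e. (v, b, e) \<in> F ==> arrs s 21 v \<le> arrs s 19 b \<and> arrs s 19 b \<le> arrs s 22 v"
   using R v unfolding rng_def by blast+
  show "arrs s' 21 v \<le> arrs s 19 v \<and> arrs s 19 v \<le> arrs s' 22 v \<and>
   (arrs s' 21 v < arrs s 19 v --> (\<exists>b. (v, b, arrs s' 23 v) \<in> insert (u, w, e) F \<and> arrs s 19 b = arrs s' 21 v)) \<and>
   (arrs s 19 v < arrs s' 22 v --> (\<exists>b. (v, b, arrs s' 24 v) \<in> insert (u, w, e) F \<and> arrs s 19 b = arrs s' 22 v)) \<and>
   (\<forall>b e'. (v, b, e') \<in> insert (u, w, e) F --> arrs s' 21 v \<le> arrs s 19 b \<and> arrs s 19 b \<le> arrs s' 22 v)"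
  proof (cases "v = u")
   case True
   have a1: "arrs s' 21 v \<le> arrs s 21 v" "arrs s 22 v \<le> arrs s' 22 v" "arrs s' 21 v \<le> ?x" "?x \<le> arrs s' 22 v"
    using that True by auto
   have a2: "\<exists>b. (v, b, arrs s' 23 v) \<in> insert (u, w, e) F \<and> arrs s 19 b = arrs s' 21 v" if "arrs s' 21 v < arrs s 19 v"
   proof (cases "?x < arrs s 21 u")
    case T: True
    then show ?thesis using \<open>v = u\<close> \<open>arrs s' 21 = _\<close> \<open>arrs s' 23 = _\<close> by (intro exI[of _ w]) simp
   next
    case False
    then show ?thesis using \<open>v = u\<close> \<open>arrs s' 21 = _\<close> \<open>arrs s' 23 = _\<close> Rv(3) that by auto
   qed
   have a3: "\<exists>b. (v, b, arrs s' 24 v) \<in> insert (u, w, e) F \<and> arrs s 19 b = arrs s' 22 v" if "arrs s 19 v < arrs s' 22 v"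
   proof (cases "arrs s 22 u < ?x")
    case T: True
    then show ?thesis using \<open>v = u\<close> \<open>arrs s' 22 = _\<close> \<open>arrs s' 24 = _\<close> by (intro exI[of _ w]) simp
   next
    case False
    then show ?thesis using \<open>v = u\<close> \<open>arrs s' 22 = _\<close> \<open>arrs s' 24 = _\<close> Rv(4) that by auto
   qed
   have a4: "arrs s' 21 v \<le> arrs s 19 b \<and> arrs s 19 b \<le> arrs s' 22 v" if "(v, b, e') \<in> insert (u, w, e) F" for b e'
   proof (cases "(v, b, e') \<in> F")
    case T: True
    show ?thesis using Rv(5)[OF T] a1 by linarith
   next
    case False
    then have "b = w" using that by simp
    then show ?thesis using a1 by simp
   qed
   show ?thesis using a1 a2 a3 a4 Rv(1,2) by (meson order_trans)
  next
   case False
   then have "arrs s' 21 v = arrs s 21 v" "arrs s' 22 v = arrs s 22 v" "arrs s' 23 v = arrs s 23 v" "arrs s' 24 v = arrs s 24 v"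
    using that by simp_all
   then show ?thesis using Rv False by auto
  qed
 qed
 define Q where "Q = rng V (arrs s 19) (insert (u, w, e) F)"
 have "tr W (upd_range a b) s 11 Q" unfolding upd_range_def
  by (rule tr_wp) (use 1[folded Q_def] r in \<open>simp_all\<close>)
 then show ?thesis unfolding Q_def .
qed

definition live :: "state \<Rightarrow> nat set" where
 "live s = {v \<in> Vof s. arrs s 14 v = 0}"

definition ledge :: "nat set \<Rightarrow> nat \<Rightarrow> nat \<Rightarrow> nat \<Rightarrow> bool" where
 "ledge L a b e \<longleftrightarrow> e < m \<and> joins eu ev e a b \<and> a \<in> L \<and> b \<in> L"

lemma ranges:
 assumes T: "tree_of s" and stt: "static s" and l: "listed (arrs s 13) (regs s 7) (arrs s 10)"
 shows "tr W ranges s (6 * n + 35 * m + 4) (rng (Vof s) (arrs s 19) {(a, b, e). ledge (live s) a b e})"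
proof -
 have cn: "0 < regs s 7" "regs s 7 \<le> n" using treeP_cnt[OF T] by auto
 let ?b1 = "Load 8 13 6 ;; Load 9 19 8 ;; Store 21 8 9 ;; Store 22 8 9"
 let ?pre = "Load 12 2 6 ;; Load 14 3 6 ;; Load 9 10 12 ;; Load 15 10 14 ;; Load 24 14 12 ;; Load 8 14 14"
 let ?u = "upd_range 12 14 ;; upd_range 14 12"
 let ?if = "If (Equal 9 0) Skip (If (Equal 15 0) Skip (If (NotEqual 24 0) Skip (If (NotEqual 8 0) Skip ?u)))"
 let ?O = "arrs s 13" and ?n = "regs s 7"
 let ?I = "\<lambda>i s'. \<forall>j<i. arrs s' 21 (?O j) = arrs s 19 (?O j) \<and> arrs s' 22 (?O j) = arrs s 19 (?O j)"
 define F where "F i = {(a, b, e). ledge (live s) a b e \<and> e < i}" for i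
 have "tr W (Const 6 0 ;; for_up 6 7 ?b1) s (n * (4 + 2) + 2) (\<lambda>s'. ?I ?n s' \<and> regs s' 6 = ?n)"
 proof (rule tr_for_up0[where T = 4])
  fix i s' assume I: "?I i s'" and i: "i < ?n" "regs s' 6 = i" and f: "frame (for_up 6 7 ?b1) s s'"
  have st': "static s'" using static_frame[OF stt f] by simp
  have e: "arrs s' 13 = ?O" "arrs s' 19 = arrs s 19" using frame_arrs[OF f] by simp_all
  define Q :: "state \<Rightarrow> bool" where "Q = ?I (Suc i)"
  have 1: "Q s''" if "arrs s'' 21 = (arrs s' 21)(?O i := arrs s 19 (?O i))"
   "arrs s'' 22 = (arrs s' 22)(?O i := arrs s 19 (?O i))" for s''
   unfolding Q_def using I that by (auto simp: less_Suc_eq)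
  have "tr W ?b1 s' 4 Q"
   by (rule tr_wp) (use 1 in \<open>simp_all add: staticD[OF st'] i(2) e\<close>)
  then show "tr W ?b1 s' 4 (?I (Suc i))" unfolding Q_def .
 qed (use stt cn W in \<open>auto simp: staticD\<close>)
 moreover have "tr W (Const 6 0 ;; for_up 6 3 (?pre ;; ?if)) s1 (m * (32 + 2) + 2)
   (rng (Vof s) (arrs s 19) {(a, b, e). ledge (live s) a b e})"
  if f: "frame (Const 6 0 ;; for_up 6 7 ?b1) s s1" and I: "?I ?n s1 \<and> regs s1 6 = ?n" for s1
 proof -
  have st1: "static s1" using static_frame[OF stt f] by simp
  have e1: "arrs s1 13 = arrs s 13" "arrs s1 10 = arrs s 10" "arrs s1 14 = arrs s 14" "arrs s1 19 = arrs s 19"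
   using frame_arrs[OF f] by simp_all
  have "tr W (Const 6 0 ;; for_up 6 3 (?pre ;; ?if)) s1 (m * (32 + 2) + 2)
   (\<lambda>s'. rng (Vof s) (arrs s 19) (F m) s' \<and> regs s' 6 = m)"
  proof (rule tr_for_up0[where T = 32])
   show "rng (Vof s) (arrs s 19) (F 0) (set_reg 6 0 s1)" using I by (auto simp: rng_def F_def)
  next
   fix i s' assume R: "rng (Vof s) (arrs s 19) (F i) s'" and i: "i < m" "regs s' 6 = i"
    and f2: "frame (for_up 6 3 (?pre ;; ?if)) s1 s'"
   have st': "static s'" using static_frame[OF st1 f2] by simp
   have e: "arrs s' 13 = arrs s 13" "arrs s' 10 = arrs s 10" "arrs s' 14 = arrs s 14" "arrs s' 19 = arrs s 19"
    using frame_arrs[OF f2] e1 by simp_all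
   let ?ux = "eu i" and ?vx = "ev i"
   have uv: "?ux < n" "?vx < n" using eun evn i by auto
   have inV: "v \<in> Vof s \<longleftrightarrow> arrs s 10 v \<noteq> 0" if "v < n" for v using l that by (simp add: listed_def)
   let ?R = "\<lambda>s2. regs s2 12 = ?ux \<and> regs s2 14 = ?vx \<and> regs s2 9 = arrs s 10 ?ux \<and> regs s2 15 = arrs s 10 ?vx \<and>
    regs s2 24 = arrs s 14 ?ux \<and> regs s2 8 = arrs s 14 ?vx \<and> arrs s2 = arrs s' \<and> static s2 \<and> regs s2 6 = i"
   have "tr W ?pre s' 6 ?R" by (rule tr_wp) (simp_all add: staticD[OF st'] st' i(2) e)
   moreover have "tr W ?if s2 26 (rng (Vof s) (arrs s 19) (F (Suc i)))" if "?R s2" for s2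
   proof -
    have r: "regs s2 12 = ?ux" "regs s2 14 = ?vx" "regs s2 9 = arrs s 10 ?ux" "regs s2 15 = arrs s 10 ?vx"
     "regs s2 24 = arrs s 14 ?ux" "regs s2 8 = arrs s 14 ?vx" "arrs s2 = arrs s'" "static s2" "regs s2 6 = i"
     using that by blast+
    have R2: "rng (Vof s) (arrs s 19) (F i) s2" using R r(7) by (simp add: rng_def)
    have FS: "F (Suc i) = F i \<union> {(a, b, e). ledge (live s) a b e \<and> e = i}" by (auto simp: F_def)
    have lv: "ledge (live s) a b i \<longleftrightarrow> (a = ?ux \<and> b = ?vx \<or> a = ?vx \<and> b = ?ux) \<and> ?ux \<in> live s \<and> ?vx \<in> live s" for a b
     using i by (auto simp: ledge_def joins_def)
    have skip: "tr W Skip s2 1 (rng (Vof s) (arrs s 19) (F (Suc i)))" if "?ux \<notin> live s \<or> ?vx \<notin> live s"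
    proof -
     have "{(a, b, e). ledge (live s) a b e \<and> e = i} = {}" using lv that by auto
     then have "F (Suc i) = F i" unfolding FS by blast
     then show ?thesis using R2 by (intro tr_wp) simp_all
    qed
    have both: "tr W ?u s2 22 (rng (Vof s) (arrs s 19) (F (Suc i)))" if lu: "?ux \<in> live s" "?vx \<in> live s"
    proof -
     have e19: "arrs s2 19 = arrs s 19" using r e by simp
     have "{(a, b, e). ledge (live s) a b e \<and> e = i} = {(?vx, ?ux, i), (?ux, ?vx, i)}" using lv lu by auto
     then have F2: "F (Suc i) = insert (?vx, ?ux, i) (insert (?ux, ?vx, i) (F i))" unfolding FS by blast
     have V: "?ux \<in> Vof s" "?vx \<in> Vof s" using lu by (auto simp: live_def)
     have "tr W (upd_range 12 14) s2 11 (rng (Vof s) (arrs s 19) (insert (?ux, ?vx, i) (F i)))"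
      using upd_range[of "Vof s" s2 "F i" 12 ?ux 14 ?vx i] R2 r V unfolding e19 by simp
     moreover have "tr W (upd_range 14 12) s3 11 (rng (Vof s) (arrs s 19) (F (Suc i)))"
      if f3: "frame (upd_range 12 14) s2 s3" and R3: "rng (Vof s) (arrs s 19) (insert (?ux, ?vx, i) (F i)) s3" for s3
     proof -
      have r3: "regs s3 12 = ?ux" "regs s3 14 = ?vx" "regs s3 6 = i" "arrs s3 19 = arrs s 19"
       using frame_regs[OF f3] frame_arrs[OF f3, of 19] r e19 by simp_all
      show ?thesis unfolding F2
       using upd_range[of "Vof s" s3 "insert (?ux, ?vx, i) (F i)" 14 ?vx 12 ?ux i] R3 r3 V unfolding r3(4) by simp
     qed
     ultimately have "tr W ?u s2 (11 + 11) (rng (Vof s) (arrs s 19) (F (Suc i)))" by (rule tr_seq)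
     then show ?thesis by simp
    qed
    note z = staticD(1)[OF r(8)]
    have 4: "tr W (If (NotEqual 8 0) Skip ?u) s2 23 (rng (Vof s) (arrs s 19) (F (Suc i)))"
     if "arrs s 10 ?ux \<noteq> 0" "arrs s 10 ?vx \<noteq> 0" "arrs s 14 ?ux = 0"
     by (rule tr_le[OF tr_If[where T = 22]])
      (use that z r(6) inV uv skip both in \<open>auto simp: live_def intro: tr_le\<close>)
    have 3: "tr W (If (NotEqual 24 0) Skip (If (NotEqual 8 0) Skip ?u)) s2 24 (rng (Vof s) (arrs s 19) (F (Suc i)))"
     if "arrs s 10 ?ux \<noteq> 0" "arrs s 10 ?vx \<noteq> 0"
     by (rule tr_le[OF tr_If[where T = 23]])
      (use that z r(5) 4 skip in \<open>auto simp: live_def intro: tr_le\<close>)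
    have 2: "tr W (If (Equal 15 0) Skip (If (NotEqual 24 0) Skip (If (NotEqual 8 0) Skip ?u))) s2 25 (rng (Vof s) (arrs s 19) (F (Suc i)))"
     if "arrs s 10 ?ux \<noteq> 0"
     by (rule tr_le[OF tr_If[where T = 24]])
      (use that z r(4) inV uv 3 skip in \<open>auto simp: live_def intro: tr_le\<close>)
    show ?thesis
     by (rule tr_le[OF tr_If[where T = 25]])
      (use z r(3) inV uv 2 skip in \<open>auto simp: live_def intro: tr_le\<close>)
   qed
   ultimately have "tr W (?pre ;; ?if) s' (6 + 26) (rng (Vof s) (arrs s 19) (F (Suc i)))" by (rule tr_seq)
   then show "tr W (?pre ;; ?if) s' 32 (rng (Vof s) (arrs s 19) (F (Suc i)))" by simp
  qed (use st1 W in \<open>auto simp: staticD rng_def\<close>)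
  moreover have "F m = {(a, b, e). ledge (live s) a b e}" by (auto simp: F_def ledge_def)
  ultimately show ?thesis by (auto intro: tr_cons)
 qed
 ultimately have "tr W ranges s ((n * (4 + 2) + 2) + (m * (32 + 2) + 2)) (rng (Vof s) (arrs s 19) {(a, b, e). ledge (live s) a b e})"
  unfolding ranges_def by (rule tr_seq)
 then show ?thesis by (rule tr_le) simp
qed

text \<open>The part of the subtree of \<open>v\<close> that has been folded into \<open>v\<close>
  when the backward pass stands at index \<open>i\<close>.\<close>

definition near :: "state \<Rightarrow> nat \<Rightarrow> nat \<Rightarrow> nat \<Rightarrow> bool" where
 "near s i v a \<longleftrightarrow> a = v \<or> (\<exists>j\<ge>i. 0 < j \<and> j < regs s 7 \<and> arrs s 11 (arrs s 13 j) = v \<and> anc rt (arrs s 11) a (arrs s 13 j))"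

definition low_ok :: "state \<Rightarrow> nat \<Rightarrow> (nat \<Rightarrow> nat) \<Rightarrow> (nat \<Rightarrow> nat) \<Rightarrow> bool" where
 "low_ok s i lo le \<longleftrightarrow> (\<forall>v\<in>Vof s. lo v \<le> arrs s 19 v \<and>
   (lo v < arrs s 19 v --> (\<exists>a b. ledge (live s) a b (le v) \<and> anc rt (arrs s 11) a v \<and> arrs s 19 b = lo v)) \<and>
   (\<forall>a b e. ledge (live s) a b e --> near s i v a --> lo v \<le> arrs s 19 b))"

text \<open>Unlike in \<open>low_ok\<close>, a witness is demanded only from
  \<open>pre v + sz v\<close> on: far ends with numbers larger than \<open>pre v\<close> may still
  lie in the subtree of \<open>v\<close>, those with smaller numbers never do.\<close>

definition high_ok :: "state \<Rightarrow> nat \<Rightarrow> (nat \<Rightarrow> nat) \<Rightarrow> (nat \<Rightarrow> nat) \<Rightarrow> bool" where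
 "high_ok s i hi he \<longleftrightarrow> (\<forall>v\<in>Vof s.
   (arrs s 19 v + arrs s 18 v \<le> hi v --> (\<exists>a b. ledge (live s) a b (he v) \<and> anc rt (arrs s 11) a v \<and> arrs s 19 b = hi v)) \<and>
   (\<forall>a b e. ledge (live s) a b e --> near s i v a --> arrs s 19 b \<le> hi v))"

text \<open>The children of vertex \<open>i\<close> have larger indices, so its subtree is complete
  at the moment when it is folded into its parent.\<close>

lemma near_step:
 assumes T: "tree_of s" and i: "0 < i" "i < regs s 7" and aV: "a \<in> Vof s"
 shows "near s i v a ==> near s (Suc i) v a \<or> v = arrs s 11 (arrs s 13 i) \<and> near s (Suc i) (arrs s 13 i) a"
proof -
 interpret rtree "Vof s" rt "arrs s 11" "inv_into {..<regs s 7} (arrs s 13)" using treeP_rtree[OF T] .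
 have below: "near s (Suc i) (arrs s 13 i) a" if s: "sub a (arrs s 13 i)"
 proof (cases "a = arrs s 13 i")
  case False
  obtain c where c: "sub a c" "c \<noteq> rt" "arrs s 11 c = arrs s 13 i" using child_towards[OF s False] by blast
  have "c \<in> Vof s" using sub_V[OF c(1)] aV by simp
  then obtain j where j: "c = arrs s 13 j" "j < regs s 7" "0 < j" using c treeP_rt[OF T] by auto
  obtain p where p: "p < j" "arrs s 11 (arrs s 13 j) = arrs s 13 p" using treeP_par[OF T j(3,2)] by blast
  then have "arrs s 13 p = arrs s 13 i" using c(3) j(1) by simp
  then have "p = i" using treeP_inj[OF T, of p i] p j i by simp
  then show ?thesis unfolding near_def using j p c by (intro disjI2 exI[of _ j]) simp
 qed (simp add: near_def)
 assume n: "near s i v a"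
 show ?thesis
 proof (cases "near s (Suc i) v a")
  case False
  then obtain j where j: "i \<le> j" "0 < j" "j < regs s 7" "arrs s 11 (arrs s 13 j) = v" "sub a (arrs s 13 j)" "a \<noteq> v"
   using n unfolding near_def by blast
  then have "\<not> Suc i \<le> j" using False unfolding near_def by blast
  then have "j = i" using j by simp
  then show ?thesis using j below by blast
 qed simp
qed

lemma ledge_V: "ledge (live s) a b e ==> a \<in> Vof s \<and> b \<in> Vof s"
 by (auto simp: ledge_def live_def)

text \<open>If the child improves on the minimum of the parent, the value is below the number of the
  parent and hence below that of the child, so the child has a witness. Its near end is below the
  parent as well.\<close>

lemma low_step:
 assumes T: "tree_of s" and N: "nums_ok s (arrs s 18) (arrs s 19)" and i: "0 < i" "i < regs s 7"
  and L: "low_ok s (Suc i) lo le"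
 shows "low_ok s i (if lo (arrs s 13 i) < lo (arrs s 11 (arrs s 13 i)) then lo(arrs s 11 (arrs s 13 i) := lo (arrs s 13 i)) else lo)
  (if lo (arrs s 13 i) < lo (arrs s 11 (arrs s 13 i)) then le(arrs s 11 (arrs s 13 i) := le (arrs s 13 i)) else le)"
  (is "low_ok s i ?lo ?le")
proof -
 let ?v = "arrs s 13 i" and ?p = "arrs s 11 (arrs s 13 i)"
 obtain p where p: "p < i" "?p = arrs s 13 p" using treeP_par[OF T i] by blast
 have V: "?v \<in> Vof s" "?p \<in> Vof s" using i p by auto
 have nr: "?v \<noteq> rt" using treeP_rt[OF T i(2)] i by simp
 have pn: "p < regs s 7" using p i by simp
 have pre: "arrs s 19 ?p < arrs s 19 ?v" using N i p(2) pn unfolding nums_ok_def by metis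
 have L1: "lo v \<le> arrs s 19 v"
  "lo v < arrs s 19 v ==> \<exists>a b. ledge (live s) a b (le v) \<and> anc rt (arrs s 11) a v \<and> arrs s 19 b = lo v"
  "\<And>a b e. ledge (live s) a b e ==> near s (Suc i) v a ==> lo v \<le> arrs s 19 b" if "v \<in> Vof s" for v
  using L that unfolding low_ok_def by blast+
 have le1: "?lo v \<le> lo v" for v by auto
 have lep: "?lo ?p \<le> lo ?v" by auto
 show ?thesis unfolding low_ok_def
 proof (intro ballI conjI impI allI)
  fix v assume v: "v \<in> Vof s"
  show "?lo v \<le> arrs s 19 v" using le1[of v] L1(1)[OF v] by linarith
  show "\<exists>a b. ledge (live s) a b (?le v) \<and> anc rt (arrs s 11) a v \<and> arrs s 19 b = ?lo v" if lt: "?lo v < arrs s 19 v"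
  proof (cases "lo ?v < lo ?p \<and> v = ?p")
   case True
   then have "lo ?v < arrs s 19 ?v" using L1(1)[OF V(2)] pre by linarith
   then obtain a b where ab: "ledge (live s) a b (le ?v)" "anc rt (arrs s 11) a ?v" "arrs s 19 b = lo ?v"
    using L1(2)[OF V(1)] by blast
   then have "anc rt (arrs s 11) a ?p" using anc_par nr by blast
   then show ?thesis using ab True by (intro exI[of _ a] exI[of _ b]) auto
  next
   case False
   then have "?lo v = lo v" "?le v = le v" by auto
   then show ?thesis using L1(2)[OF v] lt by simp
  qed
  fix a b e assume e: "ledge (live s) a b e" and n: "near s i v a"
  from near_step[OF T i _ n] ledge_V[OF e]
  have "near s (Suc i) v a \<or> v = ?p \<and> near s (Suc i) ?v a" by blast
  then show "?lo v \<le> arrs s 19 b"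
  proof
   assume "near s (Suc i) v a"
   from L1(3)[OF v e this] le1[of v] show ?thesis by linarith
  next
   assume "v = ?p \<and> near s (Suc i) ?v a"
   then have "lo ?v \<le> arrs s 19 b" "v = ?p" using L1(3)[OF V(1) e] by blast+
   then show ?thesis using lep by simp
  qed
 qed
qed

text \<open>As for the minima, using that the interval of the child ends no later than that of the
  parent.\<close>

lemma high_step:
 assumes T: "tree_of s" and N: "nums_ok s (arrs s 18) (arrs s 19)" and i: "0 < i" "i < regs s 7"
  and L: "high_ok s (Suc i) lo le"
 shows "high_ok s i (if lo (arrs s 11 (arrs s 13 i)) < lo (arrs s 13 i) then lo(arrs s 11 (arrs s 13 i) := lo (arrs s 13 i)) else lo)
  (if lo (arrs s 11 (arrs s 13 i)) < lo (arrs s 13 i) then le(arrs s 11 (arrs s 13 i) := le (arrs s 13 i)) else le)"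
  (is "high_ok s i ?lo ?le")
proof -
 let ?v = "arrs s 13 i" and ?p = "arrs s 11 (arrs s 13 i)"
 obtain p where p: "p < i" "?p = arrs s 13 p" using treeP_par[OF T i] by blast
 have V: "?v \<in> Vof s" "?p \<in> Vof s" using i p by auto
 have nr: "?v \<noteq> rt" using treeP_rt[OF T i(2)] i by simp
 have pn: "p < regs s 7" using p i by simp
 have pre: "arrs s 19 ?v + arrs s 18 ?v \<le> arrs s 19 ?p + arrs s 18 ?p"
  using N i p(2) pn unfolding nums_ok_def by metis
 have L1: "arrs s 19 v + arrs s 18 v \<le> lo v ==> \<exists>a b. ledge (live s) a b (le v) \<and> anc rt (arrs s 11) a v \<and> arrs s 19 b = lo v"
  "\<And>a b e. ledge (live s) a b e ==> near s (Suc i) v a ==> arrs s 19 b \<le> lo v" if "v \<in> Vof s" for v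
  using L that unfolding high_ok_def by blast+
 have le1: "lo v \<le> ?lo v" for v by auto
 have lep: "lo ?v \<le> ?lo ?p" by auto
 show ?thesis unfolding high_ok_def
 proof (intro ballI conjI impI allI)
  fix v assume v: "v \<in> Vof s"
  show "\<exists>a b. ledge (live s) a b (?le v) \<and> anc rt (arrs s 11) a v \<and> arrs s 19 b = ?lo v" if lt: "arrs s 19 v + arrs s 18 v \<le> ?lo v"
  proof (cases "lo ?p < lo ?v \<and> v = ?p")
   case True
   then have "arrs s 19 ?p + arrs s 18 ?p \<le> lo ?v" using lt by simp
   then have "arrs s 19 ?v + arrs s 18 ?v \<le> lo ?v" using pre by linarith
   then obtain a b where ab: "ledge (live s) a b (le ?v)" "anc rt (arrs s 11) a ?v" "arrs s 19 b = lo ?v"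
    using L1(1)[OF V(1)] by blast
   then have "anc rt (arrs s 11) a ?p" using anc_par nr by blast
   then show ?thesis using ab True by (intro exI[of _ a] exI[of _ b]) auto
  next
   case False
   then have "?lo v = lo v" "?le v = le v" by auto
   then show ?thesis using L1(1)[OF v] lt by simp
  qed
  fix a b e assume e: "ledge (live s) a b e" and n: "near s i v a"
  from near_step[OF T i _ n] ledge_V[OF e]
  have "near s (Suc i) v a \<or> v = ?p \<and> near s (Suc i) ?v a" by blast
  then show "arrs s 19 b \<le> ?lo v"
  proof
   assume "near s (Suc i) v a"
   from L1(2)[OF v e this] le1[of v] show ?thesis by linarith
  next
   assume "v = ?p \<and> near s (Suc i) ?v a"
   then have "arrs s 19 b \<le> lo ?v" "v = ?p" using L1(2)[OF V(1) e] by blast+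
   then show ?thesis using lep by simp
  qed
 qed
qed

text \<open>Equivalently, the tree path between the ends of \<open>e\<close> uses the edge from
  \<open>c\<close> to its parent, so \<open>e\<close> can replace that edge.\<close>

definition covers :: "state \<Rightarrow> nat \<Rightarrow> nat \<Rightarrow> bool" where
 "covers s c e \<longleftrightarrow> (\<exists>a b. ledge (live s) a b e \<and> anc rt (arrs s 11) a c \<and> \<not> anc rt (arrs s 11) b c)"

definition cov_ok :: "state \<Rightarrow> state \<Rightarrow> bool" where
 "cov_ok s s' \<longleftrightarrow> (\<forall>c\<in>Vof s. (arrs s' 21 c < arrs s 19 c --> covers s c (arrs s' 23 c)) \<and>
   (arrs s 19 c + arrs s 18 c \<le> arrs s' 22 c --> covers s c (arrs s' 24 c)) \<and>
   (\<forall>e. covers s c e --> arrs s' 21 c < arrs s 19 c \<or> arrs s 19 c + arrs s 18 c \<le> arrs s' 22 c))"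

text \<open>At index 1 everything below a vertex has been folded into it, so the extremes speak
  about the whole subtree, and \<open>sub_iff\<close> translates a number outside the interval into
  an end outside the subtree.\<close>

lemma push_ranges:
 assumes T: "tree_of s" and stt: "static s" and S: "sizes_ok s (arrs s 18)" and N: "nums_ok s (arrs s 18) (arrs s 19)"
  and R: "rng (Vof s) (arrs s 19) {(a, b, e). ledge (live s) a b e} s"
 shows "tr W push_ranges s (16 * n + 2) (cov_ok s)"
proof -
 have cn: "0 < regs s 7" "regs s 7 \<le> n" using treeP_cnt[OF T] by auto
 let ?b = "Load 8 13 6 ;; Load 24 11 8 ;; Load 9 21 8 ;; Load 15 21 24 ;;
    If (Less 9 15) (Store 21 24 9 ;; Load 15 23 8 ;; Store 23 24 15) Skip ;;
    Load 9 22 8 ;; Load 15 22 24 ;;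
    If (Less 15 9) (Store 22 24 9 ;; Load 15 24 8 ;; Store 24 24 15) Skip"
 let ?O = "arrs s 13" and ?n = "regs s 7"
 define I where "I i s' \<longleftrightarrow> low_ok s i (arrs s' 21) (arrs s' 23) \<and> high_ok s i (arrs s' 22) (arrs s' 24)" for i and s' :: state
 have "tr W (Move 6 7 ;; for_down 6 1 ?b) s (1 + (n * (14 + 2) + 1)) (\<lambda>s'. I 1 s' \<and> regs s' 6 = 1)"
 proof (rule tr_seq)
  show "tr W (Move 6 7) s 1 (\<lambda>s1. s1 = set_reg 6 ?n s)" by (intro tr_wp) simp_all
  fix s1 assume s1: "s1 = set_reg 6 ?n s"
  show "tr W (for_down 6 1 ?b) s1 (n * (14 + 2) + 1) (\<lambda>s'. I 1 s' \<and> regs s' 6 = 1)"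
  proof (rule tr_for_down[where T = 14])
   have near: "near s ?n v a \<longleftrightarrow> a = v" for v a by (auto simp: near_def)
   have Rv: "arrs s 21 v \<le> arrs s 19 v" "arrs s 19 v \<le> arrs s 22 v"
    "arrs s 21 v < arrs s 19 v ==> \<exists>b. ledge (live s) v b (arrs s 23 v) \<and> arrs s 19 b = arrs s 21 v"
    "arrs s 19 v < arrs s 22 v ==> \<exists>b. ledge (live s) v b (arrs s 24 v) \<and> arrs s 19 b = arrs s 22 v"
    "\<And>b e. ledge (live s) v b e ==> arrs s 21 v \<le> arrs s 19 b \<and> arrs s 19 b \<le> arrs s 22 v" if "v \<in> Vof s" for v
    using R that unfolding rng_def by blast+
   have sz1: "1 \<le> arrs s 18 v" if "v \<in> Vof s" for v using S that by (auto simp: sizes_ok_def)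
   have "low_ok s ?n (arrs s 21) (arrs s 23)" unfolding low_ok_def near
   proof (intro ballI conjI impI allI)
    fix v assume v: "v \<in> Vof s"
    show "arrs s 21 v \<le> arrs s 19 v" using Rv(1)[OF v] .
    show "\<exists>a b. ledge (live s) a b (arrs s 23 v) \<and> anc rt (arrs s 11) a v \<and> arrs s 19 b = arrs s 21 v"
     if "arrs s 21 v < arrs s 19 v"
     using Rv(3)[OF v that] anc_refl by blast
    show "arrs s 21 v \<le> arrs s 19 b" if "ledge (live s) a b e" "a = v" for a b e
     using Rv(5)[OF v, of b e] that by simp
   qed
   moreover have "high_ok s ?n (arrs s 22) (arrs s 24)" unfolding high_ok_def near
   proof (intro ballI conjI impI allI)
    fix v assume v: "v \<in> Vof s" and "arrs s 19 v + arrs s 18 v \<le> arrs s 22 v"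
    then have "arrs s 19 v < arrs s 22 v" using sz1[OF v] by linarith
    then show "\<exists>a b. ledge (live s) a b (arrs s 24 v) \<and> anc rt (arrs s 11) a v \<and> arrs s 19 b = arrs s 22 v"
     using Rv(4)[OF v] anc_refl by blast
   next
    fix v a b e assume v: "v \<in> Vof s" and "ledge (live s) a b e" "a = v"
    then show "arrs s 19 b \<le> arrs s 22 v" using Rv(5)[OF v, of b e] by simp
   qed
   ultimately show "I (regs s1 6) s1" unfolding I_def s1 by simp
  next
   fix i s' assume J: "I (Suc i) s'" and i: "1 \<le> i" "i < regs s1 6" "regs s' 6 = i" and f: "frame (for_down 6 1 ?b) s1 s'"
   have st': "static s'" using static_frame[OF _ f] stt s1 by simp
   have e: "arrs s' 13 = ?O" "arrs s' 11 = arrs s 11" using frame_arrs[OF f] s1 by simp_all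
   have i1: "0 < i" "i < ?n" using i s1 by auto
   note low = low_step[OF T N i1, of "arrs s' 21" "arrs s' 23"]
   note high = high_step[OF T N i1, of "arrs s' 22" "arrs s' 24"]
   let ?v = "?O i" and ?p = "arrs s 11 (?O i)"
   have 1: "I i s''"
    if "arrs s'' 21 = (if arrs s' 21 ?v < arrs s' 21 ?p then (arrs s' 21)(?p := arrs s' 21 ?v) else arrs s' 21)"
     "arrs s'' 23 = (if arrs s' 21 ?v < arrs s' 21 ?p then (arrs s' 23)(?p := arrs s' 23 ?v) else arrs s' 23)"
     "arrs s'' 22 = (if arrs s' 22 ?p < arrs s' 22 ?v then (arrs s' 22)(?p := arrs s' 22 ?v) else arrs s' 22)"
     "arrs s'' 24 = (if arrs s' 22 ?p < arrs s' 22 ?v then (arrs s' 24)(?p := arrs s' 24 ?v) else arrs s' 24)" for s''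
    unfolding I_def that using low high J unfolding I_def by blast
   show "tr W ?b s' 14 (I i)"
    by (rule tr_wp) (use 1 in \<open>simp_all add: staticD[OF st'] i(3) e\<close>)
  qed (use stt s1 cn in \<open>auto simp: staticD I_def\<close>)
 qed
 then show ?thesis unfolding push_ranges_def
 proof (rule tr_cons)
  fix s' assume "I 1 s' \<and> regs s' 6 = 1"
  then have L: "low_ok s 1 (arrs s' 21) (arrs s' 23)" and H: "high_ok s 1 (arrs s' 22) (arrs s' 24)" by (auto simp: I_def)
  interpret rtree "Vof s" rt "arrs s 11" "inv_into {..<regs s 7} (arrs s 13)" using treeP_rtree[OF T] .
  have near: "near s 1 c a" if sc: "sub a c" and aV: "a \<in> Vof s" for a c
  proof (cases "a = c")
   case False
   obtain d where d: "sub a d" "d \<noteq> rt" "arrs s 11 d = c" using child_towards[OF sc False] by blast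
   have "d \<in> Vof s" using sub_V[OF d(1)] aV by simp
   then obtain j where "d = arrs s 13 j" "j < regs s 7" "0 < j" using d treeP_rt[OF T] by auto
   then show ?thesis unfolding near_def using d by (intro disjI2 exI[of _ j]) simp
  qed (simp add: near_def)
  note sub_iff = sub_iff[OF T S N]
  show "cov_ok s s'" unfolding cov_ok_def
  proof (intro ballI conjI impI allI)
   fix c assume c: "c \<in> Vof s"
   show "covers s c (arrs s' 23 c)" if lt: "arrs s' 21 c < arrs s 19 c"
   proof -
    obtain a b where ab: "ledge (live s) a b (arrs s' 23 c)" "sub a c" "arrs s 19 b = arrs s' 21 c"
     using L c lt unfolding low_ok_def by blast
    then have "\<not> sub b c" using sub_iff[of b c] ledge_V[OF ab(1)] c lt by simp
    then show ?thesis using ab unfolding covers_def by blast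
   qed
   show "covers s c (arrs s' 24 c)" if lt: "arrs s 19 c + arrs s 18 c \<le> arrs s' 22 c"
   proof -
    obtain a b where ab: "ledge (live s) a b (arrs s' 24 c)" "sub a c" "arrs s 19 b = arrs s' 22 c"
     using H c lt unfolding high_ok_def by blast
    then have "\<not> sub b c" using sub_iff[of b c] ledge_V[OF ab(1)] c lt by simp
    then show ?thesis using ab unfolding covers_def by blast
   qed
   fix e assume "covers s c e"
   then obtain a b where ab: "ledge (live s) a b e" "sub a c" "\<not> sub b c" unfolding covers_def by blast
   have V: "a \<in> Vof s" "b \<in> Vof s" using ledge_V[OF ab(1)] by auto
   have "arrs s' 21 c \<le> arrs s 19 b" "arrs s 19 b \<le> arrs s' 22 c"
    using L H c ab(1) near[OF ab(2) V(1)] unfolding low_ok_def high_ok_def by blast+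
   moreover have "arrs s 19 b < arrs s 19 c \<or> arrs s 19 c + arrs s 18 c \<le> arrs s 19 b"
    using sub_iff[OF V(2) c] ab(3) by linarith
   ultimately show "arrs s' 21 c < arrs s 19 c \<or> arrs s 19 c + arrs s 18 c \<le> arrs s' 22 c" by linarith
  qed
 qed simp
qed

end

section \<open>Freeing blocked vertices and recording their replacements\<close>

definition free_vertices :: com where
 "free_vertices = (Const 21 0 ;; Const 28 0 ;; Move 6 1) ;;
   for_up 6 7 (Load 8 13 6 ;; Load 24 11 8 ;; Load 9 14 24 ;;
    If (Equal 9 0) Skip
    (Load 9 21 8 ;; Load 15 19 8 ;; Const 13 0 ;;
     If (Less 9 15) (Load 12 23 8 ;; Const 13 1)
      (Load 9 22 8 ;; Load 14 18 8 ;; Add 15 15 14 ;;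
      If (LessEq 15 9) (Load 12 24 8 ;; Const 13 1) Skip) ;;
     If (Equal 13 0) Skip
      (Store 14 24 0 ;; Store 25 24 12 ;; Store 26 24 8 ;; Store 16 19 24 ;;
      Add 19 19 1 ;; Add 21 21 1 ;; Load 9 17 24 ;;
      If (Equal 9 17) (Move 23 24 ;; Const 28 1) Skip)))"

lemma wr_free [simp]:
 "wr free_vertices = {6,8,9,12,13,14,15,19,21,23,24,28}" "wa free_vertices = {14,16,25,26}"
 by (auto simp: free_vertices_def)

context graph
begin

text \<open>Everything refers to the state before the pass: a vertex freed in it does not make
  further edges usable until the next round. So the vertices freed together can share one
  rank.\<close>

definition freed :: "state \<Rightarrow> nat \<Rightarrow> nat set" where
 "freed s i = {w. arrs s 14 w \<noteq> 0 \<and> (\<exists>j. 0 < j \<and> j < i \<and> arrs s 11 (arrs s 13 j) = w \<and> (\<exists>e. covers s (arrs s 13 j) e))}"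

definition free_inv :: "state \<Rightarrow> nat \<Rightarrow> state \<Rightarrow> bool" where
 "free_inv s i s' \<longleftrightarrow>
   (\<forall>v. arrs s' 14 v = (if v \<in> freed s i then 0 else arrs s 14 v)) \<and>
   (\<forall>w. if w \<in> freed s i then arrs s' 26 w \<in> arrs s 13 ` {0<..<i} \<and> arrs s 11 (arrs s' 26 w) = w \<and> covers s (arrs s' 26 w) (arrs s' 25 w)
    else arrs s' 26 w = arrs s 26 w \<and> arrs s' 25 w = arrs s 25 w) \<and>
   regs s' 21 = card (freed s i) \<and> regs s' 19 = regs s 19 + card (freed s i) \<and>
   (\<forall>j<regs s 19. arrs s' 16 j = arrs s 16 j) \<and>
   arrs s' 16 ` {regs s 19..<regs s' 19} = freed s i \<and> inj_on (arrs s' 16) {regs s 19..<regs s' 19} \<and>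
   (if regs s' 28 = 0 then \<forall>w\<in>freed s i. arrs s 17 w \<noteq> regs s 17
   else regs s' 23 \<in> freed s i \<and> arrs s 17 (regs s' 23) = regs s 17)"

lemma freed_V: "tree_of s ==> i \<le> regs s 7 ==> freed s i \<subseteq> Vof s"
proof
 fix w assume T: "tree_of s" and i: "i \<le> regs s 7" and "w \<in> freed s i"
 then obtain j where j: "0 < j" "j < i" "arrs s 11 (arrs s 13 j) = w" by (auto simp: freed_def)
 then obtain p where "p < j" "arrs s 11 (arrs s 13 j) = arrs s 13 p" using treeP_par[OF T, of j] i by auto
 then show "w \<in> Vof s" using j i by auto
qed

lemma freed_Suc: "0 < i ==> freed s (Suc i) =
  (if arrs s 14 (arrs s 11 (arrs s 13 i)) \<noteq> 0 \<and> (\<exists>e. covers s (arrs s 13 i) e)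
  then insert (arrs s 11 (arrs s 13 i)) (freed s i) else freed s i)"
 unfolding freed_def by (auto simp: less_Suc_eq)

lemma free_inv_mono: "free_inv s i s' ==> freed s (Suc i) = freed s i ==>
 arrs s'' = arrs s' ==> regs s'' 19 = regs s' 19 ==> regs s'' 21 = regs s' 21 ==> regs s'' 23 = regs s' 23 ==>
 regs s'' 28 = regs s' 28 ==> free_inv s (Suc i) s''"
 unfolding free_inv_def
proof (elim conjE, intro conjI)
 assume f: "freed s (Suc i) = freed s i" and a: "arrs s'' = arrs s'"
  and w: "\<forall>w. if w \<in> freed s i then arrs s' 26 w \<in> arrs s 13 ` {0<..<i} \<and> arrs s 11 (arrs s' 26 w) = w \<and> covers s (arrs s' 26 w) (arrs s' 25 w)
    else arrs s' 26 w = arrs s 26 w \<and> arrs s' 25 w = arrs s 25 w"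
 have "{0<..<i} \<subseteq> {0<..<Suc i}" by auto
 then have sub: "arrs s 13 ` {0<..<i} \<subseteq> arrs s 13 ` {0<..<Suc i}" by (rule image_mono)
 show "\<forall>w. if w \<in> freed s (Suc i) then arrs s'' 26 w \<in> arrs s 13 ` {0<..<Suc i} \<and> arrs s 11 (arrs s'' 26 w) = w \<and> covers s (arrs s'' 26 w) (arrs s'' 25 w)
    else arrs s'' 26 w = arrs s 26 w \<and> arrs s'' 25 w = arrs s 25 w"
  unfolding f a
 proof
  fix u
  show "if u \<in> freed s i then arrs s' 26 u \<in> arrs s 13 ` {0<..<Suc i} \<and> arrs s 11 (arrs s' 26 u) = u \<and> covers s (arrs s' 26 u) (arrs s' 25 u)
    else arrs s' 26 u = arrs s 26 u \<and> arrs s' 25 u = arrs s 25 u"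
  proof (cases "u \<in> freed s i")
   case True
   have "arrs s' 26 u \<in> arrs s 13 ` {0<..<i} \<and> arrs s 11 (arrs s' 26 u) = u \<and> covers s (arrs s' 26 u) (arrs s' 25 u)"
    using spec[OF w, of u] True by (simp only: if_True)
   then show ?thesis using True sub by (simp only: if_True) blast
  next
   case False
   then show ?thesis using spec[OF w, of u] by (simp only: if_False)
  qed
 qed
qed simp_all

lemma free_inv_add:
 assumes I: "free_inv s i s'" and fS: "freed s (Suc i) = insert w (freed s i)" and nw: "w \<notin> freed s i"
  and fin: "finite (freed s i)"
  and c: "0 < i" "arrs s 11 (arrs s 13 i) = w" "covers s (arrs s 13 i) e"
  and a: "arrs s'' 14 = (arrs s' 14)(w := 0)" "arrs s'' 25 = (arrs s' 25)(w := e)" "arrs s'' 26 = (arrs s' 26)(w := arrs s 13 i)"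
   "arrs s'' 16 = (arrs s' 16)(regs s' 19 := w)"
  and r: "regs s'' 19 = Suc (regs s' 19)" "regs s'' 21 = Suc (regs s' 21)"
  and k: "arrs s 17 w = regs s 17 \<and> regs s'' 23 = w \<and> regs s'' 28 = 1 \<or>
    arrs s 17 w \<noteq> regs s 17 \<and> regs s'' 23 = regs s' 23 \<and> regs s'' 28 = regs s' 28"
 shows "free_inv s (Suc i) s''"
proof -
 have I1: "\<And>v. arrs s' 14 v = (if v \<in> freed s i then 0 else arrs s 14 v)"
  and ww: "\<forall>w. if w \<in> freed s i then arrs s' 26 w \<in> arrs s 13 ` {0<..<i} \<and> arrs s 11 (arrs s' 26 w) = w \<and> covers s (arrs s' 26 w) (arrs s' 25 w)
    else arrs s' 26 w = arrs s 26 w \<and> arrs s' 25 w = arrs s 25 w"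
  and I4: "regs s' 21 = card (freed s i)" "regs s' 19 = regs s 19 + card (freed s i)"
  and I5: "\<And>j. j < regs s 19 ==> arrs s' 16 j = arrs s 16 j"
  and I6: "arrs s' 16 ` {regs s 19..<regs s' 19} = freed s i" "inj_on (arrs s' 16) {regs s 19..<regs s' 19}"
  and I7: "if regs s' 28 = 0 then \<forall>w\<in>freed s i. arrs s 17 w \<noteq> regs s 17
   else regs s' 23 \<in> freed s i \<and> arrs s 17 (regs s' 23) = regs s 17"
  using I unfolding free_inv_def by blast+
 have I2: "arrs s' 26 u \<in> arrs s 13 ` {0<..<i} \<and> arrs s 11 (arrs s' 26 u) = u \<and> covers s (arrs s' 26 u) (arrs s' 25 u)"
  if "u \<in> freed s i" for u using spec[OF ww, of u] that by (simp only: if_True)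
 have I3: "arrs s' 26 u = arrs s 26 u \<and> arrs s' 25 u = arrs s 25 u" if "u \<notin> freed s i" for u
  using spec[OF ww, of u] that by (simp only: if_False)
 have cd: "card (insert w (freed s i)) = Suc (card (freed s i))" using nw fin by simp
 let ?T = "(arrs s' 16)(regs s' 19 := w)"
 have iv: "{regs s 19..<Suc (regs s' 19)} = insert (regs s' 19) {regs s 19..<regs s' 19}" using I4 by auto
 have Te: "?T ` {regs s 19..<regs s' 19} = arrs s' 16 ` {regs s 19..<regs s' 19}" by (rule image_cong) auto
 have Ti: "inj_on ?T {regs s 19..<regs s' 19}" using I6(2) by (simp add: inj_on_def)
 have i2: "arrs s 13 ` {0<..<i} \<subseteq> arrs s 13 ` {0<..<Suc i}" by (rule image_mono) auto
 show ?thesis unfolding free_inv_def fS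
 proof (intro conjI)
  show "\<forall>v. arrs s'' 14 v = (if v \<in> insert w (freed s i) then 0 else arrs s 14 v)" using I1 a by simp
  show "\<forall>w'. if w' \<in> insert w (freed s i)
    then arrs s'' 26 w' \<in> arrs s 13 ` {0<..<Suc i} \<and> arrs s 11 (arrs s'' 26 w') = w' \<and> covers s (arrs s'' 26 w') (arrs s'' 25 w')
    else arrs s'' 26 w' = arrs s 26 w' \<and> arrs s'' 25 w' = arrs s 25 w'"
  proof
   fix w'
   show "if w' \<in> insert w (freed s i)
    then arrs s'' 26 w' \<in> arrs s 13 ` {0<..<Suc i} \<and> arrs s 11 (arrs s'' 26 w') = w' \<and> covers s (arrs s'' 26 w') (arrs s'' 25 w')
    else arrs s'' 26 w' = arrs s 26 w' \<and> arrs s'' 25 w' = arrs s 25 w'"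
   proof (cases "w' = w")
    case True
    then show ?thesis using a c by simp
   next
    case False
    then show ?thesis using a I2[of w'] I3[of w'] i2 by auto
   qed
  qed
  show "arrs s'' 16 ` {regs s 19..<regs s'' 19} = insert w (freed s i)"
   unfolding a r iv image_insert Te I6(1) by simp
  show "inj_on (arrs s'' 16) {regs s 19..<regs s'' 19}"
   unfolding a r iv using Ti Te I6(1) nw by (simp add: inj_on_insert)
  show "\<forall>j<regs s 19. arrs s'' 16 j = arrs s 16 j" using I5 I4 a by simp
  show "if regs s'' 28 = 0 then \<forall>w\<in>insert w (freed s i). arrs s 17 w \<noteq> regs s 17
   else regs s'' 23 \<in> insert w (freed s i) \<and> arrs s 17 (regs s'' 23) = regs s 17"
   using I7 k by (cases "regs s' 28 = 0") auto
 qed (use I4 r cd in simp_all)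
qed

lemma free_vertices:
 assumes T: "tree_of s" and stt: "static s" and N: "nums_ok s (arrs s 18) (arrs s 19)"
  and C: "cov_ok s s" and ne: "regs s 19 \<le> n"
 shows "tr W free_vertices s (27 * n + 4) (free_inv s (regs s 7))"
proof -
 have cn: "0 < regs s 7" "regs s 7 \<le> n" using treeP_cnt[OF T] by auto
 let ?free = "Store 14 24 0 ;; Store 25 24 12 ;; Store 26 24 8 ;; Store 16 19 24 ;;
      Add 19 19 1 ;; Add 21 21 1 ;; Load 9 17 24 ;;
      If (Equal 9 17) (Move 23 24 ;; Const 28 1) Skip"
 let ?b = "Load 8 13 6 ;; Load 24 11 8 ;; Load 9 14 24 ;;
    If (Equal 9 0) Skip
    (Load 9 21 8 ;; Load 15 19 8 ;; Const 13 0 ;;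
     If (Less 9 15) (Load 12 23 8 ;; Const 13 1)
      (Load 9 22 8 ;; Load 14 18 8 ;; Add 15 15 14 ;;
      If (LessEq 15 9) (Load 12 24 8 ;; Const 13 1) Skip) ;;
     If (Equal 13 0) Skip ?free)"
 let ?O = "arrs s 13" and ?n = "regs s 7"
 have "tr W ((Const 21 0 ;; Const 28 0 ;; Move 6 1) ;; for_up 6 7 ?b) s (3 + (n * (25 + 2) + 1)) (\<lambda>s'. free_inv s ?n s' \<and> regs s' 6 = ?n)"
 proof (rule tr_seq)
  let ?s1 = "set_reg 6 1 (set_reg 28 0 (set_reg 21 0 s))"
  show "tr W (Const 21 0 ;; Const 28 0 ;; Move 6 1) s 3 (\<lambda>s1. s1 = ?s1)"
   by (intro tr_wp) (simp_all add: staticD[OF stt])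
  fix s1 assume s1: "s1 = ?s1"
  show "tr W (for_up 6 7 ?b) s1 (n * (25 + 2) + 1) (\<lambda>s'. free_inv s ?n s' \<and> regs s' 6 = ?n)"
  proof (rule tr_for_up[where T = 25 and I = "free_inv s"])
   have "freed s 1 = {}" by (auto simp: freed_def)
   then show "free_inv s (regs s1 6) s1" using s1 by (simp add: free_inv_def)
  next
   fix i s' assume J: "free_inv s i s'" and i: "regs s1 6 \<le> i" "i < ?n" "regs s' 6 = i" and f: "frame (for_up 6 7 ?b) s1 s'"
   have st': "static s'" using static_frame[OF _ f] stt s1 by simp
   have e: "arrs s' 13 = ?O" "arrs s' 11 = arrs s 11" "arrs s' 17 = arrs s 17" "arrs s' 18 = arrs s 18" "arrs s' 19 = arrs s 19"
    "arrs s' 21 = arrs s 21" "arrs s' 22 = arrs s 22" "arrs s' 23 = arrs s 23" "arrs s' 24 = arrs s 24" "regs s' 17 = regs s 17"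
    using frame_arrs[OF f] frame_regs[OF f, of 17] s1 by simp_all
   have i1: "0 < i" using i s1 by auto
   let ?c = "?O i" and ?w = "arrs s 11 (?O i)"
   have cV: "?c \<in> Vof s" using i by simp
   have fV: "freed s i \<subseteq> Vof s" using freed_V[OF T, of i] i by simp
   have fin: "finite (freed s i)" using fV finite_subset by fastforce
   have fc: "card (freed s i) \<le> n"
    using card_mono[OF _ fV] card_image_le[of "{..<?n}" ?O] cn by fastforce
   note fS = freed_Suc[OF i1, of s]
   have bl: "arrs s' 14 ?w = (if ?w \<in> freed s i then 0 else arrs s 14 ?w)" using J by (simp add: free_inv_def)
   have c19: "regs s' 19 = regs s 19 + card (freed s i)" "regs s' 21 = card (freed s i)" using J by (simp_all add: free_inv_def)
   have b: "Suc (regs s' 19) \<le> W" "Suc (regs s' 21) \<le> W" "1 \<le> W" using c19 fc ne W8 by linarith+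
   have "arrs s 19 ?c + arrs s 18 ?c \<le> ?n" using N i(2) unfolding nums_ok_def by blast
   then have b2: "arrs s 19 ?c + arrs s 18 ?c \<le> W" using cn W8 by linarith
   have cov: "arrs s 21 ?c < arrs s 19 ?c ==> covers s ?c (arrs s 23 ?c)"
    "arrs s 19 ?c + arrs s 18 ?c \<le> arrs s 22 ?c ==> covers s ?c (arrs s 24 ?c)"
    "\<not> arrs s 21 ?c < arrs s 19 ?c ==> \<not> arrs s 19 ?c + arrs s 18 ?c \<le> arrs s 22 ?c ==> \<not> (\<exists>e. covers s ?c e)"
    using C cV unfolding cov_ok_def by blast+
   define Q where "Q = free_inv s (Suc i)"
   have skip: "Q s''" if "arrs s' 14 ?w = 0 \<or> \<not> (\<exists>e. covers s ?c e)"
    "arrs s'' = arrs s'" "regs s'' 19 = regs s' 19" "regs s'' 21 = regs s' 21" "regs s'' 23 = regs s' 23" "regs s'' 28 = regs s' 28" for s''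
   proof -
    have "freed s (Suc i) = freed s i"
    proof (cases "?w \<in> freed s i")
     case True
     then show ?thesis unfolding fS by auto
    next
     case False
     then have "arrs s 14 ?w = 0 \<or> \<not> (\<exists>e. covers s ?c e)" using that(1) bl by simp
     then show ?thesis unfolding fS by auto
    qed
    then show ?thesis unfolding Q_def using free_inv_mono[OF J] that by blast
   qed
   have add: "Q s''" if "arrs s' 14 ?w \<noteq> 0" "covers s ?c e"
    "arrs s'' 14 = (arrs s' 14)(?w := 0)" "arrs s'' 25 = (arrs s' 25)(?w := e)" "arrs s'' 26 = (arrs s' 26)(?w := ?c)"
    "arrs s'' 16 = (arrs s' 16)(regs s' 19 := ?w)" "regs s'' 19 = Suc (regs s' 19)" "regs s'' 21 = Suc (regs s' 21)"
    "arrs s 17 ?w = regs s 17 \<and> regs s'' 23 = ?w \<and> regs s'' 28 = 1 \<or>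
     arrs s 17 ?w \<noteq> regs s 17 \<and> regs s'' 23 = regs s' 23 \<and> regs s'' 28 = regs s' 28" for s'' e
   proof -
    have nw: "?w \<notin> freed s i" "arrs s 14 ?w \<noteq> 0" using that(1) bl by (auto split: if_splits)
    then have "freed s (Suc i) = insert ?w (freed s i)" unfolding fS using that(2) by auto
    then show ?thesis unfolding Q_def using free_inv_add[OF J _ nw(1) fin i1 refl that(2)] that by blast
   qed
   have free: "tr W ?free s2 10 Q" if "arrs s' 14 ?w \<noteq> 0" "covers s ?c (regs s2 12)" "arrs s2 = arrs s'" "static s2"
    "regs s2 24 = ?w" "regs s2 8 = ?c" "regs s2 19 = regs s' 19" "regs s2 21 = regs s' 21" "regs s2 23 = regs s' 23"
    "regs s2 28 = regs s' 28" "regs s2 17 = regs s 17" for s2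
    by (rule tr_wp) (use add[OF that(1,2)] b in \<open>simp_all add: that(3-) staticD[OF that(4)] e\<close>)
   let ?R = "\<lambda>s2. arrs s2 = arrs s' \<and> static s2 \<and> regs s2 24 = ?w \<and> regs s2 8 = ?c \<and> regs s2 19 = regs s' 19 \<and>
     regs s2 21 = regs s' 21 \<and> regs s2 23 = regs s' 23 \<and> regs s2 28 = regs s' 28 \<and> regs s2 17 = regs s 17"
   let ?test = "Load 9 21 8 ;; Load 15 19 8 ;; Const 13 0 ;;
     If (Less 9 15) (Load 12 23 8 ;; Const 13 1)
      (Load 9 22 8 ;; Load 14 18 8 ;; Add 15 15 14 ;;
      If (LessEq 15 9) (Load 12 24 8 ;; Const 13 1) Skip)"
   let ?R2 = "\<lambda>s3. ?R s3 \<and> (if regs s3 13 = 0 then \<not> (\<exists>e. covers s ?c e) else covers s ?c (regs s3 12))"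
   have test: "tr W ?test s2 10 ?R2" if "?R s2" for s2
   proof -
    have R: "arrs s2 = arrs s'" "static s2" "regs s2 24 = ?w" "regs s2 8 = ?c" "regs s2 19 = regs s' 19"
      "regs s2 21 = regs s' 21" "regs s2 23 = regs s' 23" "regs s2 28 = regs s' 28" "regs s2 17 = regs s 17" using that by blast+
    show ?thesis by (rule tr_wp) (use cov b b2 in \<open>simp_all add: R staticD[OF R(2)] e\<close>)
   qed
   have rest: "tr W (If (Equal 13 0) Skip ?free) s3 11 Q" if R2: "?R2 s3" and n0: "arrs s' 14 ?w \<noteq> 0" for s3
   proof -
    have R: "arrs s3 = arrs s'" "static s3" "regs s3 24 = ?w" "regs s3 8 = ?c" "regs s3 19 = regs s' 19"
      "regs s3 21 = regs s' 21" "regs s3 23 = regs s' 23" "regs s3 28 = regs s' 28" "regs s3 17 = regs s 17" using R2 by blast+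
    show ?thesis
    proof (rule tr_le[OF tr_If[where T = 10]])
     assume "holds (Equal 13 0) s3"
     then have "\<not> (\<exists>e. covers s ?c e)" using R2 staticD(1)[OF R(2)] by simp
     then have "Q s3" by (intro skip) (use R in auto)
     then show "tr W Skip s3 10 Q" by (intro tr_wp) simp_all
    next
     assume "\<not> holds (Equal 13 0) s3"
     then have "covers s ?c (regs s3 12)" using R2 staticD(1)[OF R(2)] by simp
     then show "tr W ?free s3 10 Q" using free[OF n0 _ R] by simp
    qed simp
   qed
   have all: "tr W (?test ;; If (Equal 13 0) Skip ?free) s2 (10 + 11) Q" if "?R s2" "arrs s' 14 ?w \<noteq> 0" for s2
    by (rule tr_seq[OF test[OF that(1)]]) (use rest[OF _ that(2)] in blast)
   \<comment> \<open>Sequencing nests to the right, while \<open>?test\<close> is specified as one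
     block; regrouping changes neither result nor time.\<close>
   have assoc: "tr W ((a1 ;; a2 ;; a3 ;; a4) ;; a5) s2 T0 Q' ==> tr W (a1 ;; a2 ;; a3 ;; a4 ;; a5) s2 T0 Q'" for a1 a2 a3 a4 a5 s2 T0 Q'
   proof -
    assume "tr W ((a1 ;; a2 ;; a3 ;; a4) ;; a5) s2 T0 Q'"
    then obtain t s3 where x: "exec W ((a1 ;; a2 ;; a3 ;; a4) ;; a5) s2 t s3" "t \<le> T0" "Q' s3" unfolding tr_def by blast
    then obtain t1 t2 t3 t4 t5 u1 u2 u3 u4 where y: "exec W a1 s2 t1 u1" "exec W a2 u1 t2 u2" "exec W a3 u2 t3 u3"
     "exec W a4 u3 t4 u4" "exec W a5 u4 t5 s3" "t = t1 + (t2 + (t3 + t4)) + t5" by (auto elim!: exec.cases[of _ "Seq _ _"])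
    then have "exec W (a1 ;; a2 ;; a3 ;; a4 ;; a5) s2 (t1 + (t2 + (t3 + (t4 + t5)))) s3" by (intro exec.Seq)
    then show ?thesis unfolding tr_def using x y(6) by (metis add.assoc)
   qed
   let ?pre = "Load 8 13 6 ;; Load 24 11 8 ;; Load 9 14 24"
   let ?if = "If (Equal 9 0) Skip (Load 9 21 8 ;; Load 15 19 8 ;; Const 13 0 ;;
     If (Less 9 15) (Load 12 23 8 ;; Const 13 1)
      (Load 9 22 8 ;; Load 14 18 8 ;; Add 15 15 14 ;;
      If (LessEq 15 9) (Load 12 24 8 ;; Const 13 1) Skip) ;;
     If (Equal 13 0) Skip ?free)"
   have if_ok: "tr W ?if s2 22 Q" if R: "?R s2" and r9: "regs s2 9 = arrs s' 14 ?w" for s2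
   proof (rule tr_le[OF tr_If[where T = 21]])
    have z: "regs s2 0 = 0" using R staticD(1) by blast
    assume "holds (Equal 9 0) s2"
    then have "arrs s' 14 ?w = 0" using z r9 by simp
    then have "Q s2" by (intro skip) (use R in auto)
    then show "tr W Skip s2 21 Q" by (intro tr_wp) simp_all
   next
    have z: "regs s2 0 = 0" using R staticD(1) by blast
    assume "\<not> holds (Equal 9 0) s2"
    then have n0: "arrs s' 14 ?w \<noteq> 0" using z r9 by simp
    show "tr W (Load 9 21 8 ;; Load 15 19 8 ;; Const 13 0 ;;
     If (Less 9 15) (Load 12 23 8 ;; Const 13 1)
      (Load 9 22 8 ;; Load 14 18 8 ;; Add 15 15 14 ;;
      If (LessEq 15 9) (Load 12 24 8 ;; Const 13 1) Skip) ;;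
     If (Equal 13 0) Skip ?free) s2 21 Q"
     using assoc[OF all[OF R n0]] by simp
   qed simp
   let ?P = "\<lambda>s2. ?R s2 \<and> regs s2 9 = arrs s' 14 ?w"
   have a8: "tr W (Load 8 13 6) s' 1 (\<lambda>s2. s2 = set_reg 8 ?c s')" by (intro tr_wp) (simp_all add: i(3) e)
   have a24: "tr W (Load 24 11 8) s2 1 (\<lambda>s2. s2 = set_reg 24 ?w (set_reg 8 ?c s'))" if "s2 = set_reg 8 ?c s'" for s2
    using that by (intro tr_wp) (simp_all add: e)
   have a9: "tr W (Load 9 14 24) s2 1 ?P" if "s2 = set_reg 24 ?w (set_reg 8 ?c s')" for s2
    using that st' by (intro tr_wp) (simp_all add: e)
   have "tr W (Load 9 14 24 ;; ?if) s2 (1 + 22) Q" if "s2 = set_reg 24 ?w (set_reg 8 ?c s')" for s2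
    by (rule tr_seq[OF a9[OF that]]) (use if_ok in blast)
   then have "tr W (Load 24 11 8 ;; Load 9 14 24 ;; ?if) s2 (1 + (1 + 22)) Q" if "s2 = set_reg 8 ?c s'" for s2
    by (intro tr_seq[OF a24[OF that]]) blast
   then have "tr W ?b s' (1 + (1 + (1 + 22))) Q"
    by (intro tr_seq[OF a8]) blast
   then show "tr W ?b s' 25 (free_inv s (Suc i))" unfolding Q_def by simp
  qed (use stt s1 cn W in \<open>auto simp: staticD free_inv_def\<close>)
 qed
 then show ?thesis unfolding free_vertices_def by (rule tr_cons) auto
qed

end

section \<open>How absorbing and freeing extend the record of replacements; carrying out an
  improvement\<close>

section \<open>Improving the tree\<close>

text \<open>Old vertices keep their parents, so the ancestor relation on them is unchanged, and with
  it the recorded replacements. The new ranks start at \<open>\<tau>\<close>, above all live ones,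
  and grow away from the root, as \<open>absorbed\<close> requires.\<close>

lemma improvement_absorb:
 assumes I: "improvement V rt par pos C L F rk m eu ev pe ce cc"
  and R: "rtree V' rt par' pos'" and VV: "V \<subseteq> V'"
  and ag: "\<And>v. v \<in> V ==> v \<noteq> rt ==> par' v = par v \<and> pe' v = pe v"
  and pe': "\<And>v. v \<in> V' ==> v \<noteq> rt ==>
   pe' v < m \<and> (eu (pe' v) = v \<and> ev (pe' v) = par' v \<or> eu (pe' v) = par' v \<and> ev (pe' v) = v)"
  and L': "L' = L \<union> (V' - V)" and rk': "\<And>v. rk' v = (if v \<in> V then rk v else \<tau> + f v)"
  and lt: "\<And>v. v \<in> L ==> rk v < \<tau>"
  and new: "\<And>v. v \<in> V' ==> v \<notin> V ==> par' v \<in> L' \<and> (par' v \<notin> V --> f (par' v) < f v)"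
 shows "improvement V' rt par' pos' C L' F rk' m eu ev pe' ce cc"
proof -
 interpret improvement V rt par pos C L F rk m eu ev pe ce cc by (rule I)
 have anc_eq: "anc rt par' v x \<longleftrightarrow> anc rt par v x" if "v \<in> V" for v x
  using that
 proof (induction "pos v" arbitrary: v rule: less_induct)
  case (less v)
  show ?case
  proof (cases "v = rt")
   case True
   then show ?thesis using anc_step[of rt par' v x] anc_step[of rt par v x] by simp
  next
   case False
   then have "par v \<in> V" "pos (par v) < pos v" using parV pos_par less.prems by auto
   then have "anc rt par' (par v) x \<longleftrightarrow> anc rt par (par v) x" using less.hyps by simp
   then show ?thesis using anc_step[of rt par' v x] anc_step[of rt par v x] ag[OF less.prems False] by simp
  qed
 qed
 have Lrk: "rk' v = rk v" if "v \<in> L" for v using rk' that LV by auto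
 have FL: "w \<in> L" if "w \<in> F" for w using FC that by auto
 show ?thesis
 proof (intro improvement.intro improvement_axioms.intro R)
  show "C \<subseteq> V'" "F \<subseteq> C" "rt \<in> C" using CV VV FC rootC by auto
  show "L' \<subseteq> V'" "F \<subseteq> L'" using LV VV L' FC by auto
  show "par' v \<in> C" if "v \<in> C" "v \<noteq> rt" for v using parC[OF that] ag that CV by auto
  show "pe' v < m \<and> (eu (pe' v) = v \<and> ev (pe' v) = par' v \<or> eu (pe' v) = par' v \<and> ev (pe' v) = v)"
   if "v \<in> V'" "v \<noteq> rt" for v using pe' that .
  show "v \<in> L' \<and> par' v \<in> L' \<and> rk' (par' v) < rk' v" if v: "v \<in> V'" "v \<notin> C" for v
  proof (cases "v \<in> V")
   case True
   have "v \<noteq> rt" using v rootC by auto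
   then have "par' v = par v" using ag True by simp
   then show ?thesis using absorbed[OF True v(2)] L' Lrk by auto
  next
   case False
   note n = new[OF v(1) False]
   have "rk' (par' v) < rk' v"
   proof (cases "par' v \<in> V")
    case True
    then have "par' v \<in> L" using n L' by auto
    then show ?thesis using lt[of "par' v"] Lrk[of "par' v"] rk'[of v] False by simp
   next
    case f: False
    then show ?thesis using n rk'[of v] rk'[of "par' v"] False by simp
   qed
   then show ?thesis using n v False L' by auto
  qed
  show "cc w \<in> C \<and> cc w \<noteq> rt \<and> par' (cc w) = w" if "w \<in> F" for w
   using cc[OF that] ag[of "cc w"] CV by auto
  show "ce w < m \<and> eu (ce w) \<in> L' \<and> ev (ce w) \<in> L' \<and> rk' (eu (ce w)) < rk' w \<and> rk' (ev (ce w)) < rk' w \<and>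
     anc rt par' (eu (ce w)) (cc w) \<noteq> anc rt par' (ev (ce w)) (cc w)" if w: "w \<in> F" for w
  proof -
   note c = ce[OF w]
   have "eu (ce w) \<in> V" "ev (ce w) \<in> V" using c LV by auto
   then show ?thesis using c L' Lrk FL[OF w] anc_eq by auto
  qed
  show "(\<lambda>x y. (x \<noteq> rt \<and> y = par' x \<or> y \<noteq> rt \<and> x = par' y) \<and> x \<in> L' \<and> y \<in> L' \<and> rk' x \<le> rk' w \<and> rk' y \<le> rk' w)\<^sup>*\<^sup>*
    (eu (ce w)) (ev (ce w))" if w: "w \<in> F" for w
   using ce_path[OF w]
  proof (rule rtranclp_imp)
   fix x y assume a: "(x \<noteq> rt \<and> y = par x \<or> y \<noteq> rt \<and> x = par y) \<and> x \<in> L \<and> y \<in> L \<and> rk x \<le> rk w \<and> rk y \<le> rk w"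
   then have "x \<noteq> rt \<and> y = par' x \<or> y \<noteq> rt \<and> x = par' y" using ag LV by auto
   moreover have "x \<in> L'" "y \<in> L'" "rk' x \<le> rk' w" "rk' y \<le> rk' w" using a L' Lrk FL[OF w] by auto
   ultimately show "(x \<noteq> rt \<and> y = par' x \<or> y \<noteq> rt \<and> x = par' y) \<and> x \<in> L' \<and> y \<in> L' \<and> rk' x \<le> rk' w \<and> rk' y \<le> rk' w"
    by blast
  qed
 qed
qed

text \<open>The ends of the new replacement edges are live before \<open>\<tau>\<close>. Other
  vertices of the tree path between them may have been blocked, but each of these is the parent of
  an edge covered by the replacement edge, so by \<open>cov\<close> it is freed in the same round.
  The whole path is therefore live at time \<open>\<tau>\<close>; this is why \<open>ce_path\<close>
  admits equal ranks while \<open>ce\<close> asks for smaller ones.\<close>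

lemma improvement_free:
 assumes I: "improvement V rt par pos C L F rk m eu ev pe ce cc"
  and Fn: "Fn \<subseteq> C" "Fn \<inter> L = {}"
  and new: "\<And>w. w \<in> Fn ==> cc' w \<in> C \<and> cc' w \<noteq> rt \<and> par (cc' w) = w \<and> ce' w < m \<and> eu (ce' w) \<in> L \<and> ev (ce' w) \<in> L \<and>
    anc rt par (eu (ce' w)) (cc' w) \<noteq> anc rt par (ev (ce' w)) (cc' w)"
  and old: "\<And>w. w \<in> F ==> ce' w = ce w \<and> cc' w = cc w"
  and lt: "\<And>v. v \<in> L ==> rk v < \<tau>" and rk': "\<And>v. rk' v = (if v \<in> Fn then \<tau> else rk v)"
  and cov: "\<And>c e. c \<in> V ==> c \<noteq> rt ==> e < m ==> eu e \<in> L ==> ev e \<in> L ==>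
    anc rt par (eu e) c \<noteq> anc rt par (ev e) c ==> par c \<in> L \<union> Fn"
 shows "improvement V rt par pos C (L \<union> Fn) (F \<union> Fn) rk' m eu ev pe ce' cc'"
proof -
 interpret improvement V rt par pos C L F rk m eu ev pe ce cc by (rule I)
 have Lrk: "rk' v = rk v" if "v \<in> L" for v using rk' that Fn by auto
 have FL: "w \<in> L" if "w \<in> F" for w using FC that by auto
 have le: "rk' x \<le> \<tau>" if "x \<in> L \<union> Fn" for x using that rk' lt by (auto simp: less_imp_le)
 show ?thesis
 proof (intro improvement.intro improvement_axioms.intro rtree_axioms)
  show "C \<subseteq> V" "rt \<in> C" "L \<union> Fn \<subseteq> V" "F \<union> Fn \<subseteq> C" "F \<union> Fn \<subseteq> L \<union> Fn" using CV rootC LV Fn FC by auto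
  show "par v \<in> C" if "v \<in> C" "v \<noteq> rt" for v using parC that .
  show "pe v < m \<and> (eu (pe v) = v \<and> ev (pe v) = par v \<or> eu (pe v) = par v \<and> ev (pe v) = v)"
   if "v \<in> V" "v \<noteq> rt" for v using pe that .
  show "v \<in> L \<union> Fn \<and> par v \<in> L \<union> Fn \<and> rk' (par v) < rk' v" if v: "v \<in> V" "v \<notin> C" for v
   using absorbed[OF v] Lrk by auto
  show "cc' w \<in> C \<and> cc' w \<noteq> rt \<and> par (cc' w) = w" if "w \<in> F \<union> Fn" for w
   using that cc[of w] old[of w] new[of w] by (cases "w \<in> Fn") auto
  show "ce' w < m \<and> eu (ce' w) \<in> L \<union> Fn \<and> ev (ce' w) \<in> L \<union> Fn \<and> rk' (eu (ce' w)) < rk' w \<and> rk' (ev (ce' w)) < rk' w \<and>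
     anc rt par (eu (ce' w)) (cc' w) \<noteq> anc rt par (ev (ce' w)) (cc' w)" if w: "w \<in> F \<union> Fn" for w
  proof (cases "w \<in> Fn")
   case True
   then show ?thesis using new[OF True] Lrk lt rk'[of w] by auto
  next
   case False
   then have "w \<in> F" using w by simp
   then show ?thesis using ce[of w] old[of w] Lrk FL[of w] by auto
  qed
  show "(\<lambda>x y. (x \<noteq> rt \<and> y = par x \<or> y \<noteq> rt \<and> x = par y) \<and> x \<in> L \<union> Fn \<and> y \<in> L \<union> Fn \<and> rk' x \<le> rk' w \<and> rk' y \<le> rk' w)\<^sup>*\<^sup>*
    (eu (ce' w)) (ev (ce' w))" if w: "w \<in> F \<union> Fn" for w
  proof (cases "w \<in> Fn")
   case True
   note n = new[OF True]
   have ab: "eu (ce' w) \<in> V" "ev (ce' w) \<in> V" using n LV by auto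
   have LF: "L \<union> Fn \<subseteq> V" using LV Fn CV by auto
   have c: "par c \<in> L \<union> Fn" if "c \<in> V" "c \<noteq> rt" "sub (eu (ce' w)) c \<noteq> sub (ev (ce' w)) c" for c
    using cov[OF that(1,2) _ _ _ that(3)] n by blast
   from separating_path[OF ab] show ?thesis
   proof (rule rtranclp_imp)
    fix x y assume s: "sep (eu (ce' w)) (ev (ce' w)) x y"
    have "x \<in> L \<union> Fn" "y \<in> L \<union> Fn" "x \<noteq> rt \<and> y = par x \<or> y \<noteq> rt \<and> x = par y"
     using sep_live[OF s, of L "L \<union> Fn"] n LF c by blast+
    then show "(x \<noteq> rt \<and> y = par x \<or> y \<noteq> rt \<and> x = par y) \<and> x \<in> L \<union> Fn \<and> y \<in> L \<union> Fn \<and> rk' x \<le> rk' w \<and> rk' y \<le> rk' w"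
     using le rk'[of w] True by auto
   qed
  next
   case False
   then have wF: "w \<in> F" using w by simp
   have "ce' w = ce w" using old[OF wF] by simp
   show ?thesis unfolding \<open>ce' w = ce w\<close> using ce_path[OF wF]
   proof (rule rtranclp_imp)
    fix x y assume a: "(x \<noteq> rt \<and> y = par x \<or> y \<noteq> rt \<and> x = par y) \<and> x \<in> L \<and> y \<in> L \<and> rk x \<le> rk w \<and> rk y \<le> rk w"
    then show "(x \<noteq> rt \<and> y = par x \<or> y \<noteq> rt \<and> x = par y) \<and> x \<in> L \<union> Fn \<and> y \<in> L \<union> Fn \<and> rk' x \<le> rk' w \<and> rk' y \<le> rk' w"
     using Lrk FL[OF wF] by auto
   qed
  qed
 qed
qed

lemma (in improvement) hdeg_tree:
 assumes "v \<in> C"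
 shows "hdeg (pe ` (C - {rt})) v = card {c \<in> C. c \<noteq> rt \<and> par c = v} + of_bool (v \<noteq> rt)"
proof -
 let ?K = "{c \<in> C. c \<noteq> rt \<and> (c = v \<or> par c = v)}"
 have e: "inc eu ev (pe ` (C - {rt})) v = pe ` ?K"
 proof -
  have "(eu (pe c) = v \<or> ev (pe c) = v) \<longleftrightarrow> (c = v \<or> par c = v)" if "c \<in> C" "c \<noteq> rt" for c
   using pe[of c] that CV by auto
  then show ?thesis unfolding inc_def by auto
 qed
 have "inj_on pe ?K" using pe_inj CV by (auto simp: inj_on_def)
 then have "hdeg (pe ` (C - {rt})) v = card ?K" unfolding e by (rule card_image)
 also have "?K = {c \<in> C. c \<noteq> rt \<and> par c = v} \<union> (if v \<noteq> rt then {v} else {})" using assms by auto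
 also have "card \<dots> = card {c \<in> C. c \<noteq> rt \<and> par c = v} + of_bool (v \<noteq> rt)"
 proof -
  have f: "finite {c \<in> C. c \<noteq> rt \<and> par c = v}" using finite_subset[OF CV finV] by auto
  have "v \<notin> {c \<in> C. c \<noteq> rt \<and> par c = v}"
   using pos_par[of v] assms CV by fastforce
  then show ?thesis using f by auto
 qed
 finally show ?thesis .
qed

text \<open>The time line is read backwards. A step marks only vertices of smaller rank, which can
  occur on it only at earlier positions, so one pass meets every mark after it has been set. Array
  15 tells the two kinds of step apart.\<close>

definition improve :: com where
 "improve = (Store 27 23 1 ;; Move 6 19) ;;
   for_down 6 0 (Load 8 16 6 ;; Load 9 27 8 ;;
    If (Equal 9 0) Skip (Load 9 15 8 ;;
     If (NotEqual 9 0)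
      (Load 12 12 8 ;; Store 9 12 1 ;; Load 24 11 8 ;; Store 27 24 1)
      (Load 24 26 8 ;; Load 12 12 24 ;; Store 9 12 0 ;; Load 12 25 8 ;; Store 9 12 1 ;;
      Load 14 2 12 ;; Store 27 14 1 ;; Load 14 3 12 ;; Store 27 14 1)))"

lemma wr_improve [simp]:
 "wr improve = {6,8,9,12,14,24}" "wa improve = {9,27}"
 by (auto simp: improve_def)

context graph
begin

lemma improve:
 assumes IM: "improvement (Vof s) rt (arrs s 11) pos C (live s) F rk m eu ev (arrs s 12) (arrs s 25) (arrs s 26)"
  and stt: "static s" and Vn: "Vof s \<subseteq> {..<n}"
  and ord: "\<And>i j. i < j ==> j < regs s 19 ==> rk (arrs s 16 i) \<le> rk (arrs s 16 j)"
  and inj: "inj_on (arrs s 16) {..<regs s 19}" and TL: "arrs s 16 ` {..<regs s 19} = (Vof s - C) \<union> F"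
  and ne: "regs s 19 \<le> n"
  and ab: "\<And>v. v \<in> Vof s ==> arrs s 15 v \<noteq> 0 \<longleftrightarrow> v \<notin> C"
  and mk: "\<forall>v<n. arrs s 27 v = 0"
  and fh: "\<forall>e<m. arrs s 9 e = of_bool (e \<in> arrs s 12 ` (C - {rt}))"
  and hit: "regs s 23 \<in> F"
 shows "tr W improve s (16 * n + 3) (\<lambda>s'. (\<forall>e<m. arrs s' 9 e = 0 \<or> arrs s' 9 e = 1) \<and>
   (\<forall>v\<in>C. (hadj eu ev (hset (arrs s' 9)))\<^sup>*\<^sup>* v rt) \<and>
   (\<exists>M. regs s 23 \<in> M \<and> M \<subseteq> live s \<and> (\<forall>v\<in>C. card (inc eu ev (hset (arrs s' 9)) v) + of_bool (v \<in> M \<inter> F) \<le>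
     card (inc eu ev (arrs s 12 ` (C - {rt})) v) + of_bool (v \<in> M - {regs s 23}))) \<and>
   (\<forall>v. v \<notin> C --> card (inc eu ev (hset (arrs s' 9)) v) \<le> 2))"
proof -
 interpret improvement "Vof s" rt "arrs s 11" pos C "live s" F rk m eu ev "arrs s 12" "arrs s 25" "arrs s 26" by (rule IM)
 let ?V = "Vof s" and ?par = "arrs s 11" and ?pe = "arrs s 12" and ?ce = "arrs s 25" and ?cc = "arrs s 26"
 let ?TL = "arrs s 16" and ?ne = "regs s 19" and ?w0 = "regs s 23"
 let ?b = "Load 8 16 6 ;; Load 9 27 8 ;;
    If (Equal 9 0) Skip (Load 9 15 8 ;;
     If (NotEqual 9 0)
      (Load 12 12 8 ;; Store 9 12 1 ;; Load 24 11 8 ;; Store 27 24 1)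
      (Load 24 26 8 ;; Load 12 12 24 ;; Store 9 12 0 ;; Load 12 25 8 ;; Store 9 12 1 ;;
      Load 14 2 12 ;; Store 27 14 1 ;; Load 14 3 12 ;; Store 27 14 1))"
 define mks where "mks f = {v. v < n \<and> f v \<noteq> (0::nat)}" for f
 \<comment> \<open>The processed set \<open>D\<close> of the invariant. It is defined from the
   current marks, so a position passed while unmarked must not become marked later;
   \<open>later\<close> below ensures this.\<close>
 define dns where "dns i f = {v. (\<exists>j. i \<le> j \<and> j < ?ne \<and> ?TL j = v) \<and> v \<in> mks f}" for i f
 define J :: "nat \<Rightarrow> state \<Rightarrow> bool" where
  "J i s' \<longleftrightarrow> (\<forall>e<m. arrs s' 9 e = 0 \<or> arrs s' 9 e = 1) \<and>
    Inv ?w0 (hset (arrs s' 9)) (mks (arrs s' 27)) (dns i (arrs s' 27))" for i s'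
 have Vn': "v < n" if "v \<in> ?V" for v using subsetD[OF Vn that] by simp
 have TLn: "?TL j \<in> ?V" if "j < ?ne" for j using TL that FC CV by blast
 have hs1: "hset (f(e := 1)) = insert e (hset f)" if "e < m" for f e using that by (auto simp: hset_def)
 have hs0: "hset (f(e := 0)) = hset f - {e}" for f e by (auto simp: hset_def)
 have mk1: "mks (f(v := 1)) = insert v (mks f)" if "v < n" for f v using that by (auto simp: mks_def)
 have main: "tr W ((Store 27 23 1 ;; Move 6 19) ;; for_down 6 0 ?b) s (2 + (n * (14 + 2) + 1)) (\<lambda>s'. J 0 s' \<and> regs s' 6 = 0)"
 proof (rule tr_seq)
  let ?s1 = "set_reg 6 ?ne (set_arr 27 ?w0 1 s)"
  show "tr W (Store 27 23 1 ;; Move 6 19) s 2 (\<lambda>s1. s1 = ?s1)"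
   by (intro tr_wp) (simp_all add: staticD[OF stt])
  fix s1 assume s1: "s1 = ?s1"
  show "tr W (for_down 6 0 ?b) s1 (n * (14 + 2) + 1) (\<lambda>s'. J 0 s' \<and> regs s' 6 = 0)"
  proof (rule tr_for_down[where T = 14])
   have "?w0 \<in> ?V" using hit FC(1) CV by blast
   then have w0n: "?w0 < n" by (rule Vn')
   have "hset (arrs s 9) = ?pe ` (C - {rt})"
   proof -
    have "e < m" if "e \<in> ?pe ` (C - {rt})" for e
    proof -
     obtain x where "e = ?pe x" "x \<in> C" "x \<noteq> rt" using \<open>e \<in> ?pe ` (C - {rt})\<close> by blast
     then show ?thesis using pe[of x] subsetD[OF CV] by blast
    qed
    then show ?thesis using fh by (auto simp: hset_def of_bool_def split: if_splits)
   qed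
   moreover have "mks ((arrs s 27)(?w0 := 1)) = {?w0}" using mk w0n by (auto simp: mks_def)
   moreover have "dns ?ne f = {}" for f by (auto simp: dns_def)
   ultimately show "J (regs s1 6) s1" using Inv_init[OF hit] fh s1 by (simp add: J_def)
  next
   fix i s' assume K: "J (Suc i) s'" and i: "i < regs s1 6" "regs s' 6 = i" and f: "frame (for_down 6 0 ?b) s1 s'"
   have st': "static s'" using static_frame[OF _ f] stt s1 by simp
   have e: "arrs s' 16 = ?TL" "arrs s' 15 = arrs s 15" "arrs s' 12 = ?pe" "arrs s' 11 = ?par" "arrs s' 25 = ?ce" "arrs s' 26 = ?cc"
    using frame_arrs[OF f] s1 by simp_all
   have i1: "i < ?ne" using i s1 by simp
   let ?v = "?TL i"
   have vV: "?v \<in> ?V" "?v < n" using TLn[OF i1] Vn'[OF TLn[OF i1]] by simp_all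
   have I: "Inv ?w0 (hset (arrs s' 9)) (mks (arrs s' 27)) (dns (Suc i) (arrs s' 27))"
    and H01: "\<And>e. e < m ==> arrs s' 9 e = 0 \<or> arrs s' 9 e = 1" using K by (auto simp: J_def)
   have vnd: "?v \<notin> dns (Suc i) f" for f
   proof
    assume "?v \<in> dns (Suc i) f"
    then obtain j where j: "Suc i \<le> j" "j < ?ne" "?TL j = ?v" unfolding dns_def by blast
    then have "j = i" using inj_onD[OF inj j(3)] i1 by simp
    then show False using j by simp
   qed
   have later: "?TL j \<noteq> x" if "rk x < rk ?v" "i \<le> j" "j < ?ne" for x j
    using ord[of i j] that by (cases "i = j") auto
   have dnsi: "dns i f = dns (Suc i) f \<union> ({?v} \<inter> mks f)" for f
   proof -
    have ex: "(\<exists>j. i \<le> j \<and> P j) \<longleftrightarrow> P i \<or> (\<exists>j. Suc i \<le> j \<and> P j)" for P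
     by (metis Suc_leD le_antisym not_less_eq_eq order_refl)
    have "(\<exists>j. i \<le> j \<and> j < ?ne \<and> ?TL j = x) \<longleftrightarrow> ?v = x \<or> (\<exists>j. Suc i \<le> j \<and> j < ?ne \<and> ?TL j = x)" for x
     unfolding ex[of "\<lambda>j. j < ?ne \<and> ?TL j = x"] using i1 by simp
    then show ?thesis unfolding dns_def by (intro set_eqI) (simp, metis)
   qed
   have dns_ins: "dns i (f(x := 1)) = dns i f" if "rk x < rk ?v" "x < n" for f x
    unfolding dns_def mk1[OF that(2)] using later[OF that(1)] by blast
   have 0: "J i s''" if "arrs s' 27 ?v = 0" "arrs s'' 9 = arrs s' 9" "arrs s'' 27 = arrs s' 27" for s''
   proof -
    have "?v \<notin> mks (arrs s' 27)" using that by (simp add: mks_def)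
    then have "dns i (arrs s' 27) = dns (Suc i) (arrs s' 27)" unfolding dnsi by simp
    then show ?thesis using I H01 that by (simp add: J_def)
   qed
   have 1: "J i s''" if m: "arrs s' 27 ?v \<noteq> 0" and a: "arrs s 15 ?v \<noteq> 0" and
    u: "arrs s'' 9 = (arrs s' 9)(?pe ?v := 1)" "arrs s'' 27 = (arrs s' 27)(?par ?v := 1)" for s''
   proof -
    have vM: "?v \<in> mks (arrs s' 27)" using m vV by (simp add: mks_def)
    have vC: "?v \<notin> C" using ab[OF vV(1)] a by simp
    have nr: "?v \<noteq> rt" using vC rootC by auto
    have p: "?pe ?v < m" using pe[OF vV(1) nr] by simp
    have ap: "?par ?v \<in> live s" "rk (?par ?v) < rk ?v" using absorbed[OF vV(1) vC] by auto
    have "?par ?v \<in> ?V" using ap(1) LV by blast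
    then have pn: "?par ?v < n" by (rule Vn')
    have "Inv ?w0 (insert (?pe ?v) (hset (arrs s' 9))) (insert (?par ?v) (mks (arrs s' 27))) (insert ?v (dns (Suc i) (arrs s' 27)))"
     by (rule Inv_absorbed[OF I vM vnd vC])
    moreover have "insert ?v (dns (Suc i) (arrs s' 27)) = dns i (arrs s'' 27)"
     unfolding u unfolding dns_ins[OF ap(2) pn] unfolding dnsi using vM by auto
    ultimately show ?thesis unfolding J_def u using hs1[OF p] mk1[OF pn] H01 by (simp add: u)
   qed
   have 2: "J i s''" if m: "arrs s' 27 ?v \<noteq> 0" and a: "arrs s 15 ?v = 0" and
    u: "arrs s'' 9 = (arrs s' 9)(?pe (?cc ?v) := 0, ?ce ?v := 1)"
     "arrs s'' 27 = (arrs s' 27)(eu (?ce ?v) := 1, ev (?ce ?v) := 1)" for s''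
   proof -
    have vM: "?v \<in> mks (arrs s' 27)" using m vV by (simp add: mks_def)
    have vC: "?v \<in> C" using ab[OF vV(1)] a by simp
    then have vF: "?v \<in> F" using TL i1 by blast
    note c = ce[OF vF]
    have un: "eu (?ce ?v) < n" "ev (?ce ?v) < n" using c eun evn by auto
    have "Inv ?w0 (insert (?ce ?v) (hset (arrs s' 9) - {?pe (?cc ?v)}))
      (insert (eu (?ce ?v)) (insert (ev (?ce ?v)) (mks (arrs s' 27)))) (insert ?v (dns (Suc i) (arrs s' 27)))"
     by (rule Inv_freed[OF I vM vnd vF])
    moreover have "insert ?v (dns (Suc i) (arrs s' 27)) = dns i (arrs s'' 27)"
    proof -
     have "rk (eu (?ce ?v)) < rk ?v" "rk (ev (?ce ?v)) < rk ?v" using c by blast+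
     note d = dns_ins[OF this(2) un(2)] dns_ins[OF this(1) un(1)]
     show ?thesis unfolding u unfolding d unfolding dnsi using vM by auto
    qed
    moreover have "mks (arrs s'' 27) = insert (eu (?ce ?v)) (insert (ev (?ce ?v)) (mks (arrs s' 27)))"
     unfolding u mk1[OF un(2)] mk1[OF un(1)] by auto
    moreover have "hset (arrs s'' 9) = insert (?ce ?v) (hset (arrs s' 9) - {?pe (?cc ?v)})"
     unfolding u using hs1[of "?ce ?v"] hs0 c by simp
    moreover have "arrs s'' 9 e = 0 \<or> arrs s'' 9 e = 1" if "e < m" for e using H01[OF that] by (simp add: u)
    ultimately show ?thesis unfolding J_def by simp
   qed
   show "tr W ?b s' 14 (J i)"
    by (rule tr_wp) (use 0 1 2 in \<open>simp_all add: staticD[OF st'] i(2) e\<close>)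
  qed (use stt s1 ne in \<open>auto simp: staticD J_def\<close>)
 qed
 have "tr W improve s (2 + (n * (14 + 2) + 1)) (\<lambda>s'. (\<forall>e<m. arrs s' 9 e = 0 \<or> arrs s' 9 e = 1) \<and>
   (\<forall>v\<in>C. (hadj eu ev (hset (arrs s' 9)))\<^sup>*\<^sup>* v rt) \<and>
   (\<exists>M. ?w0 \<in> M \<and> M \<subseteq> live s \<and> (\<forall>v\<in>C. card (inc eu ev (hset (arrs s' 9)) v) + of_bool (v \<in> M \<inter> F) \<le>
     card (inc eu ev (?pe ` (C - {rt})) v) + of_bool (v \<in> M - {?w0}))) \<and>
   (\<forall>v. v \<notin> C --> card (inc eu ev (hset (arrs s' 9)) v) \<le> 2))"
  unfolding improve_def
 proof (rule tr_cons[OF main order_refl])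
  fix s' assume "J 0 s' \<and> regs s' 6 = 0"
  then have H01: "\<forall>e<m. arrs s' 9 e = 0 \<or> arrs s' 9 e = 1"
   and I: "Inv ?w0 (hset (arrs s' 9)) (mks (arrs s' 27)) (dns 0 (arrs s' 27))" by (auto simp: J_def)
  have fin: "mks (arrs s' 27) \<inter> ((?V - C) \<union> F) \<subseteq> dns 0 (arrs s' 27)"
  proof
   fix v assume v: "v \<in> mks (arrs s' 27) \<inter> ((?V - C) \<union> F)"
   then obtain j where "j < ?ne" "v = ?TL j" using TL by (metis IntD2 imageE lessThan_iff)
   then show "v \<in> dns 0 (arrs s' 27)" using v unfolding dns_def by auto
  qed
  note fl = Inv_final[OF I fin hit]
  show "(\<forall>e<m. arrs s' 9 e = 0 \<or> arrs s' 9 e = 1) \<and>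
   (\<forall>v\<in>C. (hadj eu ev (hset (arrs s' 9)))\<^sup>*\<^sup>* v rt) \<and>
   (\<exists>M. ?w0 \<in> M \<and> M \<subseteq> live s \<and> (\<forall>v\<in>C. card (inc eu ev (hset (arrs s' 9)) v) + of_bool (v \<in> M \<inter> F) \<le>
     card (inc eu ev (?pe ` (C - {rt})) v) + of_bool (v \<in> M - {?w0}))) \<and>
   (\<forall>v. v \<notin> C --> card (inc eu ev (hset (arrs s' 9)) v) \<le> 2)"
   using H01 fl(1,2,3,4,5) by (intro conjI exI[of _ "mks (arrs s' 27)"]) blast+
 qed
 then show ?thesis by (rule tr_le) simp
qed

end

section \<open>One round and the certificate of separation that it leaves\<close>

section \<open>Rounds\<close>

lemma lessThan_add_split: "{..<a + d :: nat} = {..<a} \<union> (\<lambda>q. a + q) ` {..<d}"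
proof (intro set_eqI iffI)
 fix x assume x: "x \<in> {..<a + d}"
 show "x \<in> {..<a} \<union> (\<lambda>q. a + q) ` {..<d}"
 proof (cases "x < a")
  case False
  with x show ?thesis by (intro UnI2 image_eqI[of _ _ "x - a"]) auto
 qed simp
qed auto

lemma atLeastLessThan_shift: "(a::nat) \<le> b ==> {a..<b} = (\<lambda>q. a + q) ` {..<b - a}"
proof (intro set_eqI iffI)
 fix x assume "a \<le> b" "x \<in> {a..<b}"
 then show "x \<in> (\<lambda>q. a + q) ` {..<b - a}" by (intro image_eqI[of _ _ "x - a"]) auto
qed auto

text \<open>Register 29 remembers the old number of tree vertices, so that only the vertices
  absorbed now are appended to the time line.\<close>

definition search_round :: com where
 "search_round = Move 29 7 ;; grow ;; add_absorbed ;; sizes ;; preorder_nums ;; ranges ;; push_ranges ;; free_vertices"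

lemma wr_search [simp]:
 "wr search_round = {6,7,8,9,10,11,12,13,14,15,16,19,21,23,24,28,29}"
 "wa search_round = {10,11,12,13,14,15,16,18,19,20,21,22,23,24,25,26}"
 by (auto simp: search_round_def)

context graph
begin

definition blk :: "state \<Rightarrow> nat set" where
 "blk s = {v \<in> Vof s. arrs s 14 v \<noteq> 0}"

text \<open>These vertices are the freed set \<open>F\<close> of the locale
  \<open>improvement\<close>.\<close>

definition unblk :: "nat \<Rightarrow> nat set \<Rightarrow> state \<Rightarrow> nat set" where
 "unblk k C s = {v \<in> C. k - 1 \<le> arrs s 17 v \<and> arrs s 14 v = 0}"

text \<open>Ranks are ghost data: the program stores only the time line, whose order has to agree
  with them. \<open>pos\<close> is hidden too, since it changes whenever vertices are
  absorbed.\<close>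

definition ranked :: "nat \<Rightarrow> nat set \<Rightarrow> state \<Rightarrow> bool" where
 "ranked k C s \<longleftrightarrow> (\<exists>rk \<tau> pos. improvement (Vof s) rt (arrs s 11) pos C (live s) (unblk k C s) rk m eu ev (arrs s 12) (arrs s 25) (arrs s 26) \<and>
    (\<forall>v\<in>live s. rk v < \<tau>) \<and> (\<forall>i j. i < j --> j < regs s 19 --> rk (arrs s 16 i) \<le> rk (arrs s 16 j)))"

definition round_base :: "nat \<Rightarrow> nat set \<Rightarrow> state \<Rightarrow> bool" where
 "round_base k C s \<longleftrightarrow> static s \<and> tree_of s \<and> listed (arrs s 13) (regs s 7) (arrs s 10) \<and>
   regs s 17 = k \<and> 0 < regs s 18 \<and> regs s 18 \<le> regs s 7 \<and> C = arrs s 13 ` {..<regs s 18} \<and>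
   (\<forall>e<m. arrs s 8 e = 1) \<and>
   (\<forall>v<n. v \<notin> Vof s --> arrs s 14 v = 0 \<and> arrs s 15 v = 0) \<and>
   (\<forall>v\<in>Vof s. arrs s 14 v \<noteq> 0 --> v \<in> C \<and> k - 1 \<le> arrs s 17 v) \<and>
   (\<forall>v\<in>Vof s. arrs s 15 v \<noteq> 0 \<longleftrightarrow> v \<notin> C) \<and> (\<forall>v<n. arrs s 27 v = 0) \<and>
   (\<forall>e<m. arrs s 9 e = of_bool (e \<in> arrs s 12 ` (C - {rt}))) \<and>
   inj_on (arrs s 16) {..<regs s 19} \<and> arrs s 16 ` {..<regs s 19} = (Vof s - C) \<union> unblk k C s \<and>
   ranked k C s"

text \<open>The certificate for the toughness argument: once \<open>B\<close> is deleted, the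
  branches at the vertices still blocked are closed under edges of the graph.\<close>

definition separated :: "nat set \<Rightarrow> state \<Rightarrow> bool" where
 "separated B s \<longleftrightarrow>
   (\<forall>v\<in>Vof s - B. \<forall>e<m. \<forall>y. joins eu ev e v y --> y \<in> Vof s) \<and>
   (\<forall>c\<in>Vof s. c \<noteq> rt --> arrs s 11 c \<in> blk s -->
    (\<forall>e<m. \<forall>a b. joins eu ev e a b --> a \<in> Vof s - B --> b \<in> Vof s - B -->
     anc rt (arrs s 11) a c --> anc rt (arrs s 11) b c))"

definition searched :: "nat \<Rightarrow> nat set \<Rightarrow> state \<Rightarrow> state \<Rightarrow> bool" where
 "searched k C s s' \<longleftrightarrow> round_base k C s' \<and> blk s' \<subseteq> blk s \<and> regs s' 21 + card (blk s') = card (blk s) \<and>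
   separated (blk s) s' \<and>
   (\<forall>v\<in>C. arrs s' 11 v = arrs s 11 v \<and> arrs s' 12 v = arrs s 12 v) \<and> (\<forall>j<regs s 18. arrs s' 13 j = arrs s 13 j) \<and>
   (if regs s' 28 = 0 then \<forall>w\<in>unblk k C s' - unblk k C s. arrs s' 17 w \<noteq> k
   else regs s' 23 \<in> unblk k C s' \<and> arrs s' 17 (regs s' 23) = k)"

lemma tree_grown:
 assumes T: "tree_of s" and g: "grown s s'" and l: "listed (arrs s 13) (regs s 7) (arrs s 10)"
 shows "tree_of s'"
 unfolding treeP_def
proof (intro conjI allI impI)
 have g1: "regs s 7 \<le> regs s' 7" "listed (arrs s' 13) (regs s' 7) (arrs s' 10)"
  and g2: "\<And>j. j < regs s 7 ==> arrs s' 13 j = arrs s 13 j"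
  and g3: "\<And>v. v < n ==> arrs s 10 v \<noteq> 0 ==> arrs s' 11 v = arrs s 11 v \<and> arrs s' 12 v = arrs s 12 v"
  and g4: "\<And>j. regs s 7 \<le> j ==> j < regs s' 7 ==> linked (arrs s 14) (arrs s 8) (arrs s' 13) (arrs s' 11) (arrs s' 12) j"
  using g unfolding grown_def by blast+
 show "0 < regs s' 7" "arrs s' 13 0 = rt" using g1 g2[of 0] T by (auto simp: treeP_def)
 show "inj_on (arrs s' 13) {..<regs s' 7}" "Vof s' \<subseteq> {..<n}" using g1 by (auto simp: listed_def)
 fix j assume j: "0 < j" "j < regs s' 7"
 show "\<exists>i<j. arrs s' 11 (arrs s' 13 j) = arrs s' 13 i \<and> arrs s' 12 (arrs s' 13 j) < m \<and>
   joins eu ev (arrs s' 12 (arrs s' 13 j)) (arrs s' 13 j) (arrs s' 13 i)"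
 proof (cases "j < regs s 7")
  case True
  obtain i where i: "i < j" "arrs s 11 (arrs s 13 j) = arrs s 13 i" "arrs s 12 (arrs s 13 j) < m"
   "joins eu ev (arrs s 12 (arrs s 13 j)) (arrs s 13 j) (arrs s 13 i)" using treeP_par[OF T j(1) True] by blast
  have "arrs s 13 j < n" "arrs s 10 (arrs s 13 j) \<noteq> 0" using listed_lt[OF l True] by auto
  note g3[OF this]
  moreover have "arrs s' 13 j = arrs s 13 j" "arrs s' 13 i = arrs s 13 i" using g2 True i(1) by auto
  ultimately show ?thesis using i by (intro exI[of _ i]) simp
 next
  case False
  then have "linked (arrs s 14) (arrs s 8) (arrs s' 13) (arrs s' 11) (arrs s' 12) j" using g4[of j] j by simp
  then obtain i where "i < j" "arrs s' 11 (arrs s' 13 j) = arrs s' 13 i" "arrs s' 12 (arrs s' 13 j) < m"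
   "joins eu ev (arrs s' 12 (arrs s' 13 j)) (arrs s' 13 j) (arrs s' 13 i)" unfolding linked_def by blast
  then show ?thesis by blast
 qed
qed

lemma search_round:
 assumes B: "round_base k C s"
 shows "tr W search_round s (88 * n + 61 * m + 23) (searched k C s)"
proof -
 let ?s0 = "set_reg 29 (regs s 7) s"
 have stt: "static s" and T: "tree_of s" and l: "listed (arrs s 13) (regs s 7) (arrs s 10)"
  and k: "regs s 17 = k" and ct: "0 < regs s 18" "regs s 18 \<le> regs s 7" and C: "C = arrs s 13 ` {..<regs s 18}"
  and ff': "\<forall>e<m. arrs s 8 e = 1"
  and out': "\<forall>v<n. v \<notin> Vof s --> arrs s 14 v = 0 \<and> arrs s 15 v = 0"
  and bl': "\<forall>v\<in>Vof s. arrs s 14 v \<noteq> 0 --> v \<in> C \<and> k - 1 \<le> arrs s 17 v"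
  and ab': "\<forall>v\<in>Vof s. arrs s 15 v \<noteq> 0 \<longleftrightarrow> v \<notin> C" and mk: "\<forall>v<n. arrs s 27 v = 0"
  and fh: "\<forall>e<m. arrs s 9 e = of_bool (e \<in> arrs s 12 ` (C - {rt}))"
  and inj: "inj_on (arrs s 16) {..<regs s 19}" and TL: "arrs s 16 ` {..<regs s 19} = (Vof s - C) \<union> unblk k C s"
  and rank: "ranked k C s"
  using B unfolding round_base_def by - (elim conjE, assumption)+
 have ff: "arrs s 8 e = 1" if "e < m" for e using ff' that by simp
 have out: "arrs s 14 v = 0 \<and> arrs s 15 v = 0" if "v < n" "v \<notin> Vof s" for v using out' that by simp
 have bl: "v \<in> C \<and> k - 1 \<le> arrs s 17 v" if "v \<in> Vof s" "arrs s 14 v \<noteq> 0" for v using bspec[OF bl' that(1)] that(2) by simp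
 have ab: "arrs s 15 v \<noteq> 0 \<longleftrightarrow> v \<notin> C" if "v \<in> Vof s" for v using bspec[OF ab' that] .
 have CV: "C \<subseteq> Vof s" unfolding C using ct by (intro image_mono) auto
 have Vn: "v < n" if "v \<in> Vof s" for v using that treeP_lt[OF T] by auto
 have Vin: "v \<in> Vof s \<longleftrightarrow> arrs s 10 v \<noteq> 0" if "v < n" for v using l that by (simp add: listed_def)
 have neV: "arrs s 16 ` {..<regs s 19} \<subseteq> Vof s" using TL CV by (auto simp: unblk_def)
 \<comment> \<open>The time line lists tree vertices without repetition.\<close>
 have ne: "regs s 19 \<le> n"
 proof -
  have "arrs s 16 ` {..<regs s 19} \<subseteq> {..<n}" using neV Vn by blast
  then have "card (arrs s 16 ` {..<regs s 19}) \<le> n" using card_mono[of "{..<n}"] by fastforce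
  then show ?thesis using card_image[OF inj] by simp
 qed
 have st0: "static ?s0" using stt by simp
 have e0: "exec W (Move 29 7) s 1 ?s0" by (rule exec.Move)
 have l0: "listed (arrs ?s0 13) (regs ?s0 7) (arrs ?s0 10)" using l by simp
 obtain t1 s1 where x1: "exec W grow ?s0 t1 s1" "t1 \<le> 2 + 10 * n + 26 * m" and q1: "grown ?s0 s1 \<and>
  (\<forall>i<regs s1 7. arrs ?s0 14 (arrs s1 13 i) = 0 -->
    (\<forall>e<m. \<forall>y. arrs ?s0 8 e = 1 --> joins eu ev e (arrs s1 13 i) y --> arrs s1 10 y \<noteq> 0))"
  and f1: "frame grow ?s0 s1"
  by (rule trE[OF grow[OF st0 l0]]) (rule that)
 from q1 have g: "grown ?s0 s1" by (rule conjunct1)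
 from q1 have cl: "\<forall>i<regs s1 7. arrs ?s0 14 (arrs s1 13 i) = 0 -->
    (\<forall>e<m. \<forall>y. arrs ?s0 8 e = 1 --> joins eu ev e (arrs s1 13 i) y --> arrs s1 10 y \<noteq> 0)" by (rule conjunct2)
 have T1: "tree_of s1" using tree_grown[OF _ g] T l by simp
 have st1: "static s1" and l1: "listed (arrs s1 13) (regs s1 7) (arrs s1 10)" and c1: "regs s 7 \<le> regs s1 7"
  and g2: "\<And>j. j < regs s 7 ==> arrs s1 13 j = arrs s 13 j"
  and g3: "\<And>v. v < n ==> arrs s 10 v \<noteq> 0 ==> arrs s1 11 v = arrs s 11 v \<and> arrs s1 12 v = arrs s 12 v"
  and g4: "\<And>j. regs s 7 \<le> j ==> j < regs s1 7 ==> linked (arrs s 14) (arrs s 8) (arrs s1 13) (arrs s1 11) (arrs s1 12) j"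
  using g unfolding grown_def by simp_all
 have r1: "regs s1 29 = regs s 7" "regs s1 19 = regs s 19" "regs s1 17 = k" "regs s1 18 = regs s 18"
  using frame_regs[OF f1] k by simp_all
 have a1: "arrs s1 14 = arrs s 14" "arrs s1 15 = arrs s 15" "arrs s1 16 = arrs s 16" "arrs s1 17 = arrs s 17"
  "arrs s1 8 = arrs s 8" "arrs s1 9 = arrs s 9" "arrs s1 27 = arrs s 27" "arrs s1 25 = arrs s 25" "arrs s1 26 = arrs s 26"
  using frame_arrs[OF f1] by simp_all
 have c29: "regs s1 29 \<le> regs s1 7" and n19: "regs s1 19 \<le> n" using r1 c1 ne by simp_all
 obtain t2 s2 where x2: "exec W add_absorbed s1 t2 s2" "t2 \<le> 6 * n + 2"
  and q2: "regs s2 19 = regs s1 19 + (regs s1 7 - regs s1 29) \<and> (\<forall>j<regs s1 19. arrs s2 16 j = arrs s1 16 j) \<and>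
   (\<forall>j. regs s1 29 \<le> j --> j < regs s1 7 --> arrs s2 16 (regs s1 19 + (j - regs s1 29)) = arrs s1 13 j) \<and>
   (\<forall>v. arrs s2 15 v = (if v \<in> arrs s1 13 ` {regs s1 29..<regs s1 7} then 1 else arrs s1 15 v))"
  and f2: "frame add_absorbed s1 s2"
  by (rule trE[OF add_absorbed[OF T1 st1 c29 n19]]) (rule that)
 have p2: "regs s2 19 = regs s1 19 + (regs s1 7 - regs s1 29)" "\<forall>j<regs s1 19. arrs s2 16 j = arrs s1 16 j"
   "\<forall>j. regs s1 29 \<le> j --> j < regs s1 7 --> arrs s2 16 (regs s1 19 + (j - regs s1 29)) = arrs s1 13 j"
   "\<forall>v. arrs s2 15 v = (if v \<in> arrs s1 13 ` {regs s1 29..<regs s1 7} then 1 else arrs s1 15 v)"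
  using q2 by - (elim conjE, assumption)+
 have st2: "static s2" using static_frame[OF st1 f2] by simp
 have k2: "regs s2 7 = regs s1 7" "arrs s2 13 = arrs s1 13" "arrs s2 11 = arrs s1 11" "arrs s2 12 = arrs s1 12" "arrs s2 10 = arrs s1 10"
  "arrs s2 14 = arrs s1 14" using frame_regs[OF f2, of 7] frame_arrs[OF f2] by simp_all
 have T2: "tree_of s2" using T1 k2 by simp
 obtain t3 s3 where x3: "exec W sizes s2 t3 s3" "t3 \<le> 12 * n + 4" and S3: "sizes_ok s2 (arrs s3 18)" and f3: "frame sizes s2 s3"
  by (rule trE[OF sizes[OF T2 st2]]) (rule that)
 have st3: "static s3" using static_frame[OF st2 f3] by simp
 have k3: "regs s3 7 = regs s1 7" "arrs s3 13 = arrs s1 13" "arrs s3 11 = arrs s1 11" "arrs s3 12 = arrs s1 12" "arrs s3 10 = arrs s1 10"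
  "arrs s3 14 = arrs s1 14" using frame_regs[OF f3, of 7] frame_arrs[OF f3] k2 by simp_all
 have T3: "tree_of s3" using T1 k3 by simp
 have S: "sizes_ok x (arrs s3 18)" if "regs x 7 = regs s1 7" "arrs x 13 = arrs s1 13" "arrs x 11 = arrs s1 11" for x
  using S3 that k2 by (simp add: sizes_ok_def cidx_def)
 obtain t4 s4 where x4: "exec W preorder_nums s3 t4 s4" "t4 \<le> 11 * n + 4" and N4: "nums_ok s3 (arrs s3 18) (arrs s4 19)"
  and f4: "frame preorder_nums s3 s4"
  by (rule trE[OF preorder_nums[OF T3 st3 S[OF k3(1-3)]]]) (rule that)
 have st4: "static s4" using static_frame[OF st3 f4] by simp
 have k4: "regs s4 7 = regs s1 7" "arrs s4 13 = arrs s1 13" "arrs s4 11 = arrs s1 11" "arrs s4 12 = arrs s1 12" "arrs s4 10 = arrs s1 10"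
  "arrs s4 14 = arrs s1 14" "arrs s4 18 = arrs s3 18" using frame_regs[OF f4, of 7] frame_arrs[OF f4] k3 by simp_all
 have T4: "tree_of s4" using T1 k4 by simp
 have N: "nums_ok x (arrs s3 18) (arrs s4 19)" if "regs x 7 = regs s1 7" "arrs x 13 = arrs s1 13" "arrs x 11 = arrs s1 11" for x
  using N4 that k3 by (simp add: nums_ok_def)
 have l4: "listed (arrs s4 13) (regs s4 7) (arrs s4 10)" using l1 k4 by simp
 obtain t5 s5 where x5: "exec W ranges s4 t5 s5" "t5 \<le> 6 * n + 35 * m + 4"
  and R5: "rng (Vof s4) (arrs s4 19) {(a, b, e). ledge (live s4) a b e} s5" and f5: "frame ranges s4 s5"
  by (rule trE[OF ranges[OF T4 st4 l4]]) (rule that)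
 have st5: "static s5" using static_frame[OF st4 f5] by simp
 have k5: "regs s5 7 = regs s1 7" "arrs s5 13 = arrs s1 13" "arrs s5 11 = arrs s1 11" "arrs s5 12 = arrs s1 12" "arrs s5 10 = arrs s1 10"
  "arrs s5 14 = arrs s1 14" "arrs s5 18 = arrs s3 18" "arrs s5 19 = arrs s4 19"
  using frame_regs[OF f5, of 7] frame_arrs[OF f5] k4 by simp_all
 have T5: "tree_of s5" using T1 k5 by simp
 have lv5: "live s4 = live s5" "Vof s4 = Vof s5" using k4 k5 by (simp_all add: live_def)
 have S5: "sizes_ok s5 (arrs s5 18)" using S[OF k5(1-3)] k5 by simp
 have N5: "nums_ok s5 (arrs s5 18) (arrs s5 19)" using N[OF k5(1-3)] k5 by simp
 have R5': "rng (Vof s5) (arrs s5 19) {(a, b, e). ledge (live s5) a b e} s5" using R5 lv5 k5 by simp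
 obtain t6 s6 where x6: "exec W push_ranges s5 t6 s6" "t6 \<le> 16 * n + 2" and C5: "cov_ok s5 s6" and f6: "frame push_ranges s5 s6"
  by (rule trE[OF push_ranges[OF T5 st5 S5 N5 R5']]) (rule that)
 have st6: "static s6" using static_frame[OF st5 f6] by simp
 have k6: "regs s6 7 = regs s1 7" "arrs s6 13 = arrs s1 13" "arrs s6 11 = arrs s1 11" "arrs s6 12 = arrs s1 12" "arrs s6 10 = arrs s1 10"
  "arrs s6 14 = arrs s1 14" "arrs s6 18 = arrs s3 18" "arrs s6 19 = arrs s4 19"
  using frame_regs[OF f6, of 7] frame_arrs[OF f6] k5 by simp_all
 have T6: "tree_of s6" using T1 k6 by simp
 have N6: "nums_ok s6 (arrs s6 18) (arrs s6 19)" using N[OF k6(1-3)] k6 by simp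
 have cov6: "covers s5 = covers s6" using k5 k6 by (intro ext) (simp add: covers_def live_def)
 have C6: "cov_ok s6 s6" using C5 k5 k6 cov6 by (simp add: cov_ok_def)
 have x26: "exec W (add_absorbed ;; sizes ;; preorder_nums ;; ranges ;; push_ranges) s1 (t2 + (t3 + (t4 + (t5 + t6)))) s6"
  using x2(1) x3(1) x4(1) x5(1) x6(1) by (intro exec.Seq)
 note f26 = exec_frame[OF x26]
 have V1n: "v < n" if "v \<in> Vof s1" for v using that treeP_lt[OF T1] by auto
 have OV: "arrs s1 13 ` {regs s 7..<regs s1 7} = Vof s1 - Vof s" and VV: "Vof s \<subseteq> Vof s1" and inj1: "inj_on (arrs s1 13) {..<regs s1 7}"
 proof -
  show inj1: "inj_on (arrs s1 13) {..<regs s1 7}" using T1 by (simp add: treeP_def)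
  have Veq: "Vof s = arrs s1 13 ` {..<regs s 7}" using g2 by (intro image_cong) auto
  show "Vof s \<subseteq> Vof s1" unfolding Veq using c1 by (intro image_mono) auto
  have "{..<regs s1 7} = {..<regs s 7} \<union> {regs s 7..<regs s1 7}" using c1 by auto
  then have "Vof s1 = Vof s \<union> arrs s1 13 ` {regs s 7..<regs s1 7}" unfolding Veq by (simp add: image_Un)
  moreover have "Vof s \<inter> arrs s1 13 ` {regs s 7..<regs s1 7} = {}"
  proof -
   have "arrs s1 13 ` ({..<regs s 7} \<inter> {regs s 7..<regs s1 7}) = arrs s1 13 ` {..<regs s 7} \<inter> arrs s1 13 ` {regs s 7..<regs s1 7}"
    by (rule inj_on_image_Int[OF inj1]) (use c1 in auto)
   moreover have "{..<regs s 7} \<inter> {regs s 7..<regs s1 7} = {}" by auto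
   ultimately show ?thesis unfolding Veq by (metis image_empty)
  qed
  ultimately show "arrs s1 13 ` {regs s 7..<regs s1 7} = Vof s1 - Vof s" by auto
 qed
 have r6: "regs s6 19 = regs s 19 + (regs s1 7 - regs s 7)" "regs s6 17 = k" "regs s6 18 = regs s 18" "regs s6 20 = regs s 20"
 proof -
  have "frame (sizes ;; preorder_nums ;; ranges ;; push_ranges) s2 s6"
   using x3(1) x4(1) x5(1) x6(1) by (intro exec_frame[of W _ _ "t3 + (t4 + (t5 + t6))"] exec.Seq)
  then have "regs s6 19 = regs s2 19" using frame_regs[of _ s2 s6 19] by simp
  then show "regs s6 19 = regs s 19 + (regs s1 7 - regs s 7)" using p2(1) r1 by simp
  show "regs s6 17 = k" "regs s6 18 = regs s 18" "regs s6 20 = regs s 20"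
   using frame_regs[OF f26] frame_regs[OF f1] r1 by simp_all
 qed
 have a6: "arrs s6 17 = arrs s 17" "arrs s6 8 = arrs s 8" "arrs s6 9 = arrs s 9" "arrs s6 27 = arrs s 27" "arrs s6 25 = arrs s 25" "arrs s6 26 = arrs s 26"
  using frame_arrs[OF f26] a1 by simp_all
 have a6': "arrs s6 16 = arrs s2 16" "arrs s6 15 = arrs s2 15"
 proof -
  have "frame (sizes ;; preorder_nums ;; ranges ;; push_ranges) s2 s6"
   using x3(1) x4(1) x5(1) x6(1) by (intro exec_frame[of W _ _ "t3 + (t4 + (t5 + t6))"] exec.Seq)
  from frame_arrs[OF this] show "arrs s6 16 = arrs s2 16" "arrs s6 15 = arrs s2 15" by simp_all
 qed
 have lv: "live s6 = live s \<union> (Vof s1 - Vof s)"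
  using k6 a1 VV out V1n by (auto simp: live_def)
 have ub6: "unblk k C s6 = unblk k C s" using k6 a1 a6 by (simp add: unblk_def)
 have TLold: "arrs s6 16 j = arrs s 16 j" if "j < regs s 19" for j using p2(2) r1 a1 a6' that by simp
 have TLnew: "arrs s6 16 (regs s 19 + q) = arrs s1 13 (regs s 7 + q)" if "q < regs s1 7 - regs s 7" for q
  using spec[OF p2(3), of "regs s 7 + q"] r1 a6' that by simp
 have TL6: "arrs s6 16 ` {..<regs s6 19} = (Vof s1 - C) \<union> unblk k C s" and inj6: "inj_on (arrs s6 16) {..<regs s6 19}"
 proof -
  let ?d = "regs s1 7 - regs s 7"
  have iv: "{..<regs s6 19} = {..<regs s 19} \<union> (\<lambda>q. regs s 19 + q) ` {..<?d}"
   unfolding r6 by (rule lessThan_add_split)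
  have A: "arrs s6 16 ` {..<regs s 19} = arrs s 16 ` {..<regs s 19}" using TLold by (intro image_cong) auto
  have iv2: "{regs s 7..<regs s1 7} = (\<lambda>q. regs s 7 + q) ` {..<?d}"
   by (rule atLeastLessThan_shift[OF c1])
  have Bq: "arrs s6 16 ` ((\<lambda>q. regs s 19 + q) ` {..<?d}) = Vof s1 - Vof s"
   unfolding OV[symmetric] iv2 image_image using TLnew by (intro image_cong) auto
  show "arrs s6 16 ` {..<regs s6 19} = (Vof s1 - C) \<union> unblk k C s"
   unfolding iv image_Un A Bq TL using VV CV by auto
  have "inj_on (arrs s6 16) {..<regs s 19}" using inj TLold by (simp add: inj_on_def)
  moreover have "inj_on (arrs s6 16) ((\<lambda>q. regs s 19 + q) ` {..<?d})"
  proof (rule inj_onI)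
   fix x y assume "x \<in> (\<lambda>q. regs s 19 + q) ` {..<?d}" "y \<in> (\<lambda>q. regs s 19 + q) ` {..<?d}" "arrs s6 16 x = arrs s6 16 y"
   then obtain q r where q: "x = regs s 19 + q" "y = regs s 19 + r" "q < ?d" "r < ?d" "arrs s1 13 (regs s 7 + q) = arrs s1 13 (regs s 7 + r)"
    using TLnew by auto
   then have "regs s 7 + q = regs s 7 + r" using inj_onD[OF inj1 q(5)] by simp
   then show "x = y" using q by simp
  qed
  moreover have "arrs s6 16 ` {..<regs s 19} \<inter> arrs s6 16 ` ((\<lambda>q. regs s 19 + q) ` {..<?d}) = {}"
   unfolding A Bq using neV by auto
  ultimately show "inj_on (arrs s6 16) {..<regs s6 19}" unfolding iv by (subst inj_on_Un) blast
 qed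
 obtain rk \<tau> pos where IM: "improvement (Vof s) rt (arrs s 11) pos C (live s) (unblk k C s) rk m eu ev (arrs s 12) (arrs s 25) (arrs s 26)"
  and lt: "\<And>v. v \<in> live s ==> rk v < \<tau>" and rko: "\<And>i j. i < j ==> j < regs s 19 ==> rk (arrs s 16 i) \<le> rk (arrs s 16 j)"
  using rank unfolding ranked_def by blast
 let ?pos1 = "inv_into {..<regs s1 7} (arrs s1 13)"
 \<comment> \<open>The newly absorbed vertices are ranked after all old ones, in the order of the
   list, in which parents come first.\<close>
 define rk1 where "rk1 v = (if v \<in> Vof s then rk v else \<tau> + ?pos1 v)" for v
 have pos1: "?pos1 (arrs s1 13 j) = j" if "j < regs s1 7" for j using inj1 that by (intro inv_into_f_f) auto
 have IM1: "improvement (Vof s1) rt (arrs s1 11) ?pos1 C (live s6) (unblk k C s) rk1 m eu ev (arrs s1 12) (arrs s 25) (arrs s 26)"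
 proof (rule improvement_absorb[OF IM treeP_rtree[OF T1] VV _ _ lv rk1_def lt])
  fix v assume v: "v \<in> Vof s" "v \<noteq> rt"
  have "v < n" using Vn[OF v(1)] .
  moreover from this have "arrs s 10 v \<noteq> 0" using Vin v(1) by blast
  ultimately show "arrs s1 11 v = arrs s 11 v \<and> arrs s1 12 v = arrs s 12 v" by (rule g3)
 next
  fix v assume v: "v \<in> Vof s1" "v \<noteq> rt"
  then obtain j where j: "v = arrs s1 13 j" "j < regs s1 7" "0 < j" using treeP_rt[OF T1] by auto
  obtain i where "arrs s1 11 (arrs s1 13 j) = arrs s1 13 i" "arrs s1 12 (arrs s1 13 j) < m"
   "joins eu ev (arrs s1 12 (arrs s1 13 j)) (arrs s1 13 j) (arrs s1 13 i)"
   by (rule treeP_par[OF T1 j(3,2)]) (rule that)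
  then show "arrs s1 12 v < m \<and> (eu (arrs s1 12 v) = v \<and> ev (arrs s1 12 v) = arrs s1 11 v \<or> eu (arrs s1 12 v) = arrs s1 11 v \<and> ev (arrs s1 12 v) = v)"
   unfolding j(1) by (simp add: joins_def)
 next
  fix v assume v: "v \<in> Vof s1" "v \<notin> Vof s"
  then have "v \<in> arrs s1 13 ` {regs s 7..<regs s1 7}" using OV by simp
  then obtain j where j: "v = arrs s1 13 j" "regs s 7 \<le> j" "j < regs s1 7" by auto
  obtain i where i0: "i < j" "arrs s1 11 (arrs s1 13 j) = arrs s1 13 i" "arrs s 14 (arrs s1 13 i) = 0"
   using g4[OF j(2,3)] unfolding linked_def by blast
  have i: "i < j" "arrs s1 11 v = arrs s1 13 i" "arrs s 14 (arrs s1 13 i) = 0" using i0 unfolding j(1) .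
  have iV: "arrs s1 13 i \<in> Vof s1" using i j by auto
  then have "arrs s1 13 i \<in> live s6" using i k6 a1 by (simp add: live_def)
  moreover have "?pos1 (arrs s1 13 i) < ?pos1 v" using pos1[of i] pos1[of j] i j by simp
  ultimately show "arrs s1 11 v \<in> live s6 \<and> (arrs s1 11 v \<notin> Vof s --> ?pos1 (arrs s1 11 v) < ?pos1 v)" using i by simp
 qed
 have liveV: "live s \<subseteq> Vof s" by (auto simp: live_def)
 define \<tau>1 where "\<tau>1 = \<tau> + regs s1 7"
 have lt1: "rk1 v < \<tau>1" if "v \<in> live s6" for v
 proof (cases "v \<in> Vof s")
  case True
  then have "v \<in> live s" using that lv by auto
  then show ?thesis using lt[of v] True by (simp add: rk1_def \<tau>1_def)
 next
  case False
  then have "v \<in> Vof s1" using that lv liveV by auto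
  then obtain j where "v = arrs s1 13 j" "j < regs s1 7" by auto
  then show ?thesis using False pos1 by (simp add: rk1_def \<tau>1_def)
 qed
 have rk1o: "rk1 (arrs s6 16 i) \<le> rk1 (arrs s6 16 j)" if ij: "i < j" "j < regs s6 19" for i j
 proof (cases "j < regs s 19")
  case True
  then have "arrs s 16 i \<in> Vof s" "arrs s 16 j \<in> Vof s" using neV ij by auto
  then show ?thesis using rko[OF ij(1) True] TLold True ij by (simp add: rk1_def)
 next
  case False
  then obtain r where r: "j = regs s 19 + r" by (metis le_add_diff_inverse not_less)
  have rd: "r < regs s1 7 - regs s 7" using ij(2) r r6(1) by simp
  have jv: "arrs s6 16 j = arrs s1 13 (regs s 7 + r)" using TLnew[OF rd] r by simp
  have "arrs s1 13 (regs s 7 + r) \<in> Vof s1 - Vof s" unfolding OV[symmetric] using rd by simp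
  then have rj: "rk1 (arrs s6 16 j) = \<tau> + (regs s 7 + r)" unfolding jv using pos1[of "regs s 7 + r"] rd by (simp add: rk1_def)
  show ?thesis
  proof (cases "i < regs s 19")
   case True
   then have i1: "arrs s 16 i \<in> arrs s 16 ` {..<regs s 19}" by simp
   then have iV: "arrs s 16 i \<in> Vof s" using neV by blast
   \<comment> \<open>Entries of the time line are not blocked, so the old ones have ranks below
     \<open>\<tau>\<close>.\<close>
   have "arrs s 14 (arrs s 16 i) = 0"
   proof (rule ccontr)
    assume nz: "arrs s 14 (arrs s 16 i) \<noteq> 0"
    then have "arrs s 16 i \<in> C" using bl[OF iV] by blast
    moreover have "arrs s 16 i \<notin> unblk k C s" using nz unfolding unblk_def by blast
    ultimately show False using i1 TL by blast
   qed
   then have "arrs s 16 i \<in> live s" using iV unfolding live_def by blast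
   then have "rk1 (arrs s6 16 i) < \<tau>" using lt iV TLold[OF True] by (simp add: rk1_def)
   then show ?thesis using rj by simp
  next
   case False
   then obtain q where q: "i = regs s 19 + q" by (metis le_add_diff_inverse not_less)
   have qd: "q < regs s1 7 - regs s 7" "q < r" using ij q r rd by auto
   have "arrs s1 13 (regs s 7 + q) \<in> Vof s1 - Vof s" unfolding OV[symmetric] using qd(1) by simp
   then have "rk1 (arrs s6 16 i) = \<tau> + (regs s 7 + q)" using TLnew[OF qd(1)] q pos1[of "regs s 7 + q"] qd by (simp add: rk1_def)
   then show ?thesis using rj qd by simp
  qed
 qed
 have ne6: "regs s6 19 \<le> n"
 proof -
  have "unblk k C s \<subseteq> Vof s1" using CV VV unfolding unblk_def by blast
  then have "arrs s6 16 ` {..<regs s6 19} \<subseteq> Vof s1" unfolding TL6 by blast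
  then have "arrs s6 16 ` {..<regs s6 19} \<subseteq> {..<n}" using V1n by blast
  then have "card (arrs s6 16 ` {..<regs s6 19}) \<le> n" using card_mono[of "{..<n}"] by fastforce
  then show ?thesis using card_image[OF inj6] by simp
 qed
 obtain t7 s7 where x7: "exec W free_vertices s6 t7 s7" "t7 \<le> 27 * n + 4" and F7: "free_inv s6 (regs s6 7) s7" and f7: "frame free_vertices s6 s7"
  by (rule trE[OF free_vertices[OF T6 st6 N6 C6 ne6]]) (rule that)
 have x: "exec W search_round s (1 + (t1 + (t2 + (t3 + (t4 + (t5 + (t6 + t7))))))) s7"
  unfolding search_round_def using e0 x1(1) x2(1) x3(1) x4(1) x5(1) x6(1) x7(1) by (intro exec.Seq)
 let ?Fn = "freed s6 (regs s6 7)"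
 have k7: "regs s7 7 = regs s1 7" "arrs s7 13 = arrs s1 13" "arrs s7 11 = arrs s1 11" "arrs s7 12 = arrs s1 12" "arrs s7 10 = arrs s1 10"
  "regs s7 17 = k" "regs s7 18 = regs s 18" "arrs s7 17 = arrs s 17" "arrs s7 8 = arrs s 8" "arrs s7 9 = arrs s 9" "arrs s7 27 = arrs s 27"
  "arrs s7 15 = arrs s2 15"
  using frame_regs[OF f7, of 7] frame_regs[OF f7, of 17] frame_regs[OF f7, of 18] frame_arrs[OF f7] k6 r6 a6 a6' by simp_all
 have st7: "static s7" using static_frame[OF st6 f7] by simp
 have T7: "tree_of s7" using T1 k7 by simp
 have P1': "\<forall>v. arrs s7 14 v = (if v \<in> ?Fn then 0 else arrs s6 14 v)"
  and P2: "\<forall>w. if w \<in> ?Fn then arrs s7 26 w \<in> arrs s6 13 ` {0<..<regs s6 7} \<and> arrs s6 11 (arrs s7 26 w) = w \<and> covers s6 (arrs s7 26 w) (arrs s7 25 w)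
    else arrs s7 26 w = arrs s6 26 w \<and> arrs s7 25 w = arrs s6 25 w"
  and P4: "regs s7 21 = card ?Fn" "regs s7 19 = regs s6 19 + card ?Fn"
  and P5': "\<forall>j<regs s6 19. arrs s7 16 j = arrs s6 16 j"
  and P6: "arrs s7 16 ` {regs s6 19..<regs s7 19} = ?Fn" "inj_on (arrs s7 16) {regs s6 19..<regs s7 19}"
  and P7: "if regs s7 28 = 0 then \<forall>w\<in>?Fn. arrs s6 17 w \<noteq> regs s6 17
   else regs s7 23 \<in> ?Fn \<and> arrs s6 17 (regs s7 23) = regs s6 17"
  using F7 unfolding free_inv_def by - (elim conjE, assumption)+
 have P1: "arrs s7 14 v = (if v \<in> ?Fn then 0 else arrs s6 14 v)" for v using P1' by (rule spec)
 have P5: "arrs s7 16 j = arrs s6 16 j" if "j < regs s6 19" for j using P5' that by simp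
 have P2a: "arrs s7 26 w \<in> arrs s6 13 ` {0<..<regs s6 7} \<and> arrs s6 11 (arrs s7 26 w) = w \<and> covers s6 (arrs s7 26 w) (arrs s7 25 w)"
  if "w \<in> ?Fn" for w using spec[OF P2, of w] that by (simp only: if_True)
 have P2b: "arrs s7 26 w = arrs s6 26 w \<and> arrs s7 25 w = arrs s6 25 w" if "w \<notin> ?Fn" for w
  using spec[OF P2, of w] that by (simp only: if_False)
 have V6: "Vof s6 = Vof s1" "Vof s7 = Vof s1" using k6 k7 by simp_all
 have inV: "w \<in> Vof s" if w: "w \<in> Vof s1" "arrs s 14 w \<noteq> 0" for w
 proof (rule ccontr)
  assume "w \<notin> Vof s"
  then have "arrs s 14 w = 0" using out[OF V1n[OF w(1)]] by simp
  then show False using w(2) by simp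
 qed
 have FnV: "?Fn \<subseteq> Vof s1" using freed_V[OF T6, of "regs s6 7"] V6 by simp
 have b6: "arrs s6 14 = arrs s 14" using k6 a1 by simp
 have Fnb: "?Fn \<subseteq> blk s"
 proof
  fix w assume w: "w \<in> ?Fn"
  then have "arrs s 14 w \<noteq> 0" "w \<in> Vof s1" using FnV b6 by (auto simp: freed_def)
  then show "w \<in> blk s" using inV unfolding blk_def by simp
 qed
 have blkC: "blk s \<subseteq> C" using bl unfolding blk_def by blast
 have FnC: "?Fn \<subseteq> C" using Fnb blkC by blast
 have finb: "finite (blk s)" unfolding blk_def by simp
 have blk6: "blk s6 = blk s"
  unfolding blk_def V6 b6 using VV inV by blast
 have lvx: "live x = Vof x - blk x" for x :: state by (auto simp: live_def blk_def)
 have lv6: "live s6 = Vof s1 - blk s" unfolding lvx blk6 V6 ..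
 have blk7x: "x \<in> blk s7 \<longleftrightarrow> x \<in> blk s6 \<and> x \<notin> ?Fn" for x by (simp only: blk_def V6 P1 mem_Collect_eq) simp
 have blk7: "blk s7 = blk s - ?Fn" by (rule set_eqI) (simp only: blk7x blk6 Diff_iff)
 have lv7: "live s7 = live s6 \<union> ?Fn" unfolding lvx blk6 blk7 V6 using FnV by blast
 have Fnl: "?Fn \<inter> live s6 = {}" using Fnb lv6 by blast
 have ub7: "unblk k C s7 = unblk k C s \<union> ?Fn"
 proof -
  have "k - 1 \<le> arrs s 17 w" if "w \<in> ?Fn" for w using that Fnb bl unfolding blk_def by blast
  then have x1: "x \<in> C \<and> k - 1 \<le> arrs s 17 x" if "x \<in> ?Fn" for x using that FnC by blast
  have "x \<in> unblk k C s7 \<longleftrightarrow> x \<in> unblk k C s \<or> x \<in> ?Fn" for x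
  proof (cases "x \<in> ?Fn")
   case True
   then show ?thesis using x1[OF True] by (simp only: unblk_def k7(8) P1 mem_Collect_eq) simp
  next
   case False
   then show ?thesis by (simp only: unblk_def k7(8) P1 b6 mem_Collect_eq) simp
  qed
  then show ?thesis by blast
 qed
 have ledge_live: "eu e \<in> live s6 \<and> ev e \<in> live s6 \<and> e < m \<and> anc rt (arrs s1 11) (eu e) c \<noteq> anc rt (arrs s1 11) (ev e) c"
  if cv: "covers s6 c e" for c e
 proof -
  obtain a b where ab: "ledge (live s6) a b e" "anc rt (arrs s6 11) a c" "\<not> anc rt (arrs s6 11) b c"
   using cv unfolding covers_def by blast
  have "eu e = a \<and> ev e = b \<or> eu e = b \<and> ev e = a" using ab(1) unfolding ledge_def joins_def by blast
  then show ?thesis using ab k6(3) unfolding ledge_def by auto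
 qed
 have in_freed: "arrs s1 11 c \<in> ?Fn" if c: "c \<in> Vof s1" "c \<noteq> rt" and cv: "covers s6 c e" and b: "arrs s6 14 (arrs s1 11 c) \<noteq> 0" for c e
 proof -
  obtain j where j: "c = arrs s1 13 j" "j < regs s1 7" "0 < j" using c treeP_rt[OF T1] by auto
  show ?thesis unfolding freed_def mem_Collect_eq k6 using j b cv k6 by (intro conjI exI[of _ j] exI[of _ e]) simp_all
 qed
 \<comment> \<open>One common rank suffices for the vertices freed in a round, because the ends of
   their replacement edges were live before it.\<close>
 let ?rk7 = "\<lambda>v. if v \<in> ?Fn then \<tau>1 else rk1 v"
 have IM7: "improvement (Vof s1) rt (arrs s1 11) ?pos1 C (live s6 \<union> ?Fn) (unblk k C s \<union> ?Fn) ?rk7 m eu ev (arrs s1 12) (arrs s7 25) (arrs s7 26)"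
 proof (rule improvement_free[OF IM1 FnC Fnl _ _ lt1 refl])
  fix w assume w: "w \<in> ?Fn"
  note p = P2a[OF w]
  let ?c = "arrs s7 26 w"
  obtain j where j: "?c = arrs s1 13 j" "0 < j" "j < regs s1 7" using p k6 by auto
  have cV: "?c \<in> Vof s1" and cr: "?c \<noteq> rt" using j treeP_rt[OF T1 j(3)] by auto
  have pw: "arrs s1 11 ?c = w" using p k6(3) by simp
  \<comment> \<open>An absorbed vertex has a live parent, whereas \<open>w\<close> was still blocked
    when the edges were examined.\<close>
  have "?c \<in> C"
  proof (rule ccontr)
   assume "?c \<notin> C"
   then have "arrs s1 11 ?c \<in> live s6" using improvement.absorbed[OF IM1 cV] by blast
   then have "w \<in> live s6" unfolding pw .
   then show False using w Fnl by blast
  qed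
  moreover have cv: "covers s6 ?c (arrs s7 25 w)" using p by (elim conjE)
  note ledge_live[OF cv]
  ultimately show "?c \<in> C \<and> ?c \<noteq> rt \<and> arrs s1 11 ?c = w \<and> arrs s7 25 w < m \<and> eu (arrs s7 25 w) \<in> live s6 \<and> ev (arrs s7 25 w) \<in> live s6 \<and>
    anc rt (arrs s1 11) (eu (arrs s7 25 w)) ?c \<noteq> anc rt (arrs s1 11) (ev (arrs s7 25 w)) ?c"
   using cr pw by - (elim conjE, intro conjI, assumption+)
 next
  fix w assume "w \<in> unblk k C s"
  then have "w \<notin> ?Fn" using Fnb unfolding unblk_def blk_def by blast
  from P2b[OF this] show "arrs s7 25 w = arrs s 25 w \<and> arrs s7 26 w = arrs s 26 w" using a6 by simp
 next
  fix c e assume c: "c \<in> Vof s1" "c \<noteq> rt" and e: "e < m" "eu e \<in> live s6" "ev e \<in> live s6"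
   "anc rt (arrs s1 11) (eu e) c \<noteq> anc rt (arrs s1 11) (ev e) c"
  have "joins eu ev e (eu e) (ev e)" "joins eu ev e (ev e) (eu e)" by (simp_all add: joins_def)
  then have cv: "covers s6 c e" unfolding covers_def ledge_def k6(3) using e by blast
  show "arrs s1 11 c \<in> live s6 \<union> ?Fn"
  proof (cases "arrs s6 14 (arrs s1 11 c) = 0")
   case True
   interpret r1: rtree "Vof s1" rt "arrs s1 11" ?pos1 using treeP_rtree[OF T1] .
   have "arrs s1 11 c \<in> Vof s1" using r1.parV[OF c] .
   then show ?thesis using True V6 unfolding live_def by simp
  next
   case False
   then show ?thesis using in_freed[OF c cv] by blast
  qed
 qed
 have TLF: "arrs s6 16 j \<in> live s6" if "j < regs s6 19" for j
 proof -
  have "arrs s6 16 j \<in> (Vof s1 - C) \<union> unblk k C s" using TL6 that by blast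
  then show ?thesis
  proof
   assume "arrs s6 16 j \<in> Vof s1 - C"
   then show ?thesis unfolding lv6 using blkC by blast
  next
   assume u: "arrs s6 16 j \<in> unblk k C s"
   then have "arrs s6 16 j \<in> Vof s1" using CV VV unfolding unblk_def by blast
   then show ?thesis unfolding lv6 using u unfolding unblk_def blk_def by simp
  qed
 qed
 have iv7: "{..<regs s7 19} = {..<regs s6 19} \<union> {regs s6 19..<regs s7 19}" using P4 by auto
 have TLo7: "arrs s7 16 ` {..<regs s6 19} = arrs s6 16 ` {..<regs s6 19}" using P5 by (intro image_cong) auto
 have TL7: "arrs s7 16 ` {..<regs s7 19} = (Vof s7 - C) \<union> unblk k C s7"
  unfolding iv7 image_Un TLo7 P6(1) TL6 V6 ub7 by blast
 have inj7: "inj_on (arrs s7 16) {..<regs s7 19}"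
 proof -
  have "inj_on (arrs s7 16) {..<regs s6 19}" using inj6 P5 by (simp add: inj_on_def)
  moreover have "arrs s7 16 ` {..<regs s6 19} \<inter> arrs s7 16 ` {regs s6 19..<regs s7 19} = {}"
   unfolding TLo7 P6(1) using TLF Fnl by blast
  ultimately show ?thesis unfolding iv7 using P6(2) by (subst inj_on_Un) blast
 qed
 have rank7: "ranked k C s7" unfolding ranked_def
 proof (intro exI conjI ballI allI impI)
  show "improvement (Vof s7) rt (arrs s7 11) ?pos1 C (live s7) (unblk k C s7) ?rk7 m eu ev (arrs s7 12) (arrs s7 25) (arrs s7 26)"
   unfolding V6 k7 lv7 ub7 by (rule IM7)
  show "?rk7 v < Suc \<tau>1" if "v \<in> live s7" for v
   using that lt1[of v] unfolding lv7 by auto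
  show "?rk7 (arrs s7 16 i) \<le> ?rk7 (arrs s7 16 j)" if ij: "i < j" "j < regs s7 19" for i j
  proof (cases "j < regs s6 19")
   case True
   then have "arrs s6 16 j \<notin> ?Fn" "arrs s6 16 i \<notin> ?Fn" using TLF[of i] TLF[of j] ij Fnl by auto
   then show ?thesis using rk1o[OF ij(1) True] P5[of i] P5[of j] True ij by simp
  next
   case False
   then have "arrs s7 16 j \<in> ?Fn" using P6(1) ij by auto
   moreover have "?rk7 (arrs s7 16 i) \<le> \<tau>1"
   proof (cases "i < regs s6 19")
    case True
    then have "rk1 (arrs s7 16 i) < \<tau>1" using lt1[OF TLF[OF True]] P5[OF True] by simp
    then show ?thesis by simp
   next
    case f: False
    then have "arrs s7 16 i \<in> ?Fn" using P6(1) ij by auto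
    then show ?thesis by simp
   qed
   ultimately show ?thesis by simp
  qed
 qed
 have C7: "C = arrs s7 13 ` {..<regs s7 18}" unfolding k7 C using g2 ct by (intro image_cong) auto
 have par_fh: "arrs s1 12 ` (C - {rt}) = arrs s 12 ` (C - {rt})"
 proof (rule image_cong[OF refl])
  fix v assume "v \<in> C - {rt}"
  then have "v \<in> Vof s" using CV by blast
  then have "v < n" "arrs s 10 v \<noteq> 0" using Vn Vin by blast+
  then show "arrs s1 12 v = arrs s 12 v" using g3[of v] by simp
 qed
 have ab7: "arrs s7 15 v \<noteq> 0 \<longleftrightarrow> v \<notin> C" if v: "v \<in> Vof s7" for v
 proof (cases "v \<in> Vof s")
  case True
  then have "v \<notin> arrs s1 13 ` {regs s1 29..<regs s1 7}" unfolding r1 OV by blast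
  then have "arrs s2 15 v = arrs s 15 v" using p2(4) a1 by simp
  then show ?thesis using ab[OF True] k7 by simp
 next
  case False
  then have "v \<in> arrs s1 13 ` {regs s1 29..<regs s1 7}" unfolding r1 OV using v V6 by blast
  then have "arrs s2 15 v = 1" using p2(4) by simp
  then show ?thesis using False CV k7 by auto
 qed
 have out7: "arrs s7 14 v = 0 \<and> arrs s7 15 v = 0" if v: "v < n" "v \<notin> Vof s7" for v
 proof -
  have "v \<notin> Vof s" "v \<notin> Vof s1" using v VV V6 by blast+
  then have "v \<notin> arrs s1 13 ` {regs s1 29..<regs s1 7}" unfolding r1 OV by blast
  then have "arrs s2 15 v = arrs s 15 v" using p2(4) a1 by simp
  then show ?thesis using out[OF v(1) \<open>v \<notin> Vof s\<close>] k7 P1[of v] b6 by simp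
 qed
 have bl7: "v \<in> C \<and> k - 1 \<le> arrs s7 17 v" if "v \<in> Vof s7" "arrs s7 14 v \<noteq> 0" for v
 proof -
  have "v \<in> blk s" using that blk7 unfolding blk_def by blast
  then show ?thesis using bl k7 unfolding blk_def by simp
 qed
 have base: "round_base k C s7" unfolding round_base_def
 proof (intro conjI)
  show "listed (arrs s7 13) (regs s7 7) (arrs s7 10)" using l1 k7 by simp
  show "regs s7 18 \<le> regs s7 7" using k7 ct c1 by simp
  show "\<forall>e<m. arrs s7 9 e = of_bool (e \<in> arrs s7 12 ` (C - {rt}))" unfolding k7 par_fh by (rule fh)
  show "\<forall>v<n. v \<notin> Vof s7 --> arrs s7 14 v = 0 \<and> arrs s7 15 v = 0" using out7 by blast
  show "\<forall>v\<in>Vof s7. arrs s7 14 v \<noteq> 0 --> v \<in> C \<and> k - 1 \<le> arrs s7 17 v" using bl7 by blast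
  show "\<forall>v\<in>Vof s7. arrs s7 15 v \<noteq> 0 \<longleftrightarrow> v \<notin> C" using ab7 by blast
  show "static s7" "tree_of s7" "C = arrs s7 13 ` {..<regs s7 18}" "inj_on (arrs s7 16) {..<regs s7 19}"
   "arrs s7 16 ` {..<regs s7 19} = (Vof s7 - C) \<union> unblk k C s7" "ranked k C s7"
   by (fact st7 T7 C7 inj7 TL7 rank7)+
  show "regs s7 17 = k" "0 < regs s7 18" using k7 ct by simp_all
  show "\<forall>e<m. arrs s7 8 e = 1" "\<forall>v<n. arrs s7 27 v = 0" unfolding k7 using ff' mk by simp_all
 qed
 have cnt7: "regs s7 21 + card (blk s7) = card (blk s)"
  unfolding blk7 P4 using card_Diff_subset[OF finite_subset[OF Fnb finb] Fnb] card_mono[OF finb Fnb] by simp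
 have sep: "separated (blk s) s7" unfolding separated_def
 proof (intro conjI ballI allI impI)
  fix v e y assume v: "v \<in> Vof s7 - blk s" and e: "e < m" "joins eu ev e v y"
  then have v1: "v \<in> Vof s1" "v \<notin> blk s" unfolding V6 by blast+
  then have "v \<in> live s6" unfolding lv6 by blast
  then have v0: "arrs s 14 v = 0" unfolding live_def b6 by blast
  obtain i where i: "v = arrs s1 13 i" "i < regs s1 7" using v1(1) by blast
  have "\<forall>e<m. \<forall>y. arrs s 8 e = 1 --> joins eu ev e (arrs s1 13 i) y --> arrs s1 10 y \<noteq> 0"
   using spec[OF cl, of i] i(2) v0 unfolding i(1) by simp
  then have "arrs s1 10 y \<noteq> 0" using e(1) ff[OF e(1)] e(2)[unfolded i(1)] by blast
  then have "y \<in> {v. v < n \<and> arrs s1 10 v \<noteq> 0}" using joins_lt[OF e] by simp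
  moreover have "Vof s1 = {v. v < n \<and> arrs s1 10 v \<noteq> 0}" using l1 unfolding listed_def by (rule conjunct2)
  ultimately show "y \<in> Vof s7" unfolding V6 by simp
 next
  fix c e a b assume c: "c \<in> Vof s7" "c \<noteq> rt" "arrs s7 11 c \<in> blk s7" and e: "e < m" "joins eu ev e a b"
   and V: "a \<in> Vof s7 - blk s" "b \<in> Vof s7 - blk s" and an: "anc rt (arrs s7 11) a c"
  show "anc rt (arrs s7 11) b c"
  proof (rule ccontr)
   assume nb: "\<not> anc rt (arrs s7 11) b c"
   have l: "a \<in> live s6" "b \<in> live s6" using V unfolding lv6 V6 by blast+
   have "ledge (live s6) a b e" unfolding ledge_def using l e by blast
   \<comment> \<open>An edge leaving the branch covers \<open>c\<close>, and then the blocked parent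
     of \<open>c\<close> would have been freed in this round.\<close>
   then have cv: "covers s6 c e" unfolding covers_def k6(3) using an nb unfolding k7(3) by blast
   have "arrs s1 11 c \<in> blk s - ?Fn" using c(3) blk7 k7(3) by simp
   then have "arrs s6 14 (arrs s1 11 c) \<noteq> 0" "arrs s1 11 c \<notin> ?Fn" using b6 unfolding blk_def by simp_all
   then show False using in_freed[OF _ c(2) cv] c(1) V6 by simp
  qed
 qed
 have fd: "if regs s7 28 = 0 then \<forall>w\<in>unblk k C s7 - unblk k C s. arrs s7 17 w \<noteq> k
   else regs s7 23 \<in> unblk k C s7 \<and> arrs s7 17 (regs s7 23) = k"
  using P7 unfolding ub7 k7 a6(1) r6(2) by (cases "regs s7 28 = 0") auto
 have cs: "arrs s7 11 v = arrs s 11 v \<and> arrs s7 12 v = arrs s 12 v" if "v \<in> C" for v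
 proof -
  have "v \<in> Vof s" using CV that by blast
  then have "v < n" "arrs s 10 v \<noteq> 0" using Vn Vin by blast+
  then show ?thesis using g3[of v] k7 by simp
 qed
 have cs2: "arrs s7 13 j = arrs s 13 j" if "j < regs s 18" for j using that ct g2 k7 by simp
 have "blk s7 \<subseteq> blk s" unfolding blk7 by blast
 then have "searched k C s s7" unfolding searched_def using base cnt7 sep cs cs2 fd by (intro conjI ballI allI impI) simp_all
 then show ?thesis unfolding tr_def using x x1(2) x2(2) x3(2) x4(2) x5(2) x6(2) x7(2)
  by (intro exI[of _ "1 + (t1 + (t2 + (t3 + (t4 + (t5 + (t6 + t7))))))"] exI[of _ s7]) simp
qed

end

section \<open>From a stopped search to the bound on the maximum degree\<close>

section \<open>The toughness bound\<close>

text \<open>Register 22 ends the phase, register 5 the whole search. The number of freed vertices is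
  doubled for the test since the machine has no division.\<close>

definition decide :: com where
 "decide = If (NotEqual 28 0) (improve ;; Const 22 0)
   (Add 25 21 21 ;; If (LessEq 25 20) (Const 22 0 ;; Const 5 0) (Sub 20 20 21))"

definition round_loop :: com where
 "round_loop = While (NotEqual 22 0) (search_round ;; decide)"

lemma wr_round [simp]:
 "wr decide = {5,6,8,9,12,14,20,22,24,25}" "wa decide = {9,27}"
 "wr round_loop = {5,6,7,8,9,10,11,12,13,14,15,16,19,20,21,22,23,24,25,28,29}"
 "wa round_loop = {9,10,11,12,13,14,15,16,18,19,20,21,22,23,24,25,26,27}"
 by (auto simp: decide_def round_loop_def)

context graph
begin

definition core_inv :: "nat \<Rightarrow> nat set \<Rightarrow> state \<Rightarrow> bool" where
 "core_inv k C s \<longleftrightarrow> (\<forall>v\<in>C. arrs s 17 v = card {c \<in> C. c \<noteq> rt \<and> arrs s 11 c = v} + of_bool (v \<noteq> rt)) \<and>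
   (\<forall>v\<in>C. tm v = 1 \<or> (\<exists>c\<in>C. c \<noteq> rt \<and> arrs s 11 c = v)) \<and> (\<forall>v\<in>C. arrs s 17 v \<le> k)"

lemma round_baseD:
 assumes "round_base k C s"
 shows "static s" "tree_of s" "listed (arrs s 13) (regs s 7) (arrs s 10)"
  "regs s 17 = k" "0 < regs s 18" "regs s 18 \<le> regs s 7" "C = arrs s 13 ` {..<regs s 18}"
  "\<forall>v\<in>Vof s. arrs s 14 v \<noteq> 0 --> v \<in> C \<and> k - 1 \<le> arrs s 17 v"
  "\<forall>v\<in>Vof s. arrs s 15 v \<noteq> 0 \<longleftrightarrow> v \<notin> C" "\<forall>v<n. arrs s 27 v = 0"
  "\<forall>e<m. arrs s 9 e = of_bool (e \<in> arrs s 12 ` (C - {rt}))"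
  "inj_on (arrs s 16) {..<regs s 19}" "arrs s 16 ` {..<regs s 19} = (Vof s - C) \<union> unblk k C s" "ranked k C s"
 using assms unfolding round_base_def by - (elim conjE, assumption)+

lemma round_base_core:
 assumes "round_base k C s"
 shows "treeP (arrs s 13) (regs s 18) (arrs s 11) (arrs s 12)" "C \<subseteq> Vof s" "Vof s \<subseteq> {..<n}" "finite C" "blk s \<subseteq> C"
proof -
 note D = round_baseD[OF assms]
 have sub: "{..<regs s 18} \<subseteq> {..<regs s 7}" using D(6) by simp
 show CV: "C \<subseteq> Vof s" unfolding D(7) using sub by (rule image_mono)
 show "Vof s \<subseteq> {..<n}" using D(2) unfolding treeP_def by blast
 show "finite C" unfolding D(7) by simp
 show "blk s \<subseteq> C" using D(8) unfolding blk_def by blast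
 have "inj_on (arrs s 13) {..<regs s 7}" using D(2) unfolding treeP_def by blast
 then have "inj_on (arrs s 13) {..<regs s 18}" using sub by (rule inj_on_subset)
 moreover have "arrs s 13 ` {..<regs s 18} \<subseteq> {..<n}" using CV \<open>Vof s \<subseteq> {..<n}\<close> unfolding D(7) by blast
 moreover have "\<exists>i<j. arrs s 11 (arrs s 13 j) = arrs s 13 i \<and> arrs s 12 (arrs s 13 j) < m \<and>
   joins eu ev (arrs s 12 (arrs s 13 j)) (arrs s 13 j) (arrs s 13 i)" if "0 < j" "j < regs s 18" for j
 proof -
  have "j < regs s 7" using that D(6) by simp
  then show ?thesis using D(2) that(1) unfolding treeP_def by blast
 qed
 moreover have "arrs s 13 0 = rt" using D(2) unfolding treeP_def by blast
 ultimately show "treeP (arrs s 13) (regs s 18) (arrs s 11) (arrs s 12)"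
  unfolding treeP_def using D(5) by blast
qed

lemma round_ne:
 assumes "round_base k C s"
 shows "regs s 19 \<le> n"
proof -
 note D = round_baseD[OF assms] and R = round_base_core[OF assms]
 have "unblk k C s \<subseteq> C" unfolding unblk_def by blast
 then have "arrs s 16 ` {..<regs s 19} \<subseteq> {..<n}" unfolding D(13) using R(2,3) by blast
 then have "card (arrs s 16 ` {..<regs s 19}) \<le> n" using card_mono[of "{..<n}"] by fastforce
 then show ?thesis using card_image[OF D(12)] by simp
qed

text \<open>A vertex that stays blocked has at least \<open>k - 2\<close> children, as at most one
  of its tree edges leads upwards; so by \<open>leaf_children_count\<close> more than
  \<open>(k - 3) * card (blk s)\<close> branches remain. Each contains a leaf of the core, which is
  a terminal and survives the deletion because its degree is less than \<open>k - 1\<close>.\<close>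

lemma witness_bound:
 assumes RB: "round_base k C s" and CI: "core_inv k C s" and sep: "separated B s"
  and B: "blk s \<subseteq> B" "B \<subseteq> {v \<in> C. k - 1 \<le> arrs s 17 v}" and ne: "blk s \<noteq> {}"
  and cB: "card B \<le> 2 * card (blk s)" and k: "4 \<le> k"
  and G: "verts G = {..<n}" and GE: "\<And>u v. {u, v} \<in> edges G \<longleftrightarrow> (\<exists>e<m. joins eu ev e u v)"
  and tgh: "tough \<phi> X G" and phi: "0 < \<phi>" and X: "\<And>v. v < n ==> tm v = 1 ==> v \<in> X"
 shows "real k \<le> 2 / \<phi> + 3"
proof -
 note D = round_baseD[OF RB] and R = round_base_core[OF RB]
 have TC: "treeP (arrs s 13) (regs s 18) (arrs s 11) (arrs s 12)" using R(1) .
 interpret core: rtree C rt "arrs s 11" "inv_into {..<regs s 18} (arrs s 13)"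
  using treeP_rtree[OF TC] unfolding D(7)[symmetric] .
 let ?W = "blk s" and ?H = "del_verts G B"
 let ?LC = "core.leaf_children ?W"
 have WC: "?W \<subseteq> C" by (rule R(5))
 have finW: "finite ?W" using WC R(4) finite_subset by blast
 have deg: "arrs s 17 v = card (core.children v) + of_bool (v \<noteq> rt)" if "v \<in> C" for v
  using CI that unfolding core_inv_def core.children_def by blast
 have ch: "k - 2 \<le> card (core.children w)" if "w \<in> ?W" for w
 proof -
  have "k - 1 \<le> arrs s 17 w" "w \<in> C" using that B by blast+
  then show ?thesis using deg[of w] k by (cases "w = rt") auto
 qed
 have "card ?W * (k - 2) \<le> (\<Sum>w\<in>?W. card (core.children w))"
  using sum_mono[OF ch, of ?W "\<lambda>w. w"] by simp
 then have lc: "card ?W * (k - 2) + 1 \<le> card ?LC + card ?W"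
  using core.leaf_children_count[OF WC ne] by linarith
 have "card ?W * (k - 2) = card ?W * (k - 3) + card ?W" 
  using k by (metis Suc_diff_Suc add.commute mult_Suc_right Suc_1 eval_nat_numeral(3) less_le_trans lessI numeral_le_iff semiring_norm(68,69,71,76) not_less)
 then have lc': "card ?W * (k - 3) + 1 \<le> card ?LC" using lc by linarith
 have leafx: "\<exists>x. x \<in> C \<and> core.sub x c \<and> tm x = 1 \<and> x \<notin> B" if c: "c \<in> ?LC" for c
 proof -
  have "c \<in> C" using c unfolding core.leaf_children_def by blast
  then obtain x where x: "x \<in> C" "core.sub x c" "core.children x = {}" using core.exists_leaf_below by blast
  have "tm x = 1" using CI x(1,3) unfolding core_inv_def core.children_def by blast
  moreover have "x \<notin> B"
  proof
   assume "x \<in> B"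
   then have "k - 1 \<le> arrs s 17 x" using B(2) by blast
   then show False using deg[OF x(1)] x(3) k by (cases "x = rt") auto
  qed
  ultimately show ?thesis using x by blast
 qed
 then obtain x where x: "\<And>c. c \<in> ?LC ==> x c \<in> C \<and> core.sub (x c) c \<and> tm (x c) = 1 \<and> x c \<notin> B" by metis
 \<comment> \<open>The ancestor relation depends on the parent array only, so the absorbed vertices
   below \<open>c\<close> belong to its branch as well.\<close>
 let ?S = "\<lambda>c. {v \<in> Vof s. core.sub v c}"
 have vH: "verts ?H = {..<n} - B" using G by (simp add: del_verts_def)
 have eH: "{u, v} \<in> edges ?H \<longleftrightarrow> (\<exists>e<m. joins eu ev e u v) \<and> u \<notin> B \<and> v \<notin> B" for u v
  using GE[of u v] by (auto simp: del_verts_def)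
 have Cn: "v < n" if "v \<in> C" for v using that R(2,3) by blast
 have "card ?LC \<le> num_comps ?H X"
 proof (rule components_ge[where x = x and S = ?S])
  show "finite (verts ?H)" unfolding vH by simp
  show "finite ?LC" unfolding core.leaf_children_def using R(4) by simp
  fix c assume c: "c \<in> ?LC"
  note xc = x[OF c]
  have "x c \<in> Vof s" using xc R(2) by blast
  then show "x c \<in> X \<and> x c \<in> ?S c \<and> x c \<in> verts ?H" unfolding vH using xc X Cn by simp
 next
  fix c u v assume c: "c \<in> ?LC" and u: "u \<in> ?S c" "u \<in> verts ?H" and v: "v \<in> verts ?H" "{u, v} \<in> edges ?H"
  obtain e where e: "e < m" "joins eu ev e u v" using v(2) eH by blast
  have uB: "u \<in> Vof s - B" using u unfolding vH by blast
  have vV: "v \<in> Vof s" using sep uB e unfolding separated_def by blast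
  then have vB: "v \<in> Vof s - B" using v(1) unfolding vH by blast
  have cc: "c \<in> Vof s" "c \<noteq> rt" "arrs s 11 c \<in> ?W" using c R(2) unfolding core.leaf_children_def by blast+
  have uc: "core.sub u c" using u(1) by blast
  have "core.sub v c" using sep cc e uB vB uc unfolding separated_def by blast
  then show "v \<in> ?S c" using vV by blast
 next
  fix c d assume "c \<in> ?LC" "d \<in> ?LC" "c \<noteq> d"
  then have "{u. core.sub u c} \<inter> {u. core.sub u d} = {}" by (rule core.leaf_children_disjoint[OF WC])
  then show "?S c \<inter> ?S d = {}" by blast
 next
  fix u v assume "{u, v} \<in> edges ?H"
  then show "u \<in> verts ?H \<and> v \<in> verts ?H" unfolding vH using eH[of u v] joins_lt by auto
 qed
 then have num: "card ?W * (k - 3) + 1 \<le> num_comps ?H X" using lc' by linarith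
 have r1: "real (card ?W * (k - 3)) \<le> real (num_comps ?H X)" using num unfolding of_nat_le_iff by linarith
 have W1: "1 \<le> card ?W" using ne finW by (simp add: Suc_le_eq card_gt_0_iff)
 have pos: "1 \<le> card ?W * (k - 3)" using W1 k by simp
 have "B \<subseteq> verts G" unfolding G using B(2) Cn by blast
 \<comment> \<open>Toughness speaks only about more than one component. The surplus 1 in the count
   of branches supplies the second component when one blocked vertex is left and
   \<open>k = 4\<close>.\<close>
 moreover have "1 < num_comps ?H X" using num pos by linarith
 ultimately have "\<phi> * real (num_comps ?H X) \<le> real (card B)" using tgh unfolding tough_def by blast
 moreover have "\<phi> * real (card ?W * (k - 3)) \<le> \<phi> * real (num_comps ?H X)"
  using mult_left_mono[OF r1, of \<phi>] phi by linarith
 moreover have "real (card B) \<le> 2 * real (card ?W)" using cB by linarith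
 ultimately have "\<phi> * (real (card ?W) * real (k - 3)) \<le> 2 * real (card ?W)" by simp
 then have "real (card ?W) * (\<phi> * real (k - 3)) \<le> real (card ?W) * 2" by (simp add: algebra_simps)
 then have "\<phi> * real (k - 3) \<le> 2" using W1 by simp
 then have "real (k - 3) \<le> 2 / \<phi>" using phi by (simp add: field_simps)
 then show ?thesis using k by (simp add: of_nat_diff)
qed

text \<open>The certificate is detached from the current state: \<open>k\<close> alone ties it to
  the tree that is written out, so later code may overwrite the arrays.\<close>

definition stop_ok :: "nat \<Rightarrow> bool" where
 "stop_ok k \<longleftrightarrow> k \<le> 3 \<or> (\<exists>C s B. round_base k C s \<and> core_inv k C s \<and> separated B s \<and> blk s \<subseteq> B \<and>
   B \<subseteq> {v \<in> C. k - 1 \<le> arrs s 17 v} \<and> blk s \<noteq> {} \<and> card B \<le> 2 * card (blk s) \<and> 4 \<le> k)"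

definition core_same :: "nat set \<Rightarrow> state \<Rightarrow> state \<Rightarrow> bool" where
 "core_same C s s' \<longleftrightarrow> static s' \<and> (\<forall>v\<in>C. arrs s' 11 v = arrs s 11 v \<and> arrs s' 12 v = arrs s 12 v) \<and>
   (\<forall>j<regs s 18. arrs s' 13 j = arrs s 13 j) \<and> regs s' 18 = regs s 18 \<and> arrs s' 17 = arrs s 17"

text \<open>Stated for the edge set in array 9, whose acyclicity is not tracked: the next search
  extracts a tree from it, and this can only lower degrees.\<close>

definition improved :: "nat \<Rightarrow> nat \<Rightarrow> nat set \<Rightarrow> state \<Rightarrow> bool" where
 "improved k p C s \<longleftrightarrow> (\<forall>e<m. arrs s 9 e = 0 \<or> arrs s 9 e = 1) \<and>
   (\<forall>v\<in>C. (hadj eu ev (hset (arrs s 9)))\<^sup>*\<^sup>* v rt) \<and>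
   (\<forall>v. card (inc eu ev (hset (arrs s 9)) v) \<le> k) \<and> card {v. v < n \<and> card (inc eu ev (hset (arrs s 9)) v) = k} < p"

lemma core_inv_same:
 assumes "core_inv k C s" "core_same C s s'"
 shows "core_inv k C s'"
proof -
 have e: "arrs s' 17 = arrs s 17" "\<And>v. v \<in> C ==> arrs s' 11 v = arrs s 11 v" using assms(2) unfolding core_same_def by blast+
 have c1: "{c \<in> C. c \<noteq> rt \<and> arrs s' 11 c = v} = {c \<in> C. c \<noteq> rt \<and> arrs s 11 c = v}" for v using e(2) by auto
 have c2: "(\<exists>c\<in>C. c \<noteq> rt \<and> arrs s' 11 c = v) \<longleftrightarrow> (\<exists>c\<in>C. c \<noteq> rt \<and> arrs s 11 c = v)" for v using e(2) by auto
 have "core_inv k C s' = core_inv k C s" unfolding core_inv_def e(1) c1 c2 ..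
 then show ?thesis using assms(1) by simp
qed

lemma core_same_trans: "core_same C s s1 ==> core_same C s1 s2 ==> core_same C s s2"
 unfolding core_same_def by simp

text \<open>The vertex \<open>regs s 23\<close> loses an edge without gaining one. A marked freed
  vertex gains one edge and loses one. A marked vertex of \<open>C\<close> that was never blocked
  had degree at most \<open>k - 2\<close> and stays below \<open>k\<close>; one that is not marked
  gains nothing; and outside \<open>C\<close> the degree is at most \<open>2 < k\<close>.\<close>

lemma improve_step:
 assumes RB: "round_base k C s" and CI: "core_inv k C s" and hit: "regs s 23 \<in> unblk k C s" "arrs s 17 (regs s 23) = k" and k: "4 \<le> k"
 shows "tr W improve s (16 * n + 3) (improved k (card {v \<in> C. arrs s 17 v = k}) C)"
proof -
 note D = round_baseD[OF RB] and R = round_base_core[OF RB]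
 obtain rk \<tau> pos where IM: "improvement (Vof s) rt (arrs s 11) pos C (live s) (unblk k C s) rk m eu ev (arrs s 12) (arrs s 25) (arrs s 26)"
  and ord: "\<forall>i j. i < j --> j < regs s 19 --> rk (arrs s 16 i) \<le> rk (arrs s 16 j)"
  using D(14) unfolding ranked_def by (elim exE conjE) (rule that)
 let ?w = "regs s 23"
 have imp: "tr W improve s (16 * n + 3) (\<lambda>s'. (\<forall>e<m. arrs s' 9 e = 0 \<or> arrs s' 9 e = 1) \<and>
   (\<forall>v\<in>C. (hadj eu ev (hset (arrs s' 9)))\<^sup>*\<^sup>* v rt) \<and>
   (\<exists>M. ?w \<in> M \<and> M \<subseteq> live s \<and> (\<forall>v\<in>C. card (inc eu ev (hset (arrs s' 9)) v) + of_bool (v \<in> M \<inter> unblk k C s) \<le>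
     card (inc eu ev (arrs s 12 ` (C - {rt})) v) + of_bool (v \<in> M - {?w}))) \<and>
   (\<forall>v. v \<notin> C --> card (inc eu ev (hset (arrs s' 9)) v) \<le> 2))"
  by (rule improve[OF IM D(1) R(3) _ D(12,13) round_ne[OF RB] _ D(10,11) hit(1)])
   (use ord in blast, use D(9) in blast)
 show ?thesis
 proof (rule tr_cons[OF imp order_refl])
  fix s' :: state
  assume Q: "(\<forall>e<m. arrs s' 9 e = 0 \<or> arrs s' 9 e = 1) \<and>
   (\<forall>v\<in>C. (hadj eu ev (hset (arrs s' 9)))\<^sup>*\<^sup>* v rt) \<and>
   (\<exists>M. ?w \<in> M \<and> M \<subseteq> live s \<and> (\<forall>v\<in>C. card (inc eu ev (hset (arrs s' 9)) v) + of_bool (v \<in> M \<inter> unblk k C s) \<le>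
     card (inc eu ev (arrs s 12 ` (C - {rt})) v) + of_bool (v \<in> M - {?w}))) \<and>
   (\<forall>v. v \<notin> C --> card (inc eu ev (hset (arrs s' 9)) v) \<le> 2)"
  let ?h = "\<lambda>v. card (inc eu ev (hset (arrs s' 9)) v)"
  from Q obtain M where M: "?w \<in> M" "M \<subseteq> live s" "\<forall>v\<in>C. ?h v + of_bool (v \<in> M \<inter> unblk k C s) \<le>
     card (inc eu ev (arrs s 12 ` (C - {rt})) v) + of_bool (v \<in> M - {?w})" by (elim conjE exE) (rule that)
  from Q have out: "\<forall>v. v \<notin> C --> ?h v \<le> 2" and q1: "\<forall>e<m. arrs s' 9 e = 0 \<or> arrs s' 9 e = 1"
   and q2: "\<forall>v\<in>C. (hadj eu ev (hset (arrs s' 9)))\<^sup>*\<^sup>* v rt" by - (elim conjE, assumption)+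
  have dg: "card (inc eu ev (arrs s 12 ` (C - {rt})) v) = arrs s 17 v" if "v \<in> C" for v
   using improvement.hdeg_tree[OF IM that] CI that unfolding core_inv_def by simp
  have key: "?h v \<le> k \<and> (?h v = k --> arrs s 17 v = k \<and> v \<noteq> ?w)" if v: "v \<in> C" for v
  proof -
   have a: "?h v + of_bool (v \<in> M \<inter> unblk k C s) \<le> arrs s 17 v + of_bool (v \<in> M - {?w})" using bspec[OF M(3) v] dg[OF v] by simp
   have le: "arrs s 17 v \<le> k" using CI v unfolding core_inv_def by blast
   consider "v = ?w" | "v \<in> M" "v \<noteq> ?w" "v \<in> unblk k C s" | "v \<in> M" "v \<noteq> ?w" "v \<notin> unblk k C s" | "v \<notin> M" "v \<noteq> ?w" using M(1) by blast
   then show ?thesis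
   proof cases
    case 1
    then have "?h v + 1 \<le> arrs s 17 v" using a M(1) hit(1) by simp
    then show ?thesis using le by linarith
   next
    case 2
    then have "?h v \<le> arrs s 17 v" using a by simp
    then show ?thesis using le 2 by linarith
   next
    case 3
    have "arrs s 14 v = 0" using 3 M(2) unfolding live_def by blast
    then have "\<not> k - 1 \<le> arrs s 17 v" using 3 v unfolding unblk_def by blast
    moreover have "?h v \<le> arrs s 17 v + 1" using a 3 by simp
    ultimately show ?thesis using k by linarith
   next
    case 4
    then have "?h v \<le> arrs s 17 v" using a by simp
    then show ?thesis using le 4 by linarith
   qed
  qed
  have all: "?h v \<le> k \<and> (?h v = k --> v \<in> {v \<in> C. arrs s 17 v = k} - {?w})" for v
  proof (cases "v \<in> C")
   case True
   then show ?thesis using key[OF True] by simp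
  next
   case False
   then have "?h v \<le> 2" using out by simp
   then show ?thesis using k by linarith
  qed
  have wS: "?w \<in> {v \<in> C. arrs s 17 v = k}" using hit unfolding unblk_def by simp
  have fS: "finite {v \<in> C. arrs s 17 v = k}" using R(4) by simp
  have "{v. v < n \<and> ?h v = k} \<subseteq> {v \<in> C. arrs s 17 v = k} - {?w}" using all by blast
  then have "card {v. v < n \<and> ?h v = k} \<le> card ({v \<in> C. arrs s 17 v = k} - {?w})" using fS by (intro card_mono) auto
  also have "\<dots> < card {v \<in> C. arrs s 17 v = k}" using fS wS by (rule card_Diff1_less)
  finally show "improved k (card {v \<in> C. arrs s 17 v = k}) C s'"
   unfolding improved_def using q1 q2 all by blast
 qed
qed

text \<open>\<open>i\<close> counts the rounds of the phase, and the budget \<open>z\<close> pays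
  for the indices of \<open>rounds\<close> from \<open>i\<close> on. The blocked set keeps all
  vertices of degree \<open>k\<close>, so \<open>i\<close> cannot leave \<open>rounds\<close> while
  the loop runs.\<close>

definition rl_inv :: "nat \<Rightarrow> nat set \<Rightarrow> nat \<Rightarrow> state \<Rightarrow> nat \<Rightarrow> state \<Rightarrow> bool" where
 "rl_inv k C N s z s' \<longleftrightarrow> core_same C s s' \<and>
   (if regs s' 22 = 0
   then 1 \<le> z \<and> (regs s' 5 = 0 \<and> stop_ok k \<or> regs s' 5 = 1 \<and> improved k (card {v \<in> C. arrs s 17 v = k}) C s')
   else \<exists>i. regs s' 22 = 1 \<and> regs s' 5 = 1 \<and> round_base k C s' \<and> regs s' 20 = card (blk s') \<and>
    {v \<in> C. arrs s 17 v = k} \<subseteq> blk s' \<and> 2 ^ i * card (blk s') * (k - 1) \<le> N \<and>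
    1 + 160 * (n + m + 1) * card {i' \<in> rounds N k (card {v \<in> C. arrs s 17 v = k}). i \<le> i'} \<le> z)"

lemma rl_invI:
 assumes "core_same C s s'" "regs s' 22 = 1" "regs s' 5 = 1" "round_base k C s'" "regs s' 20 = card (blk s')"
  "{v \<in> C. arrs s 17 v = k} \<subseteq> blk s'" "2 ^ i * card (blk s') * (k - 1) \<le> N"
  "1 + 160 * (n + m + 1) * card {i' \<in> rounds N k (card {v \<in> C. arrs s 17 v = k}). i \<le> i'} \<le> z"
 shows "rl_inv k C N s z s'"
proof -
 have ne: "regs s' 22 \<noteq> 0" using assms(2) by simp
 show ?thesis unfolding rl_inv_def if_not_P[OF ne] using assms by blast
qed

lemma round_loop:
 assumes RB: "round_base k C s" and CI: "core_inv k C s" and nw: "regs s 20 = card (blk s)"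
  and S: "{v \<in> C. arrs s 17 v = k} \<subseteq> blk s" and k: "4 \<le> k" and p: "{v \<in> C. arrs s 17 v = k} \<noteq> {}"
  and r: "regs s 22 = 1" "regs s 5 = 1" and N: "card (blk s) * (k - 1) \<le> N"
 shows "tr W round_loop s (1 + 160 * (n + m + 1) * card (rounds N k (card {v \<in> C. arrs s 17 v = k})))
  (\<lambda>s'. core_same C s s' \<and> (regs s' 5 = 0 \<and> stop_ok k \<or> regs s' 5 = 1 \<and> improved k (card {v \<in> C. arrs s 17 v = k}) C s'))"
proof -
 let ?S = "{v \<in> C. arrs s 17 v = k}" and ?U = "160 * (n + m + 1)"
 let ?R = "rounds N k (card ?S)"
 have fC: "finite C" using round_base_core[OF RB] by blast
 have p1: "1 \<le> card ?S" using p fC by (simp add: Suc_le_eq card_gt_0_iff)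
 have finR: "finite ?R" using finite_rounds[OF p1 k] .
 have "tr W round_loop s (1 + ?U * card ?R) (\<lambda>s'. \<not> holds (NotEqual 22 0) s' \<and> (\<exists>z. rl_inv k C N s z s'))"
  unfolding round_loop_def
 proof (rule tr_while)
  have cs: "core_same C s s" using round_baseD(1)[OF RB] unfolding core_same_def by simp
  have e: "{i' \<in> ?R. 0 \<le> i'} = ?R" by simp
  show "rl_inv k C N s (1 + ?U * card ?R) s"
   by (rule rl_invI[where i = 0, OF cs r RB nw S]) (use N e in simp_all)
 next
  fix z s1 assume I: "rl_inv k C N s z s1" and h: "holds (NotEqual 22 0) s1"
  have cs1: "core_same C s s1" using I unfolding rl_inv_def by (rule conjunct1)
  have st1: "static s1" using cs1 unfolding core_same_def by blast
  have "regs s1 22 \<noteq> 0" using h staticD(1)[OF st1] by simp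
  then obtain i where i: "regs s1 22 = 1" "regs s1 5 = 1" "round_base k C s1" "regs s1 20 = card (blk s1)"
   "?S \<subseteq> blk s1" "2 ^ i * card (blk s1) * (k - 1) \<le> N" "1 + ?U * card {i' \<in> ?R. i \<le> i'} \<le> z"
   using I unfolding rl_inv_def by (simp only: if_False) (elim conjE exE, rule that)
  have d1: "arrs s1 17 = arrs s 17" and r18: "regs s1 18 = regs s 18" using cs1 unfolding core_same_def by blast+
  have fb: "finite (blk s1)" unfolding blk_def by simp
  have le1: "card ?S \<le> card (blk s1)" using card_mono[OF fb i(5)] .
  \<comment> \<open>The vertices of degree \<open>k\<close> are all blocked, so the bound on the
    blocked set puts \<open>i\<close> into \<open>rounds\<close>, where its share of the budget
    lies.\<close>
  have "card ?S * (k - 1) * 2 ^ i = card ?S * (2 ^ i * (k - 1))" by (simp only: ac_simps)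
  also have "\<dots> \<le> card (blk s1) * (2 ^ i * (k - 1))" by (rule mult_le_mono1[OF le1])
  also have "\<dots> = 2 ^ i * card (blk s1) * (k - 1)" by (simp only: ac_simps)
  also note i(6)
  finally have iR: "i \<in> ?R" unfolding rounds_def by blast
  have "{i' \<in> ?R. i \<le> i'} = insert i {i' \<in> ?R. Suc i \<le> i'}" using iR by auto
  moreover have "i \<notin> {i' \<in> ?R. Suc i \<le> i'}" by simp
  ultimately have cR: "card {i' \<in> ?R. i \<le> i'} = Suc (card {i' \<in> ?R. Suc i \<le> i'})" using finR by simp
  let ?z' = "1 + ?U * card {i' \<in> ?R. Suc i \<le> i'}"
  have zz: "?U + ?z' \<le> z" using i(7) unfolding cR by simp
  have "tr W (search_round ;; decide) s1 ((88 * n + 61 * m + 23) + (16 * n + 10)) (rl_inv k C N s ?z')"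
  proof (rule tr_seq[OF search_round[OF i(3)]])
   fix s2 assume f: "frame search_round s1 s2" and Q: "searched k C s1 s2"
   have RB2: "round_base k C s2" and bs: "blk s2 \<subseteq> blk s1" and nf: "regs s2 21 + card (blk s2) = card (blk s1)"
    and sp: "separated (blk s1) s2" and q1: "\<forall>v\<in>C. arrs s2 11 v = arrs s1 11 v \<and> arrs s2 12 v = arrs s1 12 v"
    and q2: "\<forall>j<regs s1 18. arrs s2 13 j = arrs s1 13 j"
    and fd: "if regs s2 28 = 0 then \<forall>w\<in>unblk k C s2 - unblk k C s1. arrs s2 17 w \<noteq> k
     else regs s2 23 \<in> unblk k C s2 \<and> arrs s2 17 (regs s2 23) = k"
    using Q unfolding searched_def by - (elim conjE, assumption)+
   have st2: "static s2" using round_baseD(1)[OF RB2] .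
   have f2: "arrs s2 17 = arrs s1 17" "regs s2 18 = regs s1 18" "regs s2 20 = regs s1 20" "regs s2 22 = 1" "regs s2 5 = 1"
    using frame_arrs[OF f, of 17] frame_regs[OF f] i by simp_all
   have "core_same C s1 s2" unfolding core_same_def using st2 q1 q2 f2 by blast
   then have cs2: "core_same C s s2" using core_same_trans[OF cs1] by blast
   have CI2: "core_inv k C s2" using core_inv_same[OF CI cs2] .
   have d2: "arrs s2 17 = arrs s 17" using f2 d1 by simp
   have fb2: "finite (blk s2)" unfolding blk_def by simp
   show "tr W decide s2 (16 * n + 10) (rl_inv k C N s ?z')"
    unfolding decide_def
   proof (rule tr_le[OF tr_If[where T = "16 * n + 4"]])
    assume "holds (NotEqual 28 0) s2"
    then have "regs s2 28 \<noteq> 0" using staticD(1)[OF st2] by simp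
    then have hit: "regs s2 23 \<in> unblk k C s2" "arrs s2 17 (regs s2 23) = k" using fd by simp_all
    have "tr W (improve ;; Const 22 0) s2 ((16 * n + 3) + 1) (rl_inv k C N s ?z')"
    proof (rule tr_seq[OF improve_step[OF RB2 CI2 hit k]])
     fix s3 assume f3: "frame improve s2 s3" and im: "improved k (card {v \<in> C. arrs s2 17 v = k}) C s3"
     let ?s4 = "set_reg 22 0 s3"
     have st3: "static s3" using static_frame[OF st2 f3] by simp
     have "core_same C s2 ?s4" unfolding core_same_def using frame_arrs[OF f3] frame_regs[OF f3, of 18] st3 by simp
     then have "core_same C s ?s4" using core_same_trans[OF cs2] by blast
     moreover have "improved k (card ?S) C ?s4" using im unfolding improved_def d2 by simp
     moreover have "regs ?s4 5 = 1" using frame_regs[OF f3, of 5] f2 by simp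
     ultimately have "rl_inv k C N s ?z' ?s4" unfolding rl_inv_def by simp
     then show "tr W (Const 22 0) s3 1 (rl_inv k C N s ?z')" by (intro tr_wp) simp_all
    qed
    then show "tr W (improve ;; Const 22 0) s2 (16 * n + 4) (rl_inv k C N s ?z')" by (rule tr_le) simp
   next
    assume "\<not> holds (NotEqual 28 0) s2"
    then have "regs s2 28 = 0" using staticD(1)[OF st2] by simp
    then have nS: "\<forall>w\<in>unblk k C s2 - unblk k C s1. arrs s2 17 w \<noteq> k" using fd by simp
    \<comment> \<open>A vertex of degree \<open>k\<close> freed in this round would have set
      register 28.\<close>
    have S2: "?S \<subseteq> blk s2"
    proof
     fix v assume v: "v \<in> ?S"
     then have v1: "v \<in> blk s1" "v \<in> C" "arrs s2 17 v = k" using i(5) d2 by auto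
     have vV: "v \<in> Vof s2" using v1(2) round_base_core(2)[OF RB2] by blast
     show "v \<in> blk s2"
     proof (rule ccontr)
      assume "v \<notin> blk s2"
      then have "arrs s2 14 v = 0" using vV unfolding blk_def by blast
      then have "v \<in> unblk k C s2" unfolding unblk_def using v1 by simp
      moreover have "v \<notin> unblk k C s1" using v1(1) unfolding blk_def unblk_def by blast
      ultimately show False using nS v1(3) by blast
     qed
    qed
    have ne2: "blk s2 \<noteq> {}" using S2 p by blast
    have nfn: "regs s2 21 \<le> n"
    proof -
     have "blk s1 \<subseteq> {..<n}" using round_base_core[OF i(3)] by blast
     then have "card (blk s1) \<le> n" using card_mono[of "{..<n}" "blk s1"] by simp
     then show ?thesis using nf by linarith
    qed
    have bW: "regs s2 21 + regs s2 21 \<le> W" using nfn W8 by linarith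
    have stop: "rl_inv k C N s ?z' s3"
     if le: "regs s2 21 + regs s2 21 \<le> regs s2 20" and s3: "regs s3 22 = 0" "regs s3 5 = 0" "core_same C s2 s3" for s3
    proof -
     have "card (blk s1) \<le> 2 * card (blk s2)" using le nf f2(3) i(4) by linarith
     moreover have "blk s1 \<subseteq> {v \<in> C. k - 1 \<le> arrs s2 17 v}"
      using round_baseD(8)[OF i(3)] f2(1) unfolding blk_def by auto
     ultimately have "stop_ok k" unfolding stop_ok_def
      using RB2 CI2 sp bs ne2 k by blast
     then show ?thesis unfolding rl_inv_def using s3 core_same_trans[OF cs2 s3(3)] by simp
    qed
    have cont: "rl_inv k C N s ?z' s3"
     if gt: "\<not> regs s2 21 + regs s2 21 \<le> regs s2 20" and s3: "regs s3 20 = regs s2 20 - regs s2 21" "arrs s3 = arrs s2"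
      "\<And>r. r \<notin> {20, 25} ==> regs s3 r = regs s2 r" for s3
    proof -
     have g: "regs s3 0 = regs s2 0" "regs s3 1 = regs s2 1" "regs s3 2 = regs s2 2" "regs s3 3 = regs s2 3" "regs s3 4 = regs s2 4"
      "regs s3 7 = regs s2 7" "regs s3 17 = regs s2 17" "regs s3 18 = regs s2 18" "regs s3 19 = regs s2 19" using s3(3) by simp_all
     have "round_base k C s3 = round_base k C s2"
      unfolding round_base_def static_def unblk_def ranked_def live_def s3(2) g by (rule refl)
     then have rb: "round_base k C s3" using RB2 by simp
     have "core_same C s2 s3" unfolding core_same_def using s3 round_baseD(1)[OF rb] by simp
     then have c3: "core_same C s s3" using core_same_trans[OF cs2] by blast
     have b3: "blk s3 = blk s2" unfolding blk_def using s3 by simp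
     have n3: "regs s3 20 = card (blk s3)" unfolding b3 s3(1) using nf f2(3) i(4) by linarith
     have le2: "2 * card (blk s2) \<le> card (blk s1)" using gt nf f2(3) i(4) by linarith
     have "2 ^ Suc i * card (blk s3) * (k - 1) = (2 * card (blk s2)) * (2 ^ i * (k - 1))" unfolding b3 power_Suc by (simp only: ac_simps)
     also have "\<dots> \<le> card (blk s1) * (2 ^ i * (k - 1))" by (rule mult_le_mono1[OF le2])
     also have "\<dots> = 2 ^ i * card (blk s1) * (k - 1)" by (simp only: ac_simps)
     also note i(6)
     finally have N3: "2 ^ Suc i * card (blk s3) * (k - 1) \<le> N" .
     show ?thesis by (rule rl_invI[OF c3 _ _ rb n3 _ N3]) (use s3 f2 S2 b3 in simp_all)
    qed
    have csx: "core_same C s2 (set_reg 5 0 (set_reg 22 0 (set_reg 25 x s2)))" for x unfolding core_same_def using st2 by simp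
    let ?x = "regs s2 21 + regs s2 21"
    define Q where "Q = rl_inv k C N s ?z'"
    have g1: "?x \<le> regs s2 20 ==> Q (set_reg 5 0 (set_reg 22 0 (set_reg 25 ?x s2)))"
     unfolding Q_def by (rule stop) (use csx in simp_all)
    have g2: "\<not> ?x \<le> regs s2 20 ==> Q (set_reg 20 (regs s2 20 - regs s2 21) (set_reg 25 ?x s2))"
     unfolding Q_def by (rule cont) simp_all
    have "tr W (Add 25 21 21 ;; If (LessEq 25 20) (Const 22 0 ;; Const 5 0) (Sub 20 20 21)) s2 4 Q"
     by (rule tr_wp) (use g1 g2 bW in simp_all)
    then have "tr W (Add 25 21 21 ;; If (LessEq 25 20) (Const 22 0 ;; Const 5 0) (Sub 20 20 21)) s2 4 (rl_inv k C N s ?z')"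
     unfolding Q_def .
    then show "tr W (Add 25 21 21 ;; If (LessEq 25 20) (Const 22 0 ;; Const 5 0) (Sub 20 20 21)) s2 (16 * n + 4) (rl_inv k C N s ?z')"
     by (rule tr_le) simp
   qed simp
  qed
  moreover have "(88 * n + 61 * m + 23) + (16 * n + 10) + 1 + ?z' \<le> z" using zz by simp
  ultimately show "\<exists>T z'. T + 1 + z' \<le> z \<and> tr W (search_round ;; decide) s1 T (rl_inv k C N s z')" by blast
 next
  fix z s1 assume "rl_inv k C N s z s1"
  then show "1 \<le> z" unfolding rl_inv_def by (cases "regs s1 22 = 0") auto
 qed
 then show ?thesis
 proof (rule tr_cons)
  fix s' assume "\<not> holds (NotEqual 22 0) s' \<and> (\<exists>z. rl_inv k C N s z s')"
  then obtain z where h: "\<not> holds (NotEqual 22 0) s'" and I: "rl_inv k C N s z s'" by blast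
  have c: "core_same C s s'" using I unfolding rl_inv_def by blast
  then have "regs s' 0 = 0" unfolding core_same_def using staticD(1) by blast
  then have "regs s' 22 = 0" using h by simp
  then show "core_same C s s' \<and> (regs s' 5 = 0 \<and> stop_ok k \<or> regs s' 5 = 1 \<and> improved k (card ?S) C s')"
   using I unfolding rl_inv_def by simp
 qed simp
qed

end

section \<open>Phases and the potential that bounds their total cost\<close>

section \<open>Phases\<close>

definition start :: com where
 "start = (init_phase ;; grow) ;; mark_kept ;; compress ;; Move 18 7 ;; degrees ;; max_deg"

definition prepare :: com where
 "prepare = flags ;; block ;; Const 19 0 ;; Const 22 1"

definition copy_flags :: com where
 "copy_flags = Const 6 0 ;; for_up 6 3 (Load 9 9 6 ;; Store 8 6 9)"

text \<open>A maximum degree of at most 3 meets the bound without any search, so the rounds may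
  assume \<open>4 \<le> k\<close>.\<close>

definition phase :: com where
 "phase = start ;; Const 25 3 ;; If (LessEq 17 25) (Const 5 0) (prepare ;; round_loop ;; copy_flags)"

definition main_loop :: com where
 "main_loop = While (NotEqual 5 0) phase"

lemma wr_phase [simp]:
 "wr start = {6,7,8,9,10,11,12,13,14,15,16,17,18,24}" "wa start = {10,11,12,13,14,15,17,27,28}"
 "wr prepare = {6,8,9,12,19,20,22,25}" "wa prepare = {8,9,14}"
 "wr copy_flags = {6,9}" "wa copy_flags = {8}"
 "wr phase = {5,6,7,8,9,10,11,12,13,14,15,16,17,18,19,20,21,22,23,24,25,28,29}"
 "wa phase = {8,9,10,11,12,13,14,15,16,17,18,19,20,21,22,23,24,25,26,27,28}"
 "wr main_loop = wr phase" "wa main_loop = wa phase"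
 by (auto simp: start_def prepare_def copy_flags_def phase_def main_loop_def)

context graph
begin

definition start_ok :: "nat set \<Rightarrow> state \<Rightarrow> bool" where
 "start_ok H s \<longleftrightarrow> core_ok H s \<and> regs s 18 = regs s 7 \<and> (\<forall>v<n. arrs s 14 v = 0 \<and> arrs s 15 v = 0 \<and> arrs s 27 v = 0) \<and>
   core_inv (regs s 17) (Vof s) s \<and> (\<exists>v\<in>Vof s. arrs s 17 v = regs s 17)"

lemma core_inv_set_reg [simp]: "core_inv k C (set_reg r x s) = core_inv k C s"
 unfolding core_inv_def regs_set by (rule refl)

lemma core_okD:
 assumes "core_ok H s"
 shows "static s" "tree_of s" "listed (arrs s 13) (regs s 7) (arrs s 10)" "\<forall>j. 0 < j --> j < regs s 7 --> arrs s 12 (arrs s 13 j) \<in> H"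
  "\<forall>v\<in>Vof s. tm v = 1 \<or> (\<exists>c\<in>Vof s. c \<noteq> rt \<and> arrs s 11 c = v)"
  "\<forall>v<n. tm v = 1 --> (hadj eu ev H)\<^sup>*\<^sup>* rt v --> v \<in> Vof s"
 using assms unfolding core_ok_def by - (elim conjE, assumption)+

lemma core_ok_frame:
 assumes "core_ok H s" and f: "frame c s s'" and w: "wr c \<inter> {0,1,2,3,4,7} = {}" "wa c \<inter> {2,3,4,5,6,7,10,11,12,13} = {}"
 shows "core_ok H s'"
proof -
 have st': "static s'" using static_frame[OF core_okD(1)[OF assms(1)] f] w by blast
 have e: "arrs s' 10 = arrs s 10" "arrs s' 11 = arrs s 11" "arrs s' 12 = arrs s 12" "arrs s' 13 = arrs s 13" "regs s' 7 = regs s 7"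
  by (rule frame_arrs[OF f] frame_regs[OF f], use w in blast)+
 show ?thesis using assms(1) st' unfolding core_ok_def e by blast
qed

lemma start:
 assumes stt: "static s"
 shows "tr W start s (53 * n + 26 * m + 24) (start_ok (hset (arrs s 8)))"
proof -
 let ?H = "hset (arrs s 8)"
 obtain t1 s1 where x1: "exec W (init_phase ;; grow) s t1 s1" and l1: "t1 \<le> 8 + 17 * n + 26 * m"
  and Q1: "bfs_ok s1 \<and> arrs s1 8 = arrs s 8" by (rule trE[OF bfs[OF stt]]) (rule that)
 have b1: "bfs_ok s1" and h1: "arrs s1 8 = arrs s 8" using Q1 by blast+
 have z1: "\<forall>v<n. arrs s1 14 v = 0 \<and> arrs s1 15 v = 0 \<and> arrs s1 17 v = 0 \<and> arrs s1 27 v = 0"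
  using b1 unfolding bfs_ok_def by - (elim conjE, assumption)
 obtain t2 s2 where x2: "exec W mark_kept s1 t2 s2" and l2: "t2 \<le> 12 * n + 6" and k2: "kept_ok s2 0" and f2: "frame mark_kept s1 s2"
  by (rule trE[OF mark_kept[OF b1]]) (rule that)
 have e2: "arrs s2 a = arrs s1 a" if "a \<noteq> 28" for a using frame_arrs[OF f2, of a] that by simp
 have r2: "regs s2 7 = regs s1 7" using frame_regs[OF f2, of 7] by simp
 have st1: "static s1" using b1 unfolding bfs_ok_def by (rule conjunct1)
 have st2: "static s2" using static_frame[OF st1 f2] by simp
 have "bfs_ok s2" unfolding bfs_ok_def using b1[unfolded bfs_ok_def] st2 e2 r2 by simp
 from trE[OF compress[OF this k2]] obtain t3 s3 where x3: "exec W compress s2 t3 s3" and l3: "t3 \<le> 8 * n + 4"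
  and c3: "core_ok (hset (arrs s2 8)) s3" and f3: "frame compress s2 s3" by blast
 have c3': "core_ok ?H s3" using c3 e2[of 8] h1 by simp
 have m4: "tr W (Move 18 7) s3 1 (\<lambda>s4. s4 = set_reg 18 (regs s3 7) s3)" by (rule tr_wp) simp_all
 obtain t4 s4 where x4: "exec W (Move 18 7) s3 t4 s4" and l4: "t4 \<le> 1" and Q4: "s4 = set_reg 18 (regs s3 7) s3" and f4: "frame (Move 18 7) s3 s4"
  by (rule trE[OF m4]) (rule that)
 have c4: "core_ok ?H s4" using core_ok_frame[OF c3' f4] by simp
 have e4: "arrs s4 17 = arrs s1 17" "arrs s4 14 = arrs s1 14" "arrs s4 15 = arrs s1 15" "arrs s4 27 = arrs s1 27"
  using frame_arrs[OF f3] e2 Q4 by simp_all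
 have z4: "\<forall>v<n. arrs s4 17 v = 0" using z1 unfolding e4 by blast
 note st4 = core_okD(1)[OF c4] and T4 = core_okD(2)[OF c4]
 obtain t5 s5 where x5: "exec W degrees s4 t5 s5" and l5: "t5 \<le> 10 * n + 2"
  and Q5: "\<forall>v<n. arrs s5 17 v = card (chld s4 v) + of_bool (v \<in> Vof s4 \<and> v \<noteq> rt)" and f5: "frame degrees s4 s5"
  by (rule trE[OF degrees[OF T4 st4 z4]]) (rule that)
 have c5: "core_ok ?H s5" using core_ok_frame[OF c4 f5] by simp
 obtain t6 s6 where x6: "exec W max_deg s5 t6 s6" and l6: "t6 \<le> 6 * n + 3"
  and Q6: "(\<forall>v\<in>Vof s5. arrs s5 17 v \<le> regs s6 17) \<and> (regs s6 17 = 0 \<or> (\<exists>v\<in>Vof s5. arrs s5 17 v = regs s6 17))" and f6: "frame max_deg s5 s6"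
  by (rule trE[OF max_deg[OF core_okD(2,1)[OF c5]]]) (rule that)
 have c6: "core_ok ?H s6" using core_ok_frame[OF c5 f6] by simp
 note D = core_okD[OF c6]
 have a6: "arrs s6 a = arrs s5 a" for a using frame_arrs[OF f6, of a] by simp
 have a5: "arrs s5 a = arrs s4 a" if "a \<noteq> 17" for a using frame_arrs[OF f5, of a] that by simp
 have r6: "regs s6 7 = regs s4 7" "regs s6 18 = regs s4 7" "regs s6 7 = regs s5 7" using frame_regs[OF f6] frame_regs[OF f5] Q4 by simp_all
 have V6: "Vof s6 = Vof s4" "Vof s6 = Vof s5" using r6 a6 a5 by simp_all
 have Vn: "Vof s6 \<subseteq> {..<n}" using D(2) unfolding treeP_def by blast
 have a11: "arrs s6 11 = arrs s4 11" using a6 a5 by simp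
 have dg: "arrs s6 17 v = card {c \<in> Vof s6. c \<noteq> rt \<and> arrs s6 11 c = v} + of_bool (v \<noteq> rt)" if "v \<in> Vof s6" for v
 proof -
  have "v < n" using that Vn by blast
  moreover have "chld s4 v = {c \<in> Vof s6. c \<noteq> rt \<and> arrs s6 11 c = v}" unfolding chld_def V6(1) a11 by blast
  moreover have "v \<in> Vof s4" using that V6 by blast
  ultimately show ?thesis using Q5 a6 by simp
 qed
 have mx: "\<forall>v\<in>Vof s6. arrs s6 17 v \<le> regs s6 17" using Q6 unfolding a6 r6(3) by blast
 have CI: "core_inv (regs s6 17) (Vof s6) s6" unfolding core_inv_def using dg D(5) mx by blast
 have "0 \<in> {..<regs s6 7}" "arrs s6 13 0 = rt" using D(2) unfolding treeP_def by blast+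
 then have rtV: "rt \<in> Vof s6" by (metis imageI)
 have ex: "\<exists>v\<in>Vof s6. arrs s6 17 v = regs s6 17"
 proof (cases "regs s6 17 = 0")
  case True
  then show ?thesis using mx rtV by auto
 next
  case False
  have "\<exists>v\<in>Vof s5. arrs s5 17 v = regs s6 17"
   by (rule disjE[OF conjunct2[OF Q6]]) (use False in simp, assumption)
  then show ?thesis unfolding a6 r6(3) .
 qed
 have z6: "\<forall>v<n. arrs s6 14 v = 0 \<and> arrs s6 15 v = 0 \<and> arrs s6 27 v = 0"
  using z1 a6 a5 e4 by simp
 have ok: "start_ok ?H s6" unfolding start_ok_def using c6 r6 z6 CI ex by simp
 have "exec W start s (t1 + (t2 + (t3 + (t4 + (t5 + t6))))) s6"
  unfolding start_def by (intro exec.Seq[OF x1] exec.Seq[OF x2] exec.Seq[OF x3] exec.Seq[OF x4] exec.Seq[OF x5] x6)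
 moreover have "t1 + (t2 + (t3 + (t4 + (t5 + t6)))) \<le> 53 * n + 26 * m + 24" using l1 l2 l3 l4 l5 l6 by linarith
 ultimately show ?thesis unfolding tr_def using ok by blast
qed

text \<open>Nothing is absorbed or freed yet, so a constant rank will do.\<close>

lemma ranked_start:
 assumes T: "tree_of s" and u: "unblk k (Vof s) s = {}"
 shows "ranked k (Vof s) s"
proof -
 interpret rtree "Vof s" rt "arrs s 11" "inv_into {..<regs s 7} (arrs s 13)" by (rule treeP_rtree[OF T])
 have pe: "arrs s 12 v < m \<and> (eu (arrs s 12 v) = v \<and> ev (arrs s 12 v) = arrs s 11 v \<or> eu (arrs s 12 v) = arrs s 11 v \<and> ev (arrs s 12 v) = v)"
  if v: "v \<in> Vof s" "v \<noteq> rt" for v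
 proof -
  obtain j where j: "v = arrs s 13 j" "j < regs s 7" using v(1) by blast
  have "j \<noteq> 0" using treeP_rt[OF T j(2)] j v(2) by blast
  then obtain i where "i < j" "arrs s 11 (arrs s 13 j) = arrs s 13 i" "arrs s 12 (arrs s 13 j) < m"
   "joins eu ev (arrs s 12 (arrs s 13 j)) (arrs s 13 j) (arrs s 13 i)" using treeP_par[OF T _ j(2)] by blast
  then show ?thesis unfolding j(1) joins_def by simp
 qed
 have "improvement (Vof s) rt (arrs s 11) (inv_into {..<regs s 7} (arrs s 13)) (Vof s) (live s) {} (\<lambda>_. 0) m eu ev (arrs s 12) (arrs s 25) (arrs s 26)"
 proof
  show "live s \<subseteq> Vof s" unfolding live_def by blast
  show "arrs s 12 v < m \<and> (eu (arrs s 12 v) = v \<and> ev (arrs s 12 v) = arrs s 11 v \<or> eu (arrs s 12 v) = arrs s 11 v \<and> ev (arrs s 12 v) = v)"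
   if "v \<in> Vof s" "v \<noteq> rt" for v using pe that by blast
 qed (use rootV parV in auto)
 moreover have "\<forall>v\<in>live s. (\<lambda>_. 0 :: nat) v < 1" by simp
 moreover have "\<forall>i j. i < j --> j < regs s 19 --> (\<lambda>_. 0 :: nat) (arrs s 16 i) \<le> (\<lambda>_. 0) (arrs s 16 j)" by simp
 ultimately show ?thesis unfolding ranked_def u by blast
qed

text \<open>The degrees of a tree add up to twice its number of edges, which is less than
  \<open>n\<close> and, the parent edges being distinct, at most \<open>m\<close>. Having both
  bounds turns the cost of \<open>n + m\<close> per round into a product of order
  \<open>m * n\<close>, even for graphs with few edges.\<close>

lemma sum_core_degrees:
 assumes T: "tree_of s" and CI: "core_inv k (Vof s) s" and B: "B \<subseteq> {v \<in> Vof s. k - 1 \<le> arrs s 17 v}"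
 shows "card B * (k - 1) \<le> 2 * min n m"
proof -
 interpret rtree "Vof s" rt "arrs s 11" "inv_into {..<regs s 7} (arrs s 13)" by (rule treeP_rtree[OF T])
 have BV: "B \<subseteq> Vof s" using B by blast
 have "card B * (k - 1) = (\<Sum>v\<in>B. k - 1)" by simp
 also have "\<dots> \<le> (\<Sum>v\<in>B. arrs s 17 v)" using B by (intro sum_mono) blast
 also have "\<dots> \<le> (\<Sum>v\<in>Vof s. arrs s 17 v)" using BV finV by (intro sum_mono2) auto
 also have "\<dots> = (\<Sum>v\<in>Vof s. card (children v) + of_bool (v \<noteq> rt))"
  using CI unfolding core_inv_def children_def by (intro sum.cong) blast+
 also have "\<dots> = 2 * (card (Vof s) - 1)" by (rule sum_tree_degrees)
 finally have a: "card B * (k - 1) \<le> 2 * (card (Vof s) - 1)" .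
 have "Vof s \<subseteq> {..<n}" using T unfolding treeP_def by blast
 then have cn: "card (Vof s) \<le> n" using card_mono[of "{..<n}" "Vof s"] by simp
 have rti: "\<exists>i. i < regs s 7 \<and> i \<noteq> 0 \<and> arrs s 13 i = v" if "v \<in> Vof s - {rt}" for v
  using that treeP_rt[OF T] by blast
 have "inj_on (arrs s 12) (Vof s - {rt})"
 proof (rule inj_onI)
  fix u v assume u: "u \<in> Vof s - {rt}" and v: "v \<in> Vof s - {rt}" and e: "arrs s 12 u = arrs s 12 v"
  obtain i where i: "i < regs s 7" "i \<noteq> 0" "arrs s 13 i = u" using rti[OF u] by blast
  obtain j where j: "j < regs s 7" "j \<noteq> 0" "arrs s 13 j = v" using rti[OF v] by blast
  obtain i' where i': "i' < i" "joins eu ev (arrs s 12 u) u (arrs s 13 i')" using treeP_par[OF T _ i(1)] i by blast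
  obtain j' where j': "j' < j" "joins eu ev (arrs s 12 v) v (arrs s 13 j')" using treeP_par[OF T _ j(1)] j by blast
  show "u = v"
  proof (rule ccontr)
   assume ne: "u \<noteq> v"
   have "u = arrs s 13 j'" "v = arrs s 13 i'" using i'(2) j'(2) ne unfolding e joins_def by auto
   then have "i = j'" "j = i'" using treeP_inj[OF T] i j i' j' by (metis less_trans)+
   then show False using i'(1) j'(1) by simp
  qed
 qed
 moreover have "arrs s 12 ` (Vof s - {rt}) \<subseteq> {..<m}"
 proof
  fix e assume "e \<in> arrs s 12 ` (Vof s - {rt})"
  then obtain v where v: "v \<in> Vof s - {rt}" "e = arrs s 12 v" by blast
  obtain j where j: "j < regs s 7" "j \<noteq> 0" "arrs s 13 j = v" using rti[OF v(1)] by blast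
  obtain i where "arrs s 12 v < m" using treeP_par[OF T _ j(1)] j by blast
  then show "e \<in> {..<m}" using v(2) by simp
 qed
 ultimately have "card (Vof s - {rt}) \<le> m" using card_inj_on_le[of "arrs s 12" "Vof s - {rt}" "{..<m}"] by simp
 then have "card (Vof s) - 1 \<le> m" using rootV finV by (simp add: card_Diff_singleton)
 then show ?thesis using a cn by linarith
qed

lemma copy_flags:
 assumes stt: "static s"
 shows "tr W copy_flags s (4 * m + 2) (\<lambda>s'. \<forall>e<m. arrs s' 8 e = arrs s 9 e)"
proof -
 let ?b = "Load 9 9 6 ;; Store 8 6 9"
 have "tr W copy_flags s (m * (2 + 2) + 2) (\<lambda>s'. (\<forall>e<m. arrs s' 8 e = arrs s 9 e) \<and> regs s' 6 = m)"
  unfolding copy_flags_def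
 proof (rule tr_for_up0[where T = 2 and I = "\<lambda>j s'. \<forall>e<j. arrs s' 8 e = arrs s 9 e"])
  fix j s' assume I: "\<forall>e<j. arrs s' 8 e = arrs s 9 e" and j: "j < m" "regs s' 6 = j" and f: "frame (for_up 6 3 ?b) s s'"
  have k: "arrs s' 9 = arrs s 9" using frame_arrs[OF f, of 9] by simp
  show "tr W ?b s' 2 (\<lambda>s'. \<forall>e<Suc j. arrs s' 8 e = arrs s 9 e)"
   by (rule tr_wp) (use I in \<open>simp_all add: j k less_Suc_eq\<close>)
 qed (use stt W in \<open>auto simp: staticD\<close>)
 then show ?thesis by (rule tr_cons) auto
qed

definition prepare_ok :: "state \<Rightarrow> state \<Rightarrow> bool" where
 "prepare_ok s s' \<longleftrightarrow> round_base (regs s 17) (Vof s) s' \<and> core_inv (regs s 17) (Vof s) s' \<and> regs s' 20 = card (blk s') \<and>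
   regs s' 18 = regs s 18 \<and> arrs s' 11 = arrs s 11 \<and> arrs s' 12 = arrs s 12 \<and> arrs s' 13 = arrs s 13 \<and> arrs s' 17 = arrs s 17 \<and>
   blk s' = {v \<in> Vof s. regs s 17 - 1 \<le> arrs s 17 v} \<and> regs s' 22 = 1 \<and> regs s' 5 = regs s 5"

lemma prepare:
 assumes ok: "start_ok H s"
 shows "tr W prepare s (13 * n + 4 * m + 11) (prepare_ok s)"
proof -
 have c: "core_ok H s" and r18: "regs s 18 = regs s 7" and z: "\<forall>v<n. arrs s 14 v = 0 \<and> arrs s 15 v = 0 \<and> arrs s 27 v = 0"
  and CI: "core_inv (regs s 17) (Vof s) s" using ok unfolding start_ok_def by blast+
 note D = core_okD[OF c]
 let ?k = "regs s 17"
 obtain t1 s1 where x1: "exec W flags s t1 s1" and l1: "t1 \<le> 4 * m + 5 * n + 5"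
  and Q1: "(\<forall>e<m. arrs s1 8 e = 1) \<and> (\<forall>e<m. arrs s1 9 e = of_bool (e \<in> arrs s 12 ` (Vof s - {rt})))" and f1: "frame flags s s1"
  by (rule trE[OF flags[OF D(2,1)]]) (rule that)
 have c1: "core_ok H s1" using core_ok_frame[OF c f1] by simp
 note D1 = core_okD[OF c1]
 have a1: "arrs s1 a = arrs s a" if "a \<notin> {8,9}" for a using frame_arrs[OF f1, of a] that by simp
 have r1: "regs s1 7 = regs s 7" "regs s1 17 = regs s 17" "regs s1 18 = regs s 18" "regs s1 5 = regs s 5" using frame_regs[OF f1] by simp_all
 have z1: "\<forall>v<n. arrs s1 14 v = 0" using z a1 by simp
 have V1: "Vof s1 = Vof s" using a1 r1 by simp
 obtain t2 s2 where x2: "exec W block s1 t2 s2" and l2: "t2 \<le> 8 * n + 4"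
  and Q2: "(\<forall>v<n. arrs s2 14 v = of_bool (v \<in> Vof s1 \<and> regs s1 17 - 1 \<le> arrs s1 17 v)) \<and> regs s2 20 = card {v \<in> Vof s1. regs s1 17 - 1 \<le> arrs s1 17 v}"
  and f2: "frame block s1 s2"
  by (rule trE[OF block[OF D1(2,1) z1]]) (rule that)
 have a17: "arrs s1 17 = arrs s 17" using a1 by simp
 have Q2': "(\<forall>v<n. arrs s2 14 v = of_bool (v \<in> Vof s \<and> ?k - 1 \<le> arrs s 17 v)) \<and> regs s2 20 = card {v \<in> Vof s. ?k - 1 \<le> arrs s 17 v}"
  using Q2 unfolding V1 unfolding r1 a17 .
 have c2: "core_ok H s2" using core_ok_frame[OF c1 f2] by simp
 have a2: "arrs s2 a = arrs s a" if "a \<notin> {8,9,14}" for a using frame_arrs[OF f2, of a] a1[of a] that by simp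
 have a2': "arrs s2 8 = arrs s1 8" "arrs s2 9 = arrs s1 9" using frame_arrs[OF f2] by simp_all
 have r2: "regs s2 7 = regs s 7" "regs s2 17 = regs s 17" "regs s2 18 = regs s 18" "regs s2 5 = regs s 5" using frame_regs[OF f2] r1 by simp_all
 let ?s = "set_reg 22 1 (set_reg 19 0 s2)"
 have c3: "core_ok H ?s" using core_ok_frame[OF c2, of "Const 19 0 ;; Const 22 1" ?s] by (simp add: frame_def)
 note D3 = core_okD[OF c3]
 have V3: "Vof ?s = Vof s" using a2 r2 by simp
 have Vn: "Vof s \<subseteq> {..<n}" using D(2) unfolding treeP_def by blast
 have bl: "arrs ?s 14 v = of_bool (v \<in> Vof s \<and> ?k - 1 \<le> arrs s 17 v)" if "v < n" for v
  using Q2' that by simp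
 have b3: "blk ?s = {v \<in> Vof s. ?k - 1 \<le> arrs s 17 v}" unfolding blk_def V3 using bl Vn by auto
 have u3: "unblk ?k (Vof s) ?s = {}" unfolding unblk_def using bl Vn a2[of 17] by auto
 have rk: "ranked ?k (Vof s) ?s" using ranked_start[OF D3(2), of ?k] u3 unfolding V3 by blast
 have e3: "arrs ?s 11 = arrs s 11" "arrs ?s 12 = arrs s 12" "arrs ?s 13 = arrs s 13" "arrs ?s 17 = arrs s 17"
  "arrs ?s 15 = arrs s 15" "arrs ?s 27 = arrs s 27" using a2 by simp_all
 have g3: "regs ?s 17 = ?k" "regs ?s 18 = regs s 7" "regs ?s 7 = regs s 7" "regs ?s 19 = 0" "regs ?s 5 = regs s 5" "regs ?s 22 = 1"
  using r2 r18 by simp_all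
 have pos: "0 < regs s 7" using treeP_cnt[OF D(2)] by blast
 have ff: "\<forall>e<m. arrs ?s 8 e = 1" "\<forall>e<m. arrs ?s 9 e = of_bool (e \<in> arrs s 12 ` (Vof s - {rt}))" using Q1 a2' by simp_all
 have out: "\<forall>v<n. v \<notin> Vof s --> arrs ?s 14 v = 0 \<and> arrs s 15 v = 0" using bl z by simp
 have inn: "\<forall>v\<in>Vof s. arrs ?s 14 v \<noteq> 0 --> v \<in> Vof s \<and> ?k - 1 \<le> arrs s 17 v" using bl Vn by auto
 have ab: "\<forall>v\<in>Vof s. arrs s 15 v \<noteq> 0 \<longleftrightarrow> v \<notin> Vof s" using z Vn by auto
 have em: "inj_on (arrs ?s 16) {..<0::nat}" "arrs ?s 16 ` {..<0::nat} = (Vof s - Vof s) \<union> {}" by simp_all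
 have RB: "round_base ?k (Vof s) ?s"
  unfolding round_base_def V3 u3 e3 g3 using D3(1,2,3) pos ff out inn ab z em rk unfolding e3 g3 by blast
 have CI3: "core_inv ?k (Vof s) ?s" using CI unfolding core_inv_def e3 .
 have "regs ?s 20 = card (blk ?s)" unfolding b3 using Q2' by simp
 then have "prepare_ok s ?s" unfolding prepare_ok_def using RB CI3 b3 e3 g3 r18 by simp
 then have "tr W (Const 19 0 ;; Const 22 1) s2 2 (prepare_ok s)" using W8 by (intro tr_wp) simp_all
 then obtain t3 s3 where x3: "exec W (Const 19 0 ;; Const 22 1) s2 t3 s3" and l3: "t3 \<le> 2" and Q3: "prepare_ok s s3" unfolding tr_def by blast
 have "exec W prepare s (t1 + (t2 + t3)) s3" unfolding prepare_def by (intro exec.Seq[OF x1] exec.Seq[OF x2] x3)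
 moreover have "t1 + (t2 + t3) \<le> 13 * n + 4 * m + 11" using l1 l2 l3 by linarith
 ultimately show ?thesis unfolding tr_def using Q3 by blast
qed

definition finished :: "state \<Rightarrow> bool" where
 "finished s \<longleftrightarrow> static s \<and> regs s 5 = 0 \<and> treeP (arrs s 13) (regs s 18) (arrs s 11) (arrs s 12) \<and>
   (\<forall>v<n. tm v = 1 --> v \<in> arrs s 13 ` {..<regs s 18}) \<and>
   (\<exists>k. core_inv k (arrs s 13 ` {..<regs s 18}) s \<and> stop_ok k)"

text \<open>Degrees are measured in the edge set handed over, from which the next tree will be
  extracted. \<open>K\<close> and \<open>p\<close> are upper bounds only, so the start may use
  trivial values.\<close>

definition phase_in :: "nat \<Rightarrow> nat \<Rightarrow> state \<Rightarrow> bool" where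
 "phase_in K p s \<longleftrightarrow> static s \<and> regs s 5 = 1 \<and> (\<forall>v<n. tm v = 1 --> (hadj eu ev (hset (arrs s 8)))\<^sup>*\<^sup>* rt v) \<and>
   (\<forall>v. card (inc eu ev (hset (arrs s 8)) v) \<le> K) \<and> card {v. v < n \<and> card (inc eu ev (hset (arrs s 8)) v) = K} \<le> p"

lemma treeP_cong:
 assumes T: "treeP ord cnt par pe" and o: "\<forall>j<cnt. ord' j = ord j" and p: "\<forall>v\<in>ord ` {..<cnt}. par' v = par v \<and> pe' v = pe v"
 shows "treeP ord' cnt par' pe'"
proof -
 have "0 < cnt" "ord 0 = rt" "inj_on ord {..<cnt}" "ord ` {..<cnt} \<subseteq> {..<n}" using T unfolding treeP_def by blast+
 moreover have "inj_on ord' {..<cnt} = inj_on ord {..<cnt}" using o by (intro inj_on_cong) simp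
 moreover have "ord' ` {..<cnt} = ord ` {..<cnt}" using o by (intro image_cong) simp_all
 moreover have "\<exists>i<j. par' (ord' j) = ord' i \<and> pe' (ord' j) < m \<and> joins eu ev (pe' (ord' j)) (ord' j) (ord' i)" if j: "0 < j" "j < cnt" for j
 proof -
  obtain i where i: "i < j" "par (ord j) = ord i" "pe (ord j) < m" "joins eu ev (pe (ord j)) (ord j) (ord i)" using treeP_par[OF T j] by blast
  have "ord' j = ord j" "ord' i = ord i" using o i j by auto
  moreover have "par' (ord j) = par (ord j)" "pe' (ord j) = pe (ord j)" using p j by blast+
  ultimately show ?thesis using i by (intro exI[of _ i]) simp
 qed
 ultimately show ?thesis unfolding treeP_def using o by simp
qed

text \<open>Tree degrees do not exceed those in the edge set, so the pair \<open>(k, q)\<close> of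
  the extracted tree is lexicographically at most \<open>(K, p)\<close>. A phase either ends the
  search or hands on an edge set with fewer than \<open>q\<close> vertices of degree
  \<open>k\<close>.\<close>

lemma phase:
 assumes P: "phase_in K p s"
 shows "(\<exists>k q. (k < K \<or> k = K \<and> q \<le> p) \<and> 4 \<le> k \<and> 1 \<le> q \<and> q * (k - 1) \<le> 2 * min n m \<and>
   tr W phase s (80 * (n + m + 1) + 160 * (n + m + 1) * card (rounds (2 * min n m) k q)) (\<lambda>s'. finished s' \<or> phase_in k (q - 1) s')) \<or>
  tr W phase s (80 * (n + m + 1)) finished"
proof -
 let ?H = "hset (arrs s 8)" and ?N = "2 * min n m"
 have stt: "static s" and r5: "regs s 5 = 1" and trm: "\<forall>v<n. tm v = 1 --> (hadj eu ev ?H)\<^sup>*\<^sup>* rt v"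
  and hK: "\<forall>v. card (inc eu ev ?H v) \<le> K" and hp: "card {v. v < n \<and> card (inc eu ev ?H v) = K} \<le> p"
  using P unfolding phase_in_def by - (elim conjE, assumption)+
 obtain t1 s1 where x1: "exec W start s t1 s1" and l1: "t1 \<le> 53 * n + 26 * m + 24" and ok: "start_ok ?H s1" and f1: "frame start s s1"
  by (rule trE[OF start[OF stt]]) (rule that)
 have c: "core_ok ?H s1" and r18: "regs s1 18 = regs s1 7" and CI: "core_inv (regs s1 17) (Vof s1) s1" and mx: "\<exists>v\<in>Vof s1. arrs s1 17 v = regs s1 17"
  using ok unfolding start_ok_def by blast+
 note D = core_okD[OF c]
 have r51: "regs s1 5 = 1" using frame_regs[OF f1, of 5] r5 by simp
 have trV: "\<forall>v<n. tm v = 1 --> v \<in> Vof s1" using D(6) trm by blast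
 let ?C = "Vof s1" and ?k = "regs s1 17" and ?s2 = "set_reg 25 3 s1"
 have x2: "exec W (Const 25 3) s1 1 ?s2" by (rule exec.Const) (use W8 in linarith)
 have h2: "holds (LessEq 17 25) ?s2 \<longleftrightarrow> ?k \<le> 3" by simp
 show ?thesis
 proof (cases "?k \<le> 3")
  case True
  have "exec W (Const 5 0) ?s2 1 (set_reg 5 0 ?s2)" by (rule exec.Const) simp
  then have x3: "exec W (If (LessEq 17 25) (Const 5 0) (prepare ;; round_loop ;; copy_flags)) ?s2 (1 + 1) (set_reg 5 0 ?s2)"
   using True h2 by (intro exec.IfTrue) simp_all
  have "stop_ok ?k" unfolding stop_ok_def using True by blast
  moreover have "core_inv ?k ?C (set_reg 5 0 ?s2)" using CI by (simp only: core_inv_set_reg)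
  ultimately have "finished (set_reg 5 0 ?s2)" unfolding finished_def using D(1,2) trV r18 by auto
  moreover have "exec W phase s (t1 + (1 + (1 + 1))) (set_reg 5 0 ?s2)" unfolding phase_def by (intro exec.Seq[OF x1] exec.Seq[OF x2] x3)
  moreover have "t1 + (1 + (1 + 1)) \<le> 80 * (n + m + 1)" using l1 by simp
  ultimately show ?thesis unfolding tr_def by blast
 next
  case False
  then have k4: "4 \<le> ?k" by simp
  let ?S = "{v \<in> ?C. arrs s1 17 v = ?k}"
  let ?q = "card ?S"
  have "start_ok ?H ?s2 = start_ok ?H s1" unfolding start_ok_def core_ok_def core_inv_def by simp
  then have ok2: "start_ok ?H ?s2" using ok by blast
  obtain t3 s3 where x3: "exec W prepare ?s2 t3 s3" and l3: "t3 \<le> 13 * n + 4 * m + 11" and Q3: "prepare_ok ?s2 s3"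
   by (rule trE[OF prepare[OF ok2]]) (rule that)
  have RB: "round_base ?k ?C s3" and CI3: "core_inv ?k ?C s3" and nw: "regs s3 20 = card (blk s3)" and r3: "regs s3 18 = regs s1 18" "regs s3 22 = 1" "regs s3 5 = 1"
   and e3: "arrs s3 11 = arrs s1 11" "arrs s3 12 = arrs s1 12" "arrs s3 13 = arrs s1 13" "arrs s3 17 = arrs s1 17"
   and b3: "blk s3 = {v \<in> ?C. ?k - 1 \<le> arrs s1 17 v}" using Q3 r51 unfolding prepare_ok_def by simp_all
  have Sb: "{v \<in> ?C. arrs s3 17 v = ?k} \<subseteq> blk s3" unfolding b3 e3 by auto
  have Sn: "{v \<in> ?C. arrs s3 17 v = ?k} \<noteq> {}" unfolding e3 using mx by blast
  have N: "card (blk s3) * (?k - 1) \<le> ?N" by (rule sum_core_degrees[OF D(2) CI]) (simp add: b3)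
  obtain t4 s4 where x4: "exec W round_loop s3 t4 s4" and l4: "t4 \<le> 1 + 160 * (n + m + 1) * card (rounds ?N ?k (card {v \<in> ?C. arrs s3 17 v = ?k}))"
   and Q4: "core_same ?C s3 s4 \<and> (regs s4 5 = 0 \<and> stop_ok ?k \<or> regs s4 5 = 1 \<and> improved ?k (card {v \<in> ?C. arrs s3 17 v = ?k}) ?C s4)"
   by (rule trE[OF round_loop[OF RB CI3 nw Sb k4 Sn r3(2,3) N]]) (rule that)
  have cs: "core_same ?C s3 s4" using Q4 by blast
  have st4: "static s4" using cs unfolding core_same_def by blast
  obtain t5 s5 where x5: "exec W copy_flags s4 t5 s5" and l5: "t5 \<le> 4 * m + 2" and Q5: "\<forall>e<m. arrs s5 8 e = arrs s4 9 e" and f5: "frame copy_flags s4 s5"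
   by (rule trE[OF copy_flags[OF st4]]) (rule that)
  have st5: "static s5" using static_frame[OF st4 f5] by simp
  have a5: "arrs s5 a = arrs s4 a" if "a \<noteq> 8" for a using frame_arrs[OF f5, of a] that by simp
  have r5: "regs s5 18 = regs s4 18" "regs s5 5 = regs s4 5" using frame_regs[OF f5] by simp_all
  have hs: "hset (arrs s5 8) = hset (arrs s4 9)" unfolding hset_def using Q5 by auto
  have fC: "finite ?C" by simp
  have Cn: "?C \<subseteq> {..<n}" using D(2) unfolding treeP_def by blast
  have q1: "1 \<le> ?q" using mx fC by (auto simp: Suc_le_eq card_gt_0_iff)
  have qk: "?q * (?k - 1) \<le> ?N" by (rule sum_core_degrees[OF D(2) CI]) auto
  have post: "finished s5 \<or> phase_in ?k (?q - 1) s5"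
  proof (cases "regs s4 5 = 0")
   case True
   then have so: "stop_ok ?k" using Q4 by auto
   have o: "\<forall>j<regs s1 7. arrs s5 13 j = arrs s1 13 j" "\<forall>v\<in>?C. arrs s5 11 v = arrs s1 11 v \<and> arrs s5 12 v = arrs s1 12 v" "regs s5 18 = regs s1 7"
    using cs r3 r18 r5 a5 unfolding core_same_def e3 by auto
   have "treeP (arrs s5 13) (regs s1 7) (arrs s5 11) (arrs s5 12)" by (rule treeP_cong[OF D(2) o(1,2)])
   moreover have im: "arrs s5 13 ` {..<regs s1 7} = ?C" using o(1) by (intro image_cong) simp_all
   moreover have "core_same ?C s3 s5" using cs st5 a5 r5 unfolding core_same_def by simp
   then have "core_inv ?k ?C s5" by (rule core_inv_same[OF CI3])
   ultimately have "finished s5" unfolding finished_def o(3) im using st5 True r5 trV so by auto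
   then show ?thesis ..
  next
   case False
   then have r45: "regs s4 5 = 1" and im: "improved ?k ?q ?C s4" using Q4 unfolding e3 by auto
   have i1: "\<forall>v\<in>?C. (hadj eu ev (hset (arrs s4 9)))\<^sup>*\<^sup>* v rt" and i2: "\<forall>v. card (inc eu ev (hset (arrs s4 9)) v) \<le> ?k"
    and i3: "card {v. v < n \<and> card (inc eu ev (hset (arrs s4 9)) v) = ?k} < ?q"
    using im unfolding improved_def by - (elim conjE, assumption)+
   have "\<forall>v<n. tm v = 1 --> (hadj eu ev (hset (arrs s4 9)))\<^sup>*\<^sup>* rt v" using i1 trV hadj_rtranclp_sym by metis
   moreover have "card {v. v < n \<and> card (inc eu ev (hset (arrs s4 9)) v) = ?k} \<le> ?q - 1" using i3 by linarith
   ultimately have "phase_in ?k (?q - 1) s5" unfolding phase_in_def hs using st5 r5 r45 i2 by simp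
   then show ?thesis ..
  qed
  have deg: "arrs s1 17 v \<le> card (inc eu ev ?H v)" if v: "v \<in> ?C" for v
  proof -
   obtain rk \<tau> pos where IM: "improvement (Vof s3) rt (arrs s3 11) pos ?C (live s3) (unblk ?k ?C s3) rk m eu ev (arrs s3 12) (arrs s3 25) (arrs s3 26)"
    using round_baseD(14)[OF RB] unfolding ranked_def by (elim exE conjE) (rule that)
   have d3: "arrs s3 17 v = card {c \<in> ?C. c \<noteq> rt \<and> arrs s3 11 c = v} + of_bool (v \<noteq> rt)"
    using CI3 v unfolding core_inv_def by blast
   have "card (inc eu ev (arrs s3 12 ` (?C - {rt})) v) = arrs s3 17 v"
    by (rule trans[OF improvement.hdeg_tree[OF IM v] sym[OF d3]])
   then have e: "card (inc eu ev (arrs s1 12 ` (?C - {rt})) v) = arrs s1 17 v" unfolding e3 .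
   have "arrs s1 12 ` (?C - {rt}) \<subseteq> ?H"
   proof
    fix e assume "e \<in> arrs s1 12 ` (?C - {rt})"
    then obtain j where j: "j < regs s1 7" "e = arrs s1 12 (arrs s1 13 j)" "arrs s1 13 j \<noteq> rt" by blast
    then have "0 < j" using treeP_rt[OF D(2) j(1)] by blast
    then show "e \<in> ?H" using D(4) j by blast
   qed
   then have "inc eu ev (arrs s1 12 ` (?C - {rt})) v \<subseteq> inc eu ev ?H v" unfolding inc_def by blast
   moreover have "finite (inc eu ev ?H v)" unfolding inc_def hset_def by simp
   ultimately show ?thesis using card_mono e by metis
  qed
  have kK: "?k < K \<or> ?k = K \<and> ?q \<le> p"
  proof -
   obtain v where v: "v \<in> ?C" "arrs s1 17 v = ?k" using mx by blast
   have "?k \<le> K" using deg[OF v(1)] hK v(2) by (metis le_trans)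
   moreover have "?q \<le> p" if kK: "?k = K"
   proof -
    have "?S \<subseteq> {v. v < n \<and> card (inc eu ev ?H v) = K}"
    proof
     fix u assume u: "u \<in> ?S"
     then have "card (inc eu ev ?H u) = K" using deg[of u] hK kK by (auto intro: antisym)
     then show "u \<in> {v. v < n \<and> card (inc eu ev ?H v) = K}" using u Cn by blast
    qed
    then have "?q \<le> card {v. v < n \<and> card (inc eu ev ?H v) = K}" by (intro card_mono) auto
    then show ?thesis using hp by linarith
   qed
   ultimately show ?thesis by linarith
  qed
  have "exec W (prepare ;; round_loop ;; copy_flags) ?s2 (t3 + (t4 + t5)) s5" by (intro exec.Seq[OF x3] exec.Seq[OF x4] x5)
  then have x6: "exec W (If (LessEq 17 25) (Const 5 0) (prepare ;; round_loop ;; copy_flags)) ?s2 (1 + (t3 + (t4 + t5))) s5"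
   using False h2 by (intro exec.IfFalse) simp_all
  have "exec W phase s (t1 + (1 + (1 + (t3 + (t4 + t5))))) s5" unfolding phase_def by (intro exec.Seq[OF x1] exec.Seq[OF x2] x6)
  moreover have "t1 + (1 + (1 + (t3 + (t4 + t5)))) \<le> 80 * (n + m + 1) + 160 * (n + m + 1) * card (rounds ?N ?k ?q)"
  proof -
   define Z where "Z = 160 * (n + m + 1) * card (rounds ?N ?k ?q)"
   have "t4 \<le> 1 + Z" using l4 unfolding e3 Z_def .
   then have "t1 + (1 + (1 + (t3 + (t4 + t5)))) \<le> 80 * (n + m + 1) + Z" using l1 l3 l5 by (simp add: distrib_left)
   then show ?thesis unfolding Z_def .
  qed
  ultimately have "tr W phase s (80 * (n + m + 1) + 160 * (n + m + 1) * card (rounds ?N ?k ?q)) (\<lambda>s'. finished s' \<or> phase_in ?k (?q - 1) s')"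
   unfolding tr_def using post by blast
  then show ?thesis using kK k4 q1 qk by blast
 qed
qed

lemma main_loop:
 assumes P: "phase_in K p s"
 shows "tr W main_loop s (1 + 250 * (n + m + 1) * (card (trips (2 * min n m) K p) + 1)) finished"
proof -
 let ?U = "250 * (n + m + 1)" and ?N = "2 * min n m"
 define J where "J z s \<longleftrightarrow> 1 \<le> z \<and> (finished s \<or> (\<exists>K p. phase_in K p s \<and> 1 + ?U * (card (trips ?N K p) + 1) \<le> z))" for z s
 have "tr W main_loop s (1 + ?U * (card (trips ?N K p) + 1)) (\<lambda>s'. \<not> holds (NotEqual 5 0) s' \<and> (\<exists>z. J z s'))"
  unfolding main_loop_def
 proof (rule tr_while)
  show "J (1 + ?U * (card (trips ?N K p) + 1)) s" unfolding J_def using P by auto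
  show "1 \<le> z" if "J z s" for z s using that unfolding J_def by (rule conjunct1)
  fix z s1 assume I: "J z s1" and h: "holds (NotEqual 5 0) s1"
  have "\<not> finished s1" using h staticD(1) unfolding finished_def by auto
  then obtain K p where P1: "phase_in K p s1" and z: "1 + ?U * (card (trips ?N K p) + 1) \<le> z" using I unfolding J_def by blast
  from phase[OF P1] show "\<exists>T z'. T + 1 + z' \<le> z \<and> tr W phase s1 T (J z')"
  proof (elim disjE exE)
   fix k q assume a: "(k < K \<or> k = K \<and> q \<le> p) \<and> 4 \<le> k \<and> 1 \<le> q \<and> q * (k - 1) \<le> ?N \<and>
    tr W phase s1 (80 * (n + m + 1) + 160 * (n + m + 1) * card (rounds ?N k q)) (\<lambda>s'. finished s' \<or> phase_in k (q - 1) s')"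
   then have k: "4 \<le> k" "1 \<le> q" "k < K \<or> k = K \<and> q \<le> p" "q * (k - 1) \<le> ?N"
    and t: "tr W phase s1 (80 * (n + m + 1) + 160 * (n + m + 1) * card (rounds ?N k q)) (\<lambda>s'. finished s' \<or> phase_in k (q - 1) s')" by blast+
   let ?z = "1 + ?U * (card (trips ?N k (q - 1)) + 1)" and ?T = "80 * (n + m + 1) + 160 * (n + m + 1) * card (rounds ?N k q)"
   \<comment> \<open>Since \<open>rounds\<close> is not empty, the overhead of the phase, at most
     \<open>80 * (n + m + 1)\<close> steps, can be charged to one of its elements; this makes 250
     per triple enough.\<close>
   have "0 \<in> rounds ?N k q" using k(4) unfolding rounds_def by simp
   then have "1 \<le> card (rounds ?N k q)" using finite_rounds[OF k(2,1)] by (auto simp: Suc_le_eq card_gt_0_iff)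
   then obtain r where r: "card (rounds ?N k q) = Suc r" by (cases "card (rounds ?N k q)") auto
   have le: "card (trips ?N k (q - 1)) + Suc r \<le> card (trips ?N K p)" using trips_mono[OF k(3)] trips_step[OF k(1,2)] r by metis
   have "?T + 1 + ?z \<le> 1 + ?U * (card (trips ?N k (q - 1)) + Suc r + 1)" unfolding r by (simp add: algebra_simps)
   also have "\<dots> \<le> 1 + ?U * (card (trips ?N K p) + 1)" using le by (intro add_left_mono mult_le_mono2) simp
   also note z
   finally have zz: "?T + 1 + ?z \<le> z" .
   have "tr W phase s1 ?T (J ?z)" by (rule tr_cons[OF t order_refl]) (auto simp: J_def)
   then show ?thesis using zz by blast
  next
   assume t: "tr W phase s1 (80 * (n + m + 1)) finished"
   have "tr W phase s1 (80 * (n + m + 1)) (J 1)" by (rule tr_cons[OF t order_refl]) (auto simp: J_def)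
   moreover have "80 * (n + m + 1) + 1 + 1 \<le> z" using z by simp
   ultimately show ?thesis by blast
  qed
 qed
 then show ?thesis
 proof (rule tr_cons)
  fix s' assume a: "\<not> holds (NotEqual 5 0) s' \<and> (\<exists>z. J z s')"
  then obtain z where J: "J z s'" by blast
  show "finished s'"
  proof (rule ccontr)
   assume "\<not> finished s'"
   then obtain K p where "phase_in K p s'" using J unfolding J_def by blast
   then have "regs s' 5 = 1" "static s'" unfolding phase_in_def by blast+
   then show False using a staticD(1) by auto
  qed
 qed simp
qed

end

section \<open>Input, adjacency lists and output on the machine\<close>

section \<open>Reading the input and writing the output\<close>

definition read_edges :: com where
 "read_edges = Const 8 2 ;; Const 6 0 ;; for_up 6 3 (Load 9 0 8 ;; Store 2 6 9 ;; Add 8 8 1 ;;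
   Load 9 0 8 ;; Store 3 6 9 ;; Add 8 8 1 ;; Store 8 6 1)"

text \<open>The root is the first terminal, or vertex 0 if there is none; in either case it is
  marked as a terminal.\<close>

definition read_terminals :: com where
 "read_terminals = (Load 10 0 8 ;; Add 8 8 1 ;; Const 4 0 ;; If (Equal 10 0) Skip (Load 4 0 8) ;; Store 4 4 1) ;;
   Const 6 0 ;; for_up 6 10 (Load 9 0 8 ;; Store 4 9 1 ;; Add 8 8 1)"

text \<open>Each row rescans the whole edge list. This costs a multiple of \<open>n * m\<close> in
  total, which the time bound allows, and avoids sorting.\<close>

definition csr_row :: com where
 "csr_row = Const 12 0 ;; for_up 12 3 (Load 13 2 12 ;; Load 14 3 12 ;;
   If (Equal 13 6) (Store 5 11 12 ;; Store 6 11 14 ;; Add 11 11 1)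
    (If (Equal 14 6) (Store 5 11 12 ;; Store 6 11 13 ;; Add 11 11 1) Skip))"

definition csr :: com where
 "csr = Const 11 0 ;; (Const 6 0 ;; for_up 6 2 (Store 7 6 11 ;; csr_row)) ;; Store 7 2 11"

definition prep :: com where
 "prep = (Const 1 1 ;; Load 2 0 0 ;; Load 3 0 1) ;; read_edges ;; read_terminals ;; csr ;; Const 5 1"

definition write_tree :: com where
 "write_tree = (Store 1 0 18 ;; Const 8 1) ;; (Const 6 0 ;; for_up 6 18 (Load 9 13 6 ;; Store 1 8 9 ;; Add 8 8 1)) ;;
   (Sub 9 18 1 ;; Store 1 8 9 ;; Add 8 8 1 ;; Move 6 1) ;;
   for_up 6 18 (Load 9 13 6 ;; Load 10 12 9 ;; Load 11 2 10 ;; Store 1 8 11 ;; Add 8 8 1 ;;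
    Load 11 3 10 ;; Store 1 8 11 ;; Add 8 8 1)"

lemma wr_prep [simp]:
 "wr read_edges = {6,8,9}" "wa read_edges = {2,3,8}"
 "wr read_terminals = {4,6,8,9,10}" "wa read_terminals = {4}"
 "wr csr_row = {11,12,13,14}" "wa csr_row = {5,6}"
 "wr csr = {6,11,12,13,14}" "wa csr = {5,6,7}"
 by (auto simp: read_edges_def read_terminals_def csr_row_def csr_def)

definition ent :: "(nat \<Rightarrow> nat) \<Rightarrow> (nat \<Rightarrow> nat) \<Rightarrow> nat \<Rightarrow> nat \<Rightarrow> (nat \<times> nat) list" where
 "ent eu ev v e = (if eu e = v then [(e, ev e)] else if ev e = v then [(e, eu e)] else [])"

definition row :: "(nat \<Rightarrow> nat) \<Rightarrow> (nat \<Rightarrow> nat) \<Rightarrow> nat \<Rightarrow> nat \<Rightarrow> (nat \<times> nat) list" where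
 "row eu ev q v = concat (map (ent eu ev v) [0..<q])"

definition rows :: "(nat \<Rightarrow> nat) \<Rightarrow> (nat \<Rightarrow> nat) \<Rightarrow> nat \<Rightarrow> nat \<Rightarrow> (nat \<times> nat) list" where
 "rows eu ev m v = concat (map (row eu ev m) [0..<v])"

lemma row_Suc: "row eu ev (Suc q) v = row eu ev q v @ ent eu ev v q" and row_0: "row eu ev 0 v = []"
 by (simp_all add: row_def)

lemma rows_Suc: "rows eu ev m (Suc v) = rows eu ev m v @ row eu ev m v" and rows_0: "rows eu ev m 0 = []"
 by (simp_all add: rows_def)

lemma length_row: "length (row eu ev q v) \<le> q"
 by (induction q) (auto simp: row_Suc row_0 ent_def)

text \<open>This crude bound keeps the counter within the word bound while the lists are being
  built.\<close>

lemma length_rows_le: "length (rows eu ev m v) \<le> v * m"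
proof (induction v)
 case (Suc v)
 then show ?case using length_row[of eu ev m v] by (simp add: rows_Suc)
qed (simp add: rows_0)

lemma length_row_sum: "length (row eu ev q v) = (\<Sum>e<q. length (ent eu ev v e))"
 by (induction q) (simp_all add: row_Suc row_0)

lemma length_rows_sum: "length (rows eu ev m v) = (\<Sum>v'<v. \<Sum>e<m. length (ent eu ev v' e))"
 by (induction v) (simp_all add: rows_Suc rows_0 length_row_sum)

text \<open>Exchanging the sums counts by edges: an edge occurs only in the rows of its two
  ends.\<close>

lemma length_rows: "length (rows eu ev m n) \<le> 2 * m"
proof -
 have one: "(\<Sum>v<n. of_bool (v = x)) \<le> (1::nat)" for x by (simp add: of_bool_def)
 have "(\<Sum>v<n. length (ent eu ev v e)) \<le> 2" for e
 proof -
  have "(\<Sum>v<n. length (ent eu ev v e)) \<le> (\<Sum>v<n. of_bool (v = eu e) + of_bool (v = ev e))"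
   by (intro sum_mono) (auto simp: ent_def)
  also have "\<dots> = (\<Sum>v<n. of_bool (v = eu e)) + (\<Sum>v<n. of_bool (v = ev e))" by (rule sum.distrib)
  also have "\<dots> \<le> 1 + 1" using one[of "eu e"] one[of "ev e"] by (rule add_mono)
  finally show ?thesis by simp
 qed
 then have "(\<Sum>e<m. \<Sum>v<n. length (ent eu ev v e)) \<le> (\<Sum>e<m. 2)" by (intro sum_mono) blast
 then show ?thesis unfolding length_rows_sum by (subst sum.swap) simp
qed

lemma rows_prefix: "v \<le> v' ==> \<exists>L. rows eu ev m v' = rows eu ev m v @ L"
 by (induction v' rule: dec_induct) (auto simp: rows_Suc)

lemma set_row: "set (row eu ev m v) = (\<Union>e<m. set (ent eu ev v e))"
 by (auto simp: row_def)

definition stored :: "(nat \<times> nat) list \<Rightarrow> state \<Rightarrow> bool" where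
 "stored L s \<longleftrightarrow> regs s 11 = length L \<and> (\<forall>j<length L. arrs s 5 j = fst (L ! j) \<and> arrs s 6 j = snd (L ! j))"

lemma stored_set_reg: "r \<noteq> 11 ==> stored L (set_reg r x s) = stored L s"
 by (simp add: stored_def)

lemma stored_snoc:
 assumes "stored L s" "regs s' 11 = Suc (regs s 11)"
  "arrs s' = (arrs s)(5 := (arrs s 5)(regs s 11 := e), 6 := (arrs s 6)(regs s 11 := y))"
 shows "stored (L @ [(e, y)]) s'"
 using assms by (auto simp: stored_def nth_append less_Suc_eq)

lemma read_edges:
 assumes r: "regs s 1 = 1" "regs s 3 = m" and W: "2 * m + 2 \<le> W"
  and U: "\<forall>e<m. arrs s 0 (2 + 2 * e) = U e \<and> arrs s 0 (3 + 2 * e) = V e"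
 shows "tr W read_edges s (9 * m + 3) (\<lambda>s'. regs s' 8 = 2 + 2 * m \<and> (\<forall>e<m. arrs s' 2 e = U e \<and> arrs s' 3 e = V e \<and> arrs s' 8 e = 1))"
proof -
 let ?b = "Load 9 0 8 ;; Store 2 6 9 ;; Add 8 8 1 ;; Load 9 0 8 ;; Store 3 6 9 ;; Add 8 8 1 ;; Store 8 6 1"
 let ?I = "\<lambda>j (s' :: state). regs s' 8 = 2 + 2 * j \<and> (\<forall>e<j. arrs s' 2 e = U e \<and> arrs s' 3 e = V e \<and> arrs s' 8 e = 1)"
 have "tr W read_edges s (1 + (m * (7 + 2) + 2)) (\<lambda>s'. ?I m s' \<and> regs s' 6 = m)"
  unfolding read_edges_def
 proof (rule tr_seq)
  show "tr W (Const 8 2) s 1 (\<lambda>s1. s1 = set_reg 8 2 s)" using W by (intro tr_wp) simp_all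
  fix s1 assume s1: "s1 = set_reg 8 2 s"
  show "tr W (Const 6 0 ;; for_up 6 3 ?b) s1 (m * (7 + 2) + 2) (\<lambda>s'. ?I m s' \<and> regs s' 6 = m)"
  proof (rule tr_for_up0[where T = 7])
   fix j s' assume I: "?I j s'" and j: "j < m" "regs s' 6 = j" and f: "frame (for_up 6 3 ?b) s1 s'"
   have k: "arrs s' 0 = arrs s 0" "regs s' 1 = 1" using frame_arrs[OF f, of 0] frame_regs[OF f, of 1] s1 r by simp_all
   have u: "arrs s 0 (regs s' 8) = U j" "arrs s 0 (regs s' 8 + 1) = V j" "regs s' 8 + 1 + 1 \<le> W" using U I j W by (simp_all add: numeral_3_eq_3)
   have k1: "regs s' (Suc 0) = 1" using k by simp
   define I' where "I' = ?I (Suc j)"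
   have step: "I' s''" if "regs s'' 8 = regs s' 8 + 1 + 1" "arrs s'' = (arrs s')(2 := (arrs s' 2)(j := U j), 3 := (arrs s' 3)(j := V j), 8 := (arrs s' 8)(j := 1))" for s''
    unfolding I'_def using I that by (auto simp: less_Suc_eq)
   have "tr W ?b s' 7 I'"
    by (rule tr_wp) (use step u in \<open>simp_all add: j k k1\<close>)
   then show "tr W ?b s' 7 (?I (Suc j))" unfolding I'_def .
  qed (use r s1 W in auto)
 qed
 then show ?thesis by (rule tr_cons) auto
qed

lemma read_terminals:
 assumes r: "regs s 1 = 1" "regs s 0 = 0" "regs s 8 = 2 + 2 * m" and W: "2 * m + 3 + length xs \<le> W"
  and l: "arrs s 0 (2 + 2 * m) = length xs" and x: "\<forall>i<length xs. arrs s 0 (3 + 2 * m + i) = xs ! i"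
  and z: "\<forall>v. arrs s 4 v = 0"
 shows "tr W read_terminals s (5 * length xs + 9) (\<lambda>s'. regs s' 4 = (if xs = [] then 0 else hd xs) \<and>
   (\<forall>v. arrs s' 4 v = of_bool (v = (if xs = [] then 0 else hd xs) \<or> v \<in> set xs)))"
proof -
 let ?b = "Load 9 0 8 ;; Store 4 9 1 ;; Add 8 8 1"
 let ?N = "length xs"
 define rt where "rt = (if xs = [] then 0 else hd xs)"
 let ?I = "\<lambda>j (s' :: state). regs s' 8 = 3 + 2 * m + j \<and> regs s' 4 = rt \<and> (\<forall>v. arrs s' 4 v = of_bool (v = rt \<or> v \<in> set (take j xs)))"
 have "tr W read_terminals s (7 + (?N * (3 + 2) + 2)) (\<lambda>s'. ?I ?N s' \<and> regs s' 6 = ?N)"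
  unfolding read_terminals_def
 proof (rule tr_seq)
  define Q where "Q s1 \<longleftrightarrow> regs s1 8 = 3 + 2 * m \<and> regs s1 10 = ?N \<and> regs s1 4 = rt \<and> arrs s1 = (arrs s)(4 := (arrs s 4)(rt := 1)) \<and> regs s1 1 = 1" for s1 :: state
  have q: "Q s1" if "regs s1 8 = regs s 8 + 1" "regs s1 10 = ?N" "regs s1 4 = rt" "arrs s1 = (arrs s)(4 := (arrs s 4)(rt := 1))" "regs s1 1 = 1" for s1
   unfolding Q_def using that r by simp
  have h: "rt = arrs s 0 (3 + 2 * m)" if "xs \<noteq> []" using x that unfolding rt_def by (auto simp: hd_conv_nth)
  show "tr W (Load 10 0 8 ;; Add 8 8 1 ;; Const 4 0 ;; If (Equal 10 0) Skip (Load 4 0 8) ;; Store 4 4 1) s 7 Q"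
  proof (cases "xs = []")
   case True
   then show ?thesis by (intro tr_wp) (use q r l W in \<open>simp_all add: rt_def\<close>)
  next
   case False
   have e: "Suc (2 + 2 * m) = 3 + 2 * m" by simp
   show ?thesis
    by (rule tr_wp) (use q r l W False h in \<open>simp_all add: numeral_3_eq_3\<close>)
  qed
  fix s1 assume f1: "frame (Load 10 0 8 ;; Add 8 8 1 ;; Const 4 0 ;; If (Equal 10 0) Skip (Load 4 0 8) ;; Store 4 4 1) s s1" and s1: "Q s1"
  show "tr W (Const 6 0 ;; for_up 6 10 ?b) s1 (?N * (3 + 2) + 2) (\<lambda>s'. ?I ?N s' \<and> regs s' 6 = ?N)"
  proof (rule tr_for_up0[where T = 3])
   fix j s' assume I: "?I j s'" and j: "j < ?N" "regs s' 6 = j" and f: "frame (for_up 6 10 ?b) s1 s'"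
   have k: "arrs s' 0 = arrs s 0" "regs s' 1 = 1" using frame_arrs[OF f, of 0] frame_regs[OF f, of 1] s1 unfolding Q_def by simp_all
   have u: "arrs s 0 (regs s' 8) = xs ! j" "regs s' 8 + 1 \<le> W" using x I j W by simp_all
   have k1: "regs s' (Suc 0) = 1" using k by simp
   have t: "set (take (Suc j) xs) = insert (xs ! j) (set (take j xs))" using j by (simp add: take_Suc_conv_app_nth)
   define I' where "I' = ?I (Suc j)"
   have step: "I' s''" if "regs s'' 8 = regs s' 8 + 1" "regs s'' 4 = regs s' 4" "arrs s'' = (arrs s')(4 := (arrs s' 4)(xs ! j := 1))" for s''
    unfolding I'_def t using I that by simp
   have "tr W ?b s' 3 I'"
    by (rule tr_wp) (use step u in \<open>simp_all add: j k k1\<close>)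
   then show "tr W ?b s' 3 (?I (Suc j))" unfolding I'_def .
  qed (use s1 W z in \<open>auto simp: Q_def\<close>)
 qed
 then show ?thesis unfolding rt_def[symmetric] by (rule tr_cons) simp_all
qed

lemma csr_row:
 assumes r: "regs s 1 = 1" "regs s 3 = m" "regs s 6 = v" and W: "m \<le> W" "length L + m + 1 \<le> W"
  and U: "\<forall>e<m. arrs s 2 e = U e \<and> arrs s 3 e = V e" and L: "stored L s"
 shows "tr W csr_row s (9 * m + 2) (stored (L @ row U V m v))"
proof -
 let ?b = "Load 13 2 12 ;; Load 14 3 12 ;;
   If (Equal 13 6) (Store 5 11 12 ;; Store 6 11 14 ;; Add 11 11 1)
    (If (Equal 14 6) (Store 5 11 12 ;; Store 6 11 13 ;; Add 11 11 1) Skip)"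
 have "tr W csr_row s (m * (7 + 2) + 2) (\<lambda>s'. stored (L @ row U V m v) s' \<and> regs s' 12 = m)"
  unfolding csr_row_def
 proof (rule tr_for_up0[where T = 7 and I = "\<lambda>q. stored (L @ row U V q v)"])
  fix q s' assume I: "stored (L @ row U V q v) s'" and q: "q < m" "regs s' 12 = q" and f: "frame (for_up 12 3 ?b) s s'"
  have k: "arrs s' 2 q = U q" "arrs s' 3 q = V q" "regs s' 1 = 1" "regs s' 6 = v"
   using frame_arrs[OF f] frame_regs[OF f] r U q by simp_all
  have k1: "regs s' (Suc 0) = 1" using k by simp
  have bW: "regs s' 11 + 1 \<le> W" using I W(2) q(1) length_row[of U V q v] unfolding stored_def by simp
  define I' where "I' = stored (L @ row U V (Suc q) v)"
  have s1: "I' s''" if "U q = v" "regs s'' 11 = Suc (regs s' 11)"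
   "arrs s'' = (arrs s')(5 := (arrs s' 5)(regs s' 11 := q), 6 := (arrs s' 6)(regs s' 11 := V q))" for s''
   unfolding I'_def using stored_snoc[OF I that(2,3)] that(1) by (simp add: row_Suc ent_def)
  have s2: "I' s''" if "U q \<noteq> v" "V q = v" "regs s'' 11 = Suc (regs s' 11)"
   "arrs s'' = (arrs s')(5 := (arrs s' 5)(regs s' 11 := q), 6 := (arrs s' 6)(regs s' 11 := U q))" for s''
   unfolding I'_def using stored_snoc[OF I that(3,4)] that(1,2) by (simp add: row_Suc ent_def)
  have s3: "I' s''" if "U q \<noteq> v" "V q \<noteq> v" "regs s'' 11 = regs s' 11" "arrs s'' = arrs s'" for s''
   unfolding I'_def using I that by (simp add: row_Suc ent_def stored_def)
  have "tr W ?b s' 7 I'"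
   by (rule tr_wp) (use s1 s2 s3 bW in \<open>simp_all add: q k k1\<close>)
  then show "tr W ?b s' 7 (stored (L @ row U V (Suc q) v))" unfolding I'_def .
 qed (use r W L in \<open>auto simp: stored_set_reg row_0\<close>)
 then show ?thesis by (rule tr_cons) auto
qed

lemma csr:
 assumes r: "regs s 1 = 1" "regs s 2 = n" "regs s 3 = m" and W: "n * m + n + m + 1 \<le> W"
  and U: "\<forall>e<m. arrs s 2 e = U e \<and> arrs s 3 e = V e"
 shows "tr W csr s (n * (9 * m + 5) + 4) (\<lambda>s'. stored (rows U V m n) s' \<and> (\<forall>v\<le>n. arrs s' 7 v = length (rows U V m v)))"
proof -
 let ?b = "Store 7 6 11 ;; csr_row"
 let ?I = "\<lambda>v (s' :: state). stored (rows U V m v) s' \<and> (\<forall>v'<v. arrs s' 7 v' = length (rows U V m v'))"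
 have "tr W csr s (1 + ((n * ((9 * m + 3) + 2) + 2) + 1)) (\<lambda>s'. stored (rows U V m n) s' \<and> (\<forall>v\<le>n. arrs s' 7 v = length (rows U V m v)))"
  unfolding csr_def
 proof (rule tr_seq)
  show "tr W (Const 11 0) s 1 (\<lambda>s1. s1 = set_reg 11 0 s)" by (intro tr_wp) simp_all
  fix s1 assume s1: "s1 = set_reg 11 0 s"
  show "tr W ((Const 6 0 ;; for_up 6 2 ?b) ;; Store 7 2 11) s1 ((n * ((9 * m + 3) + 2) + 2) + 1)
    (\<lambda>s'. stored (rows U V m n) s' \<and> (\<forall>v\<le>n. arrs s' 7 v = length (rows U V m v)))"
  proof (rule tr_seq)
   show "tr W (Const 6 0 ;; for_up 6 2 ?b) s1 (n * ((9 * m + 3) + 2) + 2) (\<lambda>s'. ?I n s' \<and> regs s' 6 = n)"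
   proof (rule tr_for_up0[where T = "9 * m + 3"])
    fix v s' assume I: "?I v s'" and v: "v < n" "regs s' 6 = v" and f: "frame (for_up 6 2 ?b) s1 s'"
    have k: "arrs s' 2 = arrs s 2" "arrs s' 3 = arrs s 3" "regs s' 1 = 1" "regs s' 3 = m"
     using frame_arrs[OF f] frame_regs[OF f] s1 r by simp_all
    have "Suc v * m \<le> n * m" using v(1) by (intro mult_le_mono1) simp
    then have lW: "length (rows U V m v) + m + 1 \<le> W" using length_rows_le[of U V m v] W by simp
    have "tr W ?b s' (1 + (9 * m + 2)) (?I (Suc v))"
    proof (rule tr_seq)
     show "tr W (Store 7 6 11) s' 1 (\<lambda>s2. s2 = set_arr 7 v (regs s' 11) s')" by (intro tr_wp) (simp_all add: v)
     fix s2 assume s2: "s2 = set_arr 7 v (regs s' 11) s'"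
     have L2: "stored (rows U V m v) s2" using I unfolding s2 stored_def by simp
     have a: "regs s2 1 = 1" "regs s2 3 = m" "regs s2 6 = v" "m \<le> W" "\<forall>e<m. arrs s2 2 e = U e \<and> arrs s2 3 e = V e"
      using s2 k v W U by simp_all
     show "tr W csr_row s2 (9 * m + 2) (?I (Suc v))"
     proof (rule tr_cons[OF csr_row[OF a(1,2,3,4) lW a(5) L2] order_refl])
      fix s3 assume f3: "frame csr_row s2 s3" and s3: "stored (rows U V m v @ row U V m v) s3"
      have "arrs s3 7 = (arrs s' 7)(v := length (rows U V m v))" using frame_arrs[OF f3, of 7] s2 I unfolding stored_def by simp
      then show "?I (Suc v) s3" using s3 I by (simp add: rows_Suc less_Suc_eq)
     qed
    qed
    then show "tr W ?b s' (9 * m + 3) (?I (Suc v))" by (rule tr_le) simp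
   qed (use r s1 W in \<open>auto simp: stored_def rows_0\<close>)
   fix s2 assume f2: "frame (Const 6 0 ;; for_up 6 2 ?b) s1 s2" and I: "?I n s2 \<and> regs s2 6 = n"
   have "regs s2 2 = n" "regs s2 11 = length (rows U V m n)" using frame_regs[OF f2, of 2] s1 r I unfolding stored_def by simp_all
   then show "tr W (Store 7 2 11) s2 1 (\<lambda>s'. stored (rows U V m n) s' \<and> (\<forall>v\<le>n. arrs s' 7 v = length (rows U V m v)))"
    using I by (intro tr_wp) (auto simp: stored_def)
  qed
 qed
 then show ?thesis by (rule tr_le) simp
qed

context graph
begin

definition written :: "nat list \<Rightarrow> state \<Rightarrow> bool" where
 "written L s \<longleftrightarrow> regs s 8 = length L \<and> (\<forall>j<length L. arrs s 1 j = L ! j)"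

lemma written_set_reg: "r \<noteq> 8 ==> written L (set_reg r x s) = written L s"
 by (simp add: written_def)

lemma written_snoc:
 assumes "written L s" "regs s' 8 = Suc (regs s 8)" "arrs s' 1 = (arrs s 1)(regs s 8 := x)"
 shows "written (L @ [x]) s'"
 using assms by (auto simp: written_def nth_append less_Suc_eq)

lemma written_snoc2:
 assumes "written L s" "regs s' 8 = Suc (Suc (regs s 8))" "arrs s' 1 = (arrs s 1)(regs s 8 := x, Suc (regs s 8) := y)"
 shows "written (L @ [x, y]) s'"
 using assms by (auto simp: written_def nth_append less_Suc_eq)

lemma write_tree:
 assumes stt: "static s" and c: "0 < regs s 18" "regs s 18 \<le> n"
 defines "ct \<equiv> regs s 18"
 shows "tr W write_tree s (15 * n + 12) (\<lambda>s'. \<forall>i<length (enc_output (map (arrs s 13) [0..<ct])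
   (map (\<lambda>i. (eu (arrs s 12 (arrs s 13 i)), ev (arrs s 12 (arrs s 13 i)))) [1..<ct])).
  arrs s' 1 i = enc_output (map (arrs s 13) [0..<ct]) (map (\<lambda>i. (eu (arrs s 12 (arrs s 13 i)), ev (arrs s 12 (arrs s 13 i)))) [1..<ct]) ! i)"
proof -
 let ?c1 = "Store 1 0 18 ;; Const 8 1" and ?b2 = "Load 9 13 6 ;; Store 1 8 9 ;; Add 8 8 1"
  and ?c3 = "Sub 9 18 1 ;; Store 1 8 9 ;; Add 8 8 1 ;; Move 6 1"
  and ?b4 = "Load 9 13 6 ;; Load 10 12 9 ;; Load 11 2 10 ;; Store 1 8 11 ;; Add 8 8 1 ;; Load 11 3 10 ;; Store 1 8 11 ;; Add 8 8 1"
 define od where "od = arrs s 13"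
 define P where "P = (\<lambda>i. arrs s 12 (od i))"
 define L2 where "L2 j = ct # map od [0..<j]" for j
 define L4 where "L4 j = L2 ct @ [ct - 1] @ concat (map (\<lambda>i. [eu (P i), ev (P i)]) [1..<j])" for j
 have ctn: "ct \<le> n" "0 < ct" using c unfolding ct_def by simp_all
 have l4: "length (L4 j) = ct + 2 + 2 * (j - 1)" for j unfolding L4_def L2_def by (induction j) (auto simp: nth_append)
 have e: "L4 ct = enc_output (map od [0..<ct]) (map (\<lambda>i. (eu (P i), ev (P i))) [1..<ct])"
  unfolding L4_def L2_def enc_output_def enc_list_def enc_edges_def by (simp add: comp_def)
 have q1: "tr W ?c1 s 2 (\<lambda>s1. written (L2 0) s1)"
  by (rule tr_wp) (use W8 in \<open>simp_all add: written_def L2_def staticD[OF stt] ct_def\<close>)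
 obtain t1 s1 where x1: "exec W ?c1 s t1 s1" and l1: "t1 \<le> 2" and w1: "written (L2 0) s1" and f1: "frame ?c1 s s1"
  by (rule trE[OF q1]) (rule that)
 have st1: "static s1" using static_frame[OF stt f1] by simp
 have k1: "regs s1 18 = ct" "arrs s1 13 = od" "arrs s1 12 = arrs s 12"
  using frame_regs[OF f1, of 18] frame_arrs[OF f1] unfolding ct_def od_def by simp_all
 have q2: "tr W (Const 6 0 ;; for_up 6 18 ?b2) s1 (ct * (3 + 2) + 2) (\<lambda>s'. written (L2 ct) s' \<and> regs s' 6 = ct)"
 proof (rule tr_for_up0[where T = 3 and I = "\<lambda>j. written (L2 j)"])
  fix j s' assume I: "written (L2 j) s'" and j: "j < ct" "regs s' 6 = j" and f: "frame (for_up 6 18 ?b2) s1 s'"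
  have k: "arrs s' 13 = od" "regs s' (Suc 0) = 1" using frame_arrs[OF f, of 13] frame_regs[OF f, of 1] k1 staticD[OF st1] by simp_all
  have bW: "regs s' 8 + 1 \<le> W" using I j ctn W8 unfolding written_def L2_def by simp
  define I' where "I' = written (L2 (Suc j))"
  have step: "I' s''" if "regs s'' 8 = Suc (regs s' 8)" "arrs s'' 1 = (arrs s' 1)(regs s' 8 := od j)" for s''
   using written_snoc[OF I that] unfolding I'_def L2_def by simp
  have "tr W ?b2 s' 3 I'" by (rule tr_wp) (use step bW in \<open>simp_all add: j k\<close>)
  then show "tr W ?b2 s' 3 (written (L2 (Suc j)))" unfolding I'_def .
 qed (use w1 k1 ctn W8 staticD[OF st1] in \<open>auto simp: written_set_reg\<close>)
 obtain t2 s2 where x2: "exec W (Const 6 0 ;; for_up 6 18 ?b2) s1 t2 s2" and l2: "t2 \<le> ct * (3 + 2) + 2"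
  and w2': "written (L2 ct) s2 \<and> regs s2 6 = ct" and f2: "frame (Const 6 0 ;; for_up 6 18 ?b2) s1 s2"
  by (rule trE[OF q2]) (rule that)
 have w2: "written (L2 ct) s2" using w2' by blast
 have st2: "static s2" using static_frame[OF st1 f2] by simp
 have k2: "regs s2 18 = ct" "arrs s2 13 = od" "arrs s2 12 = arrs s 12" using frame_regs[OF f2, of 18] frame_arrs[OF f2] k1 by simp_all
 have b2: "regs s2 8 + 1 \<le> W" using w2 ctn W8 unfolding written_def L2_def by simp
 define I3 where "I3 s' \<longleftrightarrow> written (L4 1) s' \<and> regs s' 6 = 1" for s'
 have step3: "I3 s''" if "regs s'' 8 = Suc (regs s2 8)" "arrs s'' 1 = (arrs s2 1)(regs s2 8 := ct - 1)" "regs s'' 6 = 1" for s''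
  using written_snoc[OF w2 that(1,2)] that(3) unfolding I3_def L4_def by simp
 have q3: "tr W ?c3 s2 4 I3"
  by (rule tr_wp) (use step3 b2 in \<open>simp_all add: staticD[OF st2] k2\<close>)
 obtain t3 s3 where x3: "exec W ?c3 s2 t3 s3" and l3: "t3 \<le> 4" and w3': "I3 s3" and f3: "frame ?c3 s2 s3"
  by (rule trE[OF q3]) (rule that)
 have w3: "written (L4 1) s3" "regs s3 6 = 1" using w3' unfolding I3_def by blast+
 have st3: "static s3" using static_frame[OF st2 f3] by simp
 have k3: "regs s3 18 = ct" "arrs s3 13 = od" "arrs s3 12 = arrs s 12" using frame_regs[OF f3, of 18] frame_arrs[OF f3] k2 by simp_all
 have q4: "tr W (for_up 6 18 ?b4) s3 (n * (8 + 2) + 1) (\<lambda>s'. written (L4 ct) s' \<and> regs s' 6 = ct)"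
 proof (rule tr_for_up[where T = 8 and I = "\<lambda>j. written (L4 j)"])
  fix j s' assume I: "written (L4 j) s'" and j0: "regs s3 6 \<le> j" and j: "j < ct" "regs s' 6 = j" and f: "frame (for_up 6 18 ?b4) s3 s'"
  have st': "static s'" using static_frame[OF st3 f] by simp
  have k: "arrs s' 13 = od" "arrs s' 12 (od j) = P j" using frame_arrs[OF f] k3 unfolding P_def by simp_all
  have j1: "1 \<le> j" using j0 w3 by simp
  have bW: "regs s' 8 + 1 + 1 \<le> W" using I j l4[of j] ctn W8 unfolding written_def by simp
  have bW': "Suc (regs s' 8) \<le> W" "Suc (Suc (regs s' 8)) \<le> W" using bW by simp_all
  have "L4 (Suc j) = L4 j @ [eu (P j), ev (P j)]" unfolding L4_def using j1 by simp
  then have step: "written (L4 (Suc j)) s''" if "regs s'' 8 = Suc (Suc (regs s' 8))"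
   "arrs s'' 1 = (arrs s' 1)(regs s' 8 := eu (P j), Suc (regs s' 8) := ev (P j))" for s''
   using written_snoc2[OF I that] by simp
  define I' where "I' = written (L4 (Suc j))"
  have "tr W ?b4 s' 8 I'" by (rule tr_wp) (use step[folded I'_def] bW' in \<open>simp_all add: j k staticD[OF st']\<close>)
  then show "tr W ?b4 s' 8 (written (L4 (Suc j)))" unfolding I'_def .
 next
  show "(ct - regs s3 6) * (8 + 2) + 1 \<le> n * (8 + 2) + 1" using ctn by simp
 qed (use w3 k3 ctn W8 staticD[OF st3] in \<open>auto simp: written_set_reg\<close>)
 obtain t4 s4 where x4: "exec W (for_up 6 18 ?b4) s3 t4 s4" and l4': "t4 \<le> n * (8 + 2) + 1"
  and w4: "written (L4 ct) s4 \<and> regs s4 6 = ct" by (rule trE[OF q4]) (rule that)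
 have "exec W write_tree s (t1 + (t2 + (t3 + t4))) s4"
  unfolding write_tree_def by (intro exec.Seq[OF x1] exec.Seq[OF x2] exec.Seq[OF x3] x4)
 moreover have "t1 + (t2 + (t3 + t4)) \<le> 15 * n + 12" using l1 l2 l3 l4' ctn by simp
 moreover have "\<forall>i<length (L4 ct). arrs s4 1 i = L4 ct ! i" using w4 unfolding written_def by blast
 ultimately show ?thesis unfolding tr_def e od_def P_def by blast
qed

end

section \<open>Correctness of the output and the final time bound\<close>

section \<open>The Steiner tree\<close>

abbreviation pairs :: "(nat \<times> nat) list \<Rightarrow> nat list" where
 "pairs es \<equiv> concat (map (\<lambda>(u, v). [u, v]) es)"

lemma length_pairs: "length (pairs es) = 2 * length es"
 by (induction es) auto

lemma nth_pairs: "e < length es ==> pairs es ! (2 * e) = fst (es ! e) \<and> pairs es ! Suc (2 * e) = snd (es ! e)"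
proof (induction es arbitrary: e)
 case (Cons p es)
 then show ?case by (cases e; cases p) auto
qed simp

lemma input_layout:
 fixes n :: nat and es :: "(nat \<times> nat) list" and xs :: "nat list"
 defines "a \<equiv> arrs (init_state (enc_input n es xs)) 0"
 shows "a 0 = n" "a 1 = length es" "\<forall>e<length es. a (2 + 2 * e) = fst (es ! e) \<and> a (3 + 2 * e) = snd (es ! e)"
  "a (2 + 2 * length es) = length xs" "\<forall>i<length xs. a (3 + 2 * length es + i) = xs ! i"
proof -
 define p where "p = pairs es"
 define inp where "inp = n # length es # p @ length xs # xs"
 have i: "enc_input n es xs = inp" unfolding inp_def p_def enc_input_def enc_edges_def enc_list_def by simp
 have a: "a j = (if j < length inp then inp ! j else 0)" for j unfolding a_def i init_state_def by simp
 have lp: "length p = 2 * length es" unfolding p_def by (rule length_pairs)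
 have li: "length inp = 3 + 2 * length es + length xs" unfolding inp_def using lp by simp
 have p2: "inp ! Suc (Suc j) = (p @ length xs # xs) ! j" for j unfolding inp_def by simp
 show "a 0 = n" "a 1 = length es" unfolding a li by (simp_all add: inp_def)
 show "\<forall>e<length es. a (2 + 2 * e) = fst (es ! e) \<and> a (3 + 2 * e) = snd (es ! e)"
 proof (intro allI impI)
  fix e assume e: "e < length es"
  have "a (2 + 2 * e) = p ! (2 * e)" "a (3 + 2 * e) = p ! Suc (2 * e)"
   unfolding a li using e p2[of "2 * e"] p2[of "Suc (2 * e)"] lp by (simp_all add: nth_append numeral_3_eq_3)
  then show "a (2 + 2 * e) = fst (es ! e) \<and> a (3 + 2 * e) = snd (es ! e)" using nth_pairs[OF e] unfolding p_def by simp
 qed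
 show "a (2 + 2 * length es) = length xs" unfolding a li using p2[of "2 * length es"] lp by (simp add: nth_append)
 show "\<forall>i<length xs. a (3 + 2 * length es + i) = xs ! i"
 proof (intro allI impI)
  fix i assume i: "i < length xs"
  have "a (3 + 2 * length es + i) = (p @ length xs # xs) ! (Suc (2 * length es + i))"
   unfolding a li using i p2[of "Suc (2 * length es + i)"] by (simp add: numeral_3_eq_3)
  also have "\<dots> = xs ! i" using lp by (simp add: nth_append)
  finally show "a (3 + 2 * length es + i) = xs ! i" .
 qed
qed

definition prep_ok :: "nat \<Rightarrow> (nat \<times> nat) list \<Rightarrow> nat list \<Rightarrow> state \<Rightarrow> bool" where
 "prep_ok n es xs s \<longleftrightarrow> regs s 0 = 0 \<and> regs s 1 = 1 \<and> regs s 2 = n \<and> regs s 3 = length es \<and> regs s 5 = 1 \<and>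
   regs s 4 = (if xs = [] then 0 else hd xs) \<and>
   (\<forall>e<length es. arrs s 2 e = fst (es ! e) \<and> arrs s 3 e = snd (es ! e) \<and> arrs s 8 e = 1) \<and>
   (\<forall>v. arrs s 4 v = of_bool (v = regs s 4 \<or> v \<in> set xs)) \<and>
   stored (rows (\<lambda>e. fst (es ! e)) (\<lambda>e. snd (es ! e)) (length es) n) s \<and>
   (\<forall>v\<le>n. arrs s 7 v = length (rows (\<lambda>e. fst (es ! e)) (\<lambda>e. snd (es ! e)) (length es) v))"

lemma prep:
 fixes n :: nat and es :: "(nat \<times> nat) list" and xs :: "nat list"
 defines "m \<equiv> length es"
 assumes W: "n * m + n + m + 1 \<le> W" "2 * m + 3 + length xs \<le> W"
 shows "tr W prep (init_state (enc_input n es xs)) (n * (9 * m + 5) + 9 * m + 5 * length xs + 20) (prep_ok n es xs)"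
proof -
 let ?s = "init_state (enc_input n es xs)"
 let ?U = "\<lambda>e. fst (es ! e)" and ?V = "\<lambda>e. snd (es ! e)"
 let ?rt = "if xs = [] then 0 else hd xs"
 note L = input_layout[where n = n and es = es and xs = xs, folded m_def]
 have r0: "regs ?s r = 0" for r by (simp add: init_state_def)
 have a0: "arrs ?s a j = 0" if "a \<noteq> 0" for a j using that by (simp add: init_state_def)
 define Q where "Q s1 \<longleftrightarrow> regs s1 0 = 0 \<and> regs s1 1 = 1 \<and> regs s1 2 = n \<and> regs s1 3 = m \<and> arrs s1 = arrs ?s" for s1 :: state
 have q: "Q s1" if "regs s1 0 = 0" "regs s1 1 = 1" "regs s1 2 = n" "regs s1 3 = m" "arrs s1 = arrs ?s" for s1
  unfolding Q_def using that by simp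
 let ?c1 = "Const 1 1 ;; Load 2 0 0 ;; Load 3 0 1"
 have q1: "tr W ?c1 ?s 3 Q" by (rule tr_wp) (use q W L(1,2) r0 in simp_all)
 obtain t1 s1 where x1: "exec W ?c1 ?s t1 s1" and l1: "t1 \<le> 3" and Q1: "Q s1" by (rule trE[OF q1]) (rule that)
 have s1: "regs s1 0 = 0" "regs s1 1 = 1" "regs s1 2 = n" "regs s1 3 = m" "arrs s1 = arrs ?s" using Q1 unfolding Q_def by blast+
 have W2: "2 * m + 2 \<le> W" using W by simp
 have U1: "\<forall>e<m. arrs s1 0 (2 + 2 * e) = ?U e \<and> arrs s1 0 (3 + 2 * e) = ?V e" unfolding s1(5) by (rule L(3))
 obtain t2 s2 where x2: "exec W read_edges s1 t2 s2" and l2: "t2 \<le> 9 * m + 3" and f2: "frame read_edges s1 s2"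
  and Q2: "regs s2 8 = 2 + 2 * m \<and> (\<forall>e<m. arrs s2 2 e = ?U e \<and> arrs s2 3 e = ?V e \<and> arrs s2 8 e = 1)"
  by (rule trE[OF read_edges[OF s1(2,4) W2 U1]]) (rule that)
 have s2: "regs s2 0 = 0" "regs s2 1 = 1" "regs s2 2 = n" "regs s2 3 = m" "arrs s2 0 = arrs ?s 0" "arrs s2 4 = arrs ?s 4"
  using frame_regs[OF f2] frame_arrs[OF f2] s1 by simp_all
 have l: "arrs s2 0 (2 + 2 * m) = length xs" unfolding s2(5) by (rule L(4))
 have x: "\<forall>i<length xs. arrs s2 0 (3 + 2 * m + i) = xs ! i" unfolding s2(5) by (rule L(5))
 have z: "\<forall>v. arrs s2 4 v = 0" unfolding s2(6) using a0 by simp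
 have Q28: "regs s2 8 = 2 + 2 * m" using Q2 by blast
 obtain t3 s3 where x3: "exec W read_terminals s2 t3 s3" and l3: "t3 \<le> 5 * length xs + 9" and f3: "frame read_terminals s2 s3"
  and Q3: "regs s3 4 = ?rt \<and> (\<forall>v. arrs s3 4 v = of_bool (v = ?rt \<or> v \<in> set xs))"
  by (rule trE[OF read_terminals[OF s2(2,1) Q28 W(2) l x z]]) (rule that)
 have s3: "regs s3 0 = 0" "regs s3 1 = 1" "regs s3 2 = n" "regs s3 3 = m" "arrs s3 2 = arrs s2 2" "arrs s3 3 = arrs s2 3" "arrs s3 8 = arrs s2 8"
  using frame_regs[OF f3] frame_arrs[OF f3] s2 by simp_all
 have U3: "\<forall>e<m. arrs s3 2 e = ?U e \<and> arrs s3 3 e = ?V e" using Q2 s3 by simp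
 obtain t4 s4 where x4: "exec W csr s3 t4 s4" and l4: "t4 \<le> n * (9 * m + 5) + 4" and f4: "frame csr s3 s4"
  and Q4: "stored (rows ?U ?V m n) s4 \<and> (\<forall>v\<le>n. arrs s4 7 v = length (rows ?U ?V m v))"
  by (rule trE[OF csr[OF s3(2,3,4) W(1) U3]]) (rule that)
 have s4: "regs s4 0 = 0" "regs s4 1 = 1" "regs s4 2 = n" "regs s4 3 = m" "regs s4 4 = ?rt" "arrs s4 2 = arrs s2 2" "arrs s4 3 = arrs s2 3"
  "arrs s4 8 = arrs s2 8" "arrs s4 4 = arrs s3 4"
  using frame_regs[OF f4] frame_arrs[OF f4] s3 Q3 by simp_all
 let ?s5 = "set_reg 5 1 s4"
 have x5: "exec W (Const 5 1) s4 1 ?s5" by (rule exec.Const) (use W in simp)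
 have "\<forall>e<m. arrs ?s5 2 e = ?U e \<and> arrs ?s5 3 e = ?V e \<and> arrs ?s5 8 e = 1" using Q2 s4 by simp
 moreover have "\<forall>v. arrs ?s5 4 v = of_bool (v = regs ?s5 4 \<or> v \<in> set xs)" using Q3 s4 by simp
 moreover have "stored (rows ?U ?V m n) ?s5" using Q4 by (simp add: stored_set_reg)
 moreover have "\<forall>v\<le>n. arrs ?s5 7 v = length (rows ?U ?V m v)" using Q4 by simp
 moreover have "regs ?s5 0 = 0" "regs ?s5 1 = 1" "regs ?s5 2 = n" "regs ?s5 3 = m" "regs ?s5 5 = 1" "regs ?s5 4 = ?rt" using s4 by simp_all
 ultimately have ok: "prep_ok n es xs ?s5" unfolding prep_ok_def m_def by blast
 have "exec W prep ?s (t1 + (t2 + (t3 + (t4 + 1)))) ?s5"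
  unfolding prep_def by (intro exec.Seq[OF x1] exec.Seq[OF x2] exec.Seq[OF x3] exec.Seq[OF x4] x5)
 moreover have "t1 + (t2 + (t3 + (t4 + 1))) \<le> n * (9 * m + 5) + 9 * m + 5 * length xs + 20" using l1 l2 l3 l4 by linarith
 ultimately show ?thesis unfolding tr_def using ok by blast
qed

lemma prep_graph:
 assumes P: "prep_ok n es xs s" and n: "1 \<le> n" and rt: "\<forall>x\<in>set xs. x < n" and W: "8 * (n + length es + 2) \<le> W"
  and E: "\<forall>e<length es. fst (es ! e) < n \<and> snd (es ! e) < n \<and> fst (es ! e) \<noteq> snd (es ! e)"
 shows "graph W n (length es) (regs s 4) (arrs s 2) (arrs s 3) (arrs s 4) (arrs s 5) (arrs s 6) (arrs s 7)"
proof -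
 let ?U = "\<lambda>e. fst (es ! e)" and ?V = "\<lambda>e. snd (es ! e)"
 let ?m = "length es"
 let ?r = "rows ?U ?V ?m"
 have r4: "regs s 4 = (if xs = [] then 0 else hd xs)"
  and ed: "\<forall>e<?m. arrs s 2 e = ?U e \<and> arrs s 3 e = ?V e \<and> arrs s 8 e = 1"
  and tm: "\<forall>v. arrs s 4 v = of_bool (v = regs s 4 \<or> v \<in> set xs)"
  and st: "stored (?r n) s" and s7: "\<forall>v\<le>n. arrs s 7 v = length (?r v)"
  using P unfolding prep_ok_def by - (elim conjE, assumption)+
 have jn: "joins (arrs s 2) (arrs s 3) e x y = joins ?U ?V e x y" if "e < ?m" for e x y using ed that unfolding joins_def by simp
 have l7: "arrs s 7 v = length (?r v)" "arrs s 7 (Suc v) = length (?r v) + length (row ?U ?V ?m v)" if "v < n" for v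
  using s7 that by (simp_all add: rows_Suc)
 have at: "arrs s 5 (length (?r v) + i) = fst (row ?U ?V ?m v ! i) \<and> arrs s 6 (length (?r v) + i) = snd (row ?U ?V ?m v ! i)"
  if v: "v < n" and i: "i < length (row ?U ?V ?m v)" for v i
 proof -
  obtain L where L: "?r n = (?r v @ row ?U ?V ?m v) @ L" using rows_prefix[of "Suc v" n ?U ?V ?m] v by (auto simp: rows_Suc)
  have "length (?r v) + i < length (?r n)" unfolding L using i by simp
  moreover have "?r n ! (length (?r v) + i) = row ?U ?V ?m v ! i" unfolding L using i by (simp add: nth_append)
  ultimately show ?thesis using st unfolding stored_def by metis
 qed
 show ?thesis
 proof
  show "1 \<le> n" by (rule n)
  show "regs s 4 < n" unfolding r4 using n rt by auto
  show "8 * (n + ?m + 2) \<le> W" by (rule W)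
  show "arrs s 2 e < n" "arrs s 3 e < n" "arrs s 2 e \<noteq> arrs s 3 e" if "e < ?m" for e using ed E that by simp_all
  show "arrs s 4 (regs s 4) = 1" using tm by simp
  show "arrs s 4 v = 0 \<or> arrs s 4 v = 1" for v using tm by simp
  show "arrs s 7 v \<le> arrs s 7 (Suc v)" if "v < n" for v using l7[OF that] by simp
  show "arrs s 7 0 = 0" using s7 by (simp add: rows_0)
  show "arrs s 7 n \<le> 2 * ?m" using s7 length_rows[of ?U ?V ?m n] by simp
  show "arrs s 5 j < ?m \<and> joins (arrs s 2) (arrs s 3) (arrs s 5 j) v (arrs s 6 j)"
   if v: "v < n" and j: "arrs s 7 v \<le> j" "j < arrs s 7 (Suc v)" for v j
  proof -
   obtain i where i: "j = length (?r v) + i" using j(1) l7(1)[OF v] le_Suc_ex by metis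
   have il: "i < length (row ?U ?V ?m v)" using j(2) unfolding i l7(2)[OF v] by simp
   have "row ?U ?V ?m v ! i \<in> set (row ?U ?V ?m v)" using il by (rule nth_mem)
   then obtain e where e: "e < ?m" "row ?U ?V ?m v ! i \<in> set (ent ?U ?V v e)" unfolding set_row by blast
   then have "fst (row ?U ?V ?m v ! i) = e \<and> joins ?U ?V e v (snd (row ?U ?V ?m v ! i))"
    unfolding ent_def joins_def by (auto split: if_splits)
   then show ?thesis using at[OF v il] e(1) jn unfolding i by simp
  qed
  show "\<exists>j. arrs s 7 v \<le> j \<and> j < arrs s 7 (Suc v) \<and> arrs s 5 j = e \<and> arrs s 6 j = y"
   if v: "v < n" and e: "e < ?m" and j: "joins (arrs s 2) (arrs s 3) e v y" for v e y
  proof -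
   have "joins ?U ?V e v y" using j unfolding jn[OF e] .
   moreover have "?U e \<noteq> ?V e" using E e by blast
   ultimately have "(e, y) \<in> set (ent ?U ?V v e)" unfolding joins_def ent_def by auto
   then have "(e, y) \<in> set (row ?U ?V ?m v)" unfolding set_row using e by blast
   then obtain i where i: "i < length (row ?U ?V ?m v)" "row ?U ?V ?m v ! i = (e, y)" unfolding in_set_conv_nth by blast
   have a5: "arrs s 5 (length (?r v) + i) = e" "arrs s 6 (length (?r v) + i) = y" using at[OF v i(1)] i(2) by simp_all
   have "arrs s 7 v \<le> length (?r v) + i" "length (?r v) + i < arrs s 7 (Suc v)" unfolding l7[OF v] using i(1) by simp_all
   then show ?thesis using a5 by blast
  qed
 qed
qed

lemma connected_in_sym: "connected_in G u v ==> connected_in G v u"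
 unfolding connected_in_def by (auto intro: rtranclp_sym simp: insert_commute)

lemma connected_in_trans: "connected_in G u v ==> connected_in G v w ==> connected_in G u w"
 unfolding connected_in_def by (elim conjE) (intro conjI, assumption, assumption, rule rtranclp_trans, assumption+)

text \<open>It makes a single vertex tough for every \<open>\<phi>\<close>, which settles the case
  of an empty terminal set, where only the root acts as a terminal.\<close>

lemma num_comps_singleton: "num_comps H {x} \<le> 1"
proof -
 have "{C \<in> components H. C \<inter> {x} \<noteq> {}} \<subseteq> {{v. connected_in H x v}}"
 proof
  fix C assume "C \<in> {C \<in> components H. C \<inter> {x} \<noteq> {}}"
  then obtain u where u: "C = {v. connected_in H u v}" "connected_in H u x" unfolding components_def by auto
  have "connected_in H x u" using u(2) by (rule connected_in_sym)
  then have "connected_in H u v \<longleftrightarrow> connected_in H x v" for v using u(2) unfolding connected_in_def by (auto intro: rtranclp_trans)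
  then show "C \<in> {{v. connected_in H x v}}" using u(1) by simp
 qed
 then show ?thesis unfolding num_comps_def using card_mono[of "{{v. connected_in H x v}}"] by simp
qed

text \<open>The vertex of largest index on a cycle would have two different neighbours of smaller
  index, but its parent is the only one.\<close>

lemma tree_parents:
 fixes od :: "nat \<Rightarrow> nat"
 assumes inj: "inj_on od {..<c}" and c: "0 < c" and p: "\<And>i. 0 < i ==> i < c ==> p i < i"
 shows "tree \<lparr>verts = od ` {..<c}, edges = {{od i, od (p i)} | i. 0 < i \<and> i < c}\<rparr>"
proof -
 let ?T = "\<lparr>verts = od ` {..<c}, edges = {{od i, od (p i)} | i. 0 < i \<and> i < c}\<rparr>"
 have oi: "od i = od j \<longleftrightarrow> i = j" if "i < c" "j < c" for i j using inj that unfolding inj_on_def by blast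
 have ne: "od i \<noteq> od (p i)" "p i < c" if "0 < i" "i < c" for i using p[OF that] oi[of i "p i"] that by auto
 have ug: "ugraph ?T" unfolding ugraph_def
 proof (intro conjI ballI)
  fix e assume "e \<in> edges ?T"
  then obtain i where i: "0 < i" "i < c" "e = {od i, od (p i)}" by auto
  then have "od i \<in> verts ?T" "od (p i) \<in> verts ?T" "od i \<noteq> od (p i)" using ne by auto
  then show "\<exists>u\<in>verts ?T. \<exists>v\<in>verts ?T. u \<noteq> v \<and> e = {u, v}" using i(3) by blast
 qed simp
 have con0: "i < c ==> connected_in ?T (od 0) (od i)" for i
 proof (induction i rule: less_induct)
  case (less i)
  show ?case
  proof (cases "i = 0")
   case False
   then have i: "0 < i" "i < c" using less.prems by simp_all
   have "connected_in ?T (od 0) (od (p i))" using less.IH[OF p[OF i]] ne[OF i] by simp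
   moreover have "{od (p i), od i} \<in> edges ?T" using i by auto
   moreover have "od i \<in> verts ?T" using i by simp
   ultimately show ?thesis unfolding connected_in_def by (auto intro: rtranclp.rtrancl_into_rtrancl)
  qed (use c in \<open>simp add: connected_in_def\<close>)
 qed
 have con: "connected_in ?T u v" if uv: "u \<in> verts ?T" "v \<in> verts ?T" for u v
 proof -
  obtain i j where ij: "i < c" "u = od i" "j < c" "v = od j" using uv by auto
  show ?thesis unfolding ij(2,4) by (rule connected_in_trans[OF connected_in_sym[OF con0[OF ij(1)]] con0[OF ij(3)]])
 qed
 have "\<not> cycle_in ?T q" for q
 proof
  assume "cycle_in ?T q"
  then have l: "3 \<le> length q" and d: "distinct q" and e: "\<And>i. i < length q ==> {q ! i, q ! (Suc i mod length q)} \<in> edges ?T"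
   unfolding cycle_in_def by auto
  let ?l = "length q"
  have ex: "\<exists>a<c. od a = q ! i" if il: "i < ?l" for i
  proof -
   obtain b where b: "0 < b" "b < c" "{q ! i, q ! (Suc i mod ?l)} = {od b, od (p b)}" using e[OF il] by auto
   then have "q ! i = od b \<or> q ! i = od (p b)" by (auto simp: doubleton_eq_iff)
   then show ?thesis using b ne(2)[OF b(1,2)] by metis
  qed
  define a where "a i = (SOME a. a < c \<and> od a = q ! i)" for i
  have a: "a i < c" "od (a i) = q ! i" if "i < ?l" for i using someI_ex[OF ex[OF that]] unfolding a_def by blast+
  have ai: "a i \<noteq> a j" if "i < ?l" "j < ?l" "i \<noteq> j" for i j
   using a(2)[OF that(1)] a(2)[OF that(2)] d that by (metis nth_eq_iff_index_eq)
  have "\<exists>M. M < ?l \<and> (\<forall>j<?l. a j \<le> a M)"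
  proof -
   have fin: "finite (a ` {..<?l})" "a ` {..<?l} \<noteq> {}" using l by (auto simp: lessThan_empty_iff)
   obtain M where "M < ?l" "a M = Max (a ` {..<?l})" using Max_in[OF fin] by auto
   then show ?thesis using Max_ge[OF fin(1)] by auto
  qed
  then obtain M where M: "M < ?l" "\<forall>j<?l. a j \<le> a M" by blast
  \<comment> \<open>A tree edge joins an index with its value under \<open>p\<close>; as
    \<open>a M\<close> is the larger of the two, the other end is \<open>p (a M)\<close>.\<close>
  have nb: "a j = p (a M)" if j: "j < ?l" "j \<noteq> M" "{q ! j, q ! M} \<in> edges ?T" for j
  proof -
   have lt: "a j < a M" using M j ai[OF j(1) M(1) j(2)] by (metis le_neq_implies_less)
   obtain b where b: "0 < b" "b < c" "{od (a j), od (a M)} = {od b, od (p b)}" using j(3) a(2)[OF j(1)] a(2)[OF M(1)] by auto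
   have "od (a j) = od b \<and> od (a M) = od (p b) \<or> od (a j) = od (p b) \<and> od (a M) = od b" using b(3) by (auto simp: doubleton_eq_iff)
   then have "a j = b \<and> a M = p b \<or> a j = p b \<and> a M = b"
    using oi a(1)[OF j(1)] a(1)[OF M(1)] b(2) ne(2)[OF b(1,2)] by metis
   then show ?thesis using lt p[OF b(1,2)] by auto
  qed
  \<comment> \<open>\<open>N\<close> and \<open>R\<close> are the positions after and before
    \<open>M\<close> on the cycle; they differ because the cycle has length at least 3.\<close>
  define N where "N = Suc M mod ?l"
  define R where "R = (if M = 0 then ?l - 1 else M - 1)"
  have N: "N < ?l" "N \<noteq> M" unfolding N_def using l M(1) by (auto simp: mod_Suc)
  have R: "R < ?l" "R \<noteq> M" "Suc R mod ?l = M" "N \<noteq> R" unfolding N_def R_def using l M(1) by (auto simp: mod_Suc)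
  have "a N = p (a M)" using nb[OF N] e[OF M(1)] unfolding N_def by (simp add: insert_commute)
  moreover have "a R = p (a M)" using nb[OF R(1,2)] e[OF R(1)] R(3) by simp
  ultimately show False using ai[OF N(1) R(1,4)] by simp
 qed
 then show ?thesis unfolding tree_def using ug con c by auto
qed

text \<open>The number of triples is of order \<open>min n m\<close> times a logarithm, and
  multiplying \<open>min n m\<close> by \<open>n + m + 1\<close> gives at most
  \<open>3 * max 1 m * n\<close>. All other terms are at most a constant times
  \<open>max 1 m * n\<close>, and 10000 is a generous total.\<close>

lemma time_bound:
 assumes n: "1 \<le> n" and mn: "1 \<le> m --> 2 \<le> n"
  and t: "t \<le> 34 + 9 * m + 25 * n + 9 * (n * m) + 250 * (n + m + 1) * (card (trips (2 * min n m) K p) + 1)"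
 shows "real t \<le> 10000 * (real (max 1 m) * real n * log 2 (real (max 2 n)))"
proof -
 define l where "l = log 2 (real (max 2 n))"
 let ?M = "max 1 m" and ?N = "2 * min n m"
 have l1: "1 \<le> l" unfolding l_def by (simp add: le_log_iff)
 have card_le: "real (card (trips ?N K p)) \<le> 12 * real (min n m) * l"
 proof (cases "m = 0")
  case True
  \<comment> \<open>Without edges the bound \<open>N\<close> is 0, while every triple has a positive
    product.\<close>
  have "trips ?N K p = {}" unfolding True trips_def by auto
  then show ?thesis using True by simp
 next
  case False
  then have N: "1 \<le> ?N" using n by simp
  have "ln (real ?N) \<le> ln (2 * real (max 2 n))" using N n by (subst ln_le_cancel_iff) auto
  also have "\<dots> = ln 2 * log 2 (2 * real (max 2 n))" by (simp add: log_def)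
  also have "\<dots> \<le> 1 * log 2 (2 * real (max 2 n))" using ln_2_less_1 by (intro mult_right_mono) (auto simp: zero_le_log_cancel_iff)
  also have "log 2 (2 * real (max 2 n)) = 1 + l" unfolding l_def by (subst log_mult) auto
  finally have "ln (real ?N) \<le> 1 * (1 + l)" .
  moreover have "1 + y \<le> 3 * l" if "y \<le> 1 * (1 + l)" for y using that l1 by simp
  ultimately have "1 + ln (real ?N) \<le> 3 * l" by blast
  then have "2 * real ?N * (1 + ln (real ?N)) \<le> 2 * real ?N * (3 * l)" by (intro mult_left_mono) auto
  with card_trips_le[OF N, of K p] have "real (card (trips ?N K p)) \<le> 2 * real ?N * (3 * l)" by (rule order_trans)
  then show ?thesis by simp
 qed
 have b: "n * min n m \<le> ?M * n" "m * min n m \<le> ?M * n" "min n m \<le> ?M * n" "m \<le> ?M * n" "n \<le> ?M * n" "n * m \<le> ?M * n" "1 \<le> ?M * n"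
 proof -
  have mM: "min n m \<le> ?M" by linarith
  show "n * min n m \<le> ?M * n" by (subst mult.commute[of ?M n]) (rule mult_le_mono2[OF mM])
  show "m * min n m \<le> ?M * n" by (rule mult_le_mono) simp_all
  show 3: "n \<le> ?M * n" using mult_le_mono1[of 1 ?M n] by simp
  show "min n m \<le> ?M * n" using 3 by linarith
  show "m \<le> ?M * n" using mult_le_mono[of m ?M 1 n] n by simp
  show "n * m \<le> ?M * n" by (subst mult.commute[of ?M n]) (rule mult_le_mono2, simp)
  show "1 \<le> ?M * n" using 3 n by linarith
 qed
 define X where "X = real ?M * real n"
 have br: "x \<le> ?M * n ==> real x \<le> X" for x unfolding X_def of_nat_mult[symmetric] of_nat_le_iff .
 have bx: "real m \<le> X" "real n \<le> X" "real (n * m) \<le> X" "1 \<le> X" using br[OF b(4)] br[OF b(5)] br[OF b(6)] br[OF b(7)] by simp_all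
 have "real (n + m + 1) * real (min n m) = real (n * min n m) + real (m * min n m) + real (min n m)" by (simp add: algebra_simps)
 also have "\<dots> \<le> X + X + X" using br[OF b(1)] br[OF b(2)] br[OF b(3)] by linarith
 finally have nm: "real (n + m + 1) * real (min n m) \<le> 3 * X" by simp
 define c where "c = real (n + m + 1) * real (card (trips ?N K p))"
 have "c \<le> real (n + m + 1) * (12 * real (min n m) * l)" unfolding c_def using card_le by (intro mult_left_mono) auto
 also have "\<dots> = 12 * l * (real (n + m + 1) * real (min n m))" by simp
 also have "\<dots> \<le> 12 * l * (3 * X)" using nm l1 by (intro mult_left_mono) auto
 finally have cX: "c \<le> 36 * (X * l)" by (simp add: ac_simps)
 have "X * 1 \<le> X * l" using bx l1 by (intro mult_left_mono) auto
 then have Xl: "X \<le> X * l" by simp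
 have "real t \<le> real (34 + 9 * m + 25 * n + 9 * (n * m) + 250 * (n + m + 1) * (card (trips ?N K p) + 1))" using t by (simp only: of_nat_le_iff)
 also have "\<dots> = 34 + 9 * real m + 25 * real n + 9 * real (n * m) + 250 * c + (250 * real n + 250 * real m + 250)" unfolding c_def by (simp add: algebra_simps)
 also have "\<dots> \<le> 10000 * (X * l)" using bx cX Xl by linarith
 finally show ?thesis unfolding X_def l_def .
qed

context graph
begin

lemma output_tree:
 assumes F: "finished s" and G: "verts G = {..<n}" and GE: "\<And>u v. {u, v} \<in> edges G \<longleftrightarrow> (\<exists>e<m. joins eu ev e u v)"
  and tgh: "tough \<phi> X G" and phi: "0 < \<phi>" and X: "\<And>v. v < n ==> tm v = 1 ==> v \<in> X"
 shows "\<exists>T. enumerates (map (arrs s 13) [0..<regs s 18]) (verts T) \<and>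
  enumerates_edges (map (\<lambda>i. (eu (arrs s 12 (arrs s 13 i)), ev (arrs s 12 (arrs s 13 i)))) [1..<regs s 18]) (edges T) \<and>
  subgraph T G \<and> tree T \<and> (\<forall>v<n. tm v = 1 --> v \<in> verts T) \<and> real (max_degree T) \<le> 2 / \<phi> + 3"
proof -
 define od where "od = arrs s 13"
 define par where "par = arrs s 11"
 define pe where "pe = arrs s 12"
 define c where "c = regs s 18"
 let ?C = "od ` {..<c}"
 have T: "treeP od c par pe" and trm: "\<forall>v<n. tm v = 1 --> v \<in> ?C" and ex: "\<exists>k. core_inv k ?C s \<and> stop_ok k"
  using F unfolding finished_def od_def par_def pe_def c_def by blast+
 obtain k where CI: "core_inv k ?C s" and so: "stop_ok k" using ex by blast
 have c0: "0 < c" and inj: "inj_on od {..<c}" and Cn: "?C \<subseteq> {..<n}" and od0: "od 0 = rt" using T unfolding treeP_def by blast+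
 have "\<forall>i. \<exists>j. 0 < i --> i < c --> j < i \<and> par (od i) = od j \<and> pe (od i) < m \<and> joins eu ev (pe (od i)) (od i) (od j)"
  using T unfolding treeP_def by blast
 then obtain p where p: "\<And>i. 0 < i ==> i < c ==> p i < i \<and> par (od i) = od (p i) \<and> pe (od i) < m \<and> joins eu ev (pe (od i)) (od i) (od (p i))"
  by metis
 have oi: "od i = od j \<longleftrightarrow> i = j" if "i < c" "j < c" for i j using inj that unfolding inj_on_def by blast
 let ?E = "{{od i, od (p i)} | i. 0 < i \<and> i < c}"
 let ?T = "\<lparr>verts = ?C, edges = ?E\<rparr>"
 have tree: "tree ?T" by (rule tree_parents[OF inj c0]) (use p in blast)
 have "distinct (map od [0..<c])" using inj by (simp add: distinct_map lessThan_atLeast0)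
 then have vs: "enumerates (map od [0..<c]) (verts ?T)" unfolding enumerates_def by (simp add: lessThan_atLeast0)
 have fe: "{eu (pe (od i)), ev (pe (od i))} = {od i, od (p i)}" if "0 < i" "i < c" for i
  using p[OF that] unfolding joins_def by auto
 have inj2: "i = j" if i: "0 < i" "i < c" and j: "0 < j" "j < c" and e: "{od i, od (p i)} = {od j, od (p j)}" for i j
 proof -
  have pi: "p i < i" "p j < j" using p[OF i] p[OF j] by blast+
  have "od i = od j \<or> od i = od (p j) \<and> od (p i) = od j" using e by (auto simp: doubleton_eq_iff)
  then have "i = j \<or> i = p j \<and> p i = j" using oi[of i j] oi[of i "p j"] oi[of "p i" j] i j pi by auto
  then show ?thesis using pi by auto
 qed
 have me: "map (\<lambda>(u, v). {u, v}) (map (\<lambda>i. (eu (pe (od i)), ev (pe (od i)))) [1..<c]) = map (\<lambda>i. {od i, od (p i)}) [1..<c]"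
  using fe by simp
 have "inj_on (\<lambda>i. {od i, od (p i)}) (set [1..<c])" by (rule inj_onI) (use inj2 in simp)
 then have "distinct (map (\<lambda>i. {od i, od (p i)}) [1..<c])" by (simp add: distinct_map)
 moreover have "set (map (\<lambda>i. {od i, od (p i)}) [1..<c]) = ?E" by (auto simp: Suc_le_eq)
 ultimately have fs: "enumerates_edges (map (\<lambda>i. (eu (pe (od i)), ev (pe (od i)))) [1..<c]) (edges ?T)"
  unfolding enumerates_edges_def me enumerates_def by simp
 have "?E \<subseteq> edges G"
 proof
  fix e assume "e \<in> ?E"
  then obtain i where i: "0 < i" "i < c" "e = {od i, od (p i)}" by blast
  then show "e \<in> edges G" using p[OF i(1,2)] GE by blast
 qed
 then have sub: "subgraph ?T G" using tree Cn G unfolding subgraph_def tree_def by simp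
 have dg: "\<forall>v\<in>?C. arrs s 17 v = card {d \<in> ?C. d \<noteq> rt \<and> par d = v} + of_bool (v \<noteq> rt)"
  using CI unfolding core_inv_def par_def by (rule conjunct1)
 have dk: "\<forall>v\<in>?C. arrs s 17 v \<le> k" using CI unfolding core_inv_def by (elim conjE)
 have deg: "degree ?T v \<le> k" if v: "v \<in> ?C" for v
 proof -
  let ?ch = "{d \<in> ?C. d \<noteq> rt \<and> par d = v}"
  have "{e \<in> ?E. v \<in> e} \<subseteq> (\<lambda>d. {d, par d}) ` ?ch \<union> (if v \<noteq> rt then {{v, par v}} else {})"
  proof
   fix e assume "e \<in> {e \<in> ?E. v \<in> e}"
   then obtain i where i: "0 < i" "i < c" "e = {od i, od (p i)}" "v \<in> e" by blast
   have pa: "od (p i) = par (od i)" using p[OF i(1,2)] by simp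
   have r: "od i \<noteq> rt" using oi[of i 0] i c0 od0 by auto
   show "e \<in> (\<lambda>d. {d, par d}) ` ?ch \<union> (if v \<noteq> rt then {{v, par v}} else {})"
   proof (cases "v = od i")
    case True
    then show ?thesis using r i(3) unfolding pa by simp
   next
    case False
    then have "od i \<in> ?ch" using i r unfolding pa by auto
    then show ?thesis using i(3) unfolding pa by blast
   qed
  qed
  moreover have fin: "finite ?ch" by simp
  ultimately have "card {e \<in> ?E. v \<in> e} \<le> card ((\<lambda>d. {d, par d}) ` ?ch \<union> (if v \<noteq> rt then {{v, par v}} else {}))"
   by (intro card_mono) auto
  also have "\<dots> \<le> card ((\<lambda>d. {d, par d}) ` ?ch) + card (if v \<noteq> rt then {{v, par v}} else {})" by (rule card_Un_le)
  also have "\<dots> \<le> card ?ch + of_bool (v \<noteq> rt)" using card_image_le[OF fin] by (intro add_mono) auto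
  also have "\<dots> = arrs s 17 v" by (rule sym[OF bspec[OF dg v]])
  also have "\<dots> \<le> k" by (rule bspec[OF dk v])
  finally show ?thesis unfolding degree_def by simp
 qed
 have "max_degree ?T \<le> k" unfolding max_degree_def using deg c0 by (subst Max_le_iff) auto
 moreover have "real k \<le> 2 / \<phi> + 3"
 proof (cases "k \<le> 3")
  case True
  then have "real k \<le> 3" by simp
  moreover have "0 < 2 / \<phi>" using phi by simp
  ultimately show ?thesis by linarith
 next
  case False
  then obtain D s' B where w: "round_base k D s'" "core_inv k D s'" "separated B s'" "blk s' \<subseteq> B"
   "B \<subseteq> {v \<in> D. k - 1 \<le> arrs s' 17 v}" "blk s' \<noteq> {}" "card B \<le> 2 * card (blk s')" "4 \<le> k"
   using so unfolding stop_ok_def by blast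
  show ?thesis by (rule witness_bound[OF w G GE tgh phi X])
 qed
 ultimately have md: "real (max_degree ?T) \<le> 2 / \<phi> + 3" by linarith
 have tv: "\<forall>v<n. tm v = 1 --> v \<in> verts ?T" using trm by simp
 have R: "enumerates (map od [0..<c]) (verts ?T) \<and> enumerates_edges (map (\<lambda>i. (eu (pe (od i)), ev (pe (od i)))) [1..<c]) (edges ?T) \<and>
  subgraph ?T G \<and> tree ?T \<and> (\<forall>v<n. tm v = 1 --> v \<in> verts ?T) \<and> real (max_degree ?T) \<le> 2 / \<phi> + 3"
  by (intro conjI vs fs sub tree tv md)
 show ?thesis unfolding od_def[symmetric] pe_def[symmetric] c_def[symmetric] by (rule exI[of _ ?T]) (rule R)
qed

end

text \<open>For \<open>S = {}\<close> toughness would give \<open>0 \<ge> \<phi> * c\<close> with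
  \<open>c > 1\<close> components, so all terminals lie in one component and are reachable from the
  root.\<close>

lemma tough_connected:
 assumes "tough \<phi> X G" "0 < \<phi>" "finite (verts G)" "x \<in> X" "y \<in> X" "x \<in> verts G" "y \<in> verts G"
 shows "connected_in G x y"
proof -
 have d: "del_verts G {} = G" unfolding del_verts_def by simp
 have "num_comps G X \<le> 1"
 proof (rule ccontr)
  assume h: "\<not> num_comps G X \<le> 1"
  then have "\<phi> * real (num_comps G X) \<le> 0" using assms(1) unfolding tough_def by (auto dest!: spec[of _ "{}"] simp: d)
  moreover have "0 < \<phi> * real (num_comps G X)" using h assms(2) by simp
  ultimately show False by linarith
 qed
 then show ?thesis by (rule num_comps_le_1[OF _ assms(3,4,5,6,7)])
qed

(* For m >= 1 a simple graph has n >= 2, so the time bound reads C * (m * n * log 2 n);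
   the two occurrences of max only matter for edgeless graphs. The word bound and the
   program do not depend on the toughness, which is not part of the input. *)
theorem mainTheorem12:
  "\<exists>(P::com) (w::nat) (C::real).
     \<forall>(G::nat ugraph) (X::nat set) (\<phi>::real) (n::nat) (m::nat)
       (es::(nat \<times> nat) list) (xs::nat list).
       ugraph G \<and> verts G = {..<n} \<and> n \<ge> 1 \<and> m = card (edges G) \<and>
       X \<subseteq> verts G \<and> \<phi> > 0 \<and> tough \<phi> X G \<and>
       enumerates_edges es (edges G) \<and> enumerates xs X \<longrightarrow>
       (\<exists>t vs fs T.
          runs ((n + m + 2) ^ w) P (enc_input n es xs) t (enc_output vs fs) \<and>
          real t \<le> C * (real (max 1 m) * real n * log 2 (real (max 2 n))) \<and>
          enumerates vs (verts T) \<and> enumerates_edges fs (edges T) \<and>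
          steiner_tree G X T \<and> real (max_degree T) \<le> 2 / \<phi> + 3)"
proof (rule exI[of _ "prep ;; main_loop ;; write_tree"], rule exI[of _ 4], rule exI[of _ 10000], intro allI impI, elim conjE)
 fix G :: "nat ugraph" and X :: "nat set" and \<phi> :: real and n m :: nat and es :: "(nat \<times> nat) list" and xs :: "nat list"
 assume ug: "ugraph G" and vG: "verts G = {..<n}" and n1: "1 \<le> n" and mE: "m = card (edges G)" and XG: "X \<subseteq> verts G"
  and phi: "0 < \<phi>" and tgh: "tough \<phi> X G" and es: "enumerates_edges es (edges G)" and xs: "enumerates xs X"
 \<comment> \<open>The second power already covers the length of the adjacency lists and the
   positions in the input. The fourth power also covers \<open>8 * (n + m + 2)\<close>, because
   \<open>n + m + 2\<close> is at least 2 and so its cube is at least 8.\<close>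
 define W where "W = (n + m + 2) ^ 4"
 define f :: "nat \<times> nat \<Rightarrow> nat set" where "f = (\<lambda>(u, v). {u, v})"
 have f: "f p = {fst p, snd p}" for p unfolding f_def by (simp add: case_prod_beta)
 have fes: "distinct (map f es)" "set (map f es) = edges G" using es unfolding enumerates_edges_def enumerates_def f_def by simp_all
 have len: "length es = m" using distinct_card[OF fes(1)] fes(2) mE by simp
 have E: "fst (es ! e) < n \<and> snd (es ! e) < n \<and> fst (es ! e) \<noteq> snd (es ! e)" if "e < m" for e
 proof -
  have "f (es ! e) \<in> edges G" using that fes(2) len by (metis length_map nth_map nth_mem)
  then obtain u v where uv: "u \<in> verts G" "v \<in> verts G" "u \<noteq> v" "{fst (es ! e), snd (es ! e)} = {u, v}"
   using ug unfolding ugraph_def f by blast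
  then show ?thesis unfolding vG by (auto simp: doubleton_eq_iff)
 qed
 have dx: "distinct xs" "set xs = X" using xs unfolding enumerates_def by simp_all
 have xn: "\<forall>x\<in>set xs. x < n" using XG unfolding dx vG by blast
 have lx: "length xs \<le> n" using distinct_card[OF dx(1)] card_mono[of "{..<n}" "set xs"] xn by auto
 have a2: "(n + m + 2) ^ 2 \<le> W" unfolding W_def by (rule power_increasing) simp_all
 have sq: "(n + m + 2) ^ 2 = n * n + m * m + 2 * (n * m) + 4 * n + 4 * m + 4" by (simp add: power2_eq_square algebra_simps)
 have W1: "n * m + n + m + 1 \<le> W" "2 * m + 3 + length xs \<le> W" using a2 lx unfolding sq by linarith+
 have "2 ^ 3 * (n + m + 2) \<le> (n + m + 2) ^ 3 * (n + m + 2)" by (intro mult_le_mono1 power_mono) simp_all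
 then have W8: "8 * (n + m + 2) \<le> W" unfolding W_def by (simp add: power_numeral_reduce)
 have tp: "tr W prep (init_state (enc_input n es xs)) (n * (9 * m + 5) + 9 * m + 5 * length xs + 20) (prep_ok n es xs)"
  by (rule prep[where n = n and es = es and W = W and xs = xs, unfolded len, OF W1])
 obtain t1 s1 where x1: "exec W prep (init_state (enc_input n es xs)) t1 s1" and l1: "t1 \<le> n * (9 * m + 5) + 9 * m + 5 * length xs + 20"
  and Q1: "prep_ok n es xs s1" by (rule trE[OF tp]) (rule that)
 have r4: "regs s1 4 = (if xs = [] then 0 else hd xs)" and r: "regs s1 0 = 0" "regs s1 1 = 1" "regs s1 2 = n" "regs s1 3 = m" "regs s1 5 = 1"
  and ed: "\<forall>e<m. arrs s1 2 e = fst (es ! e) \<and> arrs s1 3 e = snd (es ! e) \<and> arrs s1 8 e = 1"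
  and tm: "\<forall>v. arrs s1 4 v = of_bool (v = regs s1 4 \<or> v \<in> set xs)"
  using Q1 unfolding prep_ok_def len by - (elim conjE, assumption)+
 let ?rt = "regs s1 4" and ?eu = "arrs s1 2" and ?ev = "arrs s1 3"
 interpret g: graph W n m ?rt ?eu ?ev "arrs s1 4" "arrs s1 5" "arrs s1 6" "arrs s1 7"
  by (rule prep_graph[OF Q1 n1 xn, unfolded len]) (rule W8, use E in simp)
 \<comment> \<open>The program treats the root as a terminal. This enlarges \<open>X\<close> only if
   it is empty, and then toughness holds vacuously, since no deletion leaves more than one component
   with a terminal.\<close>
 let ?X = "insert ?rt X"
 have rtn: "?rt < n" using g.rtn .
 have tgh': "tough \<phi> ?X G"
 proof (cases "xs = []")
  case True
  then have X: "?X = {?rt}" using dx by simp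
  have "\<not> 1 < num_comps H {?rt}" for H using num_comps_singleton[of H ?rt] by simp
  then show ?thesis unfolding X tough_def by simp
 next
  case False
  then have "?X = X" using r4 dx hd_in_set[OF False] by auto
  then show ?thesis using tgh by simp
 qed
 have GE: "{u, v} \<in> edges G \<longleftrightarrow> (\<exists>e<m. joins ?eu ?ev e u v)" for u v
 proof -
  have nm: "map f es ! e = f (es ! e)" if "e < m" for e using that len by simp
  have "{u, v} \<in> edges G \<longleftrightarrow> (\<exists>e<m. {u, v} = f (es ! e))"
   unfolding fes(2)[symmetric] in_set_conv_nth length_map len
  proof (rule ex_cong1, rule conj_cong[OF refl])
   fix e assume "e < m"
   then show "map f es ! e = {u, v} \<longleftrightarrow> {u, v} = f (es ! e)" by (subst nm) (simp, rule eq_commute)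
  qed
  also have "\<dots> \<longleftrightarrow> (\<exists>e<m. joins ?eu ?ev e u v)"
  proof -
   have "{u, v} = f (es ! e) \<longleftrightarrow> joins ?eu ?ev e u v" if "e < m" for e
    using ed that unfolding f joins_def by (auto simp: doubleton_eq_iff)
   then show ?thesis by blast
  qed
  finally show ?thesis .
 qed
 have tmv: "arrs s1 4 v = of_bool (v = ?rt \<or> v \<in> X)" for v using spec[OF tm, of v] unfolding dx(2) .
 have tmX: "v \<in> ?X" if "v < n" "arrs s1 4 v = 1" for v
  using that(2) unfolding tmv by (cases "v = ?rt \<or> v \<in> X") simp_all
 let ?H = "g.hset (arrs s1 8)"
 have H: "?H = {e. e < m}" unfolding g.hset_def using ed by blast
 have reach: "(hadj ?eu ?ev ?H)\<^sup>*\<^sup>* ?rt v" if v: "v < n" "arrs s1 4 v = 1" for v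
 proof -
  have "connected_in G ?rt v" by (rule tough_connected[OF tgh' phi]) (use vG rtn v tmX[OF v] in simp_all)
  then have "(\<lambda>x y. {x, y} \<in> edges G)\<^sup>*\<^sup>* ?rt v" unfolding connected_in_def by blast
  moreover have "(\<lambda>x y. {x, y} \<in> edges G) = hadj ?eu ?ev ?H" unfolding GE hadj_def H joins_def by (intro ext) (simp add: Bex_def)
  ultimately show ?thesis by simp
 qed
 have deg: "card (inc ?eu ?ev ?H v) \<le> m" for v
  using card_mono[of "{e. e < m}" "inc ?eu ?ev ?H v"] unfolding inc_def H by auto
 have cn: "card {v. v < n \<and> Q v} \<le> n" for Q using card_mono[of "{..<n}" "{v. v < n \<and> Q v}"] by auto
 have stt: "g.static s1" unfolding g.static_def using r by simp
 \<comment> \<open>A vertex has at most \<open>m\<close> incident edges, and at most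
   \<open>n\<close> vertices can attain this, so the potential may start at these values.\<close>
 have pin: "g.phase_in m n s1" unfolding g.phase_in_def
  by (intro conjI allI impI; (rule stt r(5) deg cn | (rule reach; assumption)))
 obtain t2 s2 where x2: "exec W main_loop s1 t2 s2" and l2: "t2 \<le> 1 + 250 * (n + m + 1) * (card (trips (2 * min n m) m n) + 1)"
  and fin: "g.finished s2" by (rule trE[OF g.main_loop[OF pin]]) (rule that)
 have st2: "g.static s2" and T2: "g.treeP (arrs s2 13) (regs s2 18) (arrs s2 11) (arrs s2 12)" using fin unfolding g.finished_def
  by - (elim conjE, assumption)+
 have ct: "0 < regs s2 18" "regs s2 18 \<le> n" using g.treeP_cnt[OF T2] by blast+
 let ?vs = "map (arrs s2 13) [0..<regs s2 18]" and ?fs = "map (\<lambda>i. (?eu (arrs s2 12 (arrs s2 13 i)), ?ev (arrs s2 12 (arrs s2 13 i)))) [1..<regs s2 18]"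
 obtain t3 s3 where x3: "exec W write_tree s2 t3 s3" and l3: "t3 \<le> 15 * n + 12"
  and out: "\<forall>i<length (enc_output ?vs ?fs). arrs s3 1 i = enc_output ?vs ?fs ! i"
  by (rule trE[OF g.write_tree[OF st2 ct]]) (rule that)
 have run0: "exec W (prep ;; main_loop ;; write_tree) (init_state (enc_input n es xs)) (t1 + (t2 + t3)) s3"
  by (intro exec.Seq[OF x1] exec.Seq[OF x2] x3)
 have run: "runs ((n + m + 2) ^ 4) (prep ;; main_loop ;; write_tree) (enc_input n es xs) (t1 + (t2 + t3)) (enc_output ?vs ?fs)"
  unfolding runs_def W_def[symmetric] by (intro exI[of _ s3] conjI run0 out)
 have mn: "1 \<le> m --> 2 \<le> n" using E[of 0] by linarith
 have "n * (9 * m + 5) = 9 * (n * m) + 5 * n" by (simp add: algebra_simps)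
 then have "t1 + (t2 + t3) \<le> 34 + 9 * m + 25 * n + 9 * (n * m) + 250 * (n + m + 1) * (card (trips (2 * min n m) m n) + 1)"
  using l1 l2 l3 lx by linarith
 then have time: "real (t1 + (t2 + t3)) \<le> 10000 * (real (max 1 m) * real n * log 2 (real (max 2 n)))" by (rule time_bound[OF n1 mn])
 have "\<exists>T. enumerates ?vs (verts T) \<and> enumerates_edges ?fs (edges T) \<and> subgraph T G \<and> tree T \<and>
   (\<forall>v<n. arrs s1 4 v = 1 --> v \<in> verts T) \<and> real (max_degree T) \<le> 2 / \<phi> + 3"
  by (rule g.output_tree[OF fin vG GE tgh' phi tmX])
 then obtain T where T: "enumerates ?vs (verts T)" "enumerates_edges ?fs (edges T)" "subgraph T G" "tree T"
  "\<forall>v<n. arrs s1 4 v = 1 --> v \<in> verts T" "real (max_degree T) \<le> 2 / \<phi> + 3"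
  by (elim exE conjE) (rule that)
 have XT: "X \<subseteq> verts T"
 proof
  fix v assume v: "v \<in> X"
  have "v < n" using subsetD[OF XG v] unfolding vG by simp
  moreover have "arrs s1 4 v = 1" unfolding tmv using v by simp
  ultimately show "v \<in> verts T" using T(5) by blast
 qed
 have stein: "steiner_tree G X T" unfolding steiner_tree_def by (intro conjI T(3,4) XT)
 show "\<exists>t vs fs T. runs ((n + m + 2) ^ 4) (prep ;; main_loop ;; write_tree) (enc_input n es xs) t (enc_output vs fs) \<and>
   real t \<le> 10000 * (real (max 1 m) * real n * log 2 (real (max 2 n))) \<and>
   enumerates vs (verts T) \<and> enumerates_edges fs (edges T) \<and> steiner_tree G X T \<and> real (max_degree T) \<le> 2 / \<phi> + 3"
  by (rule exI[of _ "t1 + (t2 + t3)"], rule exI[of _ ?vs], rule exI[of _ ?fs], rule exI[of _ T])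
   (intro conjI run time T(1,2) stein T(6))
qed

end
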